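(* Let $(M, g)$ be a four-dimensional compact connected Riemannian manifold, $\lambda > 0$ a constant and $f : M \rightarrow \mathbb{R}$ a smooth function satisfying \[ \operatorname{Ric}_{g} + \operatorname{Hess} f = \lambda g \] (that is, $(M,g)$ is a compact connected shrinking Ricci soliton with potential function $f$). Suppose that the soliton is normalized in the sense that \[ R + |\nabla f|^{2} = 2 \lambda f \] on $M$, where $R$ is the scalar curvature of $(M,g)$. Let $R_{\mathrm{max}}$ denote the maximum value of $R$ on $M$. If \[ \sqrt{\frac{R_{\mathrm{max}}}{\lambda^{2}} \left( 4 \pi + \frac{\pi^{2}}{2} \right)} \leqslant \operatorname{diam}(M, g), \] then the soliton satisfies the Hitchin-Thorpe inequality $2 \chi(M) \geqslant 3 |\tau(M)|$.
   Context: $\operatorname{Ric}_g$ is the Ricci tensor, $\nabla f$ is the gradient of $f$, and $\operatorname{Hess} f(X,Y) = g(\nabla_X \nabla f, Y)$. $\operatorname{diam}(M,g)$ is the diameter with respect to the Riemannian distance. $\chi(M)$ is the Euler characteristic and $\tau(M)$ is the signature of $M$. For a connected gradient Ricci soliton, $R + |\nabla f|^2 - 2\lambda f$ is constant, so when $\lambda > 0$ the normalization can always be achieved by adding a constant to $f$. *)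

theory Defs
  imports "HOL-Analysis.Analysis" "HOL-Homology.Homology" "HOL-Library.Function_Algebras"
begin

section \<open>Smooth manifolds\<close>

definition coord_deriv :: "'n \<Rightarrow> (real^'n \<Rightarrow> 'b::real_normed_vector) \<Rightarrow> real^'n \<Rightarrow> 'b" where
  "coord_deriv i h y = frechet_derivative h (at y) (axis i 1)"

primrec Ck_on :: "nat \<Rightarrow> (real^'n) set \<Rightarrow> (real^'n \<Rightarrow> 'b::real_normed_vector) \<Rightarrow> bool" where
  "Ck_on 0 U h \<longleftrightarrow> continuous_on U h"
| "Ck_on (Suc k) U h \<longleftrightarrow> (\<forall>y\<in>U. h differentiable (at y)) \<and> (\<forall>i. Ck_on k U (coord_deriv i h))"

text \<open>Meant for open \<open>U\<close> only.\<close>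
definition smooth_on :: "(real^'n) set \<Rightarrow> (real^'n \<Rightarrow> 'b::real_normed_vector) \<Rightarrow> bool" where
  "smooth_on U h \<longleftrightarrow> (\<forall>k. Ck_on k U h)"

text \<open>A chart is a domain together with a coordinate map; the values of the map outside the
  domain are irrelevant.\<close>
type_synonym ('a, 'n) chart = "'a set \<times> ('a \<Rightarrow> real^'n)"

definition chart_image :: "('a, 'n::finite) chart \<Rightarrow> (real^'n) set" where
  "chart_image c = snd c ` fst c"

definition chart_inv :: "('a, 'n::finite) chart \<Rightarrow> real^'n \<Rightarrow> 'a" where
  "chart_inv c = inv_into (fst c) (snd c)"

definition is_chart :: "'a topology \<Rightarrow> ('a, 'n::finite) chart \<Rightarrow> bool" where
  "is_chart M c \<longleftrightarrow> openin M (fst c) \<and> open (chart_image c) \<and>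
     homeomorphic_map (subtopology M (fst c)) (top_of_set (chart_image c)) (snd c)"

definition chart_transition :: "('a, 'n::finite) chart \<Rightarrow> ('a, 'n) chart \<Rightarrow> real^'n \<Rightarrow> real^'n" where
  "chart_transition c d = snd d \<circ> chart_inv c"

text \<open>The atlas \<open>A\<close> need not be maximal; it determines the smooth structure.\<close>
definition smooth_manifold :: "'a topology \<Rightarrow> ('a, 'n::finite) chart set \<Rightarrow> bool" where
  "smooth_manifold M A \<longleftrightarrow>
     Hausdorff_space M \<and> second_countable M \<and>
     (\<forall>c\<in>A. is_chart M c) \<and> (\<Union>c\<in>A. fst c) = topspace M \<and>
     (\<forall>c\<in>A. \<forall>d\<in>A. smooth_on (snd c ` (fst c \<inter> fst d)) (chart_transition c d))"

definition smooth_function :: "('a, 'n::finite) chart set \<Rightarrow> ('a \<Rightarrow> real) \<Rightarrow> bool" where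
  "smooth_function A f \<longleftrightarrow> (\<forall>c\<in>A. smooth_on (chart_image c) (f \<circ> chart_inv c))"

text \<open>Only used for quantities that do not depend on the choice of the chart around \<open>p\<close>.\<close>
definition chart_at :: "('a, 'n::finite) chart set \<Rightarrow> 'a \<Rightarrow> ('a, 'n) chart" where
  "chart_at A p = (SOME c. c \<in> A \<and> p \<in> fst c)"


section \<open>Riemannian metrics\<close>

text \<open>A Riemannian metric is given by its matrix in each chart of the atlas, as a function of the
  coordinates; the last conjunct is the tensor transformation law.\<close>
type_synonym ('a, 'n) metric = "('a, 'n) chart \<Rightarrow> real^'n \<Rightarrow> real^'n^'n"

definition riemannian_manifold ::
  "'a topology \<Rightarrow> ('a, 'n::finite) chart set \<Rightarrow> ('a, 'n) metric \<Rightarrow> bool" where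
  "riemannian_manifold M A g \<longleftrightarrow>
     smooth_manifold M A \<and>
     (\<forall>c\<in>A. smooth_on (chart_image c) (g c)) \<and>
     (\<forall>c\<in>A. \<forall>y\<in>chart_image c. transpose (g c y) = g c y \<and>
        (\<forall>v. v \<noteq> 0 \<longrightarrow> v \<bullet> (g c y *v v) > 0)) \<and>
     (\<forall>c\<in>A. \<forall>d\<in>A. \<forall>y\<in>snd c ` (fst c \<inter> fst d).
        let T = chart_transition c d; DT = frechet_derivative T (at y) in
        \<forall>v w. v \<bullet> (g c y *v w) = DT v \<bullet> (g d (T y) *v DT w))"


subsection \<open>Curvature, gradient and Hessian in a coordinate domain\<close>

text \<open>Here \<open>H\<close> is the matrix field of a metric on an open subset of Euclidean space, and vector
  fields are given by their components in the coordinate frame.\<close>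

definition metric_at :: "(real^'n \<Rightarrow> real^'n^'n) \<Rightarrow> real^'n \<Rightarrow> real^'n \<Rightarrow> real^'n \<Rightarrow> real" where
  "metric_at H y v w = v \<bullet> (H y *v w)"

text \<open>\<open>christoffel H k i j\<close> has upper index \<open>k\<close> and lower indices \<open>i\<close>, \<open>j\<close>.\<close>
definition christoffel ::
  "(real^'n \<Rightarrow> real^'n^'n) \<Rightarrow> 'n::finite \<Rightarrow> 'n \<Rightarrow> 'n \<Rightarrow> real^'n \<Rightarrow> real" where
  "christoffel H k i j y = (1/2) * (\<Sum>l\<in>UNIV. matrix_inv (H y) $ k $ l *
     (coord_deriv i (\<lambda>x. H x $ j $ l) y + coord_deriv j (\<lambda>x. H x $ i $ l) y
        - coord_deriv l (\<lambda>x. H x $ i $ j) y))"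

text \<open>The Levi-Civita connection.\<close>
definition cov_deriv :: "(real^'n \<Rightarrow> real^'n^'n) \<Rightarrow> (real^'n \<Rightarrow> real^'n) \<Rightarrow> (real^'n \<Rightarrow> real^'n)
    \<Rightarrow> real^'n \<Rightarrow> real^'n::finite" where
  "cov_deriv H X Y y = frechet_derivative Y (at y) (X y) +
     (\<chi> k. \<Sum>i\<in>UNIV. \<Sum>j\<in>UNIV. christoffel H k i j y * X y $ i * Y y $ j)"

definition lie_bracket :: "(real^'n \<Rightarrow> real^'n) \<Rightarrow> (real^'n \<Rightarrow> real^'n) \<Rightarrow> real^'n \<Rightarrow> real^'n" where
  "lie_bracket X Y y = frechet_derivative Y (at y) (X y) - frechet_derivative X (at y) (Y y)"

definition riem_curvature :: "(real^'n \<Rightarrow> real^'n^'n) \<Rightarrow> (real^'n \<Rightarrow> real^'n) \<Rightarrow>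
    (real^'n \<Rightarrow> real^'n) \<Rightarrow> (real^'n \<Rightarrow> real^'n) \<Rightarrow> real^'n \<Rightarrow> real^'n::finite" where
  "riem_curvature H X Y Z y = cov_deriv H X (cov_deriv H Y Z) y
     - cov_deriv H Y (cov_deriv H X Z) y - cov_deriv H (lie_bracket X Y) Z y"

text \<open>The trace of \<open>X \<mapsto> R(X,v)w\<close>; tangent vectors are extended to vector fields
  with constant components.\<close>
definition ricci :: "(real^'n \<Rightarrow> real^'n^'n) \<Rightarrow> real^'n \<Rightarrow> real^'n \<Rightarrow> real^'n::finite \<Rightarrow> real" where
  "ricci H y v w = (\<Sum>i\<in>UNIV. riem_curvature H (\<lambda>_. axis i 1) (\<lambda>_. v) (\<lambda>_. w) y $ i)"

definition scal :: "(real^'n \<Rightarrow> real^'n^'n) \<Rightarrow> real^'n::finite \<Rightarrow> real" where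
  "scal H y = (\<Sum>i\<in>UNIV. \<Sum>j\<in>UNIV. matrix_inv (H y) $ i $ j * ricci H y (axis i 1) (axis j 1))"

definition grad :: "(real^'n \<Rightarrow> real^'n^'n) \<Rightarrow> (real^'n \<Rightarrow> real) \<Rightarrow> real^'n \<Rightarrow> real^'n::finite" where
  "grad H h y = matrix_inv (H y) *v (\<chi> i. coord_deriv i h y)"

definition hess :: "(real^'n \<Rightarrow> real^'n^'n) \<Rightarrow> (real^'n \<Rightarrow> real) \<Rightarrow> real^'n \<Rightarrow> real^'n \<Rightarrow>
    real^'n::finite \<Rightarrow> real" where
  "hess H h y v w = metric_at H y (cov_deriv H (\<lambda>_. v) (grad H h) y) w"


subsection \<open>Global notions\<close>

definition scalar_curvature :: "('a, 'n::finite) chart set \<Rightarrow> ('a, 'n) metric \<Rightarrow> 'a \<Rightarrow> real" where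
  "scalar_curvature A g p = (let c = chart_at A p in scal (g c) (snd c p))"

definition grad_norm_sq ::
  "('a, 'n::finite) chart set \<Rightarrow> ('a, 'n) metric \<Rightarrow> ('a \<Rightarrow> real) \<Rightarrow> 'a \<Rightarrow> real" where
  "grad_norm_sq A g f p = (let c = chart_at A p; y = snd c p; v = grad (g c) (f \<circ> chart_inv c) y
     in metric_at (g c) y v v)"

text \<open>The equation \<open>Ric + Hess f = lam g\<close>.\<close>
definition ricci_soliton ::
  "('a, 'n::finite) chart set \<Rightarrow> ('a, 'n) metric \<Rightarrow> ('a \<Rightarrow> real) \<Rightarrow> real \<Rightarrow> bool" where
  "ricci_soliton A g f lam \<longleftrightarrow> (\<forall>c\<in>A. \<forall>y\<in>chart_image c. \<forall>v w.
     ricci (g c) y v w + hess (g c) (f \<circ> chart_inv c) y v w = lam * metric_at (g c) y v w)"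

text \<open>One-sided derivatives have to exist and be continuous up to the finitely many break points
  \<open>S\<close>.  (With the weaker \<open>piecewise_C1_differentiable_on\<close> of the library the speed of a curve may
  fail to be integrable, and its integral would then be \<open>0\<close>.)\<close>
definition piecewise_C1_curve :: "'a topology \<Rightarrow> ('a, 'n::finite) chart set \<Rightarrow> (real \<Rightarrow> 'a) \<Rightarrow> bool" where
  "piecewise_C1_curve M A \<gamma> \<longleftrightarrow> pathin M \<gamma> \<and>
     (\<exists>S. finite S \<and> (\<forall>c\<in>A. \<forall>a b. 0 \<le> a \<and> a < b \<and> b \<le> 1 \<and> {a<..<b} \<inter> S = {} \<and>
          \<gamma> ` {a..b} \<subseteq> fst c \<longrightarrow>
        (\<exists>D. continuous_on {a..b} D \<and>
           (\<forall>t\<in>{a..b}. ((snd c \<circ> \<gamma>) has_vector_derivative D t) (at t within {a..b})))))"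

definition curve_speed :: "('a, 'n::finite) chart set \<Rightarrow> ('a, 'n) metric \<Rightarrow> (real \<Rightarrow> 'a) \<Rightarrow> real \<Rightarrow> real" where
  "curve_speed A g \<gamma> t = (let c = chart_at A (\<gamma> t); v = vector_derivative (snd c \<circ> \<gamma>) (at t)
     in sqrt (metric_at (g c) (snd c (\<gamma> t)) v v))"

definition curve_length :: "('a, 'n::finite) chart set \<Rightarrow> ('a, 'n) metric \<Rightarrow> (real \<Rightarrow> 'a) \<Rightarrow> real" where
  "curve_length A g \<gamma> = integral {0..1} (curve_speed A g \<gamma>)"

definition riem_dist ::
  "'a topology \<Rightarrow> ('a, 'n::finite) chart set \<Rightarrow> ('a, 'n) metric \<Rightarrow> 'a \<Rightarrow> 'a \<Rightarrow> real" where
  "riem_dist M A g p q =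
     Inf {curve_length A g \<gamma> | \<gamma>. piecewise_C1_curve M A \<gamma> \<and> \<gamma> 0 = p \<and> \<gamma> 1 = q}"

definition riem_diam :: "'a topology \<Rightarrow> ('a, 'n::finite) chart set \<Rightarrow> ('a, 'n) metric \<Rightarrow> real" where
  "riem_diam M A g = Sup {riem_dist M A g p q | p q. p \<in> topspace M \<and> q \<in> topspace M}"


section \<open>Euler characteristic\<close>

text \<open>The rank of an abelian group: the maximal size of a \<open>\<int>\<close>-linearly independent
  subset.\<close>
definition abelian_rank :: "('b, 'm) monoid_scheme \<Rightarrow> nat" where
  "abelian_rank G = Max {card B | B. finite B \<and> B \<subseteq> carrier G \<and>
     (\<forall>k :: 'b \<Rightarrow> int. finprod G (\<lambda>b. b [^]\<^bsub>G\<^esub> k b) B = \<one>\<^bsub>G\<^esub> \<longrightarrow> (\<forall>b\<in>B. k b = 0))}"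

definition betti :: "nat \<Rightarrow> 'a topology \<Rightarrow> nat" where
  "betti p M = abelian_rank (homology_group (int p) M)"

definition euler_characteristic :: "'a topology \<Rightarrow> int" where
  "euler_characteristic M = (\<Sum>p | betti p M \<noteq> 0. (-1) ^ p * int (betti p M))"


section \<open>Signature\<close>

subsection \<open>Singular cochains with real coefficients\<close>

type_synonym 'a cochain = "((nat \<Rightarrow> real) \<Rightarrow> 'a) \<Rightarrow> real"

definition cochain_scale :: "real \<Rightarrow> 'a cochain \<Rightarrow> 'a cochain" where
  "cochain_scale r a = (\<lambda>\<sigma>. r * a \<sigma>)"

lemma vector_space_cochain: "vector_space cochain_scale"
  by unfold_locales (auto simp: cochain_scale_def fun_eq_iff algebra_simps)

definition coboundary :: "nat \<Rightarrow> 'a cochain \<Rightarrow> 'a cochain" where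
  "coboundary p a \<sigma> = (\<Sum>k\<le>Suc p. (-1) ^ k * a (singular_face (Suc p) k \<sigma>))"

definition cocycles :: "nat \<Rightarrow> 'a topology \<Rightarrow> 'a cochain set" where
  "cocycles p M = {a. (\<forall>\<sigma>. \<not> singular_simplex p M \<sigma> \<longrightarrow> a \<sigma> = 0) \<and>
     (\<forall>\<sigma>. singular_simplex (Suc p) M \<sigma> \<longrightarrow> coboundary p a \<sigma> = 0)}"

text \<open>Points of the standard \<open>p\<close>-simplex are sequences vanishing beyond index \<open>p\<close>, so the front
  \<open>p\<close>-face of the standard \<open>(p+q)\<close>-simplex is the standard \<open>p\<close>-simplex itself.\<close>
definition front_face :: "nat \<Rightarrow> ((nat \<Rightarrow> real) \<Rightarrow> 'a) \<Rightarrow> (nat \<Rightarrow> real) \<Rightarrow> 'a" where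
  "front_face p \<sigma> = restrict \<sigma> (standard_simplex p)"

definition back_face :: "nat \<Rightarrow> nat \<Rightarrow> ((nat \<Rightarrow> real) \<Rightarrow> 'a) \<Rightarrow> (nat \<Rightarrow> real) \<Rightarrow> 'a" where
  "back_face p q \<sigma> =
     restrict (\<lambda>x. \<sigma> (\<lambda>i. if i < p then 0 else x (i - p))) (standard_simplex q)"

definition cup_product :: "nat \<Rightarrow> nat \<Rightarrow> 'a cochain \<Rightarrow> 'a cochain \<Rightarrow> 'a cochain" where
  "cup_product p q a b \<sigma> = a (front_face p \<sigma>) * b (back_face p q \<sigma>)"

definition cochain_eval :: "'a cochain \<Rightarrow> 'a chain \<Rightarrow> real" where
  "cochain_eval a z = (\<Sum>\<sigma>\<in>Poly_Mapping.keys z. of_int (Poly_Mapping.lookup z \<sigma>) * a \<sigma>)"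


subsection \<open>Intersection form of a closed connected four-manifold\<close>

text \<open>A generator of the top homology group.  For an orientable closed connected manifold there are
  exactly two, the fundamental classes of the two orientations.  In the nonorientable case the top
  homology group is trivial and its only generator is \<open>0\<close>, so that the signature below
  is \<open>0\<close>.\<close>
definition fundamental_class :: "nat \<Rightarrow> 'a topology \<Rightarrow> 'a chain set \<Rightarrow> bool" where
  "fundamental_class n M \<mu> \<longleftrightarrow> \<mu> \<in> carrier (homology_group (int n) M) \<and>
     generate (homology_group (int n) M) {\<mu>} = carrier (homology_group (int n) M)"

text \<open>Elements of a homology group are sets of homologous cycles; the value on cocycles does not
  depend on the representative.\<close>
definition intersection_form :: "'a chain set \<Rightarrow> 'a cochain \<Rightarrow> 'a cochain \<Rightarrow> real" where
  "intersection_form \<mu> a b = cochain_eval (cup_product 2 2 a b) (SOME z. z \<in> \<mu>)"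

definition positive_index :: "'a cochain set \<Rightarrow> ('a cochain \<Rightarrow> 'a cochain \<Rightarrow> real) \<Rightarrow> nat" where
  "positive_index Z Q = Max {vector_space.dim cochain_scale V | V.
     module.subspace cochain_scale V \<and> V \<subseteq> Z \<and> (\<forall>a\<in>V. a \<noteq> 0 \<longrightarrow> Q a a > 0)}"

text \<open>Coboundaries lie in the radical of the intersection form on cocycles.  Hence a definite
  subspace of the space of cocycles projects isomorphically onto a definite subspace of the second
  cohomology, every definite subspace of the latter arises in this way, and the two numbers below
  are the usual \<open>b\<^sup>+\<close> and \<open>b\<^sup>-\<close> of the intersection form on real
  cohomology.\<close>
definition signature :: "'a topology \<Rightarrow> 'a chain set \<Rightarrow> int" where
  "signature M \<mu> =
     int (positive_index (cocycles 2 M) (intersection_form \<mu>))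
     - int (positive_index (cocycles 2 M) (\<lambda>a b. - intersection_form \<mu> a b))"

end

theory Submission
  imports Defs
begin

text \<open>The hypotheses are contradictory, so no topology enters.  Let \<open>n = 4\<close> be the dimension.  The
  trace of \<open>Hess f\<close> is \<open>n lam - R\<close>.  At a maximum of \<open>f\<close> it is nonpositive, so
  \<open>R\<^sub>m\<^sub>a\<^sub>x \<ge> n lam\<close>, and the normalization gives \<open>f \<le> k\<close> with \<open>k = R\<^sub>m\<^sub>a\<^sub>x / (2 lam)\<close>.  At a minimum of
  \<open>R\<close> a Bochner argument gives \<open>R \<ge> 0\<close>, whence \<open>f \<ge> 0\<close>.

  With \<open>0 \<le> f \<le> k\<close> a Myers type argument bounds every distance \<open>D\<close> by
  \<open>lam D\<^sup>2 \<le> \<pi>\<^sup>2 (n + 99/70 k)\<close>; the constant \<open>99/70\<close> arises from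
  bounding \<open>\<bar>cos \<theta>\<bar>\<close> by a quadratic polynomial in \<open>cos \<theta>\<close>.
  Together with the assumed lower bound for the diameter and \<open>R\<^sub>m\<^sub>a\<^sub>x \<ge> 4 lam\<close> this would give
  \<open>4 \<le> \<pi> (1/2 + 99/140)\<close>, which is false.

  Geodesics are avoided.  Along a curve \<open>x\<close> from \<open>p\<close> to \<open>q\<close> whose length is within \<open>\<delta>\<close> of \<open>D\<close>, take a parallel
  orthonormal frame \<open>e\<^sub>i\<close> and \<open>\<phi> = sin (\<omega> \<sigma>)\<close>, where \<open>\<sigma>\<close> is the arc length and \<open>\<omega> \<sigma>\<close> runs from \<open>0\<close> to \<open>\<pi>\<close>.
  The \<open>2 n\<close> curves \<open>x + \<tau> e\<^sub>i - \<tau>\<^sup>2 (grad f / (2 n) + \<Gamma>(e\<^sub>i, e\<^sub>i) / 2)\<close> with \<open>\<tau> = \<plusminus> s \<phi>\<close>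
  also join \<open>p\<close> to \<open>q\<close>.  In the sum of their lengths the first order terms cancel, and the component along
  \<open>grad f\<close> turns \<open>Ric\<close> into \<open>Ric + Hess f = lam g\<close> pointwise.  Changes of charts cost \<open>O(s\<^sup>3)\<close>, since
  the coordinate formula is invariant up to second order, and their number is bounded independently of \<open>\<delta>\<close>.
  As every length is at least \<open>D\<close>, letting \<open>\<delta>\<close> and then \<open>s\<close> tend to \<open>0\<close> gives the bound.\<close>

section \<open>Calculus of smooth functions\<close>

text \<open>The given curve is only piecewise C1, so its velocity \<open>u\<close> may not be
  differentiated. A parallel frame satisfies e' = -\<Gamma>(u, e), and every other ingredient of a
  varied curve is a function of the point alone; hence the varied velocity contains \<open>u\<close>
  but no derivative of it. The frame keeps the tangential direction, and the root in the length is
  estimated by its tangent line, which drops the square of the first order term. The price is n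
  instead of n - 1 in the diameter bound, which the numerical margin can afford. Varied curves drawn
  in two charts do not fit together exactly. The quantity carried along is therefore not a length
  but the sum of the distances from \<open>p\<close> to the 2 n varied points, and the triangle
  inequality absorbs the gaps. A gap is cubic in s whereas the gain is quadratic; gaps occur once
  per fixed amount of arc length, and subdivision inside a chart costs nothing. After integration by
  parts the potential enters through f - k/2, whose absolute value is at most k/2.\<close>

abbreviation dir_deriv :: "(real^'n \<Rightarrow> 'b::real_normed_vector) \<Rightarrow> real^'n \<Rightarrow> real^'n \<Rightarrow> 'b" where
  "dir_deriv h x v \<equiv> frechet_derivative h (at x) v"

lemma vec_eq_sum_axis: "(v::real^'n) = (\<Sum>i\<in>UNIV. v $ i *\<^sub>R axis i 1)"
  by (simp add: vec_eq_iff axis_def if_distrib cong: if_cong)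

lemma dir_deriv_eq_sum:
  fixes h :: "real^'n \<Rightarrow> 'b::real_normed_vector"
  assumes "h differentiable (at x)"
  shows "dir_deriv h x v = (\<Sum>i\<in>UNIV. v $ i *\<^sub>R coord_deriv i h x)"
proof -
  have "linear (frechet_derivative h (at x))"
    using assms by (rule linear_frechet_derivative)
  then have "dir_deriv h x (\<Sum>i\<in>UNIV. v $ i *\<^sub>R axis i 1) =
      (\<Sum>i\<in>UNIV. v $ i *\<^sub>R dir_deriv h x (axis i 1))"
    by (simp add: linear_sum linear_scale)
  then show ?thesis
    unfolding coord_deriv_def using vec_eq_sum_axis[of v] by metis
qed

text \<open>\<open>frechet_derivative\<close> is a choice among all derivatives at the point.
  Functions that agree near the point admit the same ones, so even a default choice is the same and
  no differentiability has to be assumed.\<close>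

lemma coord_deriv_cong:
  assumes "open U" "x \<in> U" "\<And>y. y \<in> U \<Longrightarrow> h y = k y"
  shows "coord_deriv i h x = coord_deriv i k x"
    and "h differentiable (at x) \<longleftrightarrow> k differentiable (at x)"
proof -
  have *: "(h has_derivative D) (at x) \<longleftrightarrow> (k has_derivative D) (at x)" for D
    using has_derivative_transform_within_open[OF _ assms(1,2), of h D UNIV k]
      has_derivative_transform_within_open[OF _ assms(1,2), of k D UNIV h] assms(3) by force
  show "coord_deriv i h x = coord_deriv i k x"
    unfolding coord_deriv_def frechet_derivative_def * ..
  show "h differentiable (at x) \<longleftrightarrow> k differentiable (at x)"
    unfolding differentiable_def * ..
qed

lemma dir_deriv_cong:
  assumes "open U" "x \<in> U" "\<And>y. y \<in> U \<Longrightarrow> h y = k y"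
  shows "dir_deriv h x v = dir_deriv k x v"
proof -
  have *: "(h has_derivative D) (at x) \<longleftrightarrow> (k has_derivative D) (at x)" for D
    using has_derivative_transform_within_open[OF _ assms(1,2), of h D UNIV k]
      has_derivative_transform_within_open[OF _ assms(1,2), of k D UNIV h] assms(3) by force
  show ?thesis
    unfolding frechet_derivative_def * ..
qed

text \<open>\<open>Ck_on\<close> passes to \<open>coord_deriv i h\<close> as a function on the whole
  space, whereas a product or chain rule holds on \<open>U\<close> only. This lemma lets such a rule
  be used as if it were an equation of functions.\<close>

lemma Ck_on_cong:
  assumes "open U" "\<And>y. y \<in> U \<Longrightarrow> h y = k y"
  shows "Ck_on m U h \<longleftrightarrow> Ck_on m U k"
  using assms(2)
proof (induction m arbitrary: h k)
  case 0
  then show ?case by (auto cong: continuous_on_cong)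
next
  case (Suc m)
  have "Ck_on m U (coord_deriv i h) \<longleftrightarrow> Ck_on m U (coord_deriv i k)" for i
    by (rule Suc.IH) (rule coord_deriv_cong[OF assms(1)], auto simp: Suc.prems)
  moreover have "h differentiable (at y) \<longleftrightarrow> k differentiable (at y)" if "y \<in> U" for y
    by (rule coord_deriv_cong[OF assms(1) that]) (auto simp: Suc.prems)
  ultimately show ?case by auto
qed

lemma Ck_on_SucD: "Ck_on (Suc m) U h \<Longrightarrow> Ck_on m U h"
proof (induction m arbitrary: h)
  case 0
  then show ?case
    by (auto intro!: differentiable_imp_continuous_on
        simp: differentiable_on_def differentiable_at_withinI)
next
  case (Suc m)
  then show ?case by auto
qed

lemma coord_deriv_eqI: "(h has_derivative D) (at x) \<Longrightarrow> coord_deriv i h x = D (axis i 1)"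
  unfolding coord_deriv_def using frechet_derivative_at by metis

lemma has_derivative_dir_deriv:
  "h differentiable (at x) \<Longrightarrow> (h has_derivative dir_deriv h x) (at x)"
  using frechet_derivative_works by blast

lemma coord_deriv_linear:
  assumes "bounded_linear L" "h differentiable (at x)"
  shows "coord_deriv i (\<lambda>y. L (h y)) x = L (coord_deriv i h x)"
  using coord_deriv_eqI[OF bounded_linear.has_derivative[OF assms(1) has_derivative_dir_deriv[OF assms(2)]]]
  by (simp add: coord_deriv_def)

lemma bounded_linear_differentiable:
  fixes h :: "real^'n \<Rightarrow> 'b::real_normed_vector"
  assumes "bounded_linear L" "h differentiable (at x)"
  shows "(\<lambda>y. L (h y)) differentiable (at x)"
  using bounded_linear.has_derivative[OF assms(1) has_derivative_dir_deriv[OF assms(2)]]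
  by (rule differentiableI)

lemma Ck_on_linear:
  assumes "bounded_linear L" "open U"
  shows "Ck_on m U h \<Longrightarrow> Ck_on m U (\<lambda>x. L (h x))"
proof (induction m arbitrary: h)
  case 0
  then show ?case
    using assms(1) by (auto intro: bounded_linear.continuous_on)
next
  case (Suc m)
  have "Ck_on m U (coord_deriv i (\<lambda>x. L (h x)))" for i
  proof -
    have "Ck_on m U (\<lambda>x. L (coord_deriv i h x))"
      using Suc by auto
    then show ?thesis
      by (subst Ck_on_cong[OF assms(2), where k = "\<lambda>x. L (coord_deriv i h x)"])
        (use Suc.prems in \<open>auto simp: coord_deriv_linear[OF assms(1)]\<close>)
  qed
  then show ?case
    using Suc.prems by (auto intro: bounded_linear_differentiable[OF assms(1)])
qed

lemma coord_deriv_add: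
  assumes "h differentiable (at x)" "k differentiable (at x)"
  shows "coord_deriv i (\<lambda>y. h y + k y) x = coord_deriv i h x + coord_deriv i k x"
  using coord_deriv_eqI[OF has_derivative_add[OF assms[THEN has_derivative_dir_deriv]]]
  by (simp add: coord_deriv_def)

lemma Ck_on_add:
  assumes "open U"
  shows "Ck_on m U h \<Longrightarrow> Ck_on m U k \<Longrightarrow> Ck_on m U (\<lambda>x. h x + k x)"
proof (induction m arbitrary: h k)
  case 0
  then show ?case by (auto intro: continuous_on_add)
next
  case (Suc m)
  have "Ck_on m U (coord_deriv i (\<lambda>x. h x + k x))" for i
    by (subst Ck_on_cong[OF assms, where k = "\<lambda>x. coord_deriv i h x + coord_deriv i k x"])
      (use Suc in \<open>auto simp: coord_deriv_add\<close>)
  then show ?case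
    using Suc.prems by auto
qed

lemma coord_deriv_bilinear:
  assumes "bounded_bilinear B" "h differentiable (at x)" "k differentiable (at x)"
  shows "coord_deriv i (\<lambda>y. B (h y) (k y)) x = B (h x) (coord_deriv i k x) + B (coord_deriv i h x) (k x)"
  using coord_deriv_eqI[OF bounded_bilinear.FDERIV[OF assms(1) assms(2,3)[THEN has_derivative_dir_deriv]]]
  by (simp add: coord_deriv_def)

text \<open>The product rule pairs a derivative of one factor with the other factor itself;
  \<open>Ck_on_SucD\<close> lowers the latter to the order of the induction hypothesis.\<close>

lemma Ck_on_bilinear:
  assumes "bounded_bilinear B" "open U"
  shows "Ck_on m U h \<Longrightarrow> Ck_on m U k \<Longrightarrow> Ck_on m U (\<lambda>x. B (h x) (k x))"
proof (induction m arbitrary: h k)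
  case 0
  then show ?case
    using assms(1) by (auto intro: bounded_bilinear.continuous_on)
next
  case (Suc m)
  have "Ck_on m U (coord_deriv i (\<lambda>x. B (h x) (k x)))" for i
  proof (subst Ck_on_cong[OF assms(2)])
    show "Ck_on m U (\<lambda>x. B (h x) (coord_deriv i k x) + B (coord_deriv i h x) (k x))"
      using Suc.prems Suc.prems[THEN Ck_on_SucD]
      by (intro Ck_on_add[OF assms(2)] Suc.IH) auto
  qed (use Suc.prems in \<open>auto simp: coord_deriv_bilinear[OF assms(1)]\<close>)
  moreover have "(\<lambda>x. B (h x) (k x)) differentiable at y" if "y \<in> U" for y
    by (rule differentiableI, rule bounded_bilinear.FDERIV[OF assms(1)];
        rule has_derivative_dir_deriv, use Suc.prems that in auto)
  ultimately show ?case
    by auto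
qed

lemma Ck_on_const: "Ck_on m U (\<lambda>_. c)"
proof (induction m arbitrary: c)
  case (Suc m)
  have "coord_deriv (i::'a) (\<lambda>_. c) = (\<lambda>_. 0)" for i
    by (rule ext) (simp add: coord_deriv_def)
  then show ?case using Suc by simp
qed auto

section \<open>Closure properties of smooth functions\<close>

lemma smooth_onD: "smooth_on U h \<Longrightarrow> Ck_on m U h"
  by (simp add: smooth_on_def)

lemma smooth_on_coord_deriv:
  assumes "smooth_on U h" shows "smooth_on U (coord_deriv i h)"
  unfolding smooth_on_def
proof
  fix k show "Ck_on k U (coord_deriv i h)"
    using smooth_onD[OF assms, of "Suc k"] by simp
qed

lemma smooth_on_differentiable: "smooth_on U h \<Longrightarrow> x \<in> U \<Longrightarrow> h differentiable (at x)"
  using smooth_onD[of U h "Suc 0"] by simp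

lemma smooth_on_continuous_on: "smooth_on U h \<Longrightarrow> continuous_on U h"
  using smooth_onD[of U h 0] by simp

lemma smooth_on_cong:
  "open U \<Longrightarrow> (\<And>y. y \<in> U \<Longrightarrow> h y = k y) \<Longrightarrow> smooth_on U h \<longleftrightarrow> smooth_on U k"
  unfolding smooth_on_def using Ck_on_cong by blast

lemma smooth_on_has_derivative:
  "smooth_on U h \<Longrightarrow> x \<in> U \<Longrightarrow> (h has_derivative dir_deriv h x) (at x)"
  by (intro has_derivative_dir_deriv smooth_on_differentiable)

lemma smooth_on_linear:
  "bounded_linear L \<Longrightarrow> open U \<Longrightarrow> smooth_on U h \<Longrightarrow> smooth_on U (\<lambda>x. L (h x))"
  unfolding smooth_on_def using Ck_on_linear by blast

lemma smooth_on_bilinear: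
  "bounded_bilinear B \<Longrightarrow> open U \<Longrightarrow> smooth_on U h \<Longrightarrow> smooth_on U k \<Longrightarrow> smooth_on U (\<lambda>x. B (h x) (k x))"
  unfolding smooth_on_def using Ck_on_bilinear by blast

lemma smooth_on_const [simp]: "smooth_on U (\<lambda>_. c)"
  unfolding smooth_on_def using Ck_on_const by blast

lemma smooth_on_add: "open U \<Longrightarrow> smooth_on U h \<Longrightarrow> smooth_on U k \<Longrightarrow> smooth_on U (\<lambda>x. h x + k x)"
  unfolding smooth_on_def using Ck_on_add by blast

lemmas smooth_on_mult = smooth_on_bilinear[OF bounded_bilinear_mult]
  and smooth_on_scaleR = smooth_on_bilinear[OF bounded_bilinear_scaleR]
  and smooth_on_vec_nth = smooth_on_linear[OF bounded_linear_vec_nth]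
  and smooth_on_inner = smooth_on_bilinear[OF bounded_bilinear_inner]

lemma smooth_on_diff:
  assumes "open U" "smooth_on U h" "smooth_on U k" shows "smooth_on U (\<lambda>x. h x - k x)"
proof -
  have "smooth_on U (\<lambda>x. h x + - k x)"
    using assms by (intro smooth_on_add smooth_on_linear[OF bounded_linear_minus[OF bounded_linear_ident]])
  then show ?thesis by simp
qed

lemma smooth_on_sum:
  "open U \<Longrightarrow> (\<And>i. i \<in> I \<Longrightarrow> smooth_on U (h i)) \<Longrightarrow> smooth_on U (\<lambda>x. \<Sum>i\<in>I. h i x)"
  by (induction I rule: infinite_finite_induct) (auto intro: smooth_on_add)

lemma smooth_on_euclidean:
  fixes h :: "real^'n \<Rightarrow> 'b::euclidean_space"
  assumes "open U" "\<And>b. b \<in> Basis \<Longrightarrow> smooth_on U (\<lambda>x. h x \<bullet> b)"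
  shows "smooth_on U h"
proof -
  have "smooth_on U (\<lambda>x. \<Sum>b\<in>Basis. (h x \<bullet> b) *\<^sub>R b)"
    by (rule smooth_on_sum[OF assms(1)], rule smooth_on_scaleR[OF assms(1)], erule assms(2),
        rule smooth_on_const)
  then show ?thesis
    unfolding euclidean_representation .
qed

lemma smooth_on_vec:
  fixes h :: "real^'n \<Rightarrow> 'b::euclidean_space^'m"
  assumes "open U" "\<And>i. smooth_on U (\<lambda>x. h x $ i)"
  shows "smooth_on U h"
proof (rule smooth_on_euclidean[OF assms(1)])
  fix b :: "'b^'m" assume "b \<in> Basis"
  then obtain i u where b: "b = axis i u"
    by (auto simp: Basis_vec_def)
  show "smooth_on U (\<lambda>x. h x \<bullet> b)"
    unfolding b inner_axis by (rule smooth_on_inner[OF assms(1) assms(2) smooth_on_const])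
qed

lemma smooth_on_dir_deriv_field:
  assumes "open U" "smooth_on U h" "smooth_on U X"
  shows "smooth_on U (\<lambda>x. dir_deriv h x (X x))"
proof -
  have "smooth_on U (\<lambda>x. \<Sum>i\<in>UNIV. X x $ i *\<^sub>R coord_deriv i h x)"
    by (rule smooth_on_sum[OF assms(1)], rule smooth_on_scaleR[OF assms(1)],
        rule smooth_on_vec_nth[OF assms(1,3)], rule smooth_on_coord_deriv[OF assms(2)])
  then show ?thesis
    by (subst smooth_on_cong[OF assms(1) dir_deriv_eq_sum[OF smooth_on_differentiable[OF assms(2)]]])
qed

lemma smooth_on_dir_deriv:
  assumes "open U" "smooth_on U h"
  shows "smooth_on U (\<lambda>x. dir_deriv h x v)"
  by (rule smooth_on_dir_deriv_field[OF assms smooth_on_const])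

section \<open>Derivatives along lines and symmetry of second derivatives\<close>

lemma has_derivative_along_line:
  assumes "h differentiable (at (x + a *\<^sub>R v))"
  shows "((\<lambda>a. h (x + a *\<^sub>R v)) has_vector_derivative dir_deriv h (x + a *\<^sub>R v) v) (at a within S)"
proof -
  have 1: "((\<lambda>a. x + a *\<^sub>R v) has_derivative (\<lambda>a. a *\<^sub>R v)) (at a within S)"
    by (auto intro!: derivative_eq_intros)
  have "((\<lambda>a. h (x + a *\<^sub>R v)) has_derivative (\<lambda>t. dir_deriv h (x + a *\<^sub>R v) (t *\<^sub>R v))) (at a within S)"
    by (rule has_derivative_compose[OF 1, of h]) (rule has_derivative_dir_deriv[OF assms])
  then show ?thesis
    unfolding has_vector_derivative_def
    by (simp add: linear_scale[OF linear_frechet_derivative[OF assms]])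
qed

text \<open>The mixed second difference of \<open>h\<close> over a parallelogram is computed by applying the mean
  value theorem twice; since it is symmetric in the two sides, so is the second derivative.\<close>

lemma second_difference:
  fixes h :: "real^'n \<Rightarrow> real"
  assumes U: "open U" and h: "smooth_on U h" and "x \<in> U" and "e > 0"
  shows "\<exists>d>0. \<forall>t. 0 < t \<and> t < d \<longrightarrow>
    \<bar>h (x + t *\<^sub>R v + t *\<^sub>R w) - h (x + t *\<^sub>R v) - h (x + t *\<^sub>R w) + h x
      - t\<^sup>2 * dir_deriv (\<lambda>y. dir_deriv h y v) x w\<bar> \<le> e * t\<^sup>2"
proof -
  let ?k = "\<lambda>y. dir_deriv h y v" let ?l = "\<lambda>y. dir_deriv ?k y w"
  have k: "smooth_on U ?k" and l: "smooth_on U ?l"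
    using U h by (auto intro: smooth_on_dir_deriv)
  have "isCont ?l x"
    using smooth_on_continuous_on[OF l] U \<open>x \<in> U\<close> continuous_on_eq_continuous_at by blast
  then obtain r where r: "r > 0" "\<And>y. dist y x < r \<Longrightarrow> \<bar>?l y - ?l x\<bar> < e"
    using \<open>e > 0\<close> unfolding continuous_at_eps_delta dist_real_def by blast
  obtain r' where r': "r' > 0" "ball x r' \<subseteq> U"
    using U \<open>x \<in> U\<close> openE by blast
  define m where "m = min r r'"
  define d where "d = m / (norm v + norm w + 1)"
  have m: "m > 0" and "d > 0" using r r' by (auto simp: m_def d_def add_nonneg_pos)
  have near: "norm (a *\<^sub>R v + b *\<^sub>R w) < m" if "0 \<le> a" "a < d" "0 \<le> b" "b < d" for a b
  proof -
    have "norm (a *\<^sub>R v + b *\<^sub>R w) \<le> a * norm v + b * norm w"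
      using norm_triangle_ineq[of "a *\<^sub>R v" "b *\<^sub>R w"] that by simp
    also have "\<dots> \<le> d * (norm v + norm w)"
      using that by (simp add: distrib_left add_mono mult_right_mono)
    also have "\<dots> < d * (norm v + norm w + 1)" using \<open>d > 0\<close> by simp
    also have "\<dots> = m" unfolding d_def by (simp add: add_nonneg_pos add_pos_nonneg add_nonneg_eq_0_iff)
    finally show ?thesis .
  qed
  have inU: "x + a *\<^sub>R v + b *\<^sub>R w \<in> U" if "0 \<le> a" "a < d" "0 \<le> b" "b < d" for a b
    using r'(2) near[OF that] by (auto simp: m_def dist_norm norm_minus_commute add.assoc
        subset_iff)
  show ?thesis
  proof (intro exI[of _ d] conjI \<open>d > 0\<close> allI impI)
    fix t :: real assume t: "0 < t \<and> t < d"
    define G where "G a = h (x + t *\<^sub>R w + a *\<^sub>R v) - h (x + a *\<^sub>R v)" for a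
    have dG: "(G has_real_derivative ?k (x + t *\<^sub>R w + a *\<^sub>R v) - ?k (x + a *\<^sub>R v)) (at a)"
      if "0 \<le> a" "a \<le> t" for a
    proof -
      have "h differentiable (at (x + t *\<^sub>R w + a *\<^sub>R v))" "h differentiable (at (x + a *\<^sub>R v))"
        using inU[of a t] inU[of a 0] t that h
        by (auto intro!: smooth_on_differentiable[OF h] simp: add_ac)
      from this[THEN has_derivative_along_line] show ?thesis
        unfolding G_def has_real_derivative_iff_has_vector_derivative
        by (auto intro!: derivative_intros)
    qed
    obtain a where a: "0 < a" "a < t" and Ga:
      "G t - G 0 = (t - 0) * (?k (x + t *\<^sub>R w + a *\<^sub>R v) - ?k (x + a *\<^sub>R v))"
      using MVT2[of 0 t G "\<lambda>a. ?k (x + t *\<^sub>R w + a *\<^sub>R v) - ?k (x + a *\<^sub>R v)"] dG t by auto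
    have dK: "((\<lambda>b. ?k (x + a *\<^sub>R v + b *\<^sub>R w)) has_real_derivative ?l (x + a *\<^sub>R v + b *\<^sub>R w)) (at b)"
      if "0 \<le> b" "b \<le> t" for b
      unfolding has_real_derivative_iff_has_vector_derivative
      by (rule has_derivative_along_line, rule smooth_on_differentiable[OF k], rule inU)
        (use a t that in auto)
    obtain b where b: "0 < b" "b < t" and Kb:
      "?k (x + a *\<^sub>R v + t *\<^sub>R w) - ?k (x + a *\<^sub>R v + 0 *\<^sub>R w) = (t - 0) * ?l (x + a *\<^sub>R v + b *\<^sub>R w)"
      using MVT2[of 0 t "\<lambda>b. ?k (x + a *\<^sub>R v + b *\<^sub>R w)" "\<lambda>b. ?l (x + a *\<^sub>R v + b *\<^sub>R w)"] dK t
      by blast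
    have "\<bar>?l (x + a *\<^sub>R v + b *\<^sub>R w) - ?l x\<bar> < e"
      using near[of a b] a b t by (intro r(2)) (auto simp: m_def dist_norm algebra_simps)
    then have "t\<^sup>2 * \<bar>?l (x + a *\<^sub>R v + b *\<^sub>R w) - ?l x\<bar> \<le> t\<^sup>2 * e"
      by (intro mult_left_mono) auto
    moreover have "G t - G 0 = t\<^sup>2 * ?l (x + a *\<^sub>R v + b *\<^sub>R w)"
      using Ga Kb by (simp add: power2_eq_square add_ac)
    ultimately have "\<bar>G t - G 0 - t\<^sup>2 * ?l x\<bar> \<le> e * t\<^sup>2"
      by (simp add: right_diff_distrib[symmetric] abs_mult mult.commute)
    then show "\<bar>h (x + t *\<^sub>R v + t *\<^sub>R w) - h (x + t *\<^sub>R v) - h (x + t *\<^sub>R w) + h x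
      - t\<^sup>2 * ?l x\<bar> \<le> e * t\<^sup>2"
      unfolding G_def by (simp add: algebra_simps)
  qed
qed

lemma dir_deriv_commute_real:
  fixes h :: "real^'n \<Rightarrow> real"
  assumes "open U" "smooth_on U h" "x \<in> U"
  shows "dir_deriv (\<lambda>y. dir_deriv h y v) x w = dir_deriv (\<lambda>y. dir_deriv h y w) x v"
    (is "?a = ?b")
proof (rule ccontr)
  assume ne: "?a \<noteq> ?b"
  \<comment> \<open>Both second derivatives are within \<open>e\<close> of the same difference
    quotient, hence within \<open>2 * e\<close> of each other, which is less than their assumed
    gap.\<close>
  define e where "e = \<bar>?a - ?b\<bar> / 3"
  have e: "e > 0" using ne by (simp add: e_def)
  obtain d where d: "d > 0" "\<And>t. 0 < t \<and> t < d \<Longrightarrow>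
    \<bar>h (x + t *\<^sub>R v + t *\<^sub>R w) - h (x + t *\<^sub>R v) - h (x + t *\<^sub>R w) + h x - t\<^sup>2 * ?a\<bar> \<le> e * t\<^sup>2"
    using second_difference[OF assms e] by blast
  obtain d' where d': "d' > 0" "\<And>t. 0 < t \<and> t < d' \<Longrightarrow>
    \<bar>h (x + t *\<^sub>R w + t *\<^sub>R v) - h (x + t *\<^sub>R w) - h (x + t *\<^sub>R v) + h x - t\<^sup>2 * ?b\<bar> \<le> e * t\<^sup>2"
    using second_difference[OF assms e] by blast
  define t where "t = min d d' / 2"
  have t: "0 < t" "t < d" "t < d'" using d d' by (auto simp: t_def)
  have "\<bar>t\<^sup>2 * ?a - t\<^sup>2 * ?b\<bar> \<le> e * t\<^sup>2 + e * t\<^sup>2"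
    using d(2)[of t] d'(2)[of t] t by (simp add: add_ac)
  then have "t\<^sup>2 * \<bar>?a - ?b\<bar> \<le> t\<^sup>2 * (2 * e)"
    by (simp add: right_diff_distrib[symmetric] abs_mult mult_ac)
  then have "\<bar>?a - ?b\<bar> \<le> 2 * e" using t by simp
  then show False using e by (simp add: e_def)
qed

lemma dir_deriv_bounded_linear:
  assumes "bounded_linear L" "h differentiable (at x)"
  shows "dir_deriv (\<lambda>y. L (h y)) x v = L (dir_deriv h x v)"
  using frechet_derivative_at[OF bounded_linear.has_derivative[OF assms(1) has_derivative_dir_deriv[OF assms(2)]]]
  by metis

lemma dir_deriv_commute:
  fixes h :: "real^'n \<Rightarrow> 'b::euclidean_space"
  assumes "open U" "smooth_on U h" "x \<in> U"
  shows "dir_deriv (\<lambda>y. dir_deriv h y v) x w = dir_deriv (\<lambda>y. dir_deriv h y w) x v"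
proof (rule euclidean_eqI)
  fix b :: 'b
  note lin = bounded_linear_inner_left[of b]
  have *: "dir_deriv (\<lambda>y. dir_deriv h y v) x w \<bullet> b = dir_deriv (\<lambda>y. dir_deriv (\<lambda>z. h z \<bullet> b) y v) x w" for v w
  proof -
    have "dir_deriv (\<lambda>y. dir_deriv h y v) x w \<bullet> b = dir_deriv (\<lambda>y. dir_deriv h y v \<bullet> b) x w"
      by (rule dir_deriv_bounded_linear[OF lin, symmetric],
          rule smooth_on_differentiable[OF smooth_on_dir_deriv[OF assms(1,2)] assms(3)])
    also have "\<dots> = dir_deriv (\<lambda>y. dir_deriv (\<lambda>z. h z \<bullet> b) y v) x w"
      by (rule dir_deriv_cong[OF assms(1,3)],
          rule dir_deriv_bounded_linear[OF lin, symmetric], rule smooth_on_differentiable[OF assms(2)])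
    finally show ?thesis .
  qed
  show "dir_deriv (\<lambda>y. dir_deriv h y v) x w \<bullet> b = dir_deriv (\<lambda>y. dir_deriv h y w) x v \<bullet> b"
    unfolding * by (rule dir_deriv_commute_real[OF assms(1) smooth_on_linear[OF lin assms(1,2)] assms(3)])
qed

lemma dir_deriv_sum:
  assumes "finite I" "\<And>i. i \<in> I \<Longrightarrow> h i differentiable (at x)"
  shows "dir_deriv (\<lambda>y. \<Sum>i\<in>I. c i *\<^sub>R h i y) x v = (\<Sum>i\<in>I. c i *\<^sub>R dir_deriv (h i) x v)"
proof -
  have "((\<lambda>y. \<Sum>i\<in>I. c i *\<^sub>R h i y) has_derivative (\<lambda>v. \<Sum>i\<in>I. c i *\<^sub>R dir_deriv (h i) x v)) (at x)"
    by (rule has_derivative_sum, rule has_derivative_scaleR_right, rule has_derivative_dir_deriv, rule assms(2))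
  then show ?thesis
    by (rule fun_cong[OF frechet_derivative_at[symmetric]])
qed

text \<open>Linearity in \<open>w\<close> is built into the outer derivative; linearity in
  \<open>v\<close>, the direction fixed first, is read off from this sum.\<close>

lemma dir_deriv_dir_deriv_eq_sum:
  assumes "open U" "smooth_on U h" "x \<in> U"
  shows "dir_deriv (\<lambda>y. dir_deriv h y v) x w = (\<Sum>i\<in>UNIV. v $ i *\<^sub>R dir_deriv (coord_deriv i h) x w)"
proof -
  have "dir_deriv (\<lambda>y. dir_deriv h y v) x w = dir_deriv (\<lambda>y. \<Sum>i\<in>UNIV. v $ i *\<^sub>R coord_deriv i h y) x w"
    by (rule dir_deriv_cong[OF assms(1,3)]) (rule dir_deriv_eq_sum[OF smooth_on_differentiable[OF assms(2)]])
  then show ?thesis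
    using assms by (simp add: dir_deriv_sum smooth_on_differentiable[OF smooth_on_coord_deriv])
qed

section \<open>Bounds for derivatives on compact sets\<close>

lemma continuous_on_compact_bound:
  fixes h :: "'a::topological_space \<Rightarrow> 'b::real_normed_vector"
  assumes "compact K" "continuous_on K h"
  shows "\<exists>C\<ge>0. \<forall>x\<in>K. norm (h x) \<le> C"
proof -
  have "bounded (h ` K)"
    using assms by (intro compact_imp_bounded compact_continuous_image)
  then obtain C where "\<forall>x\<in>K. norm (h x) \<le> C"
    unfolding bounded_iff by blast
  then have "\<forall>x\<in>K. norm (h x) \<le> \<bar>C\<bar>" by force
  then show ?thesis by (intro exI[of _ "\<bar>C\<bar>"]) auto
qed

text \<open>Turns bounds for the finitely many partial derivatives into one that is uniform in the
  direction. The weight \<open>B\<close> carries the norms of directions treated earlier, so that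
  the step can be repeated for second and third derivatives.\<close>

lemma sum_component_bound:
  fixes h :: "'n::finite \<Rightarrow> 'p \<Rightarrow> 'b::real_normed_vector"
  assumes "\<And>i. \<exists>C\<ge>0. \<forall>p\<in>P. norm (h i p) \<le> C * B p"
  shows "\<exists>C\<ge>0. \<forall>p\<in>P. \<forall>v::real^'n. norm (\<Sum>i\<in>UNIV. v $ i *\<^sub>R h i p) \<le> C * norm v * B p"
proof -
  obtain C where C: "\<And>i. C i \<ge> 0" "\<And>i p. p \<in> P \<Longrightarrow> norm (h i p) \<le> C i * B p"
    using assms by metis
  have "norm (\<Sum>i\<in>UNIV. v $ i *\<^sub>R h i p) \<le> (\<Sum>i\<in>UNIV. C i) * norm v * B p"
    if "p \<in> P" for p and v :: "real^'n"
  proof -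
    have "norm (\<Sum>i\<in>UNIV. v $ i *\<^sub>R h i p) \<le> (\<Sum>i\<in>UNIV. norm v * (C i * B p))"
    proof (rule order_trans[OF norm_sum], rule sum_mono)
      fix i show "norm (v $ i *\<^sub>R h i p) \<le> norm v * (C i * B p)"
        using mult_mono[OF component_le_norm_cart[of v i] C(2)[OF that, of i]] by simp
    qed
    then show ?thesis by (simp add: sum_distrib_left sum_distrib_right mult_ac)
  qed
  then show ?thesis
    using C(1) by (intro exI[of _ "\<Sum>i\<in>UNIV. C i"]) (auto intro: sum_nonneg)
qed

lemma dir_deriv_bound1:
  fixes h :: "real^'n \<Rightarrow> 'b::real_normed_vector"
  assumes "open U" "smooth_on U h" "compact K" "K \<subseteq> U"
  shows "\<exists>C\<ge>0. \<forall>x\<in>K. \<forall>v. norm (dir_deriv h x v) \<le> C * norm v"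
proof -
  have *: "\<exists>C\<ge>0. \<forall>x\<in>K. norm (coord_deriv i h x) \<le> C * 1" for i
    using continuous_on_compact_bound[OF assms(3) continuous_on_subset[OF
        smooth_on_continuous_on[OF smooth_on_coord_deriv[OF assms(2)]] assms(4)]] by simp
  obtain C where "C \<ge> 0"
    "\<forall>x\<in>K. \<forall>v. norm (\<Sum>i\<in>UNIV. v $ i *\<^sub>R coord_deriv i h x) \<le> C * norm v * 1"
    using sum_component_bound[of K "\<lambda>i. coord_deriv i h" "\<lambda>_. 1", OF *] by blast
  then show ?thesis
    using dir_deriv_eq_sum[OF smooth_on_differentiable[OF assms(2)]] assms(4)
    by (intro exI[of _ C]) (simp add: subset_iff)
qed

lemma dir_deriv_bound2:
  fixes h :: "real^'n \<Rightarrow> 'b::real_normed_vector"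
  assumes "open U" "smooth_on U h" "compact K" "K \<subseteq> U"
  shows "\<exists>C\<ge>0. \<forall>x\<in>K. \<forall>v w. norm (dir_deriv (\<lambda>y. dir_deriv h y v) x w) \<le> C * norm v * norm w"
proof -
  have "\<exists>C\<ge>0. \<forall>p\<in>K \<times> UNIV. norm (dir_deriv (coord_deriv i h) (fst p) (snd p)) \<le> C * norm (snd p)" for i
    using dir_deriv_bound1[OF assms(1) smooth_on_coord_deriv[OF assms(2)] assms(3,4)] by fastforce
  from sum_component_bound[OF this] obtain C where C: "C \<ge> 0"
    "\<And>x w v. x \<in> K \<Longrightarrow> norm (\<Sum>i\<in>UNIV. v $ i *\<^sub>R dir_deriv (coord_deriv i h) x w) \<le> C * norm v * norm w"
    by fastforce
  then show ?thesis
    using dir_deriv_dir_deriv_eq_sum[OF assms(1,2)] assms(4)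
    by (intro exI[of _ C]) (simp add: subset_iff)
qed

lemma dir_deriv_bound3:
  fixes h :: "real^'n \<Rightarrow> 'b::real_normed_vector"
  assumes "open U" "smooth_on U h" "compact K" "K \<subseteq> U"
  shows "\<exists>C\<ge>0. \<forall>x\<in>K. \<forall>u v w.
    norm (dir_deriv (\<lambda>z. dir_deriv (\<lambda>y. dir_deriv h y u) z v) x w) \<le> C * norm u * (norm v * norm w)"
proof -
  have "\<exists>C\<ge>0. \<forall>p\<in>K \<times> UNIV \<times> UNIV.
      norm (dir_deriv (\<lambda>y. dir_deriv (coord_deriv i h) y (fst (snd p))) (fst p) (snd (snd p)))
        \<le> C * (norm (fst (snd p)) * norm (snd (snd p)))" for i
    using dir_deriv_bound2[OF assms(1) smooth_on_coord_deriv[OF assms(2)] assms(3,4)]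
    by (fastforce simp: mult.assoc)
  from sum_component_bound[OF this] obtain C where C: "C \<ge> 0"
    "\<And>x v w u. x \<in> K \<Longrightarrow> norm (\<Sum>i\<in>UNIV. u $ i *\<^sub>R dir_deriv (\<lambda>y. dir_deriv (coord_deriv i h) y v) x w)
       \<le> C * norm u * (norm v * norm w)"
    by fastforce
  have "dir_deriv (\<lambda>z. dir_deriv (\<lambda>y. dir_deriv h y u) z v) x w =
      (\<Sum>i\<in>UNIV. u $ i *\<^sub>R dir_deriv (\<lambda>y. dir_deriv (coord_deriv i h) y v) x w)" if "x \<in> U" for x u v w
  proof -
    have "dir_deriv (\<lambda>z. dir_deriv (\<lambda>y. dir_deriv h y u) z v) x w =
        dir_deriv (\<lambda>z. \<Sum>i\<in>UNIV. u $ i *\<^sub>R dir_deriv (coord_deriv i h) z v) x w"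
      by (rule dir_deriv_cong[OF assms(1) that]) (rule dir_deriv_dir_deriv_eq_sum[OF assms(1,2)])
    then show ?thesis
      using assms that by (simp add: dir_deriv_sum
          smooth_on_differentiable[OF smooth_on_dir_deriv[OF _ smooth_on_coord_deriv]])
  qed
  then show ?thesis
    using C assms(4) by (intro exI[of _ C]) (simp add: subset_iff)
qed

section \<open>Taylor expansion with a uniform cubic remainder\<close>

lemma compact_in_open_thicken:
  fixes K :: "'a::euclidean_space set"
  assumes "compact K" "open U" "K \<subseteq> U"
  shows "\<exists>r>0. \<exists>L. compact L \<and> L \<subseteq> U \<and> (\<forall>x\<in>K. \<forall>\<xi>. norm \<xi> \<le> r \<longrightarrow> x + \<xi> \<in> L)"
proof -
  obtain r where r: "r > 0" "(\<Union>x\<in>K. cball x r) \<subseteq> U"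
    using compact_subset_open_imp_cball_epsilon_subset[OF assms] by blast
  let ?L = "{x + \<xi> | x \<xi>. x \<in> K \<and> \<xi> \<in> cball 0 r}"
  have "?L \<subseteq> U"
    using r(2) by (force simp: dist_norm)
  moreover have "compact ?L"
    using assms(1) by (intro compact_sums) auto
  ultimately show ?thesis
    using r(1) by (intro exI[of _ r] conjI exI[of _ ?L]) auto
qed

lemma taylor3_real:
  fixes h :: "real^'n \<Rightarrow> real"
  assumes "open U" "smooth_on U h" "compact K" "K \<subseteq> U"
  shows "\<exists>r>0. \<exists>C\<ge>0. \<forall>x\<in>K. \<forall>\<xi>. norm \<xi> \<le> r \<longrightarrow> x + \<xi> \<in> U \<and>
    \<bar>h (x + \<xi>) - h x - dir_deriv h x \<xi> - dir_deriv (\<lambda>y. dir_deriv h y \<xi>) x \<xi> / 2\<bar> \<le> C * norm \<xi> ^ 3"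
proof -
  \<comment> \<open>The remainder is evaluated between \<open>x\<close> and
    \<open>x + \<xi>\<close>, in general outside \<open>K\<close>, so the third derivatives are
    bounded on the thickening \<open>L\<close>.\<close>
  obtain r L where r: "r > 0" and L: "compact L" "L \<subseteq> U" "\<And>x \<xi>. x \<in> K \<Longrightarrow> norm \<xi> \<le> r \<Longrightarrow> x + \<xi> \<in> L"
    using compact_in_open_thicken[OF assms(3,1,4)] by blast
  obtain C where C: "C \<ge> 0" "\<And>x u v w. x \<in> L \<Longrightarrow>
    norm (dir_deriv (\<lambda>z. dir_deriv (\<lambda>y. dir_deriv h y u) z v) x w) \<le> C * norm u * (norm v * norm w)"
    using dir_deriv_bound3[OF assms(1,2) L(1,2)] by blast
  have "x + \<xi> \<in> U \<and>
    \<bar>h (x + \<xi>) - h x - dir_deriv h x \<xi> - dir_deriv (\<lambda>y. dir_deriv h y \<xi>) x \<xi> / 2\<bar> \<le> C * norm \<xi> ^ 3"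
    if x: "x \<in> K" and \<xi>: "norm \<xi> \<le> r" for x \<xi>
  proof
    show "x + \<xi> \<in> U" using L x \<xi> by blast
    have in_L: "x + t *\<^sub>R \<xi> \<in> L" if "0 \<le> t" "t \<le> 1" for t
      using L(3)[OF x, of "t *\<^sub>R \<xi>"] that \<xi> mult_left_le_one_le[of "norm \<xi>" t] by simp
    define diff where "diff m = (if m = 0 then h else if m = 1 then (\<lambda>y. dir_deriv h y \<xi>)
      else if m = 2 then (\<lambda>z. dir_deriv (\<lambda>y. dir_deriv h y \<xi>) z \<xi>)
      else (\<lambda>x. dir_deriv (\<lambda>z. dir_deriv (\<lambda>y. dir_deriv h y \<xi>) z \<xi>) x \<xi>))" for m :: nat
    have sm: "smooth_on U (diff m)" for m
      unfolding diff_def using assms(1,2) by (auto intro!: smooth_on_dir_deriv)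
    have "((\<lambda>t. diff m (x + t *\<^sub>R \<xi>)) has_real_derivative diff (Suc m) (x + t *\<^sub>R \<xi>)) (at t)"
      if "m < 3" "0 \<le> t" "t \<le> 1" for m t
    proof -
      have "diff (Suc m) = (\<lambda>y. dir_deriv (diff m) y \<xi>)"
        using that(1) unfolding diff_def by (auto simp: less_Suc_eq numeral_3_eq_3)
      then show ?thesis
        using has_derivative_along_line[OF smooth_on_differentiable[OF sm], of x t \<xi> m UNIV] in_L[of t] L(2) that
        unfolding has_real_derivative_iff_has_vector_derivative by auto
    qed
    then obtain t where t: "0 < t" "t < 1" and eq:
      "h (x + 1 *\<^sub>R \<xi>) = (\<Sum>m<3. diff m (x + 0 *\<^sub>R \<xi>) / fact m * 1 ^ m) + diff 3 (x + t *\<^sub>R \<xi>) / fact 3 * 1 ^ 3"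
      using Maclaurin[of 1 3 "\<lambda>m t. diff m (x + t *\<^sub>R \<xi>)" "\<lambda>t. h (x + t *\<^sub>R \<xi>)"]
      by (auto simp: diff_def)
    have "h (x + \<xi>) - h x - dir_deriv h x \<xi> - dir_deriv (\<lambda>y. dir_deriv h y \<xi>) x \<xi> / 2 = diff 3 (x + t *\<^sub>R \<xi>) / 6"
      using eq by (simp add: diff_def numeral_3_eq_3 fact_numeral)
    moreover have "\<bar>diff 3 (x + t *\<^sub>R \<xi>)\<bar> \<le> C * norm \<xi> ^ 3"
      using C(2)[OF in_L[of t], of \<xi> \<xi> \<xi>] t by (simp add: diff_def power3_eq_cube mult_ac)
    ultimately show "\<bar>h (x + \<xi>) - h x - dir_deriv h x \<xi> - dir_deriv (\<lambda>y. dir_deriv h y \<xi>) x \<xi> / 2\<bar>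
      \<le> C * norm \<xi> ^ 3" by simp
  qed
  with r C(1) show ?thesis by blast
qed

text \<open>The intermediate point of the scalar remainder differs from component to component. Only
  the bounds survive: radii are replaced by their minimum and constants by their sum.\<close>

lemma taylor3:
  fixes h :: "real^'n \<Rightarrow> 'b::euclidean_space"
  assumes "open U" "smooth_on U h" "compact K" "K \<subseteq> U"
  shows "\<exists>r>0. \<exists>C\<ge>0. \<forall>x\<in>K. \<forall>\<xi>. norm \<xi> \<le> r \<longrightarrow> x + \<xi> \<in> U \<and>
    norm (h (x + \<xi>) - h x - dir_deriv h x \<xi> - dir_deriv (\<lambda>y. dir_deriv h y \<xi>) x \<xi> /\<^sub>R 2) \<le> C * norm \<xi> ^ 3"
proof -
  have "\<forall>b\<in>(Basis::'b set). \<exists>r>0. \<exists>C\<ge>0. \<forall>x\<in>K. \<forall>\<xi>. norm \<xi> \<le> r \<longrightarrow> x + \<xi> \<in> U \<and>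
    \<bar>(h (x + \<xi>) - h x - dir_deriv h x \<xi> - dir_deriv (\<lambda>y. dir_deriv h y \<xi>) x \<xi> /\<^sub>R 2) \<bullet> b\<bar> \<le> C * norm \<xi> ^ 3"
  proof
    fix b :: 'b
    note lin = bounded_linear_inner_left[of b]
    have 1: "dir_deriv (\<lambda>z. h z \<bullet> b) y v = dir_deriv h y v \<bullet> b" if "y \<in> U" for y v
      by (rule dir_deriv_bounded_linear[OF lin], rule smooth_on_differentiable[OF assms(2) that])
    have 2: "dir_deriv (\<lambda>y. dir_deriv (\<lambda>z. h z \<bullet> b) y v) x w = dir_deriv (\<lambda>y. dir_deriv h y v) x w \<bullet> b"
      if "x \<in> U" for x v w
    proof -
      have "dir_deriv (\<lambda>y. dir_deriv (\<lambda>z. h z \<bullet> b) y v) x w = dir_deriv (\<lambda>y. dir_deriv h y v \<bullet> b) x w"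
        by (rule dir_deriv_cong[OF assms(1) that 1])
      also have "\<dots> = dir_deriv (\<lambda>y. dir_deriv h y v) x w \<bullet> b"
        by (rule dir_deriv_bounded_linear[OF lin],
            rule smooth_on_differentiable[OF smooth_on_dir_deriv[OF assms(1,2)] that])
      finally show ?thesis .
    qed
    show "\<exists>r>0. \<exists>C\<ge>0. \<forall>x\<in>K. \<forall>\<xi>. norm \<xi> \<le> r \<longrightarrow> x + \<xi> \<in> U \<and>
    \<bar>(h (x + \<xi>) - h x - dir_deriv h x \<xi> - dir_deriv (\<lambda>y. dir_deriv h y \<xi>) x \<xi> /\<^sub>R 2) \<bullet> b\<bar> \<le> C * norm \<xi> ^ 3"
      using taylor3_real[OF assms(1) smooth_on_linear[OF lin assms(1,2)] assms(3,4)] assms(4)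
      by (simp add: 1 2 subset_iff inner_diff_left cong: conj_cong)
  qed
  then obtain r C where rC: "\<And>b. b \<in> Basis \<Longrightarrow> r b > 0" "\<And>b. b \<in> Basis \<Longrightarrow> C b \<ge> 0"
    "\<And>b x \<xi>. b \<in> (Basis::'b set) \<Longrightarrow> x \<in> K \<Longrightarrow> norm \<xi> \<le> r b \<Longrightarrow> x + \<xi> \<in> U \<and>
    \<bar>(h (x + \<xi>) - h x - dir_deriv h x \<xi> - dir_deriv (\<lambda>y. dir_deriv h y \<xi>) x \<xi> /\<^sub>R 2) \<bullet> b\<bar> \<le> C b * norm \<xi> ^ 3"
    by metis
  let ?r = "Min (r ` Basis)"
  have r: "?r > 0" "\<And>b. b \<in> Basis \<Longrightarrow> ?r \<le> r b" using rC(1) by auto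
  have "x + \<xi> \<in> U \<and> norm (h (x + \<xi>) - h x - dir_deriv h x \<xi> - dir_deriv (\<lambda>y. dir_deriv h y \<xi>) x \<xi> /\<^sub>R 2)
        \<le> (\<Sum>b\<in>Basis. C b) * norm \<xi> ^ 3"
    if x: "x \<in> K" and \<xi>: "norm \<xi> \<le> ?r" for x \<xi>
  proof
    have le: "norm \<xi> \<le> r b" if "b \<in> Basis" for b using order_trans[OF \<xi> r(2)[OF that]] .
    show "x + \<xi> \<in> U"
      using rC(3)[OF _ x le] SOME_Basis by blast
    show "norm (h (x + \<xi>) - h x - dir_deriv h x \<xi> - dir_deriv (\<lambda>y. dir_deriv h y \<xi>) x \<xi> /\<^sub>R 2)
        \<le> (\<Sum>b\<in>Basis. C b) * norm \<xi> ^ 3"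
      unfolding sum_distrib_right
      by (rule order_trans[OF norm_le_l1], rule sum_mono) (use rC(3)[OF _ x le] in blast)
  qed
  moreover have "(\<Sum>b\<in>Basis. C b) \<ge> 0" using rC(2) by (rule sum_nonneg)
  ultimately show ?thesis using r(1) by blast
qed

lemma local_min_second_derivative:
  fixes h :: "real^'n \<Rightarrow> real"
  assumes "open U" "smooth_on U h" "x \<in> U" and min: "\<And>y. y \<in> U \<Longrightarrow> h x \<le> h y"
  shows "dir_deriv h x v = 0" and "dir_deriv (\<lambda>y. dir_deriv h y v) x v \<ge> 0"
proof -
  obtain r L where r: "r > 0" and L: "L \<subseteq> U" "\<And>\<xi>. norm \<xi> \<le> r \<Longrightarrow> x + \<xi> \<in> L"
    using compact_in_open_thicken[of "{x}" U] assms by auto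
  define d where "d = r / (norm v + 1)"
  have d: "d > 0" using r by (simp add: d_def add_nonneg_pos)
  have inU: "x + a *\<^sub>R v \<in> U" if "\<bar>a\<bar> \<le> d" for a
  proof -
    have "norm (a *\<^sub>R v) \<le> d * norm v"
      using that by (simp add: mult_right_mono)
    also have "\<dots> \<le> d * (norm v + 1)" using d by simp
    also have "\<dots> = r" using norm_ge_zero[of v] by (simp add: d_def add_nonneg_eq_0_iff)
    finally show ?thesis using L by blast
  qed
  let ?p = "\<lambda>a. h (x + a *\<^sub>R v)"
  have D: "(?p has_real_derivative dir_deriv h (x + a *\<^sub>R v) v) (at a)" if "\<bar>a\<bar> \<le> d" for a
    unfolding has_real_derivative_iff_has_vector_derivative
    by (rule has_derivative_along_line smooth_on_differentiable[OF assms(2) inU[OF that]])+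
  have D2: "((\<lambda>a. dir_deriv h (x + a *\<^sub>R v) v) has_real_derivative dir_deriv (\<lambda>y. dir_deriv h y v) (x + 0 *\<^sub>R v) v) (at 0)"
    unfolding has_real_derivative_iff_has_vector_derivative
    by (rule has_derivative_along_line[where a = 0 and h = "\<lambda>y. dir_deriv h y v"])
      (rule smooth_on_differentiable[OF smooth_on_dir_deriv[OF assms(1,2)]], use assms in simp)
  show 0: "dir_deriv h x v = 0"
    using DERIV_local_min[OF D[of 0] d] min[OF inU] d by auto
  show "dir_deriv (\<lambda>y. dir_deriv h y v) x v \<ge> 0"
  proof (rule ccontr)
    assume "\<not> ?thesis"
    \<comment> \<open>A negative second derivative makes the first one negative just to the right of
      0, and the mean value theorem then produces a value below the minimum.\<close>
    then obtain e where e: "e > 0" "\<And>a. 0 < a \<Longrightarrow> a < e \<Longrightarrow> dir_deriv h (x + a *\<^sub>R v) v < 0"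
      using DERIV_neg_dec_right[OF D2] 0 by auto
    define b where "b = min d (e / 2)"
    have b: "0 < b" "b < e" "b \<le> d" using d e by (auto simp: b_def)
    obtain a where "0 < a" "a < b" "?p b - ?p 0 = (b - 0) * dir_deriv h (x + a *\<^sub>R v) v"
      using MVT2[of 0 b ?p "\<lambda>a. dir_deriv h (x + a *\<^sub>R v) v"] D b by auto
    moreover have "dir_deriv h (x + a *\<^sub>R v) v < 0" using e \<open>0 < a\<close> \<open>a < b\<close> b by auto
    ultimately have "?p b < h x"
      using b by (simp add: mult_pos_neg algebra_simps)
    then show False using min[OF inU[of b]] b by auto
  qed
qed

section \<open>Smoothness of reciprocals, determinants and inverse matrices\<close>

lemma Ck_on_inverse:
  fixes h :: "real^'n \<Rightarrow> real"
  assumes "open U" "smooth_on U h" "\<And>x. x \<in> U \<Longrightarrow> h x \<noteq> 0"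
  shows "Ck_on m U (\<lambda>x. inverse (h x))"
proof (induction m)
  case 0
  then show ?case
    using smooth_on_continuous_on[OF assms(2)] assms(3) by (auto intro: continuous_on_inverse)
next
  case (Suc m)
  \<comment> \<open>The derivative of the reciprocal is a product with the reciprocal again, so
    order \<open>Suc m\<close> reduces to order \<open>m\<close> for the same
    \<open>h\<close>.\<close>
  have *: "((\<lambda>x. inverse (h x)) has_derivative (\<lambda>v. - (inverse (h y) * dir_deriv h y v * inverse (h y)))) (at y)"
    if "y \<in> U" for y
    by (rule Deriv.has_derivative_inverse[OF _ smooth_on_has_derivative[OF assms(2) that]]) (use assms(3) that in auto)
  have "Ck_on m U (coord_deriv i (\<lambda>x. inverse (h x)))" for i
  proof (subst Ck_on_cong[OF assms(1)])
    show "Ck_on m U (\<lambda>y. - 1 * (inverse (h y) * coord_deriv i h y * inverse (h y)))"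
      by (intro Ck_on_bilinear[OF bounded_bilinear_mult assms(1)] Suc.IH Ck_on_const
          smooth_onD[OF smooth_on_coord_deriv[OF assms(2)]])
  qed (simp add: coord_deriv_eqI[OF *], simp add: coord_deriv_def)
  then show ?case
    using * by (auto simp: differentiable_def)
qed

lemma smooth_on_inverse:
  fixes h :: "real^'n \<Rightarrow> real"
  assumes "open U" "smooth_on U h" "\<And>x. x \<in> U \<Longrightarrow> h x \<noteq> 0"
  shows "smooth_on U (\<lambda>x. inverse (h x))"
  using Ck_on_inverse[OF assms] by (simp add: smooth_on_def)

lemma smooth_on_prod:
  fixes h :: "'i \<Rightarrow> real^'n \<Rightarrow> real"
  assumes "open U"
  shows "(\<And>i. i \<in> I \<Longrightarrow> smooth_on U (h i)) \<Longrightarrow> smooth_on U (\<lambda>x. \<Prod>i\<in>I. h i x)"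
  by (induction I rule: infinite_finite_induct) (auto intro: smooth_on_mult assms)

lemma smooth_on_det:
  fixes H :: "real^'n \<Rightarrow> real^'m^'m"
  assumes "open U" "\<And>i j. smooth_on U (\<lambda>x. H x $ i $ j)"
  shows "smooth_on U (\<lambda>x. det (H x))"
  unfolding det_def
  by (rule smooth_on_sum[OF assms(1)], rule smooth_on_mult[OF assms(1) smooth_on_const],
      rule smooth_on_prod[OF assms(1)], rule assms(2))

lemma matrix_inv_works:
  fixes A :: "real^'n^'n"
  assumes "invertible A"
  shows "A ** matrix_inv A = mat 1" "matrix_inv A ** A = mat 1"
  using someI_ex[OF assms[unfolded invertible_def]] unfolding matrix_inv_def by auto

text \<open>Cramer's rule exhibits the entries of the inverse as quotients of polynomials in the
  entries of the matrix, which is what smoothness of the inverse rests on.\<close>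

lemma matrix_inv_component:
  fixes A :: "real^'n^'n"
  assumes "invertible A"
  shows "matrix_inv A $ k $ j = det (\<chi> i l. if l = k then axis j 1 $ i else A $ i $ l) / det A"
proof -
  have "A *v (matrix_inv A *v axis j 1) = axis j 1"
    using matrix_inv_works(1)[OF assms] by (simp add: matrix_vector_mul_assoc)
  then have "matrix_inv A *v axis j 1 = (\<chi> k. det (\<chi> i l. if l = k then axis j 1 $ i else A $ i $ l) / det A)"
    using cramer[of A] assms by (simp add: invertible_det_nz)
  then show ?thesis
    by (simp add: vec_eq_iff matrix_vector_mul_component inner_axis)
qed

lemma smooth_on_matrix_inv:
  fixes H :: "real^'n \<Rightarrow> real^'m^'m"
  assumes "open U" "smooth_on U H" "\<And>x. x \<in> U \<Longrightarrow> invertible (H x)"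
  shows "smooth_on U (\<lambda>x. matrix_inv (H x))"
proof (rule smooth_on_vec[OF assms(1)], rule smooth_on_vec[OF assms(1)])
  fix k j :: 'm
  have comp: "smooth_on U (\<lambda>x. H x $ i $ l)" for i l
    by (intro smooth_on_vec_nth assms)
  have "smooth_on U (\<lambda>x. (\<chi> i l. if l = k then axis j 1 $ i else H x $ i $ l) $ i $ l)" for i l
    using comp[of i l] by (cases "l = k") auto
  then have "smooth_on U (\<lambda>x. det (\<chi> i l. if l = k then axis j 1 $ i else H x $ i $ l) * inverse (det (H x)))"
    using assms(3) by (intro smooth_on_mult smooth_on_inverse smooth_on_det assms(1) comp)
      (auto simp: invertible_det_nz)
  then show "smooth_on U (\<lambda>x. matrix_inv (H x) $ k $ j)"
    by (subst smooth_on_cong[OF assms(1)]) (auto simp: matrix_inv_component[OF assms(3)] divide_inverse)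
qed

section \<open>Local Riemannian geometry\<close>

lemma bilinear_eq_sum:
  fixes B :: "real^'m \<Rightarrow> real^'l \<Rightarrow> 'b::real_vector"
  assumes bil: "bilinear B"
  shows "B v w = (\<Sum>i\<in>UNIV. \<Sum>j\<in>UNIV. (v $ i * w $ j) *\<^sub>R B (axis i 1) (axis j 1))"
proof -
  have "B v w = B (\<Sum>i\<in>UNIV. v $ i *\<^sub>R axis i 1) (\<Sum>j\<in>UNIV. w $ j *\<^sub>R axis j 1)"
    using vec_eq_sum_axis[of v] vec_eq_sum_axis[of w] by simp
  also have "\<dots> = (\<Sum>i\<in>UNIV. \<Sum>j\<in>UNIV. (v $ i * w $ j) *\<^sub>R B (axis i 1) (axis j 1))"
    by (simp add: bilinear_sum[OF bil] sum.cartesian_product bilinear_lmul[OF bil] bilinear_rmul[OF bil] mult.commute)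
  finally show ?thesis .
qed

text \<open>The product rule for a bilinear map that depends on the base point. The parameter
  \<open>t\<close> lies in any normed space: it is a point for vector fields and transition maps,
  and a time for fields along a curve. Expansion in the coordinate axes reduces it to scalar
  factors.\<close>

lemma has_derivative_bilinear_field:
  fixes B :: "real^'n \<Rightarrow> real^'m \<Rightarrow> real^'l \<Rightarrow> 'b::real_normed_vector"
  assumes bil: "\<And>y. bilinear (B y)"
    and B: "\<And>v w. (\<lambda>y. B y v w) differentiable (at (x t))"
    and x: "(x has_derivative x') (at t within S)"
    and X: "(X has_derivative X') (at t within S)"
    and Y: "(Y has_derivative Y') (at t within S)"
  shows "((\<lambda>t. B (x t) (X t) (Y t)) has_derivative
    (\<lambda>h. dir_deriv (\<lambda>y. B y (X t) (Y t)) (x t) (x' h) + B (x t) (X' h) (Y t) + B (x t) (X t) (Y' h)))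
    (at t within S)"
proof -
  let ?b = "\<lambda>i j y. B y (axis i 1) (axis j 1)"
  have expand: "B y v w = (\<Sum>i\<in>UNIV. \<Sum>j\<in>UNIV. (v $ i * w $ j) *\<^sub>R ?b i j y)" for y v w
    by (rule bilinear_eq_sum[OF bil])
  have b: "((\<lambda>t. ?b i j (x t)) has_derivative (\<lambda>h. dir_deriv (?b i j) (x t) (x' h))) (at t within S)" for i j
    by (rule has_derivative_compose[OF x has_derivative_dir_deriv[OF B]])
  have comp: "((\<lambda>t. X t $ i) has_derivative (\<lambda>h. X' h $ i)) (at t within S)"
    "((\<lambda>t. Y t $ j) has_derivative (\<lambda>h. Y' h $ j)) (at t within S)" for i j
    by (rule bounded_linear.has_derivative[OF bounded_linear_vec_nth X]
        bounded_linear.has_derivative[OF bounded_linear_vec_nth Y])+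
  have main: "((\<lambda>t. \<Sum>i\<in>UNIV. \<Sum>j\<in>UNIV. (X t $ i * Y t $ j) *\<^sub>R ?b i j (x t)) has_derivative
    (\<lambda>h. \<Sum>i\<in>UNIV. \<Sum>j\<in>UNIV. (X t $ i * Y t $ j) *\<^sub>R dir_deriv (?b i j) (x t) (x' h)
       + (X t $ i * Y' h $ j + X' h $ i * Y t $ j) *\<^sub>R ?b i j (x t))) (at t within S)"
    by (intro has_derivative_sum has_derivative_scaleR has_derivative_mult comp b)
  have D0: "dir_deriv (\<lambda>y. B y (X t) (Y t)) (x t) h = (\<Sum>i\<in>UNIV. \<Sum>j\<in>UNIV. (X t $ i * Y t $ j) *\<^sub>R dir_deriv (?b i j) (x t) h)" for h
  proof -
    have "((\<lambda>y. \<Sum>i\<in>UNIV. \<Sum>j\<in>UNIV. (X t $ i * Y t $ j) *\<^sub>R ?b i j y) has_derivative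
      (\<lambda>h. \<Sum>i\<in>UNIV. \<Sum>j\<in>UNIV. (X t $ i * Y t $ j) *\<^sub>R dir_deriv (?b i j) (x t) h)) (at (x t))"
      by (intro has_derivative_sum has_derivative_scaleR_right has_derivative_dir_deriv B)
    then show ?thesis
      unfolding expand[of _ "X t" "Y t", symmetric] by (rule fun_cong[OF frechet_derivative_at[symmetric]])
  qed
  have D: "(\<lambda>h. dir_deriv (\<lambda>y. B y (X t) (Y t)) (x t) (x' h) + B (x t) (X' h) (Y t) + B (x t) (X t) (Y' h))
    = (\<lambda>h. \<Sum>i\<in>UNIV. \<Sum>j\<in>UNIV. (X t $ i * Y t $ j) *\<^sub>R dir_deriv (?b i j) (x t) (x' h)
       + (X t $ i * Y' h $ j + X' h $ i * Y t $ j) *\<^sub>R ?b i j (x t))"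
    by (simp only: D0 expand[of "x t" "X' _" "Y t"] expand[of "x t" "X t" "Y' _"])
      (simp add: sum.distrib scaleR_add_left add_ac)
  have E: "(\<lambda>t. B (x t) (X t) (Y t)) = (\<lambda>t. \<Sum>i\<in>UNIV. \<Sum>j\<in>UNIV. (X t $ i * Y t $ j) *\<^sub>R ?b i j (x t))"
    by (rule ext) (rule expand)
  show ?thesis
    unfolding D E by (rule main)
qed

lemma dir_deriv_bilinear_field:
  fixes B :: "real^'n \<Rightarrow> real^'m \<Rightarrow> real^'l \<Rightarrow> 'b::real_normed_vector"
  assumes "\<And>y. bilinear (B y)" "\<And>v w. (\<lambda>y. B y v w) differentiable (at x)"
    and "X differentiable (at x)" "Y differentiable (at x)"
  shows "dir_deriv (\<lambda>y. B y (X y) (Y y)) x h =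
    dir_deriv (\<lambda>y. B y (X x) (Y x)) x h + B x (dir_deriv X x h) (Y x) + B x (X x) (dir_deriv Y x h)"
  by (rule fun_cong[OF frechet_derivative_at[symmetric]], rule has_derivative_bilinear_field[where x = "\<lambda>x. x"])
    (use assms in \<open>auto intro: has_derivative_dir_deriv\<close>)

lemma smooth_on_bilinear_field:
  fixes B :: "real^'n \<Rightarrow> real^'m \<Rightarrow> real^'l \<Rightarrow> 'b::real_normed_vector"
  assumes bil: "\<And>y. bilinear (B y)" and U: "open U" and B: "\<And>v w. smooth_on U (\<lambda>y. B y v w)"
    and X: "smooth_on U X" and Y: "smooth_on U Y"
  shows "smooth_on U (\<lambda>y. B y (X y) (Y y))"
proof -
  have "B y v w = (\<Sum>i\<in>UNIV. \<Sum>j\<in>UNIV. (v $ i * w $ j) *\<^sub>R B y (axis i 1) (axis j 1))" for y v w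
    by (rule bilinear_eq_sum[OF bil])
  then have eq: "(\<lambda>y. B y (X y) (Y y)) =
      (\<lambda>y. \<Sum>i\<in>UNIV. \<Sum>j\<in>UNIV. (X y $ i * Y y $ j) *\<^sub>R B y (axis i 1) (axis j 1))" by blast
  show ?thesis
    unfolding eq
    by (intro smooth_on_sum smooth_on_scaleR smooth_on_mult smooth_on_vec_nth X Y B U)
qed

section \<open>Connection, metric and curvature in a coordinate domain\<close>

definition gam :: "(real^'n \<Rightarrow> real^'n^'n) \<Rightarrow> real^'n \<Rightarrow> real^'n \<Rightarrow> real^'n \<Rightarrow> real^'n::finite" where
  "gam H x v w = (\<chi> k. \<Sum>i\<in>UNIV. \<Sum>j\<in>UNIV. christoffel H k i j x * v $ i * w $ j)"

lemma cov_deriv_gam: "cov_deriv H X Y y = dir_deriv Y y (X y) + gam H y (X y) (Y y)"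
  by (simp add: cov_deriv_def gam_def)

lemma bilinear_gam: "bilinear (gam H x)"
  unfolding bilinear_def linear_iff gam_def
  by (auto simp: vec_eq_iff algebra_simps sum.distrib sum_distrib_left)

lemmas gam_simps =
  bilinear_ladd[OF bilinear_gam] bilinear_radd[OF bilinear_gam]
  bilinear_lmul[OF bilinear_gam] bilinear_rmul[OF bilinear_gam]
  bilinear_lneg[OF bilinear_gam] bilinear_rneg[OF bilinear_gam]
  bilinear_lzero[OF bilinear_gam] bilinear_rzero[OF bilinear_gam]
  bilinear_lsub[OF bilinear_gam] bilinear_rsub[OF bilinear_gam]

lemma bilinear_metric_at: "bilinear (metric_at H x)"
  unfolding bilinear_def linear_iff metric_at_def
  by (auto simp: inner_add_left inner_add_right matrix_vector_right_distrib matrix_vector_mult_scaleR)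

lemmas metric_at_simps =
  bilinear_ladd[OF bilinear_metric_at] bilinear_radd[OF bilinear_metric_at]
  bilinear_lmul[OF bilinear_metric_at] bilinear_rmul[OF bilinear_metric_at]
  bilinear_lneg[OF bilinear_metric_at] bilinear_rneg[OF bilinear_metric_at]
  bilinear_lzero[OF bilinear_metric_at] bilinear_rzero[OF bilinear_metric_at]
  bilinear_lsub[OF bilinear_metric_at] bilinear_rsub[OF bilinear_metric_at]

lemma metric_at_sum_sum: "metric_at H x v w = (\<Sum>i\<in>UNIV. \<Sum>j\<in>UNIV. v $ i * w $ j * H x $ i $ j)"
  by (simp add: metric_at_def inner_vec_def matrix_vector_mult_def sum_distrib_left mult_ac)

text \<open>The curvature R(a, b)w on fields with constant components, whose Lie bracket vanishes.
  In this form it depends on vectors at \<open>x\<close> only.\<close>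

definition curv :: "(real^'n \<Rightarrow> real^'n^'n) \<Rightarrow> real^'n \<Rightarrow> real^'n \<Rightarrow> real^'n \<Rightarrow> real^'n \<Rightarrow> real^'n::finite" where
  "curv H x a b w = dir_deriv (\<lambda>y. gam H y b w) x a - dir_deriv (\<lambda>y. gam H y a w) x b
     + gam H x a (gam H x b w) - gam H x b (gam H x a w)"

locale metric_domain =
  fixes U :: "(real^'n::finite) set" and H :: "real^'n \<Rightarrow> real^'n^'n"
  assumes open_U: "open U" and smooth_H: "smooth_on U H"
    and transpose_H: "\<And>x. x \<in> U \<Longrightarrow> transpose (H x) = H x"
    and pos_H: "\<And>x v. x \<in> U \<Longrightarrow> v \<noteq> 0 \<Longrightarrow> v \<bullet> (H x *v v) > 0"
begin

lemma H_sym: "x \<in> U \<Longrightarrow> H x $ i $ j = H x $ j $ i"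
  using transpose_H[of x] by (simp add: transpose_def vec_eq_iff)

lemma metric_sym: "x \<in> U \<Longrightarrow> metric_at H x v w = metric_at H x w v"
  unfolding metric_at_sum_sum by (subst sum.swap) (simp add: mult_ac H_sym[of x])

lemma metric_pos: "x \<in> U \<Longrightarrow> v \<noteq> 0 \<Longrightarrow> metric_at H x v v > 0"
  unfolding metric_at_def by (rule pos_H)

lemma metric_nonneg: "x \<in> U \<Longrightarrow> metric_at H x v v \<ge> 0"
  using metric_pos[of x v] by (cases "v = 0") (auto simp: metric_at_simps)

lemma metric_nondegenerate:
  assumes "x \<in> U" "\<And>w. metric_at H x v w = metric_at H x v' w" shows "v = v'"
  using metric_pos[OF assms(1), of "v - v'"] assms(2)[of "v - v'"] by (auto simp: metric_at_simps)

lemma invertible_H: "x \<in> U \<Longrightarrow> invertible (H x)"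
  unfolding invertible_left_inverse matrix_left_invertible_ker
  using pos_H[of x] by (metis inner_zero_right less_irrefl)

lemma smooth_metric: "smooth_on U (\<lambda>x. metric_at H x v w)"
  unfolding metric_at_sum_sum
  by (intro smooth_on_sum smooth_on_mult smooth_on_const smooth_on_vec_nth open_U smooth_H)

lemma smooth_christoffel: "smooth_on U (christoffel H k i j)"
proof -
  have "christoffel H k i j = (\<lambda>y. (1/2) * (\<Sum>l\<in>UNIV. matrix_inv (H y) $ k $ l *
     (coord_deriv i (\<lambda>x. H x $ j $ l) y + coord_deriv j (\<lambda>x. H x $ i $ l) y
        - coord_deriv l (\<lambda>x. H x $ i $ j) y)))"
    by (rule ext) (simp add: christoffel_def)
  then show ?thesis
    by (simp only:) (intro smooth_on_sum smooth_on_mult smooth_on_const smooth_on_vec_nth open_U smooth_H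
        smooth_on_matrix_inv smooth_on_diff smooth_on_add smooth_on_coord_deriv invertible_H)
qed

lemma smooth_gam: "smooth_on U (\<lambda>x. gam H x v w)"
  unfolding gam_def
  by (rule smooth_on_vec[OF open_U]) (simp, intro smooth_on_sum smooth_on_mult smooth_on_const
      smooth_christoffel open_U)

lemmas diff_metric = smooth_on_differentiable[OF smooth_metric]
  and diff_gam = smooth_on_differentiable[OF smooth_gam]

lemma gam_sym: "x \<in> U \<Longrightarrow> gam H x v w = gam H x w v"
proof -
  assume x: "x \<in> U"
  have "coord_deriv l (\<lambda>x. H x $ i $ j) x = coord_deriv l (\<lambda>x. H x $ j $ i) x" for l i j
    by (rule coord_deriv_cong(1)[OF open_U x]) (rule H_sym)
  then have "christoffel H k i j x = christoffel H k j i x" for i j k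
    unfolding christoffel_def by (simp add: add_ac)
  then show ?thesis
    unfolding gam_def by (subst sum.swap) (simp add: mult_ac)
qed

lemma dir_deriv_metric_sum:
  assumes "x \<in> U"
  shows "dir_deriv (\<lambda>y. metric_at H y v w) x a =
    (\<Sum>i\<in>UNIV. \<Sum>j\<in>UNIV. \<Sum>l\<in>UNIV. a $ i * v $ j * w $ l * coord_deriv i (\<lambda>y. H y $ j $ l) x)"
proof -
  have d: "(\<lambda>y. H y $ j $ l) differentiable (at x)" for j l
    by (rule smooth_on_differentiable[OF _ assms]) (intro smooth_on_vec_nth open_U smooth_H)
  have "((\<lambda>y. \<Sum>j\<in>UNIV. \<Sum>l\<in>UNIV. (v $ j * w $ l) * H y $ j $ l) has_derivative
     (\<lambda>a. \<Sum>j\<in>UNIV. \<Sum>l\<in>UNIV. (v $ j * w $ l) * dir_deriv (\<lambda>y. H y $ j $ l) x a)) (at x)"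
    by (intro has_derivative_sum has_derivative_mult_right has_derivative_dir_deriv d)
  from fun_cong[OF frechet_derivative_at[OF this], of a]
  have "dir_deriv (\<lambda>y. metric_at H y v w) x a =
      (\<Sum>j\<in>UNIV. \<Sum>l\<in>UNIV. (v $ j * w $ l) * (\<Sum>i\<in>UNIV. a $ i * coord_deriv i (\<lambda>y. H y $ j $ l) x))"
    unfolding metric_at_sum_sum by (simp add: dir_deriv_eq_sum[OF d])
  also have "\<dots> = (\<Sum>j\<in>UNIV. \<Sum>l\<in>UNIV. \<Sum>i\<in>UNIV. a $ i * v $ j * w $ l * coord_deriv i (\<lambda>y. H y $ j $ l) x)"
    by (simp add: sum_distrib_left mult_ac)
  also have "\<dots> = (\<Sum>j\<in>UNIV. \<Sum>i\<in>UNIV. \<Sum>l\<in>UNIV. a $ i * v $ j * w $ l * coord_deriv i (\<lambda>y. H y $ j $ l) x)"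
    by (rule sum.cong[OF refl], rule sum.swap)
  also have "\<dots> = (\<Sum>i\<in>UNIV. \<Sum>j\<in>UNIV. \<Sum>l\<in>UNIV. a $ i * v $ j * w $ l * coord_deriv i (\<lambda>y. H y $ j $ l) x)"
    by (rule sum.swap)
  finally show ?thesis .
qed

text \<open>Multiplication by the metric cancels the inverse matrix in the Christoffel symbols and
  leaves the symbols of the first kind.\<close>

lemma lower_gam_component:
  assumes x: "x \<in> U"
  shows "(H x *v gam H x v w) $ l = (\<Sum>i\<in>UNIV. \<Sum>j\<in>UNIV. (1/2) * (coord_deriv i (\<lambda>x. H x $ j $ l) x
    + coord_deriv j (\<lambda>x. H x $ i $ l) x - coord_deriv l (\<lambda>x. H x $ i $ j) x) * v $ i * w $ j)"
proof -
  define c where "c i j m = (1/2) * (coord_deriv i (\<lambda>x. H x $ j $ m) x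
    + coord_deriv j (\<lambda>x. H x $ i $ m) x - coord_deriv m (\<lambda>x. H x $ i $ j) x)" for i j m
  define q :: "real^'n" where "q = (\<chi> m. \<Sum>i\<in>UNIV. \<Sum>j\<in>UNIV. c i j m * v $ i * w $ j)"
  have chr: "christoffel H k i j x = (\<Sum>m\<in>UNIV. matrix_inv (H x) $ k $ m * c i j m)" for i j k
    unfolding christoffel_def c_def by (simp add: sum_distrib_left)
  have "gam H x v w = matrix_inv (H x) *v q"
  proof (rule vec_eq_iff[THEN iffD2], rule allI)
    fix k
    have "gam H x v w $ k = (\<Sum>i\<in>UNIV. \<Sum>j\<in>UNIV. \<Sum>m\<in>UNIV. matrix_inv (H x) $ k $ m * (c i j m * v $ i * w $ j))"
      unfolding gam_def chr by (simp add: sum_distrib_right sum_distrib_left mult_ac)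
    also have "\<dots> = (\<Sum>i\<in>UNIV. \<Sum>m\<in>UNIV. \<Sum>j\<in>UNIV. matrix_inv (H x) $ k $ m * (c i j m * v $ i * w $ j))"
      by (rule sum.cong[OF refl], rule sum.swap)
    also have "\<dots> = (\<Sum>m\<in>UNIV. \<Sum>i\<in>UNIV. \<Sum>j\<in>UNIV. matrix_inv (H x) $ k $ m * (c i j m * v $ i * w $ j))"
      by (rule sum.swap)
    also have "\<dots> = (matrix_inv (H x) *v q) $ k"
      by (simp add: matrix_vector_mult_def q_def sum_distrib_left)
    finally show "gam H x v w $ k = (matrix_inv (H x) *v q) $ k" .
  qed
  then have "H x *v gam H x v w = q"
    using matrix_inv_works(1)[OF invertible_H[OF x]] by (simp add: matrix_vector_mul_assoc)
  then show ?thesis by (simp add: q_def c_def)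
qed

text \<open>For fields with constant components the bracket terms of the Koszul formula vanish, and
  three derivatives of the metric remain.\<close>

lemma koszul:
  assumes x: "x \<in> U"
  shows "metric_at H x (gam H x v w) z = (dir_deriv (\<lambda>y. metric_at H y w z) x v
    + dir_deriv (\<lambda>y. metric_at H y v z) x w - dir_deriv (\<lambda>y. metric_at H y v w) x z) / 2"
proof -
  let ?d = "\<lambda>i j l. coord_deriv i (\<lambda>y. H y $ j $ l) x"
  have 1: "metric_at H x (gam H x v w) z = (\<Sum>l\<in>UNIV. \<Sum>i\<in>UNIV. \<Sum>j\<in>UNIV.
      (?d i j l * v $ i * w $ j * z $ l + ?d j i l * v $ i * w $ j * z $ l - ?d l i j * v $ i * w $ j * z $ l) / 2)"
    unfolding metric_sym[OF x, of "gam H x v w" z]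
    unfolding metric_at_def inner_vec_def inner_real_def lower_gam_component[OF x]
    by (simp add: sum_distrib_left algebra_simps add_divide_distrib diff_divide_distrib)
  have 2: "(\<Sum>l\<in>UNIV. \<Sum>i\<in>UNIV. \<Sum>j\<in>UNIV. ?d i j l * v $ i * w $ j * z $ l) = dir_deriv (\<lambda>y. metric_at H y w z) x v"
  proof -
    have "(\<Sum>l\<in>UNIV. \<Sum>i\<in>UNIV. \<Sum>j\<in>UNIV. ?d i j l * v $ i * w $ j * z $ l)
       = (\<Sum>i\<in>UNIV. \<Sum>l\<in>UNIV. \<Sum>j\<in>UNIV. ?d i j l * v $ i * w $ j * z $ l)" by (rule sum.swap)
    also have "\<dots> = (\<Sum>i\<in>UNIV. \<Sum>j\<in>UNIV. \<Sum>l\<in>UNIV. ?d i j l * v $ i * w $ j * z $ l)"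
      by (rule sum.cong[OF refl], rule sum.swap)
    finally show ?thesis unfolding dir_deriv_metric_sum[OF x] by (simp add: mult_ac)
  qed
  have 3: "(\<Sum>l\<in>UNIV. \<Sum>i\<in>UNIV. \<Sum>j\<in>UNIV. ?d j i l * v $ i * w $ j * z $ l) = dir_deriv (\<lambda>y. metric_at H y v z) x w"
  proof -
    have "(\<Sum>l\<in>UNIV. \<Sum>i\<in>UNIV. \<Sum>j\<in>UNIV. ?d j i l * v $ i * w $ j * z $ l)
       = (\<Sum>l\<in>UNIV. \<Sum>j\<in>UNIV. \<Sum>i\<in>UNIV. ?d j i l * v $ i * w $ j * z $ l)"
      by (rule sum.cong[OF refl], rule sum.swap)
    also have "\<dots> = (\<Sum>j\<in>UNIV. \<Sum>l\<in>UNIV. \<Sum>i\<in>UNIV. ?d j i l * v $ i * w $ j * z $ l)" by (rule sum.swap)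
    also have "\<dots> = (\<Sum>j\<in>UNIV. \<Sum>i\<in>UNIV. \<Sum>l\<in>UNIV. ?d j i l * v $ i * w $ j * z $ l)"
      by (rule sum.cong[OF refl], rule sum.swap)
    finally show ?thesis unfolding dir_deriv_metric_sum[OF x] by (simp add: mult_ac)
  qed
  have 4: "(\<Sum>l\<in>UNIV. \<Sum>i\<in>UNIV. \<Sum>j\<in>UNIV. ?d l i j * v $ i * w $ j * z $ l) = dir_deriv (\<lambda>y. metric_at H y v w) x z"
    unfolding dir_deriv_metric_sum[OF x] by (simp add: mult_ac)
  show ?thesis
    unfolding 1 sum_divide_distrib[symmetric] sum.distrib sum_subtractf 2 3 4 ..
qed

text \<open>In the sum of the two Koszul formulas all terms cancel except two equal halves of the
  left-hand side.\<close>

lemma metric_compat: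
  assumes x: "x \<in> U"
  shows "dir_deriv (\<lambda>y. metric_at H y v w) x a = metric_at H x (gam H x a v) w + metric_at H x v (gam H x a w)"
proof -
  have "dir_deriv (\<lambda>y. metric_at H y v w) x a = dir_deriv (\<lambda>y. metric_at H y w v) x a"
    by (rule dir_deriv_cong[OF open_U x]) (rule metric_sym)
  moreover have "dir_deriv (\<lambda>y. metric_at H y a v) x w = dir_deriv (\<lambda>y. metric_at H y v a) x w"
    "dir_deriv (\<lambda>y. metric_at H y a w) x v = dir_deriv (\<lambda>y. metric_at H y w a) x v"
    by (rule dir_deriv_cong[OF open_U x], rule metric_sym, assumption)+
  ultimately show ?thesis
    unfolding metric_sym[OF x, of v] koszul[OF x] by (simp add: field_simps)
qed

lemma smooth_cov_const: "smooth_on U (\<lambda>y. metric_at H y (gam H y b v) w)"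
  by (rule smooth_on_bilinear_field[OF bilinear_metric_at open_U smooth_metric smooth_gam smooth_on_const])

lemma dir_deriv_metric_field:
  assumes "x \<in> U" "X differentiable (at x)" "Y differentiable (at x)"
  shows "dir_deriv (\<lambda>y. metric_at H y (X y) (Y y)) x a =
    metric_at H x (dir_deriv X x a + gam H x a (X x)) (Y x) + metric_at H x (X x) (dir_deriv Y x a + gam H x a (Y x))"
  using dir_deriv_bilinear_field[OF bilinear_metric_at diff_metric[OF assms(1)] assms(2,3)]
  by (simp add: metric_compat[OF assms(1)] metric_at_simps)

lemma dir_deriv_gam_field:
  assumes "x \<in> U" "X differentiable (at x)" "Y differentiable (at x)"
  shows "dir_deriv (\<lambda>y. gam H y (X y) (Y y)) x a =
    dir_deriv (\<lambda>y. gam H y (X x) (Y x)) x a + gam H x (dir_deriv X x a) (Y x) + gam H x (X x) (dir_deriv Y x a)"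
  by (rule dir_deriv_bilinear_field[OF bilinear_gam diff_gam[OF assms(1)] assms(2,3)])

text \<open>The second derivatives of \<open>metric_at H y w z\<close> in the directions
  \<open>a\<close> and \<open>b\<close> commute. Written out by \<open>metric_compat\<close>, the
  mixed products of two connection terms are symmetric in \<open>a\<close> and \<open>b\<close>;
  what remains is the claim.\<close>

lemma curv_skew:
  assumes x: "x \<in> U"
  shows "metric_at H x (curv H x a b w) z + metric_at H x w (curv H x a b z) = 0"
proof -
  have T: "dir_deriv (\<lambda>y. dir_deriv (\<lambda>y. metric_at H y w z) y b) x a =
     metric_at H x (dir_deriv (\<lambda>y. gam H y b w) x a + gam H x a (gam H x b w)) z
     + metric_at H x (gam H x b w) (gam H x a z)
     + metric_at H x (gam H x a w) (gam H x b z)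
     + metric_at H x w (dir_deriv (\<lambda>y. gam H y b z) x a + gam H x a (gam H x b z))" for a b
  proof -
    have "dir_deriv (\<lambda>y. dir_deriv (\<lambda>y. metric_at H y w z) y b) x a =
      dir_deriv (\<lambda>y. metric_at H y (gam H y b w) z + metric_at H y w (gam H y b z)) x a"
      by (rule dir_deriv_cong[OF open_U x metric_compat])
    also have "\<dots> = dir_deriv (\<lambda>y. metric_at H y (gam H y b w) z) x a + dir_deriv (\<lambda>y. metric_at H y w (gam H y b z)) x a"
      by (rule fun_cong[OF frechet_derivative_at[symmetric]], intro has_derivative_add smooth_on_has_derivative[OF _ x]
          smooth_on_bilinear_field[OF bilinear_metric_at open_U smooth_metric] smooth_gam smooth_on_const)
    finally show ?thesis
      using dir_deriv_metric_field[OF x diff_gam[OF x, of b w] differentiable_const[of z], of a]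
        dir_deriv_metric_field[OF x differentiable_const[of w] diff_gam[OF x, of b z], of a]
      by (simp add: metric_at_simps)
  qed
  have "dir_deriv (\<lambda>y. dir_deriv (\<lambda>y. metric_at H y w z) y b) x a = dir_deriv (\<lambda>y. dir_deriv (\<lambda>y. metric_at H y w z) y a) x b"
    by (rule dir_deriv_commute[OF open_U smooth_metric x])
  then show ?thesis
    unfolding T curv_def by (simp add: metric_at_simps)
qed

lemma riem_curvature_const:
  assumes x: "x \<in> U"
  shows "riem_curvature H (\<lambda>_. a) (\<lambda>_. b) (\<lambda>_. w) x = curv H x a b w"
proof -
  have c: "cov_deriv H (\<lambda>_. b) (\<lambda>_. w) = (\<lambda>y. gam H y b w)" for b
    by (rule ext) (simp add: cov_deriv_gam)
  have l: "lie_bracket (\<lambda>_. a) (\<lambda>_. b) = (\<lambda>_. 0)"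
    by (rule ext) (simp add: lie_bracket_def)
  show ?thesis
    unfolding riem_curvature_def c l by (simp add: cov_deriv_gam gam_simps curv_def)
qed

lemma ricci_eq:
  assumes x: "x \<in> U"
  shows "ricci H x v w = (\<Sum>i\<in>UNIV. curv H x (axis i 1) v w $ i)"
  unfolding ricci_def using riem_curvature_const[OF x] by simp

lemma metric_grad:
  assumes x: "x \<in> U" and F: "F differentiable (at x)"
  shows "metric_at H x (grad H F x) v = dir_deriv F x v"
proof -
  have "H x *v grad H F x = (\<chi> i. coord_deriv i F x)"
    unfolding grad_def using matrix_inv_works(1)[OF invertible_H[OF x]] by (simp add: matrix_vector_mul_assoc)
  then show ?thesis
    unfolding metric_sym[OF x, of "grad H F x" v]
    unfolding metric_at_def dir_deriv_eq_sum[OF F]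
    by (simp add: inner_vec_def)
qed

lemma smooth_grad:
  assumes "smooth_on U F" shows "smooth_on U (grad H F)"
proof -
  show ?thesis
    unfolding grad_def matrix_vector_mult_def
    by (rule smooth_on_vec[OF open_U]) (simp, intro smooth_on_sum smooth_on_mult smooth_on_vec_nth open_U
        smooth_on_matrix_inv smooth_H invertible_H smooth_on_coord_deriv assms)
qed

text \<open>Comes from differentiating \<open>metric_grad\<close> by metric compatibility. In this
  form the symmetry and the behaviour at a critical point are visible.\<close>

lemma hess_eq:
  assumes x: "x \<in> U" and F: "smooth_on U F"
  shows "hess H F x v w = dir_deriv (\<lambda>y. dir_deriv F y w) x v - dir_deriv F x (gam H x v w)"
proof -
  let ?Z = "grad H F"
  have dZ: "?Z differentiable (at x)"
    by (rule smooth_on_differentiable[OF smooth_grad[OF F] x])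
  have "dir_deriv (\<lambda>y. dir_deriv F y w) x v = dir_deriv (\<lambda>y. metric_at H y (?Z y) w) x v"
    by (rule dir_deriv_cong[OF open_U x], rule metric_grad[symmetric], assumption,
        rule smooth_on_differentiable[OF F])
  also have "\<dots> = metric_at H x (dir_deriv ?Z x v + gam H x v (?Z x)) w + metric_at H x (?Z x) (gam H x v w)"
    using dir_deriv_metric_field[OF x dZ differentiable_const[of w], of v] by (simp add: metric_at_simps)
  also have "\<dots> = hess H F x v w + dir_deriv F x (gam H x v w)"
    unfolding hess_def cov_deriv_gam using metric_grad[OF x smooth_on_differentiable[OF F x]] by simp
  finally show ?thesis by simp
qed

lemma hess_sym:
  assumes x: "x \<in> U" and F: "smooth_on U F"
  shows "hess H F x v w = hess H F x w v"
  unfolding hess_eq[OF assms] using dir_deriv_commute[OF open_U F x] gam_sym[OF x] by metis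

end

lemma dir_deriv_dir_deriv_field:
  fixes Z :: "real^'n \<Rightarrow> 'b::real_normed_vector"
  assumes open_U: "open U" and x: "x \<in> U" and Z: "smooth_on U Z" and X: "X differentiable (at x)"
  shows "(\<lambda>y. dir_deriv Z y (X y)) differentiable (at x)"
    and "dir_deriv (\<lambda>y. dir_deriv Z y (X y)) x v =
    dir_deriv (\<lambda>y. dir_deriv Z y (X x)) x v + dir_deriv Z x (dir_deriv X x v)"
proof -
  note sum = dir_deriv_eq_sum[OF smooth_on_differentiable[OF Z]]
  have "((\<lambda>y. \<Sum>i\<in>UNIV. X y $ i *\<^sub>R coord_deriv i Z y) has_derivative
    (\<lambda>v. \<Sum>i\<in>UNIV. X x $ i *\<^sub>R dir_deriv (coord_deriv i Z) x v + dir_deriv X x v $ i *\<^sub>R coord_deriv i Z x)) (at x)"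
    by (intro has_derivative_sum has_derivative_scaleR smooth_on_has_derivative[OF smooth_on_coord_deriv[OF Z] x]
        bounded_linear.has_derivative[OF bounded_linear_vec_nth has_derivative_dir_deriv[OF X]])
  then have *: "((\<lambda>y. dir_deriv Z y (X y)) has_derivative
    (\<lambda>v. \<Sum>i\<in>UNIV. X x $ i *\<^sub>R dir_deriv (coord_deriv i Z) x v + dir_deriv X x v $ i *\<^sub>R coord_deriv i Z x)) (at x)"
    by (rule has_derivative_transform_within_open[OF _ open_U x]) (simp add: sum)
  then show "(\<lambda>y. dir_deriv Z y (X y)) differentiable (at x)" by (rule differentiableI)
  show "dir_deriv (\<lambda>y. dir_deriv Z y (X y)) x v =
    dir_deriv (\<lambda>y. dir_deriv Z y (X x)) x v + dir_deriv Z x (dir_deriv X x v)"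
    unfolding fun_cong[OF frechet_derivative_at[OF *, symmetric]]
    by (simp add: sum.distrib dir_deriv_dir_deriv_eq_sum[OF open_U Z x] sum[OF x])
qed

section \<open>Orthonormal frames and traces\<close>

definition frame :: "(real^'n \<Rightarrow> real^'n^'n) \<Rightarrow> real^'n \<Rightarrow> ('n \<Rightarrow> real^'n::finite) \<Rightarrow> bool" where
  "frame H x E \<longleftrightarrow> (\<forall>i j. metric_at H x (E i) (E j) = (if i = j then 1 else 0))"

definition tr :: "(real^'n \<Rightarrow> real^'n) \<Rightarrow> real" where
  "tr L = (\<Sum>i\<in>UNIV. L (axis i 1) $ i)"

lemma tr_add: "tr (\<lambda>v. L v + M v) = tr L + tr M"
  by (simp add: tr_def sum.distrib)

lemma tr_diff: "tr (\<lambda>v. L v - M v) = tr L - tr M"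
  by (simp add: tr_def sum_subtractf)

lemma tr_scaleR: "tr (\<lambda>v. c *\<^sub>R L v) = c * tr L"
  by (simp add: tr_def sum_distrib_left)

lemma tr_comp_commute:
  fixes L M :: "real^'n \<Rightarrow> real^'n"
  assumes "linear L" "linear M"
  shows "tr (\<lambda>v. L (M v)) = tr (\<lambda>v. M (L v))"
proof -
  have *: "tr (\<lambda>v. L (M v)) = (\<Sum>i\<in>UNIV. \<Sum>j\<in>UNIV. M (axis i 1) $ j * L (axis j 1) $ i)"
    if "linear L" for L M :: "real^'n \<Rightarrow> real^'n"
  proof -
    have comp: "L w $ i = (\<Sum>j\<in>UNIV. w $ j * L (axis j 1) $ i)" for w i
    proof -
      have "L w = L (\<Sum>j\<in>UNIV. w $ j *\<^sub>R axis j 1)" using vec_eq_sum_axis[of w] by simp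
      then show ?thesis using that by (simp add: linear_sum linear_scale)
    qed
    show ?thesis unfolding tr_def comp[of "M _"] ..
  qed
  show ?thesis
    unfolding *[OF assms(1)] *[OF assms(2)] by (subst sum.swap) (simp add: mult.commute)
qed

lemma linear_fixed_args:
  "bilinear B \<Longrightarrow> linear (\<lambda>v. B v w)" "bilinear B \<Longrightarrow> linear (\<lambda>w. B v w)"
  by (auto simp: bilinear_def)

lemma metric_at_sum_left: "metric_at H x (\<Sum>i\<in>I. h i) w = (\<Sum>i\<in>I. metric_at H x (h i) w)"
  by (rule linear_sum[OF linear_fixed_args(1)[OF bilinear_metric_at]])

context metric_domain begin

text \<open>Gram-Schmidt along a growing index set: fewer than n vectors do not span, so a vector
  outside their span exists and is made orthogonal and normalized.\<close>

lemma exists_orthonormal_family: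
  assumes x: "x \<in> U" and "finite J"
  shows "\<exists>E :: 'n \<Rightarrow> real^'n. \<forall>i\<in>J. \<forall>j\<in>J. metric_at H x (E i) (E j) = (if i = j then 1 else 0)"
  using \<open>finite J\<close>
proof (induction J)
  case (insert k J)
  then obtain E :: "'n \<Rightarrow> real^'n" where
    E: "\<And>i j. i \<in> J \<Longrightarrow> j \<in> J \<Longrightarrow> metric_at H x (E i) (E j) = (if i = j then 1 else 0)" by blast
  have "card J < CARD('n)"
    using insert by (intro psubset_card_mono) auto
  then have "card (E ` J) < DIM(real^'n)"
    using card_image_le[OF insert(1), of E] by simp
  then have "span (E ` J) \<noteq> UNIV"
    using dim_le_card[of UNIV "E ` J"] insert(1) by (auto simp: dim_UNIV)
  then obtain v where v: "v \<notin> span (E ` J)" by blast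
  define u where "u = v - (\<Sum>j\<in>J. metric_at H x v (E j) *\<^sub>R E j)"
  have "(\<Sum>j\<in>J. metric_at H x v (E j) *\<^sub>R E j) \<in> span (E ` J)"
    by (intro span_sum span_scale span_base) auto
  then have "u \<noteq> 0" using v by (auto simp: u_def)
  then have m: "metric_at H x u u > 0" by (rule metric_pos[OF x])
  have orth: "metric_at H x u (E i) = 0" if "i \<in> J" for i
  proof -
    have "metric_at H x (\<Sum>j\<in>J. metric_at H x v (E j) *\<^sub>R E j) (E i) = (\<Sum>j\<in>J. metric_at H x v (E j) * metric_at H x (E j) (E i))"
      by (simp add: metric_at_simps metric_at_sum_left)
    also have "\<dots> = (\<Sum>j\<in>J. if j = i then metric_at H x v (E j) else 0)"
      by (rule sum.cong) (use E that in auto)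
    also have "\<dots> = metric_at H x v (E i)" using insert(1) that by simp
    finally show ?thesis by (simp add: u_def metric_at_simps)
  qed
  define E' where "E' = E(k := (1 / sqrt (metric_at H x u u)) *\<^sub>R u)"
  have "metric_at H x (E' i) (E' j) = (if i = j then 1 else 0)" if "i \<in> insert k J" "j \<in> insert k J" for i j
    using that E orth m insert(2) metric_sym[OF x, of "E i" u]
    by (auto simp: E'_def metric_at_simps field_simps)
  then show ?case by blast
qed auto

lemma exists_frame: "x \<in> U \<Longrightarrow> \<exists>E. frame H x E"
  using exists_orthonormal_family[of x UNIV] by (auto simp: frame_def)

text \<open>Orthonormality says that \<open>transpose M ** H x\<close> is a left inverse of the
  matrix \<open>M\<close> with columns \<open>E i\<close>. For a square matrix it is a right inverse
  as well, and that is the expansion.\<close>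

lemma frame_expand:
  assumes x: "x \<in> U" and E: "frame H x E"
  shows "(\<Sum>i\<in>UNIV. metric_at H x v (E i) *\<^sub>R E i) = v"
proof -
  define M :: "real^'n^'n" where "M = (\<chi> a i. E i $ a)"
  have comp: "((transpose M ** H x) *v v) $ i = metric_at H x (E i) v" for v i
    unfolding matrix_vector_mul_assoc[symmetric] metric_at_def
    by (simp add: matrix_vector_mult_def transpose_def M_def inner_vec_def)
  have col: "M *v axis j 1 = E j" for j
    by (simp add: vec_eq_iff M_def matrix_vector_mult_def axis_def if_distrib cong: if_cong)
  have "(transpose M ** H x) ** M = mat 1"
  proof -
    have "((transpose M ** H x) ** M) *v axis j 1 = mat 1 *v axis j 1" for j
      unfolding matrix_vector_mul_assoc[symmetric, of "transpose M ** H x"] col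
      using E by (simp add: vec_eq_iff comp frame_def axis_def)
    then show ?thesis
      by (simp add: matrix_vector_mult_basis vec_eq_iff column_def)
  qed
  then have "M ** (transpose M ** H x) = mat 1"
    using matrix_left_right_inverse by blast
  then have "M *v ((transpose M ** H x) *v v) = v"
    by (simp add: matrix_vector_mul_assoc)
  moreover have "M *v w = (\<Sum>i\<in>UNIV. w $ i *\<^sub>R E i)" for w
    by (simp add: vec_eq_iff M_def matrix_vector_mult_def mult.commute)
  ultimately show ?thesis
    by (simp add: comp metric_sym[OF x, of v])
qed

text \<open>The coordinate trace \<open>tr\<close> becomes a sum of values of a bilinear form on a
  frame, to which sign conditions and the Cauchy-Schwarz inequality apply.\<close>

lemma tr_frame:
  assumes x: "x \<in> U" and E: "frame H x E" and L: "linear L"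
  shows "tr L = (\<Sum>i\<in>UNIV. metric_at H x (L (E i)) (E i))"
proof -
  have "metric_at H x (L (E i)) (E i) = (\<Sum>k\<in>UNIV. E i $ k * metric_at H x (L (axis k 1)) (E i))" for i
  proof -
    have "L (E i) = L (\<Sum>k\<in>UNIV. E i $ k *\<^sub>R axis k 1)" using vec_eq_sum_axis[of "E i"] by simp
    also have "\<dots> = (\<Sum>k\<in>UNIV. E i $ k *\<^sub>R L (axis k 1))" using L by (simp add: linear_sum linear_scale)
    finally show ?thesis
      by (simp add: metric_at_simps metric_at_sum_left)
  qed
  then have "(\<Sum>i\<in>UNIV. metric_at H x (L (E i)) (E i)) =
      (\<Sum>k\<in>UNIV. \<Sum>i\<in>UNIV. E i $ k * metric_at H x (L (axis k 1)) (E i))"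
    by (simp, subst sum.swap, simp)
  also have "\<dots> = (\<Sum>k\<in>UNIV. (\<Sum>i\<in>UNIV. metric_at H x (L (axis k 1)) (E i) *\<^sub>R E i) $ k)"
    by (simp add: mult.commute)
  finally show ?thesis
    unfolding frame_expand[OF x E] tr_def ..
qed

text \<open>The inverse matrix raises the index: contracted with the products of \<open>v\<close>
  with the axes it returns the components of \<open>v\<close>. The scalar curvature thus becomes the
  trace of an endomorphism.\<close>

lemma tr_matrix_inv:
  assumes x: "x \<in> U"
  shows "(\<Sum>i\<in>UNIV. \<Sum>j\<in>UNIV. matrix_inv (H x) $ i $ j * metric_at H x (L (axis i 1)) (axis j 1)) = tr L"
proof -
  have "(\<Sum>j\<in>UNIV. matrix_inv (H x) $ i $ j * metric_at H x v (axis j 1)) = v $ i" for i v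
  proof -
    have "(\<Sum>j\<in>UNIV. matrix_inv (H x) $ i $ j * metric_at H x v (axis j 1)) = (matrix_inv (H x) *v (H x *v v)) $ i"
      unfolding metric_sym[OF x, of v]
      by (simp add: metric_at_def inner_axis' matrix_vector_mult_def[of "matrix_inv (H x)"])
    then show ?thesis
      using matrix_inv_works(2)[OF invertible_H[OF x]] by (simp add: matrix_vector_mul_assoc)
  qed
  then show ?thesis unfolding tr_def by simp
qed

lemma linear_dir_deriv: "smooth_on U h \<Longrightarrow> x \<in> U \<Longrightarrow> linear (dir_deriv h x)"
  by (intro linear_frechet_derivative smooth_on_differentiable)

lemma dir_deriv_gam_linear:
  assumes x: "x \<in> U"
  shows "linear (\<lambda>a. dir_deriv (\<lambda>y. gam H y v w) x a)" "linear (\<lambda>v. dir_deriv (\<lambda>y. gam H y v w) x a)"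
    "linear (\<lambda>w. dir_deriv (\<lambda>y. gam H y v w) x a)"
proof -
  note has = smooth_on_has_derivative[OF smooth_gam x]
  show "linear (\<lambda>a. dir_deriv (\<lambda>y. gam H y v w) x a)"
    by (rule linear_dir_deriv[OF smooth_gam x])
  show "linear (\<lambda>v. dir_deriv (\<lambda>y. gam H y v w) x a)"
  proof (rule linearI)
    fix v v' c
    show "dir_deriv (\<lambda>y. gam H y (v + v') w) x a = dir_deriv (\<lambda>y. gam H y v w) x a + dir_deriv (\<lambda>y. gam H y v' w) x a"
      unfolding gam_simps by (rule fun_cong[OF frechet_derivative_at[symmetric]]) (intro has_derivative_add has)
    show "dir_deriv (\<lambda>y. gam H y (c *\<^sub>R v) w) x a = c *\<^sub>R dir_deriv (\<lambda>y. gam H y v w) x a"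
      unfolding gam_simps by (rule fun_cong[OF frechet_derivative_at[symmetric]]) (intro has_derivative_scaleR_right has)
  qed
  show "linear (\<lambda>w. dir_deriv (\<lambda>y. gam H y v w) x a)"
  proof (rule linearI)
    fix w w' c
    show "dir_deriv (\<lambda>y. gam H y v (w + w')) x a = dir_deriv (\<lambda>y. gam H y v w) x a + dir_deriv (\<lambda>y. gam H y v w') x a"
      unfolding gam_simps by (rule fun_cong[OF frechet_derivative_at[symmetric]]) (intro has_derivative_add has)
    show "dir_deriv (\<lambda>y. gam H y v (c *\<^sub>R w)) x a = c *\<^sub>R dir_deriv (\<lambda>y. gam H y v w) x a"
      unfolding gam_simps by (rule fun_cong[OF frechet_derivative_at[symmetric]]) (intro has_derivative_scaleR_right has)
  qed
qed

lemma curv_linear1: "x \<in> U \<Longrightarrow> linear (\<lambda>a. curv H x a b w)"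
  unfolding linear_iff curv_def
  using dir_deriv_gam_linear[of x] by (auto simp: linear_iff gam_simps algebra_simps)

text \<open>\<open>curv_skew\<close> moves one \<open>u\<close> out of the curvature and produces
  the sign. In the sum over a frame the curvature term of the variation thereby turns into -Ric(u,
  u).\<close>

lemma ricci_frame:
  assumes x: "x \<in> U" and E: "frame H x E"
  shows "(\<Sum>i\<in>UNIV. metric_at H x u (curv H x (E i) u (E i))) = - ricci H x u u"
proof -
  have "ricci H x u u = tr (\<lambda>a. curv H x a u u)"
    unfolding ricci_eq[OF x] tr_def ..
  also have "\<dots> = (\<Sum>i\<in>UNIV. metric_at H x (curv H x (E i) u u) (E i))"
    by (rule tr_frame[OF x E curv_linear1[OF x]])
  also have "\<dots> = (\<Sum>i\<in>UNIV. - metric_at H x u (curv H x (E i) u (E i)))"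
    using curv_skew[OF x, of _ u u] by (intro sum.cong refl) (simp add: add_eq_0_iff2)
  finally show ?thesis by (simp add: sum_negf)
qed

text \<open>The left-hand side is the \<open>s\<^sup>2\<close>-coefficient of the squared length of the velocity of
  \<open>x + s v + s\<^sup>2 (w - gam v v / 2)\<close>, where \<open>u\<close>, \<open>vd\<close> and \<open>wd\<close> are the time derivatives of
  \<open>x\<close>, \<open>v\<close> and \<open>w\<close>.\<close>

lemma second_variation_coefficient:
  assumes x: "x \<in> U"
  shows "metric_at H x vd vd
      + 2 * metric_at H x u (wd - (1/2) *\<^sub>R dir_deriv (\<lambda>y. gam H y v v) x u - gam H x v vd)
      + 2 * dir_deriv (\<lambda>y. metric_at H y u vd) x v
      + dir_deriv (\<lambda>y. metric_at H y u u) x (w - (1/2) *\<^sub>R gam H x v v)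
      + dir_deriv (\<lambda>y. dir_deriv (\<lambda>y. metric_at H y u u) y v) x v / 2
    = metric_at H x (vd + gam H x u v) (vd + gam H x u v) + metric_at H x u (curv H x v u v)
      + 2 * metric_at H x u (wd + gam H x u w)"
proof -
  define g where "g = gam H x u v"
  have gsym: "gam H x v u = g" "gam H x w u = gam H x u w" "gam H x (gam H x v v) u = gam H x u (gam H x v v)"
    unfolding g_def by (rule gam_sym[OF x])+
  have sym: "metric_at H x g vd = metric_at H x vd g"
    "metric_at H x (gam H x u w) u = metric_at H x u (gam H x u w)"
    "metric_at H x (gam H x v g) u = metric_at H x u (gam H x v g)"
    "metric_at H x (dir_deriv (\<lambda>y. gam H y v u) x v) u = metric_at H x u (dir_deriv (\<lambda>y. gam H y v u) x v)"
    "metric_at H x (gam H x u (gam H x v v)) u = metric_at H x u (gam H x u (gam H x v v))"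
    by (rule metric_sym[OF x])+
  have c: "dir_deriv (\<lambda>y. metric_at H y u u) y v = 2 * metric_at H y (gam H y v u) u" if "y \<in> U" for y
    unfolding metric_compat[OF that] metric_sym[OF that, of u "gam H y v u"] by simp
  have "dir_deriv (\<lambda>y. dir_deriv (\<lambda>y. metric_at H y u u) y v) x v
      = dir_deriv (\<lambda>y. 2 * metric_at H y (gam H y v u) u) x v"
    by (rule dir_deriv_cong[OF open_U x c])
  also have "\<dots> = 2 * dir_deriv (\<lambda>y. metric_at H y (gam H y v u) u) x v"
    by (rule dir_deriv_bounded_linear[OF bounded_linear_mult_right])
      (rule smooth_on_differentiable[OF smooth_cov_const x])
  also have "dir_deriv (\<lambda>y. metric_at H y (gam H y v u) u) x v =
      metric_at H x (dir_deriv (\<lambda>y. gam H y v u) x v + gam H x v g) u + metric_at H x g g"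
    using dir_deriv_metric_field[OF x diff_gam[OF x, of v u] differentiable_const[of u], of v]
    by (simp add: metric_at_simps gsym)
  finally have TT: "dir_deriv (\<lambda>y. dir_deriv (\<lambda>y. metric_at H y u u) y v) x v / 2
      = metric_at H x u (dir_deriv (\<lambda>y. gam H y v u) x v) + metric_at H x u (gam H x v g)
      + metric_at H x g g"
    by (simp add: metric_at_simps sym)
  have "dir_deriv (\<lambda>y. gam H y v u) x v = dir_deriv (\<lambda>y. gam H y u v) x v"
    by (rule dir_deriv_cong[OF open_U x gam_sym])
  then show ?thesis
    unfolding TT metric_compat[OF x] curv_def g_def[symmetric] gsym
    by (simp add: metric_at_simps gam_simps gsym sym algebra_simps)
qed

section \<open>The Bochner argument\<close>

lemma smooth_cov_field:
  assumes "smooth_on U Z"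
  shows "smooth_on U (\<lambda>y. dir_deriv Z y a + gam H y a (Z y))"
  by (intro smooth_on_add open_U smooth_on_dir_deriv assms
      smooth_on_bilinear_field[OF bilinear_gam open_U smooth_gam smooth_on_const])

lemma dir_deriv_cov_field:
  assumes x: "x \<in> U" and Z: "smooth_on U Z"
  shows "dir_deriv (\<lambda>y. dir_deriv Z y b + gam H y b (Z y)) x a =
    dir_deriv (\<lambda>y. dir_deriv Z y b) x a + dir_deriv (\<lambda>y. gam H y b (Z x)) x a + gam H x b (dir_deriv Z x a)"
proof -
  have "dir_deriv (\<lambda>y. dir_deriv Z y b + gam H y b (Z y)) x a =
      dir_deriv (\<lambda>y. dir_deriv Z y b) x a + dir_deriv (\<lambda>y. gam H y b (Z y)) x a"
    by (rule fun_cong[OF frechet_derivative_at[symmetric]], intro has_derivative_add smooth_on_has_derivative[OF _ x]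
        smooth_on_dir_deriv open_U Z smooth_on_bilinear_field[OF bilinear_gam open_U smooth_gam smooth_on_const])
  then show ?thesis
    using dir_deriv_gam_field[OF x differentiable_const smooth_on_differentiable[OF Z x], of b a]
    by (simp add: gam_simps)
qed

text \<open>The Ricci identity for the field \<open>Z\<close>. Flat second derivatives cancel by
  symmetry, and so would the torsion term S(\<Gamma>(a, b)), which is therefore omitted on both
  sides.\<close>

lemma cov_commute:
  assumes x: "x \<in> U" and Z: "smooth_on U Z"
  defines "S \<equiv> \<lambda>y a. dir_deriv Z y a + gam H y a (Z y)"
  shows "dir_deriv (\<lambda>y. S y b) x a + gam H x a (S x b) - dir_deriv (\<lambda>y. S y a) x b - gam H x b (S x a)
    = curv H x a b (Z x)"
  unfolding S_def dir_deriv_cov_field[OF x Z] curv_def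
  using dir_deriv_commute[OF open_U Z x, of a b] by (simp add: gam_simps)

end

context metric_domain begin

lemma metric_cauchy_schwarz_unit:
  assumes x: "x \<in> U" and e: "metric_at H x e e = 1"
  shows "(metric_at H x v e)\<^sup>2 \<le> metric_at H x v v"
proof -
  let ?c = "metric_at H x v e"
  have "0 \<le> metric_at H x (v - ?c *\<^sub>R e) (v - ?c *\<^sub>R e)" by (rule metric_nonneg[OF x])
  also have "\<dots> = metric_at H x v v - ?c\<^sup>2"
    by (simp add: metric_at_simps e metric_sym[OF x, of e v] power2_eq_square)
  finally show ?thesis by simp
qed

end

section \<open>Gradient solitons in a coordinate domain\<close>

locale soliton_domain = metric_domain +
  fixes F :: "real^'a \<Rightarrow> real" and lam :: real
  assumes smooth_F: "smooth_on U F"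
    and soliton: "\<And>x v w. x \<in> U \<Longrightarrow> ricci H x v w + hess H F x v w = lam * metric_at H x v w"
begin

abbreviation Z :: "real^'a \<Rightarrow> real^'a" where "Z \<equiv> grad H F"

text \<open>The Hessian of \<open>F\<close> as an endomorphism, the covariant derivative of the
  gradient; it is self-adjoint by \<open>metric_S_sym\<close>.\<close>

abbreviation S :: "real^'a \<Rightarrow> real^'a \<Rightarrow> real^'a" where
  "S y v \<equiv> dir_deriv Z y v + gam H y v (Z y)"

lemmas smooth_Z = smooth_grad[OF smooth_F]

lemma metric_Z: "x \<in> U \<Longrightarrow> metric_at H x (Z x) v = dir_deriv F x v"
  by (rule metric_grad) (auto intro: smooth_on_differentiable[OF smooth_F])

lemma hess_S: "hess H F x v w = metric_at H x (S x v) w"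
  by (simp add: hess_def cov_deriv_gam)

lemma metric_S_sym: "x \<in> U \<Longrightarrow> metric_at H x (S x v) w = metric_at H x (S x w) v"
  unfolding hess_S[symmetric] by (rule hess_sym[OF _ smooth_F])

lemma ricci_S: "x \<in> U \<Longrightarrow> ricci H x v w = metric_at H x (lam *\<^sub>R v - S x v) w"
  using soliton[of x v w] by (simp add: hess_S metric_at_simps)

lemma linear_S: "x \<in> U \<Longrightarrow> linear (S x)"
  by (intro linear_compose_add linear_dir_deriv smooth_Z linear_fixed_args bilinear_gam)

lemma scal_eq: "x \<in> U \<Longrightarrow> scal H x = CARD('a) * lam - tr (S x)"
  using tr_matrix_inv[of x "\<lambda>v. lam *\<^sub>R v - S x v"]
  unfolding scal_def tr_diff tr_scaleR by (simp add: ricci_S) (simp add: tr_def)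

text \<open>Where the gradient vanishes, \<open>hess_eq\<close> loses its connection term, so the
  second derivative test along coordinate lines bounds the Hessian itself.\<close>

lemma scal_at_max:
  assumes x: "x \<in> U" and max: "\<And>y. y \<in> U \<Longrightarrow> F y \<le> F x"
  shows "Z x = 0" and "scal H x \<ge> CARD('a) * lam"
proof -
  have neg: "(\<lambda>y. dir_deriv (\<lambda>y. - F y) y v) = (\<lambda>y. dir_deriv (\<lambda>y. - F y) y v)" for v ..
  have smF: "smooth_on U (\<lambda>y. - F y)"
    using smooth_on_linear[OF bounded_linear_minus[OF bounded_linear_ident] open_U smooth_F] .
  have m: "- F x \<le> - F y" if "y \<in> U" for y using max[OF that] by simp
  have d: "dir_deriv (\<lambda>y. - F y) y v = - dir_deriv F y v" if "y \<in> U" for y v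
    by (rule dir_deriv_bounded_linear[OF bounded_linear_minus[OF bounded_linear_ident]])
      (rule smooth_on_differentiable[OF smooth_F that])
  have dF: "dir_deriv F x v = 0" for v
    using local_min_second_derivative(1)[OF open_U smF x m, of v] d[OF x] by simp
  show Z0: "Z x = 0"
    by (rule metric_nondegenerate[OF x]) (simp add: metric_Z[OF x] dF metric_at_simps)
  obtain E where E: "frame H x E" using exists_frame[OF x] by blast
  have "metric_at H x (S x v) v \<le> 0" for v
  proof -
    have "dir_deriv (\<lambda>y. dir_deriv (\<lambda>y. - F y) y v) x v = dir_deriv (\<lambda>y. - dir_deriv F y v) x v"
      by (rule dir_deriv_cong[OF open_U x d])
    also have "\<dots> = - dir_deriv (\<lambda>y. dir_deriv F y v) x v"
      by (rule dir_deriv_bounded_linear[OF bounded_linear_minus[OF bounded_linear_ident]])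
        (rule smooth_on_differentiable[OF smooth_on_dir_deriv[OF open_U smooth_F] x])
    finally show ?thesis
      using local_min_second_derivative(2)[OF open_U smF x m, of v]
      unfolding hess_S[symmetric] hess_eq[OF x smooth_F] dF by simp
  qed
  then have "tr (S x) \<le> 0"
    unfolding tr_frame[OF x E linear_S[OF x]] by (intro sum_nonpos) auto
  then show "scal H x \<ge> CARD('a) * lam" unfolding scal_eq[OF x] by simp
qed

text \<open>By the normalization R = 2 lam F - |grad F|^2, with gradient \<open>W\<close> = 2
  Ric(grad F). At a minimum \<open>W\<close> vanishes and its divergence is nonnegative. The Ricci
  identity evaluates that divergence as twice lam T - tr(S S) with T = tr S, so T^2 / n \<le> tr(S
  S) \<le> lam T. Hence T \<le> n lam, and R = n lam - T is nonnegative.\<close>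

lemma scal_nonneg_at_min:
  assumes x: "x \<in> U" and lam: "lam > 0"
    and normalized: "\<And>y. y \<in> U \<Longrightarrow> scal H y + metric_at H y (Z y) (Z y) = 2 * lam * F y"
    and min: "\<And>y. y \<in> U \<Longrightarrow> scal H x \<le> scal H y"
  shows "scal H x \<ge> 0"
proof -
  define R where "R y = 2 * lam * F y - metric_at H y (Z y) (Z y)" for y
  define W where "W y = (2 * lam) *\<^sub>R Z y - 2 *\<^sub>R S y (Z y)" for y
  have scal_R: "scal H y = R y" if "y \<in> U" for y
    using normalized[OF that] by (simp add: R_def)
  have smZZ: "smooth_on U (\<lambda>y. metric_at H y (Z y) (Z y))"
    by (rule smooth_on_bilinear_field[OF bilinear_metric_at open_U smooth_metric smooth_Z smooth_Z])
  have smR: "smooth_on U R"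
    unfolding R_def by (intro smooth_on_diff smooth_on_mult smooth_on_const smooth_F open_U smZZ)
  have dZ: "Z differentiable (at y)" if "y \<in> U" for y
    by (rule smooth_on_differentiable[OF smooth_Z that])
  have smSZ: "smooth_on U (\<lambda>y. S y (Z y))"
    by (intro smooth_on_add open_U smooth_on_dir_deriv_field smooth_Z
        smooth_on_bilinear_field[OF bilinear_gam open_U smooth_gam])
  have smW: "smooth_on U W"
    unfolding W_def by (intro smooth_on_diff smooth_on_scaleR smooth_on_const open_U smooth_Z smSZ)
  have dR: "dir_deriv R y v = metric_at H y (W y) v" if y: "y \<in> U" for y v
  proof -
    have "(R has_derivative (\<lambda>v. 2 * lam * dir_deriv F y v - dir_deriv (\<lambda>y. metric_at H y (Z y) (Z y)) y v)) (at y)"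
      unfolding R_def
      by (intro has_derivative_diff has_derivative_mult_right smooth_on_has_derivative[OF _ y] smooth_F smZZ)
    from fun_cong[OF frechet_derivative_at[OF this], of v]
    have "dir_deriv R y v = 2 * lam * metric_at H y (Z y) v - (metric_at H y (S y v) (Z y) + metric_at H y (Z y) (S y v))"
      unfolding metric_Z[OF y] dir_deriv_metric_field[OF y dZ[OF y] dZ[OF y]] by simp
    then show ?thesis
      unfolding W_def by (simp add: metric_at_simps metric_sym[OF y, of "Z y" "dir_deriv Z y v"]
          metric_sym[OF y, of "Z y" "gam H y v (Z y)"] metric_S_sym[OF y, of v "Z y", simplified metric_at_simps])
  qed
  have minR: "R x \<le> R y" if "y \<in> U" for y using min[OF that] scal_R that x by simp
  have W0: "W x = 0"
    by (rule metric_nondegenerate[OF x])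
      (simp add: dR[OF x, symmetric] local_min_second_derivative(1)[OF open_U smR x minR] metric_at_simps)
  \<comment> \<open>Since \<open>W\<close> is twice the Ricci tensor applied to the gradient, its
    vanishing makes the gradient an eigenvector of \<open>S\<close>.\<close>
  then have SZ: "S x (Z x) = lam *\<^sub>R Z x"
    using scaleR_cancel_left[of 2 "lam *\<^sub>R Z x" "S x (Z x)"] unfolding W_def by simp
  have dW: "metric_at H x (dir_deriv W x v) v \<ge> 0" for v
  proof -
    have "dir_deriv (\<lambda>y. dir_deriv R y v) x v = dir_deriv (\<lambda>y. metric_at H y (W y) v) x v"
      by (rule dir_deriv_cong[OF open_U x dR])
    also have "\<dots> = metric_at H x (dir_deriv W x v) v"
      using dir_deriv_metric_field[OF x smooth_on_differentiable[OF smW x] differentiable_const[of v], of v]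
      by (simp add: W0 gam_simps metric_at_simps)
    finally show ?thesis using local_min_second_derivative(2)[OF open_U smR x minR, of v] by simp
  qed
  obtain E where E: "frame H x E" using exists_frame[OF x] by blast
  have trW: "tr (dir_deriv W x) \<ge> 0"
    unfolding tr_frame[OF x E linear_dir_deriv[OF smW x]] by (intro sum_nonneg dW)

  define z where "z = Z x"
  have smS: "smooth_on U (\<lambda>y. S y b)" for b by (rule smooth_cov_field[OF smooth_Z])
  have DSZ: "dir_deriv (\<lambda>y. S y (Z y)) x v = dir_deriv (\<lambda>y. S y z) x v + S x (dir_deriv Z x v)" for v
  proof -
    have "dir_deriv (\<lambda>y. S y (Z y)) x v = dir_deriv (\<lambda>y. dir_deriv Z y (Z y)) x v + dir_deriv (\<lambda>y. gam H y (Z y) (Z y)) x v"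
      by (rule fun_cong[OF frechet_derivative_at[symmetric]], intro has_derivative_add
          has_derivative_dir_deriv dir_deriv_dir_deriv_field(1)[OF open_U x smooth_Z dZ[OF x]]
          smooth_on_differentiable[OF smooth_on_bilinear_field[OF bilinear_gam open_U smooth_gam smooth_Z smooth_Z] x])
    then show ?thesis
      unfolding dir_deriv_dir_deriv_field(2)[OF open_U x smooth_Z dZ[OF x]] dir_deriv_gam_field[OF x dZ[OF x] dZ[OF x]]
        dir_deriv_cov_field[OF x smooth_Z] z_def
      by simp
  qed
  have DW: "dir_deriv W x v = (2 * lam) *\<^sub>R dir_deriv Z x v - 2 *\<^sub>R (dir_deriv (\<lambda>y. S y z) x v + S x (dir_deriv Z x v))" for v
  proof -
    have "(W has_derivative (\<lambda>v. (2 * lam) *\<^sub>R dir_deriv Z x v - 2 *\<^sub>R dir_deriv (\<lambda>y. S y (Z y)) x v)) (at x)"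
      unfolding W_def
      by (intro has_derivative_diff has_derivative_scaleR_right smooth_on_has_derivative[OF _ x] smooth_Z smSZ)
    from fun_cong[OF frechet_derivative_at[OF this], of v] show ?thesis unfolding DSZ by simp
  qed

  define T where "T = tr (S x)"
  \<comment> \<open>The trace of \<open>S\<close> is n lam - R, and the point is critical for
    R.\<close>
  have dT: "(\<Sum>i\<in>UNIV. dir_deriv (\<lambda>y. S y (axis i 1)) x z $ i) = 0"
  proof -
    have "((\<lambda>y. \<Sum>i\<in>UNIV. S y (axis i 1) $ i) has_derivative (\<lambda>v. \<Sum>i\<in>UNIV. dir_deriv (\<lambda>y. S y (axis i 1)) x v $ i)) (at x)"
      by (intro has_derivative_sum bounded_linear.has_derivative[OF bounded_linear_vec_nth]
          smooth_on_has_derivative[OF smS x])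
    from fun_cong[OF frechet_derivative_at[OF this], of z]
    have "(\<Sum>i\<in>UNIV. dir_deriv (\<lambda>y. S y (axis i 1)) x z $ i) = dir_deriv (\<lambda>y. tr (S y)) x z"
      unfolding tr_def by simp
    also have "\<dots> = dir_deriv (\<lambda>y. CARD('a) * lam - R y) x z"
      by (rule dir_deriv_cong[OF open_U x]) (simp add: scal_R[symmetric] scal_eq)
    also have "\<dots> = 0 - dir_deriv R x z"
      by (rule fun_cong[OF frechet_derivative_at[symmetric]], intro has_derivative_diff has_derivative_const
          smooth_on_has_derivative[OF smR x])
    also have "\<dots> = 0" by (simp add: dR[OF x] W0 metric_at_simps)
    finally show ?thesis .
  qed
  \<comment> \<open>Ric(z, z) = lam g(z, z) - g(S z, z), which vanishes by
    \<open>SZ\<close>.\<close>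
  have ric0: "(\<Sum>i\<in>UNIV. curv H x (axis i 1) z z $ i) = 0"
    unfolding ricci_eq[OF x, symmetric] ricci_S[OF x] by (simp add: SZ[folded z_def, simplified] z_def SZ metric_at_simps)
  have "(\<Sum>i\<in>UNIV. dir_deriv (\<lambda>y. S y z) x (axis i 1) $ i) =
      (\<Sum>i\<in>UNIV. (curv H x (axis i 1) z z - gam H x (axis i 1) (S x z) + dir_deriv (\<lambda>y. S y (axis i 1)) x z
         + gam H x z (S x (axis i 1))) $ i)"
  proof (rule sum.cong[OF refl])
    fix i
    have "dir_deriv (\<lambda>y. S y z) x (axis i 1) = curv H x (axis i 1) z z - gam H x (axis i 1) (S x z)
      + dir_deriv (\<lambda>y. S y (axis i 1)) x z + gam H x z (S x (axis i 1))"
      using cov_commute[OF x smooth_Z, of z "axis i 1", folded z_def] by (simp add: z_def algebra_simps)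
    then show "dir_deriv (\<lambda>y. S y z) x (axis i 1) $ i = (curv H x (axis i 1) z z - gam H x (axis i 1) (S x z)
      + dir_deriv (\<lambda>y. S y (axis i 1)) x z + gam H x z (S x (axis i 1))) $ i"
      by (rule arg_cong)
  qed
  then have trDS: "tr (dir_deriv (\<lambda>y. S y z) x) = tr (\<lambda>v. gam H x z (S x v)) - lam * tr (\<lambda>v. gam H x v z)"
    unfolding SZ[folded z_def] using dT ric0
    by (simp add: tr_def sum.distrib sum_subtractf gam_simps sum_distrib_left z_def SZ)
  have trDZ: "tr (dir_deriv Z x) = T - tr (\<lambda>v. gam H x v z)"
    unfolding T_def by (simp add: tr_add z_def)
  have "S x (dir_deriv Z x v) = S x (S x v) - S x (gam H x v z)" for v
    using linear_diff[OF linear_S[OF x], of "S x v" "gam H x v z"] by (simp add: z_def)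
  then have trSDZ: "tr (\<lambda>v. S x (dir_deriv Z x v)) = tr (\<lambda>v. S x (S x v)) - tr (\<lambda>v. S x (gam H x v z))"
    by (simp only: tr_diff)
  \<comment> \<open>Coordinate derivatives in place of covariant ones leave connection terms behind.
    Those with \<open>lam\<close> cancel between \<open>trDZ\<close> and \<open>trDS\<close>; the
    others cancel because a trace is invariant under exchanging the factors.\<close>
  have "tr (\<lambda>v. S x (gam H x v z)) = tr (\<lambda>v. S x (gam H x z v))"
    unfolding gam_sym[OF x, of _ z] ..
  also have "\<dots> = tr (\<lambda>v. gam H x z (S x v))"
    by (rule tr_comp_commute[OF linear_S[OF x] linear_fixed_args(2)[OF bilinear_gam]])
  finally have comm: "tr (\<lambda>v. S x (gam H x v z)) = tr (\<lambda>v. gam H x z (S x v))" .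
  have "tr (dir_deriv W x) = 2 * lam * tr (dir_deriv Z x) - 2 * (tr (dir_deriv (\<lambda>y. S y z) x) + tr (\<lambda>v. S x (dir_deriv Z x v)))"
    unfolding DW[abs_def] tr_diff tr_scaleR tr_add ..
  then have key: "0 \<le> lam * T - tr (\<lambda>v. S x (S x v))"
    using trW unfolding trDZ trDS trSDZ comm by (simp add: algebra_simps)

  \<comment> \<open>The Cauchy-Schwarz inequality is used twice: for the diagonal entries in a
    frame, and for each entry against the length of \<open>S x (E i)\<close>.\<close>
  have "T\<^sup>2 \<le> CARD('a) * tr (\<lambda>v. S x (S x v))"
  proof -
    have "T\<^sup>2 = (\<Sum>i\<in>UNIV. metric_at H x (S x (E i)) (E i))\<^sup>2"
      unfolding T_def tr_frame[OF x E linear_S[OF x]] ..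
    also have "\<dots> \<le> (\<Sum>i\<in>UNIV. (metric_at H x (S x (E i)) (E i))\<^sup>2) * CARD('a)"
      by (rule sum_squared_le_sum_of_squares)
    also have "\<dots> \<le> (\<Sum>i\<in>UNIV. metric_at H x (S x (E i)) (S x (E i))) * CARD('a)"
      using E by (intro mult_right_mono sum_mono metric_cauchy_schwarz_unit[OF x]) (auto simp: frame_def)
    also have "(\<Sum>i\<in>UNIV. metric_at H x (S x (E i)) (S x (E i))) = tr (\<lambda>v. S x (S x v))"
      unfolding tr_frame[OF x E linear_compose[OF linear_S[OF x] linear_S[OF x], unfolded o_def]]
      by (rule sum.cong[OF refl]) (rule metric_S_sym[OF x])
    finally show ?thesis by (simp add: mult.commute)
  qed
  also have "\<dots> \<le> CARD('a) * (lam * T)" using key by simp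
  finally have "T * (CARD('a) * lam - T) \<ge> 0" by (simp add: power2_eq_square algebra_simps)
  moreover have "CARD('a) * lam > 0" using lam by simp
  ultimately have "T \<le> CARD('a) * lam"
    by (smt (verit, best) mult_pos_neg)
  then show ?thesis unfolding scal_eq[OF x] T_def by simp
qed

end

section \<open>Charts and transition maps\<close>

locale smooth_mfd =
  fixes M :: "'a topology" and A :: "('a, 'n::finite) chart set"
  assumes smooth_manifold: "smooth_manifold M A"
begin

definition overlap :: "('a, 'n) chart \<Rightarrow> ('a, 'n) chart \<Rightarrow> (real^'n) set" where
  "overlap c d = snd c ` (fst c \<inter> fst d)"

lemma hausdorff: "Hausdorff_space M"
  using smooth_manifold by (simp add: smooth_manifold_def)

lemma is_chart: "c \<in> A \<Longrightarrow> is_chart M c"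
  using smooth_manifold by (simp add: smooth_manifold_def)

lemma cover: "p \<in> topspace M \<Longrightarrow> \<exists>c\<in>A. p \<in> fst c"
  using smooth_manifold unfolding smooth_manifold_def by blast

lemma smooth_transition: "c \<in> A \<Longrightarrow> d \<in> A \<Longrightarrow> smooth_on (overlap c d) (chart_transition c d)"
  using smooth_manifold unfolding smooth_manifold_def overlap_def by blast

lemma open_chart_image: "c \<in> A \<Longrightarrow> open (chart_image c)"
  using is_chart unfolding is_chart_def by blast

lemma dom_open: "c \<in> A \<Longrightarrow> openin M (fst c)"
  using is_chart unfolding is_chart_def by blast

lemma dom_topspace: "c \<in> A \<Longrightarrow> fst c \<subseteq> topspace M"
  using dom_open openin_subset by blast

lemma chart_homeo: "c \<in> A \<Longrightarrow> homeomorphic_map (subtopology M (fst c)) (top_of_set (chart_image c)) (snd c)"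
  using is_chart unfolding is_chart_def by blast

lemma inj_chart: "c \<in> A \<Longrightarrow> inj_on (snd c) (fst c)"
  using homeomorphic_imp_injective_map[OF chart_homeo] dom_topspace
  by (simp add: topspace_subtopology inf.absorb2)

lemma chart_inv_chart [simp]: "c \<in> A \<Longrightarrow> p \<in> fst c \<Longrightarrow> chart_inv c (snd c p) = p"
  unfolding chart_inv_def by (rule inv_into_f_f[OF inj_chart])

lemma chart_in_image [simp]: "p \<in> fst c \<Longrightarrow> snd c p \<in> chart_image c"
  unfolding chart_image_def by blast

lemma chart_inv_in_dom [simp]: "y \<in> chart_image c \<Longrightarrow> chart_inv c y \<in> fst c"
  unfolding chart_image_def chart_inv_def by (rule inv_into_into)

lemma chart_chart_inv [simp]: "y \<in> chart_image c \<Longrightarrow> snd c (chart_inv c y) = y"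
  unfolding chart_image_def chart_inv_def by (rule f_inv_into_f)

lemma chart_inv_topspace: "c \<in> A \<Longrightarrow> y \<in> chart_image c \<Longrightarrow> chart_inv c y \<in> topspace M"
  using dom_topspace[of c] chart_inv_in_dom[of y c] by blast

lemma continuous_map_chart: "c \<in> A \<Longrightarrow> continuous_map (subtopology M (fst c)) euclidean (snd c)"
  using homeomorphic_imp_continuous_map[OF chart_homeo] continuous_map_in_subtopology by blast

lemma chart_preimage_open:
  assumes "c \<in> A" "open V"
  shows "openin M {p \<in> fst c. snd c p \<in> V}"
proof -
  have "openin (subtopology M (fst c)) {p \<in> topspace (subtopology M (fst c)). snd c p \<in> V}"
    using continuous_map_chart[OF assms(1)] assms(2) unfolding continuous_map_def by simp
  then have "openin M {p \<in> topspace (subtopology M (fst c)). snd c p \<in> V}"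
    using openin_trans_full dom_open[OF assms(1)] by blast
  moreover have "{p \<in> topspace (subtopology M (fst c)). snd c p \<in> V} = {p \<in> fst c. snd c p \<in> V}"
    using dom_topspace[OF assms(1)] by auto
  ultimately show ?thesis by simp
qed

lemma continuous_map_chart_inv:
  assumes "c \<in> A"
  shows "continuous_map (top_of_set (chart_image c)) M (chart_inv c)"
  unfolding continuous_map_def
proof (intro conjI allI impI)
  show "chart_inv c \<in> topspace (top_of_set (chart_image c)) \<rightarrow> topspace M"
    using chart_inv_topspace[OF assms] by auto
  fix V assume V: "openin M V"
  have "open_map (subtopology M (fst c)) (top_of_set (chart_image c)) (snd c)"
    using homeomorphic_imp_open_map[OF chart_homeo[OF assms]] .
  moreover have "openin (subtopology M (fst c)) (V \<inter> fst c)"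
    using V by (auto simp: openin_subtopology)
  ultimately have "openin (top_of_set (chart_image c)) (snd c ` (V \<inter> fst c))"
    unfolding open_map_def by blast
  moreover have "snd c ` (V \<inter> fst c) = {x \<in> topspace (top_of_set (chart_image c)). chart_inv c x \<in> V}"
  proof (intro Set.set_eqI iffI)
    fix x assume "x \<in> {x \<in> topspace (top_of_set (chart_image c)). chart_inv c x \<in> V}"
    then have "x = snd c (chart_inv c x)" "chart_inv c x \<in> V \<inter> fst c" by auto
    then show "x \<in> snd c ` (V \<inter> fst c)" by (rule image_eqI)
  qed (use assms in auto)
  ultimately show "openin (top_of_set (chart_image c)) {x \<in> topspace (top_of_set (chart_image c)). chart_inv c x \<in> V}"
    by simp
qed

lemma overlap_subset: "overlap c d \<subseteq> chart_image c"
  by (auto simp: overlap_def chart_image_def)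

lemma overlap_iff:
  assumes "c \<in> A" shows "y \<in> overlap c d \<longleftrightarrow> y \<in> chart_image c \<and> chart_inv c y \<in> fst d"
proof
  assume "y \<in> chart_image c \<and> chart_inv c y \<in> fst d"
  then have "y = snd c (chart_inv c y)" "chart_inv c y \<in> fst c \<inter> fst d" by auto
  then show "y \<in> overlap c d" unfolding overlap_def by (rule image_eqI)
qed (use assms in \<open>auto simp: overlap_def\<close>)

lemma open_overlap:
  assumes "c \<in> A" "d \<in> A"
  shows "open (overlap c d)"
proof -
  have "openin (top_of_set (chart_image c)) {x \<in> topspace (top_of_set (chart_image c)). chart_inv c x \<in> fst d}"
    using continuous_map_chart_inv[OF assms(1)] dom_open[OF assms(2)] unfolding continuous_map_def by blast
  moreover have "{x \<in> topspace (top_of_set (chart_image c)). chart_inv c x \<in> fst d} = overlap c d"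
    by (auto simp: overlap_iff[OF assms(1), of _ d])
  ultimately show ?thesis
    using open_chart_image[OF assms(1)] openin_open_trans by metis
qed

lemma transition_chart [simp]: "c \<in> A \<Longrightarrow> p \<in> fst c \<Longrightarrow> chart_transition c d (snd c p) = snd d p"
  by (simp add: chart_transition_def)

lemma transition_overlap: "c \<in> A \<Longrightarrow> d \<in> A \<Longrightarrow> y \<in> overlap c d \<Longrightarrow> chart_transition c d y \<in> overlap d c"
  by (auto simp: overlap_def)

lemma transition_inverse: "c \<in> A \<Longrightarrow> d \<in> A \<Longrightarrow> y \<in> overlap c d \<Longrightarrow> chart_transition d c (chart_transition c d y) = y"
  by (auto simp: overlap_def)

lemma chart_inv_transition: "c \<in> A \<Longrightarrow> d \<in> A \<Longrightarrow> y \<in> overlap c d \<Longrightarrow> chart_inv d (chart_transition c d y) = chart_inv c y"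
  by (auto simp: overlap_def)

lemma transition_has_derivative:
  "c \<in> A \<Longrightarrow> d \<in> A \<Longrightarrow> y \<in> overlap c d \<Longrightarrow>
    (chart_transition c d has_derivative dir_deriv (chart_transition c d) y) (at y)"
  by (rule smooth_on_has_derivative[OF smooth_transition])

lemma linear_transition:
  "c \<in> A \<Longrightarrow> d \<in> A \<Longrightarrow> y \<in> overlap c d \<Longrightarrow> linear (dir_deriv (chart_transition c d) y)"
  by (intro linear_frechet_derivative smooth_on_differentiable[OF smooth_transition])

lemma transition_derivative_inverse:
  assumes c: "c \<in> A" and d: "d \<in> A" and y: "y \<in> overlap c d"
  shows "dir_deriv (chart_transition d c) (chart_transition c d y) (dir_deriv (chart_transition c d) y v) = v"
proof -
  have "((\<lambda>y. chart_transition d c (chart_transition c d y)) has_derivative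
    (\<lambda>v. dir_deriv (chart_transition d c) (chart_transition c d y) (dir_deriv (chart_transition c d) y v))) (at y)"
    by (rule has_derivative_compose[OF transition_has_derivative[OF c d y] transition_has_derivative[OF d c]])
      (rule transition_overlap[OF c d y])
  moreover have "((\<lambda>y. chart_transition d c (chart_transition c d y)) has_derivative (\<lambda>v. v)) (at y)"
    by (rule has_derivative_transform_within_open[OF has_derivative_ident open_overlap[OF c d] y])
      (simp add: transition_inverse[OF c d])
  ultimately have "(\<lambda>v. dir_deriv (chart_transition d c) (chart_transition c d y) (dir_deriv (chart_transition c d) y v)) = (\<lambda>v. v)"
    by (rule has_derivative_unique)
  then show ?thesis by meson
qed

text \<open>Supplies test vectors: nondegeneracy of the metric in the target chart is checked on
  images of vectors of the source chart.\<close>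

lemma transition_derivative_surj:
  assumes "c \<in> A" "d \<in> A" "y \<in> overlap c d"
  obtains v where "w = dir_deriv (chart_transition c d) y v"
  using transition_derivative_inverse[OF assms(2,1) transition_overlap[OF assms]]
    transition_inverse[OF assms] by metis

lemma continuous_map_from_charts:
  assumes "\<And>c. c \<in> A \<Longrightarrow> continuous_on (chart_image c) (\<lambda>y. h (chart_inv c y))"
  shows "continuous_map M (euclidean :: 'b::topological_space topology) h"
  unfolding continuous_map_def
proof (intro conjI allI impI)
  fix V :: "'b set" assume "openin euclidean V"
  then have V: "open V" by simp
  have "{p \<in> topspace M. h p \<in> V} = (\<Union>c\<in>A. {p \<in> fst c. snd c p \<in> {y \<in> chart_image c. h (chart_inv c y) \<in> V}})"
  proof (intro Set.set_eqI iffI)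
    fix p assume p: "p \<in> {p \<in> topspace M. h p \<in> V}"
    then obtain c where "c \<in> A" "p \<in> fst c" using cover[of p] by auto
    then show "p \<in> (\<Union>c\<in>A. {p \<in> fst c. snd c p \<in> {y \<in> chart_image c. h (chart_inv c y) \<in> V}})"
      using p by auto
  next
    fix p assume "p \<in> (\<Union>c\<in>A. {p \<in> fst c. snd c p \<in> {y \<in> chart_image c. h (chart_inv c y) \<in> V}})"
    then obtain c where c: "c \<in> A" "p \<in> fst c" "h (chart_inv c (snd c p)) \<in> V" by blast
    then show "p \<in> {p \<in> topspace M. h p \<in> V}"
      using dom_topspace[OF c(1)] by auto
  qed
  moreover have "open {y \<in> chart_image c. h (chart_inv c y) \<in> V}" if "c \<in> A" for c
    using continuous_open_preimage[OF assms[OF that] open_chart_image[OF that] V]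
    by (simp add: vimage_def Int_def)
  ultimately show "openin M {p \<in> topspace M. h p \<in> V}"
    by (simp only:) (rule openin_Union, erule imageE, simp only:, rule chart_preimage_open)
qed auto

lemma attains_bounds:
  assumes "compact_space M" "topspace M \<noteq> {}" and h: "continuous_map M euclideanreal h"
  shows "\<exists>p\<in>topspace M. \<forall>q\<in>topspace M. h p \<le> h q" "\<exists>p\<in>topspace M. \<forall>q\<in>topspace M. h q \<le> h p"
proof -
  have "compact (h ` topspace M)"
    using image_compactin[OF assms(1)[unfolded compact_space_def] h] by simp
  then show "\<exists>p\<in>topspace M. \<forall>q\<in>topspace M. h p \<le> h q" "\<exists>p\<in>topspace M. \<forall>q\<in>topspace M. h q \<le> h p"
    using compact_attains_inf[of "h ` topspace M"] compact_attains_sup[of "h ` topspace M"] assms(2) by auto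
qed

lemma chart_at: "p \<in> topspace M \<Longrightarrow> chart_at A p \<in> A \<and> p \<in> fst (chart_at A p)"
  unfolding chart_at_def using cover[of p] by (metis (mono_tags, lifting) someI_ex)

end

section \<open>Transformation laws of the metric, the connection and the gradient\<close>

locale riem_mfd =
  fixes M :: "'a topology" and A :: "('a, 'n::finite) chart set" and g :: "('a, 'n) metric"
  assumes riemannian: "riemannian_manifold M A g"

sublocale riem_mfd \<subseteq> smooth_mfd
  using riemannian by unfold_locales (simp add: riemannian_manifold_def)

context riem_mfd begin

lemma metric_domain: "c \<in> A \<Longrightarrow> metric_domain (chart_image c) (g c)"
  using riemannian open_chart_image unfolding riemannian_manifold_def metric_domain_def by blast

lemma metric_transition:
  "c \<in> A \<Longrightarrow> d \<in> A \<Longrightarrow> y \<in> overlap c d \<Longrightarrow> metric_at (g c) y v w =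
    metric_at (g d) (chart_transition c d y) (dir_deriv (chart_transition c d) y v) (dir_deriv (chart_transition c d) y w)"
  using riemannian unfolding riemannian_manifold_def overlap_def metric_at_def Let_def by blast

text \<open>Both sides are tested against a vector by the Koszul formulas of the two charts.
  Differentiating \<open>metric_transition\<close> adds second derivatives of the transition map; by
  their symmetry one of them survives as the inhomogeneous term.\<close>

lemma gam_transition:
  assumes c: "c \<in> A" and d: "d \<in> A" and y: "y \<in> overlap c d"
  defines "T \<equiv> chart_transition c d"
  shows "dir_deriv T y (gam (g c) y v w) =
    dir_deriv (\<lambda>y. dir_deriv T y v) y w + gam (g d) (T y) (dir_deriv T y v) (dir_deriv T y w)"
proof -
  interpret C: metric_domain "chart_image c" "g c" by (rule metric_domain[OF c])
  interpret D: metric_domain "chart_image d" "g d" by (rule metric_domain[OF d])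
  have yc: "y \<in> chart_image c" using y overlap_subset by blast
  have Ty: "T y \<in> chart_image d"
    unfolding T_def using transition_overlap[OF c d y] overlap_subset by blast
  let ?D2 = "\<lambda>v w. dir_deriv (\<lambda>y. dir_deriv T y v) y w"
  let ?m = "metric_at (g d) (T y)"
  let ?DT = "dir_deriv T y"
  have smT: "smooth_on (overlap c d) T" unfolding T_def by (rule smooth_transition[OF c d])
  note opn = open_overlap[OF c d]
  have D2sym: "?D2 v w = ?D2 w v" for v w
    by (rule dir_deriv_commute[OF opn smT y])
  have expand: "dir_deriv (\<lambda>y. metric_at (g c) y v w) y a =
      dir_deriv (\<lambda>x. metric_at (g d) x (?DT v) (?DT w)) (T y) (?DT a)
        + ?m (?D2 v a) (?DT w) + ?m (?DT v) (?D2 w a)" for v w a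
  proof -
    have "dir_deriv (\<lambda>y. metric_at (g c) y v w) y a = dir_deriv (\<lambda>y. metric_at (g d) (T y) (dir_deriv T y v) (dir_deriv T y w)) y a"
      unfolding T_def by (rule dir_deriv_cong[OF opn y metric_transition[OF c d]])
    also have "\<dots> = dir_deriv (\<lambda>x. metric_at (g d) x (?DT v) (?DT w)) (T y) (?DT a)
        + ?m (?D2 v a) (?DT w) + ?m (?DT v) (?D2 w a)"
      by (rule fun_cong[OF frechet_derivative_at[symmetric]], rule has_derivative_bilinear_field)
        (auto intro: bilinear_metric_at D.diff_metric[OF Ty] smooth_on_has_derivative[OF smT y]
          smooth_on_has_derivative[OF smooth_on_dir_deriv[OF opn smT] y])
    finally show ?thesis .
  qed
  show ?thesis
  proof (rule D.metric_nondegenerate[OF Ty])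
    fix z'
    obtain z where z: "z' = ?DT z"
      using transition_derivative_surj[OF c d y] unfolding T_def by metis
    have "?m (?DT (gam (g c) y v w)) z' = metric_at (g c) y (gam (g c) y v w) z"
      unfolding z T_def by (rule metric_transition[OF c d y, symmetric])
    also have "\<dots> = ?m (?D2 v w + gam (g d) (T y) (?DT v) (?DT w)) z'"
      unfolding C.koszul[OF yc] z expand metric_at_simps D.koszul[OF Ty]
      using D2sym[of w v] D2sym[of z v] D2sym[of z w] D.metric_sym[OF Ty]
      by (simp add: field_simps)
    finally show "?m (?DT (gam (g c) y v w)) z' = ?m (?D2 v w + gam (g d) (T y) (?DT v) (?DT w)) z'" .
  qed
qed

lemma frame_transition:
  assumes "c \<in> A" "d \<in> A" "y \<in> overlap c d" "frame (g c) y E"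
  shows "frame (g d) (chart_transition c d y) (\<lambda>i. dir_deriv (chart_transition c d) y (E i))"
  using assms(4) unfolding frame_def metric_transition[OF assms(1-3), symmetric] .

end

locale riem_mfd_fun = riem_mfd +
  fixes f :: "'a \<Rightarrow> real"
  assumes smooth_f: "smooth_function A f"
begin

definition Fc :: "('a, 'b) chart \<Rightarrow> real^'b \<Rightarrow> real" where
  "Fc c = f \<circ> chart_inv c"

abbreviation Zc :: "('a, 'b) chart \<Rightarrow> real^'b \<Rightarrow> real^'b" where
  "Zc c \<equiv> grad (g c) (Fc c)"

lemma smooth_Fc: "c \<in> A \<Longrightarrow> smooth_on (chart_image c) (Fc c)"
  using smooth_f by (simp add: smooth_function_def Fc_def)

lemma smooth_Zc: "c \<in> A \<Longrightarrow> smooth_on (chart_image c) (Zc c)"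
  by (rule metric_domain.smooth_grad[OF metric_domain smooth_Fc])

lemma continuous_f: "continuous_map M euclideanreal f"
  by (rule continuous_map_from_charts) (use smooth_on_continuous_on[OF smooth_Fc] in \<open>simp add: Fc_def o_def\<close>)

lemma grad_transition:
  assumes c: "c \<in> A" and d: "d \<in> A" and y: "y \<in> overlap c d"
  shows "dir_deriv (chart_transition c d) y (Zc c y) = Zc d (chart_transition c d y)"
proof -
  interpret C: metric_domain "chart_image c" "g c" by (rule metric_domain[OF c])
  interpret D: metric_domain "chart_image d" "g d" by (rule metric_domain[OF d])
  let ?T = "chart_transition c d" let ?DT = "dir_deriv ?T y"
  have yc: "y \<in> chart_image c" using y overlap_subset by blast
  have Ty: "?T y \<in> chart_image d"
    using transition_overlap[OF c d y] overlap_subset by blast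
  note dF = smooth_on_has_derivative[OF smooth_Fc]
  have dFc: "dir_deriv (Fc c) y v = dir_deriv (Fc d) (?T y) (?DT v)" for v
  proof -
    have "dir_deriv (Fc c) y v = dir_deriv (\<lambda>y. Fc d (?T y)) y v"
      by (rule dir_deriv_cong[OF open_overlap[OF c d] y]) (simp add: Fc_def chart_inv_transition[OF c d])
    also have "\<dots> = dir_deriv (Fc d) (?T y) (?DT v)"
      by (rule fun_cong[OF frechet_derivative_at[symmetric]], rule has_derivative_compose[OF transition_has_derivative[OF c d y]])
        (rule dF[OF d Ty])
    finally show ?thesis .
  qed
  show ?thesis
  proof (rule D.metric_nondegenerate[OF Ty])
    fix z'
    obtain z where z: "z' = ?DT z" using transition_derivative_surj[OF c d y] by metis
    have "metric_at (g d) (?T y) (?DT (Zc c y)) z' = metric_at (g c) y (Zc c y) z"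
      unfolding z by (rule metric_transition[OF c d y, symmetric])
    also have "\<dots> = dir_deriv (Fc c) y z"
      by (rule C.metric_grad[OF yc smooth_on_differentiable[OF smooth_Fc[OF c] yc]])
    also have "\<dots> = metric_at (g d) (?T y) (Zc d (?T y)) z'"
      unfolding dFc z by (rule D.metric_grad[OF Ty smooth_on_differentiable[OF smooth_Fc[OF d] Ty], symmetric])
    finally show "metric_at (g d) (?T y) (?DT (Zc c y)) z' = metric_at (g d) (?T y) (Zc d (?T y)) z'" .
  qed
qed

text \<open>Differentiating \<open>grad_transition\<close> produces a second derivative of the
  transition map, which cancels the inhomogeneous term of \<open>gam_transition\<close>. The Hessian
  endomorphism is therefore a tensor.\<close>

lemma cov_grad_transition:
  assumes c: "c \<in> A" and d: "d \<in> A" and y: "y \<in> overlap c d"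
  defines "T \<equiv> chart_transition c d"
  shows "dir_deriv T y (dir_deriv (Zc c) y v + gam (g c) y v (Zc c y)) =
    dir_deriv (Zc d) (T y) (dir_deriv T y v) + gam (g d) (T y) (dir_deriv T y v) (Zc d (T y))"
proof -
  have yc: "y \<in> chart_image c" using y overlap_subset by blast
  have Ty: "T y \<in> chart_image d"
    unfolding T_def using transition_overlap[OF c d y] overlap_subset by blast
  have smT: "smooth_on (overlap c d) T" unfolding T_def by (rule smooth_transition[OF c d])
  note opn = open_overlap[OF c d]
  have dZ: "Zc c differentiable (at y)" by (rule smooth_on_differentiable[OF smooth_Zc[OF c] yc])
  have ZT: "dir_deriv T z (Zc c z) = Zc d (T z)" if "z \<in> overlap c d" for z
    unfolding T_def by (rule grad_transition[OF c d that])
  have "dir_deriv (Zc d) (T y) (dir_deriv T y v) = dir_deriv (\<lambda>y. Zc d (T y)) y v"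
    by (rule fun_cong[OF frechet_derivative_at], rule has_derivative_compose[OF smooth_on_has_derivative[OF smT y]])
      (rule smooth_on_has_derivative[OF smooth_Zc[OF d] Ty])
  also have "\<dots> = dir_deriv (\<lambda>y. dir_deriv T y (Zc c y)) y v"
    by (rule dir_deriv_cong[OF opn y]) (simp add: ZT)
  also have "\<dots> = dir_deriv (\<lambda>x. dir_deriv T x (Zc c y)) y v + dir_deriv T y (dir_deriv (Zc c) y v)"
    by (rule dir_deriv_dir_deriv_field(2)[OF opn y smT dZ])
  also have "dir_deriv (\<lambda>x. dir_deriv T x (Zc c y)) y v = dir_deriv (\<lambda>x. dir_deriv T x v) y (Zc c y)"
    by (rule dir_deriv_commute[OF opn smT y])
  finally show ?thesis
    using gam_transition[OF c d y, folded T_def, of v "Zc c y"] linear_transition[OF c d y, folded T_def]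
    by (simp add: linear_add ZT[OF y])
qed

end

section \<open>Scalar curvature and potential of a normalized soliton\<close>

locale ricci_soliton_mfd = riem_mfd_fun +
  fixes lam :: real
  assumes soliton: "ricci_soliton A g f lam"
    and normalized: "\<And>p. p \<in> topspace M \<Longrightarrow> scalar_curvature A g p + grad_norm_sq A g f p = 2 * lam * f p"
begin

lemma soliton_domain:
  assumes c: "c \<in> A" shows "soliton_domain (chart_image c) (g c) (Fc c) lam"
proof -
  interpret C: metric_domain "chart_image c" "g c" by (rule metric_domain[OF c])
  show ?thesis
    using smooth_Fc[OF c] soliton c unfolding ricci_soliton_def Fc_def by unfold_locales blast+
qed

text \<open>By the soliton equation the scalar curvature is n lam - tr S. The Hessian endomorphisms
  of the two charts are conjugate, so their traces agree; a transformation law for the full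
  curvature tensor is bypassed.\<close>

lemma scal_transition:
  assumes c: "c \<in> A" and d: "d \<in> A" and y: "y \<in> overlap c d"
  shows "scal (g d) (chart_transition c d y) = scal (g c) y"
proof -
  interpret C: soliton_domain "chart_image c" "g c" "Fc c" lam by (rule soliton_domain[OF c])
  interpret D: soliton_domain "chart_image d" "g d" "Fc d" lam by (rule soliton_domain[OF d])
  let ?T = "chart_transition c d" let ?DT = "dir_deriv ?T y"
  let ?DT' = "dir_deriv (chart_transition d c) (?T y)"
  have yc: "y \<in> chart_image c" using y overlap_subset by blast
  have Ty': "?T y \<in> overlap d c" by (rule transition_overlap[OF c d y])
  then have Ty: "?T y \<in> chart_image d" using overlap_subset by blast
  have inv: "?DT' (?DT v) = v" "?DT (?DT' v) = v" for v
    using transition_derivative_inverse[OF c d y] transition_derivative_inverse[OF d c Ty'] transition_inverse[OF c d y] by auto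
  have S: "D.S (?T y) v = ?DT (C.S y (?DT' v))" for v
    using cov_grad_transition[OF c d y, of "?DT' v"] by (simp add: inv)
  have "tr (D.S (?T y)) = tr (\<lambda>v. ?DT (C.S y (?DT' v)))" unfolding S ..
  also have "\<dots> = tr (\<lambda>v. C.S y (?DT' (?DT v)))"
    by (rule tr_comp_commute[OF linear_transition[OF c d y]
        linear_compose[OF linear_transition[OF d c Ty'] C.linear_S[OF yc], unfolded o_def]])
  finally show ?thesis
    unfolding C.scal_eq[OF yc] D.scal_eq[OF Ty] inv by simp
qed

lemma scalar_curvature_chart:
  assumes c: "c \<in> A" and p: "p \<in> fst c"
  shows "scalar_curvature A g p = scal (g c) (snd c p)"
proof -
  have d: "chart_at A p \<in> A" "p \<in> fst (chart_at A p)"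
    using chart_at dom_topspace[OF c] p by blast+
  then have y: "snd c p \<in> overlap c (chart_at A p)" using p by (auto simp: overlap_def)
  show ?thesis
    using scal_transition[OF c d(1) y] c p by (simp add: scalar_curvature_def)
qed

lemma grad_norm_sq_chart:
  assumes c: "c \<in> A" and p: "p \<in> fst c"
  shows "grad_norm_sq A g f p = metric_at (g c) (snd c p) (Zc c (snd c p)) (Zc c (snd c p))"
proof -
  have d: "chart_at A p \<in> A" "p \<in> fst (chart_at A p)"
    using chart_at dom_topspace[OF c] p by blast+
  then have y: "snd c p \<in> overlap c (chart_at A p)" using p by (auto simp: overlap_def)
  show ?thesis
    unfolding metric_transition[OF c d(1) y] grad_transition[OF c d(1) y]
    using c p by (simp add: grad_norm_sq_def Fc_def Let_def)
qed

lemma normalized_chart: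
  assumes c: "c \<in> A" and y: "y \<in> chart_image c"
  shows "scal (g c) y + metric_at (g c) y (Zc c y) (Zc c y) = 2 * lam * Fc c y"
  using normalized[OF chart_inv_topspace[OF c y]] scalar_curvature_chart[OF c chart_inv_in_dom[OF y]]
    grad_norm_sq_chart[OF c chart_inv_in_dom[OF y]] y by (simp add: Fc_def)

text \<open>The normalization expresses the scalar curvature through \<open>f\<close> and its
  gradient, whose continuity is already known.\<close>

lemma continuous_scalar_curvature: "continuous_map M euclideanreal (scalar_curvature A g)"
proof (rule continuous_map_from_charts)
  fix c assume c: "c \<in> A"
  interpret C: soliton_domain "chart_image c" "g c" "Fc c" lam by (rule soliton_domain[OF c])
  have "smooth_on (chart_image c) (\<lambda>y. 2 * lam * Fc c y - metric_at (g c) y (Zc c y) (Zc c y))"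
    by (intro smooth_on_diff smooth_on_mult smooth_on_const C.open_U smooth_Fc c
        smooth_on_bilinear_field[OF bilinear_metric_at C.open_U C.smooth_metric C.smooth_Z C.smooth_Z])
  then have "continuous_on (chart_image c) (\<lambda>y. 2 * lam * Fc c y - metric_at (g c) y (Zc c y) (Zc c y))"
    by (rule smooth_on_continuous_on)
  then show "continuous_on (chart_image c) (\<lambda>y. scalar_curvature A g (chart_inv c y))"
  proof (rule continuous_on_eq)
    fix y assume y: "y \<in> chart_image c"
    show "2 * lam * Fc c y - metric_at (g c) y (Zc c y) (Zc c y) = scalar_curvature A g (chart_inv c y)"
      using normalized_chart[OF c y] scalar_curvature_chart[OF c chart_inv_in_dom[OF y]] y by simp
  qed
qed

theorem potential_bounds:
  assumes "compact_space M" "topspace M \<noteq> {}" and lam: "lam > 0"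
    and Rmax: "\<And>p. p \<in> topspace M \<Longrightarrow> scalar_curvature A g p \<le> Rmax"
  shows "CARD('b) * lam \<le> Rmax" and "p \<in> topspace M \<Longrightarrow> 0 \<le> f p" and "p \<in> topspace M \<Longrightarrow> f p \<le> Rmax / (2 * lam)"
proof -
  obtain q where q: "q \<in> topspace M" "\<And>p. p \<in> topspace M \<Longrightarrow> f p \<le> f q"
    using attains_bounds(2)[OF assms(1,2) continuous_f] by blast
  obtain c where c: "c \<in> A" "q \<in> fst c" using cover q(1) by blast
  interpret C: soliton_domain "chart_image c" "g c" "Fc c" lam by (rule soliton_domain[OF c(1)])
  have max: "Fc c y \<le> Fc c (snd c q)" if "y \<in> chart_image c" for y
    using q(2) chart_inv_topspace[OF c(1) that] c by (simp add: Fc_def)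
  note at_max = C.scal_at_max[OF chart_in_image[OF c(2)] max]
  show "CARD('b) * lam \<le> Rmax"
    using at_max(2) Rmax[OF q(1)] scalar_curvature_chart[OF c] by simp
  have "2 * lam * f q = scalar_curvature A g q"
    using normalized_chart[OF c(1) chart_in_image[OF c(2)]] at_max(1) scalar_curvature_chart[OF c] c
    by (simp add: metric_at_simps Fc_def)
  then have "f q \<le> Rmax / (2 * lam)" using Rmax[OF q(1)] lam by (simp add: field_simps)
  then show "p \<in> topspace M \<Longrightarrow> f p \<le> Rmax / (2 * lam)" using q(2) by fastforce
  obtain q' where q': "q' \<in> topspace M" "\<And>p. p \<in> topspace M \<Longrightarrow> scalar_curvature A g q' \<le> scalar_curvature A g p"
    using attains_bounds(1)[OF assms(1,2) continuous_scalar_curvature] by blast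
  obtain d where d: "d \<in> A" "q' \<in> fst d" using cover q'(1) by blast
  interpret D: soliton_domain "chart_image d" "g d" "Fc d" lam by (rule soliton_domain[OF d(1)])
  have min: "scal (g d) (snd d q') \<le> scal (g d) y" if "y \<in> chart_image d" for y
    using q'(2)[OF chart_inv_topspace[OF d(1) that]] scalar_curvature_chart[OF d]
      scalar_curvature_chart[OF d(1) chart_inv_in_dom[OF that]] that by simp
  have "scal (g d) (snd d q') \<ge> 0"
    by (rule D.scal_nonneg_at_min[OF chart_in_image[OF d(2)] lam normalized_chart[OF d(1)] min])
  then have R0: "scalar_curvature A g p \<ge> 0" if "p \<in> topspace M" for p
    using q'(2)[OF that] scalar_curvature_chart[OF d] by simp
  assume p: "p \<in> topspace M"
  obtain e where e: "e \<in> A" "p \<in> fst e" using cover p by blast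
  have "grad_norm_sq A g f p \<ge> 0"
    unfolding grad_norm_sq_chart[OF e]
    by (rule metric_domain.metric_nonneg[OF metric_domain[OF e(1)] chart_in_image[OF e(2)]])
  then have "2 * lam * f p \<ge> 0" using normalized[OF p] R0[OF p] by simp
  then show "0 \<le> f p" using lam by (simp add: zero_le_mult_iff)
qed

end

section \<open>Curves and distance\<close>

context riem_mfd begin

abbreviation nrm :: "('a, 'n) chart \<Rightarrow> real^'n \<Rightarrow> real^'n \<Rightarrow> real" where
  "nrm c x v \<equiv> sqrt (metric_at (g c) x v v)"

lemma nrm_nonneg: "c \<in> A \<Longrightarrow> x \<in> chart_image c \<Longrightarrow> nrm c x v \<ge> 0"
  using metric_domain.metric_nonneg[OF metric_domain] by simp

lemma continuous_on_metric_at: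
  assumes c: "c \<in> A" and "continuous_on S x" "continuous_on S v" "continuous_on S w" "x ` S \<subseteq> chart_image c"
  shows "continuous_on S (\<lambda>t. metric_at (g c) (x t) (v t) (w t))"
proof -
  interpret C: metric_domain "chart_image c" "g c" by (rule metric_domain[OF c])
  have G: "continuous_on S (\<lambda>t. g c (x t) $ i $ j)" for i j
    by (rule continuous_on_compose2[OF smooth_on_continuous_on assms(2) assms(5)])
      (intro smooth_on_vec_nth C.open_U C.smooth_H)
  show ?thesis
    unfolding metric_at_sum_sum by (intro continuous_on_sum continuous_on_mult continuous_on_component G assms)
qed

lemma pathin_nbhd:
  assumes "pathin M \<gamma>" "0 \<le> t" "t \<le> 1" "openin M V" "\<gamma> t \<in> V"
  shows "\<exists>e>0. \<forall>s. 0 \<le> s \<and> s \<le> 1 \<and> \<bar>s - t\<bar> < e \<longrightarrow> \<gamma> s \<in> V"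
proof -
  have "openin (top_of_set {0..1}) {s \<in> {0..1}. \<gamma> s \<in> V}"
    using assms(1,4) unfolding pathin_def continuous_map_def by simp
  then obtain e where "e > 0" "ball t e \<inter> {0..1} \<subseteq> {s \<in> {0..1}. \<gamma> s \<in> V}"
    using assms unfolding openin_contains_ball by (metis (no_types, lifting) atLeastAtMost_iff mem_Collect_eq)
  then show ?thesis
    by (intro exI[of _ e]) (auto simp: dist_real_def abs_minus_commute subset_iff)
qed

lemma pathin_topspace: "pathin M \<gamma> \<Longrightarrow> 0 \<le> t \<Longrightarrow> t \<le> 1 \<Longrightarrow> \<gamma> t \<in> topspace M"
  unfolding pathin_def continuous_map_def by auto

text \<open>\<open>curve_speed\<close> selects a chart anew at every parameter. A fixed chart gives
  the same value since the metric is compatible with the transition map; the open set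
  \<open>W\<close> reflects that the velocity is a two-sided derivative.\<close>

lemma curve_speed_eq:
  assumes c: "c \<in> A" and W: "open W" "t \<in> W" "\<gamma> ` W \<subseteq> fst c"
    and D: "((\<lambda>t. snd c (\<gamma> t)) has_vector_derivative u) (at t)"
  shows "curve_speed A g \<gamma> t = nrm c (snd c (\<gamma> t)) u"
proof -
  have tc: "\<gamma> t \<in> fst c" using W by blast
  define d where "d = chart_at A (\<gamma> t)"
  have d: "d \<in> A" "\<gamma> t \<in> fst d"
    unfolding d_def using chart_at dom_topspace[OF c] tc by blast+
  let ?T = "chart_transition c d" let ?x = "\<lambda>t. snd c (\<gamma> t)"
  have y: "?x t \<in> overlap c d" using tc d by (auto simp: overlap_def)
  have "isCont ?x t" by (rule has_vector_derivative_continuous[OF D])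
  then have "\<exists>V. open V \<and> t \<in> V \<and> (\<forall>s\<in>V. ?x s \<in> overlap c d)"
    using y open_overlap[OF c d(1)] unfolding continuous_at_open by blast
  then obtain V where V: "open V" "t \<in> V" "\<And>s. s \<in> V \<Longrightarrow> ?x s \<in> overlap c d" by blast
  have "((\<lambda>s. ?T (?x s)) has_derivative (\<lambda>h. dir_deriv ?T (?x t) (h *\<^sub>R u))) (at t)"
    by (rule has_derivative_compose[OF D[unfolded has_vector_derivative_def] transition_has_derivative[OF c d(1) y]])
  then have "((\<lambda>s. ?T (?x s)) has_vector_derivative dir_deriv ?T (?x t) u) (at t)"
    unfolding has_vector_derivative_def by (simp add: linear_scale[OF linear_transition[OF c d(1) y]])
  then have "((snd d \<circ> \<gamma>) has_vector_derivative dir_deriv ?T (?x t) u) (at t)"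
    by (rule has_vector_derivative_transform_within_open[of _ _ _ "V \<inter> W"])
      (use V W c in auto)
  then have "vector_derivative (snd d \<circ> \<gamma>) (at t) = dir_deriv ?T (?x t) u"
    by (rule vector_derivative_at)
  then show ?thesis
    unfolding curve_speed_def d_def[symmetric] Let_def
    using metric_transition[OF c d(1) y, of u u] tc c by simp
qed

section \<open>Smooth pieces of a curve and induction over them\<close>

definition C1_piece :: "(real \<Rightarrow> 'a) \<Rightarrow> ('a, 'n) chart \<Rightarrow> real \<Rightarrow> real \<Rightarrow> (real \<Rightarrow> real^'n) \<Rightarrow> bool" where
  "C1_piece \<gamma> c a b D \<longleftrightarrow> a < b \<and> \<gamma> ` {a..b} \<subseteq> fst c \<and> continuous_on {a..b} D \<and>
     (\<forall>t\<in>{a..b}. ((\<lambda>t. snd c (\<gamma> t)) has_vector_derivative D t) (at t within {a..b}))"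

lemma C1_piece_continuous: "C1_piece \<gamma> c a b D \<Longrightarrow> continuous_on {a..b} (\<lambda>t. snd c (\<gamma> t))"
  unfolding C1_piece_def continuous_on_eq_continuous_within
  using has_vector_derivative_continuous by blast

lemma C1_piece_speed:
  assumes c: "c \<in> A" and p: "C1_piece \<gamma> c a b D" and t: "a < t" "t < b"
  shows "curve_speed A g \<gamma> t = nrm c (snd c (\<gamma> t)) (D t)"
proof (rule curve_speed_eq[OF c, of "{a<..<b}"])
  show "((\<lambda>t. snd c (\<gamma> t)) has_vector_derivative D t) (at t)"
    using p t at_within_Icc_at[of a t b] unfolding C1_piece_def by (metis atLeastAtMost_iff less_imp_le)
qed (use p t in \<open>auto simp: C1_piece_def image_subset_iff\<close>)

lemma C1_piece_speed_integral:
  assumes c: "c \<in> A" and p: "C1_piece \<gamma> c a b D"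
  shows "continuous_on {a..b} (\<lambda>t. nrm c (snd c (\<gamma> t)) (D t))"
    and "(curve_speed A g \<gamma> has_integral integral {a..b} (\<lambda>t. nrm c (snd c (\<gamma> t)) (D t))) {a..b}"
proof -
  show cont: "continuous_on {a..b} (\<lambda>t. nrm c (snd c (\<gamma> t)) (D t))"
    using p C1_piece_continuous[OF p]
    by (intro continuous_intros continuous_on_metric_at[OF c]) (auto simp: C1_piece_def image_subset_iff)
  \<comment> \<open>At \<open>a\<close> and \<open>b\<close> only one-sided derivatives are known,
    so the speed may take another value there; two points do not affect the integral.\<close>
  show "(curve_speed A g \<gamma> has_integral integral {a..b} (\<lambda>t. nrm c (snd c (\<gamma> t)) (D t))) {a..b}"
    by (rule has_integral_spike_finite[of "{a, b}", OF _ _ integrable_integral[OF integrable_continuous_real[OF cont]]])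
      (use C1_piece_speed[OF c p] in auto)
qed

text \<open>Bisection replaces an ordered list of break points: a short interval around
  \<open>x\<close> contains no break point except possibly \<open>x\<close>, and splitting it there
  leaves at most two smooth pieces.\<close>

lemma piecewise_chart_induct:
  assumes pw: "piecewise_C1_curve M A \<gamma>" and c: "c \<in> A"
    and ab: "0 \<le> a" "a \<le> b" "b \<le> 1" and dom: "\<gamma> ` {a..b} \<subseteq> fst c"
    and refl: "\<And>t. Q t t" and trans: "\<And>s t u. s \<le> t \<Longrightarrow> t \<le> u \<Longrightarrow> Q s t \<Longrightarrow> Q t u \<Longrightarrow> Q s u"
    and piece: "\<And>s t D. a \<le> s \<Longrightarrow> s < t \<Longrightarrow> t \<le> b \<Longrightarrow> C1_piece \<gamma> c s t D \<Longrightarrow> Q s t"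
  shows "Q a b"
proof -
  obtain S where S: "finite S" and pS: "\<And>s t. 0 \<le> s \<Longrightarrow> s < t \<Longrightarrow> t \<le> 1 \<Longrightarrow> {s<..<t} \<inter> S = {} \<Longrightarrow> \<gamma> ` {s..t} \<subseteq> fst c \<Longrightarrow>
      \<exists>D. continuous_on {s..t} D \<and> (\<forall>u\<in>{s..t}. ((snd c \<circ> \<gamma>) has_vector_derivative D u) (at u within {s..t}))"
    using pw c unfolding piecewise_C1_curve_def by meson
  define P where "P s t \<longleftrightarrow> (a \<le> s \<and> t \<le> b \<longrightarrow> Q s t)" for s t
  have free: "P s t" if le: "s \<le> t" and fr: "{s<..<t} \<inter> S = {}" for s t
  proof (cases "s = t")
    case False
    show ?thesis unfolding P_def
    proof
      assume st: "a \<le> s \<and> t \<le> b"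
      have "\<gamma> ` {s..t} \<subseteq> fst c" using dom st by (auto simp: image_subset_iff)
      then obtain D where "continuous_on {s..t} D" "\<forall>u\<in>{s..t}. ((snd c \<circ> \<gamma>) has_vector_derivative D u) (at u within {s..t})"
        using pS[of s t] le fr False st ab by auto
      then show "Q s t"
        using piece[of s t D] st le False \<open>\<gamma> ` {s..t} \<subseteq> fst c\<close> by (simp add: C1_piece_def o_def)
    qed
  qed (simp add: P_def refl)
  have "P a b"
  proof (rule Bolzano[OF ab(2)])
    show "P s u" if "P s t" "P t u" "s \<le> t" "t \<le> u" for s t u
      using that trans unfolding P_def by (meson order_trans)
    fix x
    obtain d where d: "d > 0" "\<forall>s\<in>S. s \<noteq> x \<longrightarrow> d \<le> dist x s"
      using finite_set_avoid[OF S] by blast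
    show "\<exists>d>0. \<forall>s t. s \<le> x \<and> x \<le> t \<and> t - s < d \<longrightarrow> P s t"
    proof (intro exI[of _ d] conjI d(1) allI impI)
      fix s t assume st: "s \<le> x \<and> x \<le> t \<and> t - s < d"
      have "{s<..<x} \<inter> S = {}" "{x<..<t} \<inter> S = {}"
        using d(2) st by (fastforce simp: dist_real_def)+
      then have "P s x" "P x t" using free st by auto
      then show "P s t" using st trans unfolding P_def by (meson order_trans)
    qed
  qed
  then show ?thesis by (simp add: P_def)
qed

text \<open>The same bisection, now in order to fit into charts: a short interval around
  \<open>x\<close> is mapped into one chart domain, where \<open>piecewise_chart_induct\<close>
  applies.\<close>

lemma piecewise_induct:
  assumes pw: "piecewise_C1_curve M A \<gamma>"
    and ab: "0 \<le> a" "a \<le> b" "b \<le> 1"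
    and refl: "\<And>t. Q t t" and trans: "\<And>s t u. s \<le> t \<Longrightarrow> t \<le> u \<Longrightarrow> Q s t \<Longrightarrow> Q t u \<Longrightarrow> Q s u"
    and piece: "\<And>c s t D. c \<in> A \<Longrightarrow> a \<le> s \<Longrightarrow> s < t \<Longrightarrow> t \<le> b \<Longrightarrow> C1_piece \<gamma> c s t D \<Longrightarrow> Q s t"
  shows "Q a b"
proof -
  have path: "pathin M \<gamma>" using pw by (simp add: piecewise_C1_curve_def)
  define P where "P s t \<longleftrightarrow> (a \<le> s \<and> t \<le> b \<longrightarrow> Q s t)" for s t
  have "P a b"
  proof (rule Bolzano[OF ab(2)])
    show "P s u" if "P s t" "P t u" "s \<le> t" "t \<le> u" for s t u
      using that trans unfolding P_def by (meson order_trans)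
    fix x assume x: "a \<le> x" "x \<le> b"
    then obtain c where c: "c \<in> A" "\<gamma> x \<in> fst c"
      using cover[OF pathin_topspace[OF path, of x]] ab by auto
    obtain e where e: "e > 0" "\<And>s. 0 \<le> s \<Longrightarrow> s \<le> 1 \<Longrightarrow> \<bar>s - x\<bar> < e \<Longrightarrow> \<gamma> s \<in> fst c"
      using pathin_nbhd[OF path _ _ dom_open[OF c(1)] c(2)] x ab by force
    show "\<exists>d>0. \<forall>s t. s \<le> x \<and> x \<le> t \<and> t - s < d \<longrightarrow> P s t"
    proof (intro exI[of _ e] conjI e(1) allI impI)
      fix s t assume st: "s \<le> x \<and> x \<le> t \<and> t - s < e"
      show "P s t" unfolding P_def
      proof
        assume ab': "a \<le> s \<and> t \<le> b"
        show "Q s t"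
        proof (rule piecewise_chart_induct[OF pw c(1) _ _ _ _ refl trans])
          show "\<gamma> ` {s..t} \<subseteq> fst c" using e(2) st ab' ab by force
          show "Q s' t'" if "s \<le> s'" "s' < t'" "t' \<le> t" "C1_piece \<gamma> c s' t' D" for s' t' D
            by (rule piece[OF c(1) _ that(2) _ that(4)]) (use that ab' in auto)
        qed (use st ab ab' in auto)
      qed
    qed
  qed
  then show ?thesis by (simp add: P_def)
qed

section \<open>Lengths of piecewise smooth curves\<close>

lemma curve_speed_integrable:
  assumes pw: "piecewise_C1_curve M A \<gamma>" and ab: "0 \<le> a" "a \<le> b" "b \<le> 1"
  shows "curve_speed A g \<gamma> integrable_on {a..b}"
proof (rule piecewise_induct[OF pw ab])
  show "curve_speed A g \<gamma> integrable_on {s..u}"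
    if "s \<le> t" "t \<le> u" "curve_speed A g \<gamma> integrable_on {s..t}" "curve_speed A g \<gamma> integrable_on {t..u}" for s t u
    using that by (rule Henstock_Kurzweil_Integration.integrable_combine)
  show "curve_speed A g \<gamma> integrable_on {s..t}" if "c \<in> A" "C1_piece \<gamma> c s t D" for c s t D
    using C1_piece_speed_integral(2)[OF that] by blast
  show "curve_speed A g \<gamma> integrable_on {t..t}" for t
    using integrable_on_refl[of _ t] by simp
qed

lemma curve_speed_nonneg:
  assumes "\<gamma> t \<in> topspace M" shows "curve_speed A g \<gamma> t \<ge> 0"
  using chart_at[OF assms] metric_domain.metric_nonneg[OF metric_domain[of "chart_at A (\<gamma> t)"]]
  unfolding curve_speed_def Let_def by simp

lemma curve_length_nonneg: "piecewise_C1_curve M A \<gamma> \<Longrightarrow> curve_length A g \<gamma> \<ge> 0"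
  unfolding curve_length_def
  by (intro integral_nonneg curve_speed_integrable curve_speed_nonneg)
    (auto simp: piecewise_C1_curve_def pathin_topspace)

text \<open>Length as a relation: \<open>has_integral\<close> carries existence along with the
  value, so that concatenation becomes plain addition.\<close>

definition conn :: "'a \<Rightarrow> 'a \<Rightarrow> real \<Rightarrow> bool" where
  "conn p q l \<longleftrightarrow> (\<exists>\<gamma>. piecewise_C1_curve M A \<gamma> \<and> \<gamma> 0 = p \<and> \<gamma> 1 = q \<and> (curve_speed A g \<gamma> has_integral l) {0..1})"

lemma conn_curve:
  "piecewise_C1_curve M A \<gamma> \<Longrightarrow> conn (\<gamma> 0) (\<gamma> 1) (curve_length A g \<gamma>)"
  unfolding conn_def curve_length_def
  using integrable_integral[OF curve_speed_integrable[of \<gamma> 0 1]] by auto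

lemma conn_set: "{curve_length A g \<gamma> | \<gamma>. piecewise_C1_curve M A \<gamma> \<and> \<gamma> 0 = p \<and> \<gamma> 1 = q} = {l. conn p q l}"
proof -
  have "conn p q l \<longleftrightarrow> (\<exists>\<gamma>. l = curve_length A g \<gamma> \<and> piecewise_C1_curve M A \<gamma> \<and> \<gamma> 0 = p \<and> \<gamma> 1 = q)" for l
    using conn_curve unfolding conn_def curve_length_def by (metis integral_unique)
  then show ?thesis by blast
qed

lemma conn_nonneg: "conn p q l \<Longrightarrow> 0 \<le> l"
  unfolding conn_def using curve_length_nonneg unfolding curve_length_def by (metis integral_unique)

lemma riem_dist_conn: "riem_dist M A g p q = Inf {l. conn p q l}"
  unfolding riem_dist_def conn_set ..

lemma riem_dist_le: "conn p q l \<Longrightarrow> riem_dist M A g p q \<le> l"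
  unfolding riem_dist_conn by (rule cInf_lower) (auto intro!: bdd_belowI[of _ 0] conn_nonneg)

text \<open>In any other chart the curve is composed with a smooth transition map, so no break
  points arise and the exceptional set is empty.\<close>

lemma chart_curve_piecewise:
  assumes c: "c \<in> A" and img: "y ` {0..1} \<subseteq> chart_image c" and D: "continuous_on {0..1} D"
    and y: "\<And>t. t \<in> {0..1} \<Longrightarrow> (y has_vector_derivative D t) (at t within {0..1})"
  shows "piecewise_C1_curve M A (\<lambda>t. chart_inv c (y t))"
proof -
  have ycont: "continuous_on {0..1} y"
    unfolding continuous_on_eq_continuous_within using has_vector_derivative_continuous[OF y] by blast
  have "pathin M (\<lambda>t. chart_inv c (y t))"
    unfolding pathin_def
    by (rule continuous_map_compose[OF _ continuous_map_chart_inv[OF c], unfolded o_def])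
      (use ycont img in \<open>auto simp: continuous_map_in_subtopology image_subset_iff_funcset\<close>)
  moreover have "\<exists>E. continuous_on {a..b} E \<and> (\<forall>t\<in>{a..b}. ((snd d \<circ> (\<lambda>t. chart_inv c (y t))) has_vector_derivative E t) (at t within {a..b}))"
    if d: "d \<in> A" and ab: "0 \<le> a" "a < b" "b \<le> 1" and sub: "(\<lambda>t. chart_inv c (y t)) ` {a..b} \<subseteq> fst d" for d a b
  proof -
    let ?T = "chart_transition c d"
    have ov: "y t \<in> overlap c d" if "t \<in> {a..b}" for t
      using overlap_iff[OF c, of "y t" d] img sub that ab by (auto simp: image_subset_iff)
    have eq: "dir_deriv ?T (y t) (D t) = (\<Sum>i\<in>UNIV. D t $ i *\<^sub>R coord_deriv i ?T (y t))" if "t \<in> {a..b}" for t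
      by (rule dir_deriv_eq_sum[OF smooth_on_differentiable[OF smooth_transition[OF c d] ov[OF that]]])
    have sub01: "{a..b} \<subseteq> {0..1}" using ab by auto
    have "continuous_on {a..b} (\<lambda>t. \<Sum>i\<in>UNIV. D t $ i *\<^sub>R coord_deriv i ?T (y t))"
      by (intro continuous_intros continuous_on_subset[OF D sub01]
          continuous_on_compose2[OF smooth_on_continuous_on[OF smooth_on_coord_deriv[OF smooth_transition[OF c d]]]
            continuous_on_subset[OF ycont sub01]])
        (use ov in auto)
    then have "continuous_on {a..b} (\<lambda>t. dir_deriv ?T (y t) (D t))"
      by (rule continuous_on_eq) (simp add: eq)
    moreover have "((snd d \<circ> (\<lambda>t. chart_inv c (y t))) has_vector_derivative dir_deriv ?T (y t) (D t)) (at t within {a..b})"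
      if t: "t \<in> {a..b}" for t
    proof -
      have "(y has_derivative (\<lambda>h. h *\<^sub>R D t)) (at t within {a..b})"
        using y[of t] t sub01 has_vector_derivative_within_subset[OF _ sub01] unfolding has_vector_derivative_def by blast
      then have "((\<lambda>t. ?T (y t)) has_derivative (\<lambda>h. dir_deriv ?T (y t) (h *\<^sub>R D t))) (at t within {a..b})"
        by (rule has_derivative_compose[where g = ?T and f = y]) (rule transition_has_derivative[OF c d ov[OF t]])
      then have "((\<lambda>t. ?T (y t)) has_vector_derivative dir_deriv ?T (y t) (D t)) (at t within {a..b})"
        unfolding has_vector_derivative_def by (simp add: linear_scale[OF linear_transition[OF c d ov[OF t]]])
      then show ?thesis by (simp add: chart_transition_def o_def)
    qed
    ultimately show ?thesis by blast
  qed
  ultimately show ?thesis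
    unfolding piecewise_C1_curve_def by (intro conjI exI[of _ "{}"]) auto
qed

lemma chart_curve_conn:
  assumes c: "c \<in> A" and img: "y ` {0..1} \<subseteq> chart_image c" and D: "continuous_on {0..1} D"
    and y: "\<And>t. t \<in> {0..1} \<Longrightarrow> (y has_vector_derivative D t) (at t within {0..1})"
  shows "conn (chart_inv c (y 0)) (chart_inv c (y 1)) (integral {0..1} (\<lambda>t. nrm c (y t) (D t)))"
    and "continuous_on {0..1} (\<lambda>t. nrm c (y t) (D t))"
proof -
  let ?\<gamma> = "\<lambda>t. chart_inv c (y t)"
  have eq: "snd c (?\<gamma> t) = y t" if "t \<in> {0..1}" for t
    using img that by (auto simp: image_subset_iff)
  have p: "C1_piece ?\<gamma> c 0 1 D"
    unfolding C1_piece_def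
  proof (intro conjI ballI)
    show "?\<gamma> ` {0..1} \<subseteq> fst c" using img by (auto simp: image_subset_iff)
    fix t :: real assume t: "t \<in> {0..1}"
    show "((\<lambda>t. snd c (?\<gamma> t)) has_vector_derivative D t) (at t within {0..1})"
      by (rule has_vector_derivative_transform[OF t eq y[OF t]])
  qed (use D in auto)
  have "integral {0..1} (\<lambda>t. nrm c (snd c (?\<gamma> t)) (D t)) = integral {0..1} (\<lambda>t. nrm c (y t) (D t))"
    by (rule integral_cong) (simp add: eq)
  then show "conn (chart_inv c (y 0)) (chart_inv c (y 1)) (integral {0..1} (\<lambda>t. nrm c (y t) (D t)))"
    unfolding conn_def using chart_curve_piecewise[OF assms] C1_piece_speed_integral(2)[OF c p] by auto
  show "continuous_on {0..1} (\<lambda>t. nrm c (y t) (D t))"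
    by (rule continuous_on_eq[OF C1_piece_speed_integral(1)[OF c p]]) (simp add: eq)
qed

end

section \<open>Uniform bounds for families of bilinear maps and for the metric\<close>

lemma bilinear_bound_from_axes:
  fixes B :: "'p \<Rightarrow> real^'m \<Rightarrow> real^'l \<Rightarrow> 'b::real_normed_vector"
  assumes bil: "\<And>p. p \<in> P \<Longrightarrow> bilinear (B p)"
    and ax: "\<And>i j. \<exists>C\<ge>0. \<forall>p\<in>P. norm (B p (axis i 1) (axis j 1)) \<le> C * W p"
  shows "\<exists>C\<ge>0. \<forall>p\<in>P. \<forall>v w. norm (B p v w) \<le> C * norm v * norm w * W p"
proof -
  obtain C where C: "\<And>i j. C i j \<ge> 0" "\<And>i j p. p \<in> P \<Longrightarrow> norm (B p (axis i 1) (axis j 1)) \<le> C i j * W p"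
    using ax by metis
  have "norm (B x v w) \<le> (\<Sum>i\<in>UNIV. \<Sum>j\<in>UNIV. C i j) * norm v * norm w * W x" if x: "x \<in> P" for x v w
  proof -
    have "norm (B x v w) \<le> (\<Sum>i\<in>UNIV. \<Sum>j\<in>UNIV. norm ((v $ i * w $ j) *\<^sub>R B x (axis i 1) (axis j 1)))"
      unfolding bilinear_eq_sum[OF bil[OF x], of v w] by (intro order_trans[OF norm_sum] sum_mono norm_sum)
    also have "\<dots> \<le> (\<Sum>i\<in>UNIV. \<Sum>j\<in>UNIV. C i j * (norm v * norm w * W x))"
    proof (intro sum_mono)
      fix i j
      have "\<bar>v $ i\<bar> * \<bar>w $ j\<bar> * norm (B x (axis i 1) (axis j 1)) \<le> norm v * norm w * (C i j * W x)"
        by (intro mult_mono C(2)[OF x] component_le_norm_cart mult_nonneg_nonneg) auto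
      then show "norm ((v $ i * w $ j) *\<^sub>R B x (axis i 1) (axis j 1)) \<le> C i j * (norm v * norm w * W x)"
        by (simp add: abs_mult mult_ac)
    qed
    finally show ?thesis by (simp add: sum_distrib_right mult.assoc)
  qed
  then show ?thesis
    using C(1) by (intro exI[of _ "\<Sum>i\<in>UNIV. \<Sum>j\<in>UNIV. C i j"]) (auto intro!: sum_nonneg)
qed

lemma bilinear_family_bound:
  fixes B :: "'x::topological_space \<Rightarrow> real^'m \<Rightarrow> real^'l \<Rightarrow> 'b::real_normed_vector"
  assumes bil: "\<And>x. x \<in> K \<Longrightarrow> bilinear (B x)" and K: "compact K"
    and cont: "\<And>v w. continuous_on K (\<lambda>x. B x v w)"
  shows "\<exists>C\<ge>0. \<forall>x\<in>K. \<forall>v w. norm (B x v w) \<le> C * norm v * norm w"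
proof -
  have "\<exists>C\<ge>0. \<forall>x\<in>K. norm (B x (axis i 1) (axis j 1)) \<le> C * 1" for i j
    using continuous_on_compact_bound[OF K cont] by simp
  from bilinear_bound_from_axes[OF bil this] show ?thesis by simp
qed

context metric_domain begin

lemma metric_upper_bound:
  assumes "compact K" "K \<subseteq> U"
  shows "\<exists>C\<ge>0. \<forall>x\<in>K. \<forall>v w. \<bar>metric_at H x v w\<bar> \<le> C * norm v * norm w"
  using bilinear_family_bound[of K "metric_at H"] bilinear_metric_at assms
    continuous_on_subset[OF smooth_on_continuous_on[OF smooth_metric] assms(2)] by force

text \<open>The metric attains a positive minimum on the compact set of Euclidean unit vectors over
  \<open>K\<close>; homogeneity extends it to all vectors.\<close>

lemma metric_lower_bound:
  assumes "compact K" "K \<subseteq> U"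
  shows "\<exists>m>0. \<forall>x\<in>K. \<forall>v. m * norm v \<le> sqrt (metric_at H x v v)"
proof (cases "K = {}")
  case True then show ?thesis by (auto intro: exI[of _ 1])
next
  case False
  let ?S = "K \<times> sphere (0::real^'n) 1"
  have ne: "?S \<noteq> {}" using False by (auto intro: exI[of _ "axis _ 1"] simp: norm_axis_1)
  have c: "continuous_on ?S (\<lambda>p. metric_at H (fst p) (snd p) (snd p))"
  proof -
    have G: "continuous_on ?S (\<lambda>p. H (fst p) $ i $ j)" for i j
      by (rule continuous_on_compose2[OF smooth_on_continuous_on[of U "\<lambda>x. H x $ i $ j"]])
        (use assms in \<open>auto intro!: smooth_on_vec_nth open_U smooth_H continuous_intros\<close>)
    show ?thesis
      unfolding metric_at_sum_sum
      by (intro continuous_on_sum continuous_on_mult G continuous_on_component continuous_on_snd continuous_on_id)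
  qed
  obtain p where p: "p \<in> ?S" "\<And>q. q \<in> ?S \<Longrightarrow> metric_at H (fst p) (snd p) (snd p) \<le> metric_at H (fst q) (snd q) (snd q)"
    using continuous_attains_inf[OF compact_Times[OF assms(1) compact_sphere] ne c] by blast
  define m2 where "m2 = metric_at H (fst p) (snd p) (snd p)"
  have m2: "m2 > 0"
    unfolding m2_def by (rule metric_pos) (use p(1) assms(2) in auto)
  have "sqrt m2 * norm v \<le> sqrt (metric_at H x v v)" if x: "x \<in> K" for x v
  proof (cases "v = 0")
    case False
    have "m2 \<le> metric_at H x (v /\<^sub>R norm v) (v /\<^sub>R norm v)"
      using p(2)[of "(x, v /\<^sub>R norm v)"] x False by (simp add: m2_def)
    then have "m2 * (norm v)\<^sup>2 \<le> metric_at H x v v"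
      using False by (simp add: metric_at_simps field_simps power2_eq_square)
    then have "sqrt (m2 * (norm v)\<^sup>2) \<le> sqrt (metric_at H x v v)" by simp
    then show ?thesis by (simp add: real_sqrt_mult)
  qed (simp add: metric_at_simps)
  then show ?thesis using m2 by (intro exI[of _ "sqrt m2"]) auto
qed

end

context riem_mfd begin

section \<open>Reparametrisation and concatenation of curves\<close>

lemma piecewise_iff_pieces:
  "piecewise_C1_curve M A \<gamma> \<longleftrightarrow> pathin M \<gamma> \<and> (\<exists>S. finite S \<and> (\<forall>c\<in>A. \<forall>a b.
     0 \<le> a \<and> a < b \<and> b \<le> 1 \<and> {a<..<b} \<inter> S = {} \<and> \<gamma> ` {a..b} \<subseteq> fst c \<longrightarrow> (\<exists>D. C1_piece \<gamma> c a b D)))"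
  unfolding piecewise_C1_curve_def
  by (intro conj_cong refl ex_cong1 ball_cong iff_allI imp_cong) (simp add: C1_piece_def o_def)

lemma C1_piece_affine:
  assumes p: "C1_piece \<gamma>1 c (m * a + k) (m * b + k) D" and m: "m > 0"
    and eq: "\<And>t. a \<le> t \<Longrightarrow> t \<le> b \<Longrightarrow> \<gamma> t = \<gamma>1 (m * t + k)"
  shows "C1_piece \<gamma> c a b (\<lambda>t. m *\<^sub>R D (m * t + k))"
proof -
  have ab: "a < b" using p m by (auto simp: C1_piece_def)
  have img: "(\<lambda>t. m * t + k) ` {a..b} = {m * a + k..m * b + k}"
    using image_affinity_atLeastAtMost[of m k a b] m ab by auto
  show ?thesis
    unfolding C1_piece_def
  proof (intro conjI ballI ab)
    show "\<gamma> ` {a..b} \<subseteq> fst c"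
      using p eq img unfolding C1_piece_def by (auto simp: image_subset_iff)
    have "continuous_on {a..b} (\<lambda>t. D (m * t + k))"
    proof (rule continuous_on_compose2[of "{m * a + k..m * b + k}" D])
      show "continuous_on {a..b} (\<lambda>t. m * t + k)" by (intro continuous_intros)
    qed (use p img in \<open>simp_all add: C1_piece_def\<close>)
    then show "continuous_on {a..b} (\<lambda>t. m *\<^sub>R D (m * t + k))"
      by (intro continuous_on_scaleR continuous_on_const)
    fix t assume t: "t \<in> {a..b}"
    have 1: "((\<lambda>t. m * t + k) has_vector_derivative m) (at t within {a..b})"
      by (auto intro!: derivative_eq_intros)
    have 2: "((\<lambda>t. snd c (\<gamma>1 t)) has_vector_derivative D (m * t + k)) (at (m * t + k) within (\<lambda>t. m * t + k) ` {a..b})"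
      using p t m unfolding C1_piece_def img by auto
    have "((\<lambda>t. snd c (\<gamma>1 (m * t + k))) has_vector_derivative m *\<^sub>R D (m * t + k)) (at t within {a..b})"
      using vector_diff_chain_within[OF 1 2] by (simp add: o_def)
    then show "((\<lambda>t. snd c (\<gamma> t)) has_vector_derivative m *\<^sub>R D (m * t + k)) (at t within {a..b})"
      by (rule has_vector_derivative_transform[OF t, rotated]) (simp add: eq)
  qed
qed

lemma curve_speed_affine:
  assumes c: "c \<in> A" and p: "C1_piece \<gamma>1 c (m * a + k) (m * b + k) D" and m: "m > 0"
    and eq: "\<And>t. a \<le> t \<Longrightarrow> t \<le> b \<Longrightarrow> \<gamma> t = \<gamma>1 (m * t + k)" and t: "a < t" "t < b"
  shows "curve_speed A g \<gamma> t = m * curve_speed A g \<gamma>1 (m * t + k)"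
proof -
  have "curve_speed A g \<gamma>1 (m * t + k) = nrm c (snd c (\<gamma>1 (m * t + k))) (D (m * t + k))"
    by (rule C1_piece_speed[OF c p]) (use t m in auto)
  moreover have "curve_speed A g \<gamma> t = nrm c (snd c (\<gamma> t)) (m *\<^sub>R D (m * t + k))"
    by (rule C1_piece_speed[OF c C1_piece_affine[OF p m eq] t])
  ultimately show ?thesis
    using t m eq[of t] by (simp add: metric_at_simps real_sqrt_mult)
qed

text \<open>At these parameters the two-sided formula for the speed is available; the finite
  exceptional set is invisible to integrals.\<close>

lemma piece_near:
  assumes "piecewise_C1_curve M A \<gamma>"
  shows "\<exists>S. finite S \<and> (\<forall>t. 0 < t \<and> t < 1 \<and> t \<notin> S \<longrightarrow>
    (\<exists>c\<in>A. \<exists>e>0. \<exists>D. 0 \<le> t - e \<and> t + e \<le> 1 \<and> C1_piece \<gamma> c (t - e) (t + e) D))"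
proof -
  obtain S where path: "pathin M \<gamma>" and S: "finite S" and pS: "\<And>c a b. c \<in> A \<Longrightarrow>
     0 \<le> a \<Longrightarrow> a < b \<Longrightarrow> b \<le> 1 \<Longrightarrow> {a<..<b} \<inter> S = {} \<Longrightarrow> \<gamma> ` {a..b} \<subseteq> fst c \<Longrightarrow> (\<exists>D. C1_piece \<gamma> c a b D)"
    using assms unfolding piecewise_iff_pieces by meson
  have "\<exists>c\<in>A. \<exists>e>0. \<exists>D. 0 \<le> t - e \<and> t + e \<le> 1 \<and> C1_piece \<gamma> c (t - e) (t + e) D"
    if t: "0 < t" "t < 1" "t \<notin> S" for t
  proof -
    obtain c where c: "c \<in> A" "\<gamma> t \<in> fst c"
      using cover[OF pathin_topspace[OF path, of t]] t by auto
    obtain e where e: "e > 0" "\<And>s. 0 \<le> s \<Longrightarrow> s \<le> 1 \<Longrightarrow> \<bar>s - t\<bar> < e \<Longrightarrow> \<gamma> s \<in> fst c"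
      using pathin_nbhd[OF path _ _ dom_open[OF c(1)] c(2)] t by force
    obtain d where d: "d > 0" "\<forall>s\<in>S. s \<noteq> t \<longrightarrow> d \<le> dist t s"
      using finite_set_avoid[OF S] by blast
    define r where "r = min (min (e / 2) (d / 2)) (min t (1 - t))"
    have r: "r > 0" "r \<le> e / 2" "r \<le> d / 2" "r \<le> t" "r \<le> 1 - t"
      using e(1) d(1) t(1,2) unfolding r_def min_def by auto
    have "s \<notin> S" if "s \<in> {t - r<..<t + r}" for s
    proof
      assume "s \<in> S"
      then have "d \<le> dist t s" using d(2) t(3) by metis
      then show False using that r d(1) by (auto simp: dist_real_def)
    qed
    then have "{t - r<..<t + r} \<inter> S = {}" by blast
    moreover have "\<gamma> ` {t - r..t + r} \<subseteq> fst c" using e(1) r by (auto intro!: e(2))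
    ultimately obtain D where "C1_piece \<gamma> c (t - r) (t + r) D"
      using pS[OF c(1), of "t - r" "t + r"] r by auto
    then show ?thesis using c(1) r by (intro bexI[of _ c] exI[of _ r]) auto
  qed
  then show ?thesis using S by blast
qed

text \<open>The slope \<open>2\<close> with the shifts \<open>0\<close> and \<open>- 1\<close>
  describes the two halves of a concatenation. Away from finitely many parameters the chain rule
  doubles the speed while the interval is halved.\<close>

lemma curve_speed_rescale:
  assumes pw: "piecewise_C1_curve M A \<gamma>1" and l: "(curve_speed A g \<gamma>1 has_integral l) {0..1}"
    and eq: "\<And>t. 0 \<le> 2 * t + k \<Longrightarrow> 2 * t + k \<le> 1 \<Longrightarrow> \<gamma> t = \<gamma>1 (2 * t + k)"
  shows "(curve_speed A g \<gamma> has_integral l) {- k / 2..(1 - k) / 2}"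
proof -
  obtain S where S: "finite S" and near: "\<And>t. 0 < t \<Longrightarrow> t < 1 \<Longrightarrow> t \<notin> S \<Longrightarrow>
    (\<exists>c\<in>A. \<exists>e>0. \<exists>D. 0 \<le> t - e \<and> t + e \<le> 1 \<and> C1_piece \<gamma>1 c (t - e) (t + e) D)"
    using piece_near[OF pw] by blast
  have "((\<lambda>x. curve_speed A g \<gamma>1 (2 *\<^sub>R x + k)) has_integral (l /\<^sub>R 2 ^ DIM(real))) (cbox ((0 - k) /\<^sub>R 2) ((1 - k) /\<^sub>R 2))"
    by (rule has_integral_affinity') (use l in auto)
  moreover have "(0 - k) /\<^sub>R 2 = - k / 2" "(1 - k) /\<^sub>R 2 = (1 - k) / 2"
    unfolding real_scaleR_def divide_inverse diff_0 by (rule mult.commute)+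
  moreover have "l /\<^sub>R 2 ^ DIM(real) = l / 2"
    unfolding real_scaleR_def DIM_real power_one_right divide_inverse by (rule mult.commute)
  ultimately have "((\<lambda>x. curve_speed A g \<gamma>1 (2 * x + k)) has_integral l / 2) {- k / 2..(1 - k) / 2}"
    by (simp only: box_real real_scaleR_def)
  from has_integral_mult_right[OF this, of 2]
  have I: "((\<lambda>x. 2 * curve_speed A g \<gamma>1 (2 * x + k)) has_integral l) {- k / 2..(1 - k) / 2}" by simp
  show ?thesis
  proof (rule has_integral_spike_finite[OF _ _ I])
    show "finite ((\<lambda>s. (s - k) / 2) ` (S \<union> {0, 1}))" using S by simp
    fix t assume t: "t \<in> {- k / 2..(1 - k) / 2} - (\<lambda>s. (s - k) / 2) ` (S \<union> {0, 1})"
    have n: "2 * t + k \<notin> S \<union> {0, 1}"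
    proof
      assume "2 * t + k \<in> S \<union> {0, 1}"
      then have "(2 * t + k - k) / 2 \<in> (\<lambda>s. (s - k) / 2) ` (S \<union> {0, 1})" by (rule imageI)
      then show False using t by simp
    qed
    then obtain c e D where c: "c \<in> A" and e: "e > 0" "0 \<le> 2 * t + k - e" "2 * t + k + e \<le> 1"
      and p: "C1_piece \<gamma>1 c (2 * t + k - e) (2 * t + k + e) D"
      using near[of "2 * t + k"] t by auto
    have es: "2 * (t - e / 2) + k = 2 * t + k - e" "2 * (t + e / 2) + k = 2 * t + k + e" by auto
    have p': "C1_piece \<gamma>1 c (2 * (t - e / 2) + k) (2 * (t + e / 2) + k) D" unfolding es by (rule p)
    show "curve_speed A g \<gamma> t = 2 * curve_speed A g \<gamma>1 (2 * t + k)"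
      by (rule curve_speed_affine[OF c p']) (use e in \<open>auto intro!: eq\<close>)
  qed
qed

lemma conn_trans:
  assumes "conn p q l" "conn q r m"
  shows "conn p r (l + m)"
proof -
  obtain \<gamma>1 where 1: "piecewise_C1_curve M A \<gamma>1" "\<gamma>1 0 = p" "\<gamma>1 1 = q" "(curve_speed A g \<gamma>1 has_integral l) {0..1}"
    using assms(1) unfolding conn_def by blast
  obtain \<gamma>2 where 2: "piecewise_C1_curve M A \<gamma>2" "\<gamma>2 0 = q" "\<gamma>2 1 = r" "(curve_speed A g \<gamma>2 has_integral m) {0..1}"
    using assms(2) unfolding conn_def by blast
  define \<gamma> where "\<gamma> t = (if t \<le> 1/2 then \<gamma>1 (2 * t) else \<gamma>2 (2 * t - 1))" for t
  have e1: "\<gamma> t = \<gamma>1 (2 * t + 0)" if "t \<le> 1/2" for t using that by (simp add: \<gamma>_def)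
  have e2: "\<gamma> t = \<gamma>2 (2 * t + - 1)" if "1/2 \<le> t" for t
  proof (cases "t = 1/2")
    case True
    show ?thesis using 1(3) 2(2) unfolding True \<gamma>_def by simp
  qed (use that in \<open>auto simp: \<gamma>_def\<close>)
  obtain S1 where S1: "finite S1" and p1: "\<And>c a b. c \<in> A \<Longrightarrow> 0 \<le> a \<Longrightarrow> a < b \<Longrightarrow> b \<le> 1 \<Longrightarrow>
      {a<..<b} \<inter> S1 = {} \<Longrightarrow> \<gamma>1 ` {a..b} \<subseteq> fst c \<Longrightarrow> (\<exists>D. C1_piece \<gamma>1 c a b D)" and path1: "pathin M \<gamma>1"
    using 1(1) unfolding piecewise_iff_pieces by meson
  obtain S2 where S2: "finite S2" and p2: "\<And>c a b. c \<in> A \<Longrightarrow> 0 \<le> a \<Longrightarrow> a < b \<Longrightarrow> b \<le> 1 \<Longrightarrow>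
      {a<..<b} \<inter> S2 = {} \<Longrightarrow> \<gamma>2 ` {a..b} \<subseteq> fst c \<Longrightarrow> (\<exists>D. C1_piece \<gamma>2 c a b D)" and path2: "pathin M \<gamma>2"
    using 2(1) unfolding piecewise_iff_pieces by meson
  let ?T01 = "top_of_set {0..1::real}"
  have "continuous_map ?T01 M (\<lambda>x. if x \<le> 1/2 then (\<gamma>1 \<circ> (\<lambda>t. 2 * t)) x else (\<gamma>2 \<circ> (\<lambda>t. 2 * t - 1)) x)"
  proof (intro continuous_map_cases_le continuous_map_compose, force, force)
    show "continuous_map (subtopology ?T01 {x \<in> topspace ?T01. x \<le> 1/2}) ?T01 ((*) 2)"
      by (auto simp: continuous_map_in_subtopology continuous_map_from_subtopology)
    have "continuous_map
           (subtopology (top_of_set {0..1}) {x. 0 \<le> x \<and> x \<le> 1 \<and> 1 \<le> x * 2})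
           euclideanreal (\<lambda>t. 2 * t - 1)"
      by (intro continuous_intros) (force intro: continuous_map_from_subtopology)
    then show "continuous_map (subtopology ?T01 {x \<in> topspace ?T01. 1/2 \<le> x}) ?T01 (\<lambda>t. 2 * t - 1)"
      by (force simp: continuous_map_in_subtopology)
    show "(\<gamma>1 \<circ> (*) 2) x = (\<gamma>2 \<circ> (\<lambda>t. 2 * t - 1)) x" if "x \<in> topspace ?T01" "x = 1/2" for x
      using 1(3) 2(2) unfolding that(2) by simp
  qed (use path1 path2 in \<open>auto simp: pathin_def\<close>)
  moreover have "\<gamma> = (\<lambda>x. if x \<le> 1/2 then (\<gamma>1 \<circ> (\<lambda>t. 2 * t)) x else (\<gamma>2 \<circ> (\<lambda>t. 2 * t - 1)) x)"
    by (rule ext) (simp add: \<gamma>_def o_def)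
  ultimately have path: "pathin M \<gamma>"
    unfolding pathin_def by (simp only:)
  \<comment> \<open>The junction \<open>1/2\<close> becomes a break point, as the two velocities
    need not match there.\<close>
  define S where "S = {1/2} \<union> (\<lambda>s. s / 2) ` S1 \<union> (\<lambda>s. (s + 1) / 2) ` S2"
  have pc: "\<exists>D. C1_piece \<gamma> c a b D"
    if c: "c \<in> A" and ab: "0 \<le> a" "a < b" "b \<le> 1" and free: "{a<..<b} \<inter> S = {}" and img: "\<gamma> ` {a..b} \<subseteq> fst c" for c a b
  proof (cases "b \<le> 1/2")
    case True
    have "{2 * a<..<2 * b} \<inter> S1 = {}"
    proof (rule ccontr)
      assume "{2 * a<..<2 * b} \<inter> S1 \<noteq> {}"
      then obtain s where "s \<in> S1" "2 * a < s" "s < 2 * b" by auto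
      then have "s / 2 \<in> {a<..<b} \<inter> S" by (auto simp: S_def)
      then show False using free by blast
    qed
    moreover have "\<gamma>1 ` {2 * a..2 * b} \<subseteq> fst c"
    proof
      fix x assume "x \<in> \<gamma>1 ` {2 * a..2 * b}"
      then obtain t where "2 * a \<le> t" "t \<le> 2 * b" "x = \<gamma>1 t" by auto
      then have "x = \<gamma> (t / 2)" "t / 2 \<in> {a..b}" using True by (auto simp: e1)
      then show "x \<in> fst c" using img by auto
    qed
    ultimately obtain D where "C1_piece \<gamma>1 c (2 * a) (2 * b) D"
      using p1[OF c, of "2 * a" "2 * b"] ab True by auto
    then have pp: "C1_piece \<gamma>1 c (2 * a + 0) (2 * b + 0) D" by simp
    have "C1_piece \<gamma> c a b (\<lambda>t. 2 *\<^sub>R D (2 * t + 0))"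
      by (rule C1_piece_affine[OF pp], simp, rule e1, use True in linarith)
    then show ?thesis by blast
  next
    case False
    have a: "a \<ge> 1/2"
    proof (rule ccontr)
      assume "\<not> a \<ge> 1/2"
      then have "1/2 \<in> {a<..<b} \<inter> S" using False by (auto simp: S_def)
      then show False using free by blast
    qed
    have "{2 * a + - 1<..<2 * b + - 1} \<inter> S2 = {}"
    proof (rule ccontr)
      assume "{2 * a + - 1<..<2 * b + - 1} \<inter> S2 \<noteq> {}"
      then obtain s where "s \<in> S2" "2 * a + - 1 < s" "s < 2 * b + - 1" by auto
      then have "(s + 1) / 2 \<in> {a<..<b} \<inter> S" by (auto simp: S_def)
      then show False using free by blast
    qed
    moreover have "\<gamma>2 ` {2 * a + - 1..2 * b + - 1} \<subseteq> fst c"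
    proof
      fix x assume "x \<in> \<gamma>2 ` {2 * a + - 1..2 * b + - 1}"
      then obtain t where "2 * a + - 1 \<le> t" "t \<le> 2 * b + - 1" "x = \<gamma>2 t" by auto
      then have "x = \<gamma> ((t + 1) / 2)" "(t + 1) / 2 \<in> {a..b}" using a by (auto simp: e2 add_divide_distrib)
      then show "x \<in> fst c" using img by auto
    qed
    ultimately obtain D where pp: "C1_piece \<gamma>2 c (2 * a + - 1) (2 * b + - 1) D"
      using p2[OF c, of "2 * a + - 1" "2 * b + - 1"] ab a by auto
    have "C1_piece \<gamma> c a b (\<lambda>t. 2 *\<^sub>R D (2 * t + - 1))"
      by (rule C1_piece_affine[OF pp], simp, rule e2, use a in linarith)
    then show ?thesis by blast
  qed
  have "piecewise_C1_curve M A \<gamma>"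
    unfolding piecewise_iff_pieces
  proof (intro conjI path exI[of _ S] ballI allI impI)
    show "finite S" using S1 S2 by (simp add: S_def)
    fix c a b
    assume "c \<in> A" "0 \<le> a \<and> a < b \<and> b \<le> 1 \<and> {a<..<b} \<inter> S = {} \<and> \<gamma> ` {a..b} \<subseteq> fst c"
    then show "\<exists>D. C1_piece \<gamma> c a b D" using pc[of c a b] by simp
  qed
  moreover have "(curve_speed A g \<gamma> has_integral l) {- 0 / 2..(1 - 0) / 2}"
    by (rule curve_speed_rescale[OF 1(1,4)]) (rule e1, simp)
  moreover have "(curve_speed A g \<gamma> has_integral m) {- (- 1) / 2..(1 - (- 1)) / 2}"
    by (rule curve_speed_rescale[OF 2(1,4)]) (rule e2, simp)
  ultimately show ?thesis
    unfolding conn_def using has_integral_combine[of 0 "1/2" 1 "curve_speed A g \<gamma>" l m] 1 2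
    by (intro exI[of _ \<gamma>]) (auto simp: \<gamma>_def)
qed

section \<open>Riemannian distance: Lipschitz bound, finiteness and triangle inequality\<close>

lemma segment_conn:
  assumes c: "c \<in> A" and V: "convex V" "V \<subseteq> chart_image c" "y1 \<in> V" "y2 \<in> V"
  shows "conn (chart_inv c y1) (chart_inv c y2) (integral {0..1} (\<lambda>t. nrm c (y1 + t *\<^sub>R (y2 - y1)) (y2 - y1)))"
    and "continuous_on {0..1} (\<lambda>t. nrm c (y1 + t *\<^sub>R (y2 - y1)) (y2 - y1))"
    and "t \<in> {0..1} \<Longrightarrow> y1 + t *\<^sub>R (y2 - y1) \<in> V"
proof -
  have inV: "y1 + t *\<^sub>R (y2 - y1) \<in> V" if "t \<in> {0..1}" for t
  proof -
    have "(1 - t) *\<^sub>R y1 + t *\<^sub>R y2 \<in> V"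
      using V that by (intro convexD) auto
    then show ?thesis by (simp add: algebra_simps)
  qed
  then show "t \<in> {0..1} \<Longrightarrow> y1 + t *\<^sub>R (y2 - y1) \<in> V" .
  have D: "((\<lambda>t. y1 + t *\<^sub>R (y2 - y1)) has_vector_derivative (y2 - y1)) (at t within {0..1})" for t
    by (auto intro!: derivative_eq_intros)
  show "conn (chart_inv c y1) (chart_inv c y2) (integral {0..1} (\<lambda>t. nrm c (y1 + t *\<^sub>R (y2 - y1)) (y2 - y1)))"
    "continuous_on {0..1} (\<lambda>t. nrm c (y1 + t *\<^sub>R (y2 - y1)) (y2 - y1))"
    using chart_curve_conn[OF c _ continuous_on_const[of _ "y2 - y1"] D] inV V(2) by (force simp: image_subset_iff)+
qed

lemma riem_dist_refl_le:
  assumes "p \<in> topspace M" shows "riem_dist M A g p p \<le> 0"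
proof -
  obtain c where c: "c \<in> A" "p \<in> fst c" using cover assms by blast
  have "conn (chart_inv c (snd c p)) (chart_inv c (snd c p)) (integral {0..1} (\<lambda>t. nrm c (snd c p + t *\<^sub>R (snd c p - snd c p)) (snd c p - snd c p)))"
    by (rule segment_conn(1)[OF c(1), of "{snd c p}"]) (use c in auto)
  then have "conn p p 0" using c by (simp add: metric_at_simps)
  then show ?thesis by (rule riem_dist_le)
qed

text \<open>Coordinate segments stay in the convex set, and their length is controlled by an upper
  bound of the metric. This later converts a discrepancy of coordinates into a distance.\<close>

lemma riem_dist_lipschitz:
  assumes c: "c \<in> A" and V: "convex V" "compact V" "V \<subseteq> chart_image c"
  shows "\<exists>C\<ge>0. \<forall>y1\<in>V. \<forall>y2\<in>V. riem_dist M A g (chart_inv c y1) (chart_inv c y2) \<le> C * norm (y2 - y1)"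
proof -
  interpret C: metric_domain "chart_image c" "g c" by (rule metric_domain[OF c])
  obtain K where K: "K \<ge> 0" "\<And>x v w. x \<in> V \<Longrightarrow> \<bar>metric_at (g c) x v w\<bar> \<le> K * norm v * norm w"
    using C.metric_upper_bound[OF V(2,3)] by blast
  have "riem_dist M A g (chart_inv c y1) (chart_inv c y2) \<le> sqrt K * norm (y2 - y1)" if y: "y1 \<in> V" "y2 \<in> V" for y1 y2
  proof -
    note seg = segment_conn[OF c V(1,3) y]
    have "integral {0..1} (\<lambda>t. nrm c (y1 + t *\<^sub>R (y2 - y1)) (y2 - y1)) \<le> integral {0..1} (\<lambda>t::real. sqrt K * norm (y2 - y1))"
    proof (rule integral_le)
      fix t :: real assume t: "t \<in> {0..1}"
      have "metric_at (g c) (y1 + t *\<^sub>R (y2 - y1)) (y2 - y1) (y2 - y1) \<le> K * norm (y2 - y1) * norm (y2 - y1)"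
        using K(2)[OF seg(3)[OF t], of "y2 - y1" "y2 - y1"] by simp
      then have "nrm c (y1 + t *\<^sub>R (y2 - y1)) (y2 - y1) \<le> sqrt (K * norm (y2 - y1) * norm (y2 - y1))" by simp
      then show "nrm c (y1 + t *\<^sub>R (y2 - y1)) (y2 - y1) \<le> sqrt K * norm (y2 - y1)"
        by (simp add: real_sqrt_mult mult.assoc)
    qed (use integrable_continuous_real[OF seg(2)] in auto)
    then show ?thesis using riem_dist_le[OF seg(1)] by simp
  qed
  then show ?thesis using K(1) by (intro exI[of _ "sqrt K"]) auto
qed

text \<open>The points reachable from \<open>p\<close> form a set that is open and closed. Segments
  in a coordinate ball are supplied in both directions, which spares the reversal of curves. Without
  a connecting curve the infimum in \<open>riem_dist\<close> would be taken over the empty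
  set.\<close>

lemma conn_exists:
  assumes conn: "connected_space M" and p: "p \<in> topspace M" and q: "q \<in> topspace M"
  shows "\<exists>l. conn p q l"
proof -
  let ?R = "{q \<in> topspace M. \<exists>l. conn p q l}"
  have near: "\<exists>T. openin M T \<and> q \<in> T \<and> (\<forall>q'\<in>T. (\<exists>l. conn q q' l) \<and> (\<exists>l. conn q' q l))" if q: "q \<in> topspace M" for q
  proof -
    obtain c where c: "c \<in> A" "q \<in> fst c" using cover q by blast
    obtain r where r: "r > 0" "ball (snd c q) r \<subseteq> chart_image c"
      using open_chart_image[OF c(1)] chart_in_image[OF c(2)] openE by blast
    let ?T = "{q' \<in> fst c. snd c q' \<in> ball (snd c q) r}"
    have "(\<exists>l. conn q q' l) \<and> (\<exists>l. conn q' q l)" if "q' \<in> ?T" for q'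
      using segment_conn(1)[OF c(1) convex_ball r(2), of "snd c q" "snd c q'"]
        segment_conn(1)[OF c(1) convex_ball r(2), of "snd c q'" "snd c q"] that r(1) c by auto
    then show ?thesis
      using chart_preimage_open[OF c(1) open_ball] c(2) r(1) by (intro exI[of _ ?T]) auto
  qed
  have "openin M ?R"
    unfolding openin_subopen[of M ?R]
  proof
    fix q assume q: "q \<in> ?R"
    then obtain k where k: "conn p q k" by auto
    obtain T where T: "openin M T" "q \<in> T" "\<And>q'. q' \<in> T \<Longrightarrow> \<exists>l. conn q q' l"
      using near[of q] q by auto
    have "T \<subseteq> ?R"
    proof
      fix q' assume q': "q' \<in> T"
      obtain l where "conn q q' l" using T(3)[OF q'] ..
      from conn_trans[OF k this] show "q' \<in> ?R" using openin_subset[OF T(1)] q' by auto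
    qed
    with T(1,2) show "\<exists>T. openin M T \<and> q \<in> T \<and> T \<subseteq> ?R" by (intro exI[of _ T] conjI)
  qed
  moreover have "openin M (topspace M - ?R)"
    unfolding openin_subopen[of M "topspace M - ?R"]
  proof
    fix q assume q: "q \<in> topspace M - ?R"
    obtain T where T: "openin M T" "q \<in> T" "\<And>q'. q' \<in> T \<Longrightarrow> \<exists>l. conn q' q l"
      using near[of q] q by auto
    have "T \<subseteq> topspace M - ?R"
    proof
      fix q' assume q': "q' \<in> T"
      obtain l where l: "conn q' q l" using T(3)[OF q'] ..
      have "\<not> conn p q' k" for k
        using conn_trans[OF _ l, of p k] q by auto
      then show "q' \<in> topspace M - ?R" using openin_subset[OF T(1)] q' by auto
    qed
    with T(1,2) show "\<exists>T'. openin M T' \<and> q \<in> T' \<and> T' \<subseteq> topspace M - ?R" by (intro exI[of _ T] conjI)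
  qed
  then have "closedin M ?R" by (auto simp: closedin_def)
  moreover have "p \<in> ?R" using near[OF p] p by blast
  ultimately have "?R = topspace M"
    using conn unfolding connected_space_clopen_in by blast
  then show ?thesis using q by blast
qed

lemma riem_dist_approx:
  assumes "connected_space M" "p \<in> topspace M" "q \<in> topspace M" "e > 0"
  shows "\<exists>l. conn p q l \<and> l < riem_dist M A g p q + e"
proof -
  have "Inf {l. conn p q l} < riem_dist M A g p q + e"
    using assms(4) by (simp add: riem_dist_conn)
  then show ?thesis
    using cInf_lessD[of "{l. conn p q l}"] conn_exists[OF assms(1-3)] by blast
qed

lemma riem_dist_triangle:
  assumes M: "connected_space M" and p: "p \<in> topspace M" and q: "q \<in> topspace M" and r: "r \<in> topspace M"
  shows "riem_dist M A g p r \<le> riem_dist M A g p q + riem_dist M A g q r"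
proof (rule field_le_epsilon)
  fix e :: real assume "e > 0"
  then obtain l m where "conn p q l" "l < riem_dist M A g p q + e / 2" "conn q r m" "m < riem_dist M A g q r + e / 2"
    using riem_dist_approx[OF M p q, of "e / 2"] riem_dist_approx[OF M q r, of "e / 2"] by auto
  then show "riem_dist M A g p r \<le> riem_dist M A g p q + riem_dist M A g q r + e"
    using riem_dist_le[OF conn_trans] by fastforce
qed

end

section \<open>A linear differential equation\<close>

text \<open>Picard iteration: \<open>L * (b - a) \<le> 1 / 2\<close> makes the integral operator a
  contraction with factor 1/2. Short intervals suffice because parallel frames are continued step by
  step.\<close>

lemma linear_ode_short:
  fixes A :: "real \<Rightarrow> real^'n \<Rightarrow> real^'n"
  assumes ab: "a \<le> b" and lin: "\<And>t. t \<in> {a..b} \<Longrightarrow> linear (A t)"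
    and cont: "\<And>v. continuous_on {a..b} (\<lambda>t. A t v)"
    and bound: "\<And>t v. t \<in> {a..b} \<Longrightarrow> norm (A t v) \<le> L * norm v"
    and short: "L * (b - a) \<le> 1 / 2" and L: "L \<ge> 0"
  shows "\<exists>e. e a = e0 \<and> (\<forall>t\<in>{a..b}. (e has_vector_derivative A t (e t)) (at t within {a..b}))"
proof -
  have contA: "continuous_on {a..b} (\<lambda>t. A t (e t))" if e: "continuous_on {a..b} e" for e
  proof -
    have "continuous_on {a..b} (\<lambda>t. \<Sum>i\<in>UNIV. e t $ i *\<^sub>R A t (axis i 1))"
      by (intro continuous_on_sum continuous_on_scaleR continuous_on_component e cont)
    then show ?thesis
    proof (rule continuous_on_eq)
      fix t assume t: "t \<in> {a..b}"
      have "A t (e t) = A t (\<Sum>i\<in>UNIV. e t $ i *\<^sub>R axis i 1)" using vec_eq_sum_axis[of "e t"] by simp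
      also have "\<dots> = (\<Sum>i\<in>UNIV. e t $ i *\<^sub>R A t (axis i 1))"
        using lin[OF t] by (simp add: linear_sum linear_scale)
      finally show "(\<Sum>i\<in>UNIV. e t $ i *\<^sub>R A t (axis i 1)) = A t (e t)" by simp
    qed
  qed
  \<comment> \<open>Bounded continuous functions live on the whole line; clamping the time to the
    interval extends the integral operator to them.\<close>
  define cl where "cl t = max a (min b t)" for t
  have cl: "cl t \<in> {a..b}" for t using ab by (auto simp: cl_def)
  have cl_id: "cl t = t" if "t \<in> {a..b}" for t using that by (auto simp: cl_def)
  have cl_cont: "continuous_on UNIV cl" unfolding cl_def by (intro continuous_intros)
  define J where "J e t = e0 + integral {a..t} (\<lambda>u. A u (e u))" for e :: "real \<Rightarrow> real^'n" and t
  have J_cont: "continuous_on {a..b} (J e)" if "continuous_on {a..b} e" for e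
    unfolding J_def
    by (intro continuous_on_add continuous_on_const indefinite_integral_continuous_1
        integrable_continuous_real contA that)
  have inB: "(\<lambda>t. J e (cl t)) \<in> bcontfun" if e: "continuous_on {a..b} e" for e
  proof -
    have "continuous_on UNIV (\<lambda>t. J e (cl t))"
      by (rule continuous_on_compose2[OF J_cont[OF e] cl_cont]) (use cl in auto)
    moreover have "bounded (J e ` {a..b})"
      by (intro compact_imp_bounded compact_continuous_image J_cont e) auto
    then have "bounded (range (\<lambda>t. J e (cl t)))"
      by (rule bounded_subset) (use cl in auto)
    ultimately show ?thesis by (simp add: bcontfun_def)
  qed
  define T where "T e = Bcontfun (\<lambda>t. J (apply_bcontfun e) (cl t))" for e :: "real \<Rightarrow>\<^sub>C (real^'n)"
  have ec: "continuous_on S (apply_bcontfun e)" for S and e :: "real \<Rightarrow>\<^sub>C (real^'n)"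
    by (rule continuous_on_subset[of UNIV]) auto
  have T: "apply_bcontfun (T e) t = J (apply_bcontfun e) (cl t)" for e t
    unfolding T_def using Bcontfun_inverse[OF inB[OF ec]] by simp
  have "dist (T e) (T e') \<le> (1 / 2) * dist e e'" for e e'
  proof (rule dist_bound)
    fix t
    have i: "(\<lambda>u. A u (apply_bcontfun e u)) integrable_on {a..cl t}" for e :: "real \<Rightarrow>\<^sub>C (real^'n)"
      by (intro integrable_continuous_real continuous_on_subset[OF contA[OF ec]]) (use cl[of t] in auto)
    have "J (apply_bcontfun e) (cl t) - J (apply_bcontfun e') (cl t)
        = integral {a..cl t} (\<lambda>u. A u (apply_bcontfun e u) - A u (apply_bcontfun e' u))"
      unfolding J_def using integral_diff[OF i i, of e e'] by simp
    also have "norm \<dots> \<le> (L * dist e e') * (cl t - a)"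
    proof (rule integral_bound)
      show "a \<le> cl t" using cl[of t] by auto
      show "continuous_on {a..cl t} (\<lambda>u. A u (apply_bcontfun e u) - A u (apply_bcontfun e' u))"
        by (intro continuous_on_diff continuous_on_subset[OF contA[OF ec]]) (use cl[of t] in auto)
      fix u assume "u \<in> {a..cl t}"
      then have u: "u \<in> {a..b}" using cl[of t] by auto
      have "norm (A u (apply_bcontfun e u - apply_bcontfun e' u)) \<le> L * norm (apply_bcontfun e u - apply_bcontfun e' u)"
        by (rule bound[OF u])
      also have "\<dots> \<le> L * dist e e'"
        using dist_bounded[of e u e'] L by (intro mult_left_mono) (auto simp: dist_norm)
      finally show "norm (A u (apply_bcontfun e u) - A u (apply_bcontfun e' u)) \<le> L * dist e e'"
        by (simp add: linear_diff[OF lin[OF u]])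
    qed
    also have "\<dots> \<le> (L * dist e e') * (b - a)"
      using cl[of t] L by (intro mult_left_mono) auto
    also have "\<dots> = (L * (b - a)) * dist e e'" by simp
    also have "\<dots> \<le> (1 / 2) * dist e e'" by (rule mult_right_mono[OF short]) auto
    finally show "dist (apply_bcontfun (T e) t) (apply_bcontfun (T e') t) \<le> (1 / 2) * dist e e'"
      by (simp add: T dist_norm)
  qed
  then have "\<exists>!e. T e = e"
    by (intro banach_fix_type[of "1/2"]) auto
  then obtain e where e: "T e = e" by blast
  have eq: "apply_bcontfun e t = J (apply_bcontfun e) t" if "t \<in> {a..b}" for t
    using T[of e t] cl_id[OF that] by (simp add: e)
  have JD: "((\<lambda>t. J (apply_bcontfun e) t) has_vector_derivative A t (apply_bcontfun e t)) (at t within {a..b})"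
    if "t \<in> {a..b}" for t
  proof -
    have "((\<lambda>t. e0 + integral {a..t} (\<lambda>u. A u (apply_bcontfun e u))) has_vector_derivative 0 + A t (apply_bcontfun e t)) (at t within {a..b})"
      by (intro has_vector_derivative_add has_vector_derivative_const integral_has_vector_derivative contA ec that)
    then show ?thesis by (simp add: J_def)
  qed
  have "(apply_bcontfun e has_vector_derivative A t (apply_bcontfun e t)) (at t within {a..b})"
    if "t \<in> {a..b}" for t
    by (rule has_vector_derivative_transform[OF that eq JD[OF that]])
  moreover have "apply_bcontfun e a = e0" using eq[of a] ab by (simp add: J_def)
  ultimately show ?thesis by blast
qed

section \<open>Lengths of families of curves and short curves\<close>

context riem_mfd begin

lemma nrm_scaleR:
  assumes "m \<ge> 0" shows "nrm c x (m *\<^sub>R v) = m * nrm c x v"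
proof -
  have "metric_at (g c) x (m *\<^sub>R v) (m *\<^sub>R v) = m\<^sup>2 * metric_at (g c) x v v"
    by (simp add: metric_at_simps power2_eq_square)
  then show ?thesis using assms by (simp add: real_sqrt_mult)
qed

text \<open>Only the sum of the speeds obeys the wanted bound, since first order terms cancel
  between opposite curves. The sum is therefore compared with \<open>B'\<close> pointwise, before
  any integration.\<close>

lemma dist_family_le:
  fixes y D :: "'i \<Rightarrow> real \<Rightarrow> real^'n"
  assumes c: "c \<in> A" and fin: "finite I" and ab: "a < b"
    and img: "\<And>i t. i \<in> I \<Longrightarrow> t \<in> {a..b} \<Longrightarrow> y i t \<in> chart_image c"
    and D: "\<And>i. i \<in> I \<Longrightarrow> continuous_on {a..b} (D i)"
    and y: "\<And>i t. i \<in> I \<Longrightarrow> t \<in> {a..b} \<Longrightarrow> (y i has_vector_derivative D i t) (at t within {a..b})"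
    and B: "\<And>t. t \<in> {a..b} \<Longrightarrow> (B has_vector_derivative B' t) (at t within {a..b})"
    and le: "\<And>t. t \<in> {a..b} \<Longrightarrow> (\<Sum>i\<in>I. nrm c (y i t) (D i t)) \<le> B' t"
  shows "(\<Sum>i\<in>I. riem_dist M A g (chart_inv c (y i a)) (chart_inv c (y i b))) \<le> B b - B a"
proof -
  define m where "m = b - a"
  have m: "m > 0" using ab by (simp add: m_def)
  define h where "h t = m * t + a" for t
  have h: "h t \<in> {a..b}" if "t \<in> {0..1}" for t
  proof -
    have "m * t \<le> m * 1" "0 \<le> m * t" using that m by (auto intro!: mult_left_mono mult_nonneg_nonneg)
    then show ?thesis unfolding h_def atLeastAtMost_iff using m_def by linarith
  qed
  have himg: "h ` {0..1} = {a..b}"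
    unfolding h_def using image_affinity_atLeastAtMost[of m a 0 1] m ab by (auto simp: m_def)
  have hd: "(h has_vector_derivative m) (at t within {0..1})" for t
    unfolding h_def by (auto intro!: derivative_eq_intros)
  have hc: "continuous_on {0..1} h" unfolding h_def by (intro continuous_intros)
  have chain: "((\<lambda>t. k (h t)) has_vector_derivative m *\<^sub>R k' (h t)) (at t within {0..1})"
    if "\<And>t. t \<in> {a..b} \<Longrightarrow> (k has_vector_derivative k' t) (at t within {a..b})" "t \<in> {0..1}"
    for k k' :: "real \<Rightarrow> 'v::real_normed_vector" and t
    using vector_diff_chain_within[OF hd[of t], of k "k' (h t)"] that(1)[OF h[OF that(2)]] by (simp add: himg o_def)
  have conn: "conn (chart_inv c (y i a)) (chart_inv c (y i b)) (integral {0..1} (\<lambda>t. nrm c (y i (h t)) (m *\<^sub>R D i (h t))))"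
    and cont: "continuous_on {0..1} (\<lambda>t. nrm c (y i (h t)) (m *\<^sub>R D i (h t)))" if i: "i \<in> I" for i
  proof -
    have 1: "(\<lambda>t. y i (h t)) ` {0..1} \<subseteq> chart_image c" using img[OF i] h by auto
    have 2: "continuous_on {0..1} (\<lambda>t. m *\<^sub>R D i (h t))"
      by (intro continuous_on_scaleR continuous_on_const continuous_on_compose2[OF D[OF i] hc]) (use himg in auto)
    note cc = chart_curve_conn[OF c 1 2 chain[OF y[OF i]]]
    show "conn (chart_inv c (y i a)) (chart_inv c (y i b)) (integral {0..1} (\<lambda>t. nrm c (y i (h t)) (m *\<^sub>R D i (h t))))"
      using cc(1) by (simp add: h_def m_def)
    show "continuous_on {0..1} (\<lambda>t. nrm c (y i (h t)) (m *\<^sub>R D i (h t)))" by (rule cc(2))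
  qed
  have "(\<Sum>i\<in>I. riem_dist M A g (chart_inv c (y i a)) (chart_inv c (y i b)))
      \<le> (\<Sum>i\<in>I. integral {0..1} (\<lambda>t. nrm c (y i (h t)) (m *\<^sub>R D i (h t))))"
    by (intro sum_mono riem_dist_le conn)
  also have "\<dots> \<le> B b - B a"
  proof (rule has_integral_le)
    show "((\<lambda>t. \<Sum>i\<in>I. nrm c (y i (h t)) (m *\<^sub>R D i (h t))) has_integral
        (\<Sum>i\<in>I. integral {0..1} (\<lambda>t. nrm c (y i (h t)) (m *\<^sub>R D i (h t))))) {0..1}"
      by (intro has_integral_sum fin integrable_integral integrable_continuous_real cont)
    have "((\<lambda>t. m *\<^sub>R B' (h t)) has_integral (B (h 1) - B (h 0))) {0..1}"
      by (rule fundamental_theorem_of_calculus) (use chain[OF B] in auto)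
    then show "((\<lambda>t. m *\<^sub>R B' (h t)) has_integral (B b - B a)) {0..1}" by (simp add: h_def m_def)
    fix t :: real assume t: "t \<in> {0..1}"
    have "(\<Sum>i\<in>I. nrm c (y i (h t)) (m *\<^sub>R D i (h t))) = m * (\<Sum>i\<in>I. nrm c (y i (h t)) (D i (h t)))"
      using m by (simp add: nrm_scaleR sum_distrib_left)
    also have "\<dots> \<le> m *\<^sub>R B' (h t)" using le[OF h[OF t]] m by simp
    finally show "(\<Sum>i\<in>I. nrm c (y i (h t)) (m *\<^sub>R D i (h t))) \<le> m *\<^sub>R B' (h t)" .
  qed
  finally show ?thesis .
qed

section \<open>Short curves stay in coordinate balls\<close>

lemma C1_piece_subinterval:
  assumes "C1_piece \<gamma> c a b D" "a \<le> s" "s < t" "t \<le> b"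
  shows "C1_piece \<gamma> c s t D"
proof -
  have "{s..t} \<subseteq> {a..b}" using assms by auto
  then show ?thesis
    using assms has_vector_derivative_within_subset[of _ _ _ "{a..b}" "{s..t}"] continuous_on_subset[of "{a..b}" D "{s..t}"]
    unfolding C1_piece_def by (meson image_mono subset_iff subset_trans)
qed

text \<open>Integrates the comparison of the Euclidean norm with the metric over the pieces, and so
  turns a bound on the length into a bound on coordinates.\<close>

lemma displacement_le_length:
  assumes pw: "piecewise_C1_curve M A \<gamma>" and c: "c \<in> A" and K: "K \<subseteq> chart_image c"
    and m: "m \<ge> 0" "\<And>x v. x \<in> K \<Longrightarrow> m * norm v \<le> nrm c x v"
    and ab: "0 \<le> a" "a \<le> b" "b \<le> 1" and dom: "\<And>t. t \<in> {a..b} \<Longrightarrow> \<gamma> t \<in> fst c \<and> snd c (\<gamma> t) \<in> K"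
  shows "m * norm (snd c (\<gamma> b) - snd c (\<gamma> a)) \<le> integral {a..b} (curve_speed A g \<gamma>)"
proof -
  define Q where "Q s t \<longleftrightarrow> (a \<le> s \<and> t \<le> b \<longrightarrow> m * norm (snd c (\<gamma> t) - snd c (\<gamma> s)) \<le> integral {s..t} (curve_speed A g \<gamma>))" for s t
  have "Q a b"
  proof (rule piecewise_chart_induct[OF pw c ab])
    show "\<gamma> ` {a..b} \<subseteq> fst c" using dom by auto
    show "Q t t" for t by (simp add: Q_def)
    show "Q s u" if "s \<le> t" "t \<le> u" "Q s t" "Q t u" for s t u
      unfolding Q_def
    proof
      assume su: "a \<le> s \<and> u \<le> b"
      have "curve_speed A g \<gamma> integrable_on {s..u}"
        by (rule curve_speed_integrable[OF pw]) (use su that ab in auto)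
      then have "integral {s..u} (curve_speed A g \<gamma>) = integral {s..t} (curve_speed A g \<gamma>) + integral {t..u} (curve_speed A g \<gamma>)"
        using Henstock_Kurzweil_Integration.integral_combine[OF that(1,2)] by metis
      moreover have "m * norm (snd c (\<gamma> t) - snd c (\<gamma> s)) \<le> integral {s..t} (curve_speed A g \<gamma>)"
        "m * norm (snd c (\<gamma> u) - snd c (\<gamma> t)) \<le> integral {t..u} (curve_speed A g \<gamma>)"
        using that su unfolding Q_def by auto
      moreover have "m * norm (snd c (\<gamma> u) - snd c (\<gamma> s))
          \<le> m * norm (snd c (\<gamma> t) - snd c (\<gamma> s)) + m * norm (snd c (\<gamma> u) - snd c (\<gamma> t))"
        using norm_triangle_ineq[of "snd c (\<gamma> t) - snd c (\<gamma> s)" "snd c (\<gamma> u) - snd c (\<gamma> t)"] m(1)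
        by (simp add: distrib_left[symmetric] mult_left_mono)
      ultimately show "m * norm (snd c (\<gamma> u) - snd c (\<gamma> s)) \<le> integral {s..u} (curve_speed A g \<gamma>)"
        by linarith
    qed
    show "Q s t" if st: "a \<le> s" "s < t" "t \<le> b" and p: "C1_piece \<gamma> c s t D" for s t D
    proof -
      note sp = C1_piece_speed_integral[OF c p]
      have "(D has_integral (snd c (\<gamma> t) - snd c (\<gamma> s))) {s..t}"
        by (rule fundamental_theorem_of_calculus) (use p st in \<open>auto simp: C1_piece_def\<close>)
      then have I: "((\<lambda>u. m *\<^sub>R D u) has_integral m *\<^sub>R (snd c (\<gamma> t) - snd c (\<gamma> s))) {s..t}"
        by (rule has_integral_cmul)
      have "norm (integral {s..t} (\<lambda>u. m *\<^sub>R D u)) \<le> integral {s..t} (\<lambda>u. nrm c (snd c (\<gamma> u)) (D u))"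
      proof (rule integral_norm_bound_integral[OF has_integral_integrable[OF I] integrable_continuous_real[OF sp(1)]])
        fix u assume "u \<in> {s..t}"
        then have "m * norm (D u) \<le> nrm c (snd c (\<gamma> u)) (D u)"
          by (intro m(2)) (use dom[of u] st in auto)
        then show "norm (m *\<^sub>R D u) \<le> nrm c (snd c (\<gamma> u)) (D u)" using m(1) by simp
      qed
      then have "norm (m *\<^sub>R (snd c (\<gamma> t) - snd c (\<gamma> s))) \<le> integral {s..t} (\<lambda>u. nrm c (snd c (\<gamma> u)) (D u))"
        unfolding integral_unique[OF I] .
      then show "Q s t" using m(1) integral_unique[OF sp(2)] by (simp add: Q_def)
    qed
  qed
  then show ?thesis by (simp add: Q_def)
qed

text \<open>Compactness and the Hausdorff property make the ball closed in \<open>M\<close>, not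
  just in the chart domain. A curve starting inside thus cannot leave the chart domain without
  crossing the boundary sphere.\<close>

lemma closedin_chart_cball:
  assumes c: "c \<in> A" and "cball z r \<subseteq> chart_image c"
  shows "closedin M {p \<in> fst c. snd c p \<in> cball z r}"
proof -
  have "compactin (top_of_set (chart_image c)) (cball z r)"
    using assms(2) by (simp add: compactin_subtopology)
  then have "compactin M (chart_inv c ` cball z r)"
    by (rule image_compactin[OF _ continuous_map_chart_inv[OF c]])
  then have "closedin M (chart_inv c ` cball z r)"
    by (rule compactin_imp_closedin[OF hausdorff])
  moreover have "chart_inv c ` cball z r = {p \<in> fst c. snd c p \<in> cball z r}"
  proof (intro Set.set_eqI iffI)
    fix p assume "p \<in> chart_inv c ` cball z r"
    then obtain y where "y \<in> cball z r" "p = chart_inv c y" by blast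
    then show "p \<in> {p \<in> fst c. snd c p \<in> cball z r}" using assms(2) by (auto simp: subset_iff)
  next
    fix p assume "p \<in> {p \<in> fst c. snd c p \<in> cball z r}"
    then have "p = chart_inv c (snd c p)" "snd c p \<in> cball z r" using c by auto
    then show "p \<in> chart_inv c ` cball z r" by (rule image_eqI)
  qed
  ultimately show ?thesis by simp
qed

text \<open>A continuation argument: while the curve stays in the open set \<open>G\<close>, its
  displacement is at most \<open>r\<close>, which keeps it in the smaller closed set
  \<open>C\<close>. Were \<open>\<gamma> x\<close> outside \<open>G\<close>, a whole neighbourhood
  of \<open>x\<close> would miss \<open>C\<close>, and no initial segment reaching that
  neighbourhood could lie in \<open>G\<close>.\<close>

lemma short_curve_in_ball:
  assumes pw: "piecewise_C1_curve M A \<gamma>" and c: "c \<in> A" and r: "cball z (2 * r) \<subseteq> chart_image c"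
    and m: "m > 0" "\<And>x v. x \<in> cball z (2 * r) \<Longrightarrow> m * norm v \<le> nrm c x v"
    and ab: "0 \<le> a" "a \<le> b" "b \<le> 1" and start: "\<gamma> a \<in> fst c" "snd c (\<gamma> a) \<in> ball z r"
    and short: "integral {a..b} (curve_speed A g \<gamma>) \<le> m * r"
  shows "\<And>t. t \<in> {a..b} \<Longrightarrow> \<gamma> t \<in> fst c \<and> snd c (\<gamma> t) \<in> ball z (2 * r)"
proof -
  have path: "pathin M \<gamma>" using pw by (simp add: piecewise_C1_curve_def)
  define G where "G = {p \<in> fst c. snd c p \<in> ball z (2 * r)}"
  \<comment> \<open>Smaller than \<open>2 * r\<close> because the starting point lies in the open
    ball of radius \<open>r\<close>.\<close>
  define \<rho> where "\<rho> = dist z (snd c (\<gamma> a)) + r"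
  define C where "C = {p \<in> fst c. snd c p \<in> cball z \<rho>}"
  have \<rho>: "\<rho> < 2 * r" using start(2) by (simp add: \<rho>_def)
  have opG: "openin M G" unfolding G_def by (rule chart_preimage_open[OF c open_ball])
  have "closedin M C" unfolding C_def
    by (rule closedin_chart_cball[OF c]) (use \<rho> r in \<open>auto simp: subset_iff\<close>)
  then have opC: "openin M (topspace M - C)" by (simp add: closedin_def)
  have CG: "C \<subseteq> G" using \<rho> by (auto simp: C_def G_def)
  have stay: "\<gamma> s \<in> C" if s: "a \<le> s" "s \<le> b" and sub: "\<gamma> ` {a..s} \<subseteq> G" for s
  proof -
    have "m * norm (snd c (\<gamma> s) - snd c (\<gamma> a)) \<le> integral {a..s} (curve_speed A g \<gamma>)"
      by (rule displacement_le_length[OF pw c r less_imp_le[OF m(1)] m(2)])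
        (use s ab sub in \<open>auto simp: G_def image_subset_iff intro: less_imp_le\<close>)
    also have "\<dots> \<le> integral {a..b} (curve_speed A g \<gamma>)"
      by (rule integral_subset_le)
        (use s ab curve_speed_integrable[OF pw] curve_speed_nonneg[OF pathin_topspace[OF path]] in auto)
    also have "\<dots> \<le> m * r" by (rule short)
    finally have "norm (snd c (\<gamma> s) - snd c (\<gamma> a)) \<le> r" using m(1) by simp
    then have "dist z (snd c (\<gamma> s)) \<le> \<rho>"
      using dist_triangle[of z "snd c (\<gamma> s)" "snd c (\<gamma> a)"] unfolding \<rho>_def
      by (simp add: dist_norm[of "snd c (\<gamma> a)"] norm_minus_commute)
    then show ?thesis using sub s by (auto simp: C_def G_def image_subset_iff)
  qed
  \<comment> \<open>As an implication between initial segments the property composes over adjacent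
    intervals, which bisection demands.\<close>
  define P where "P s t \<longleftrightarrow> (a \<le> s \<and> t \<le> b \<longrightarrow> \<gamma> ` {a..s} \<subseteq> G \<longrightarrow> \<gamma> ` {a..t} \<subseteq> G)" for s t
  have "P a b"
  proof (rule Bolzano[OF ab(2)])
    show "P s u" if "P s t" "P t u" "s \<le> t" "t \<le> u" for s t u
      using that unfolding P_def by simp
    fix x assume x: "a \<le> x" "x \<le> b"
    then have x01: "0 \<le> x" "x \<le> 1" using ab by auto
    show "\<exists>d>0. \<forall>s t. s \<le> x \<and> x \<le> t \<and> t - s < d \<longrightarrow> P s t"
    proof (cases "\<gamma> x \<in> G")
      case True
      obtain e where e: "e > 0" "\<And>s. 0 \<le> s \<Longrightarrow> s \<le> 1 \<Longrightarrow> \<bar>s - x\<bar> < e \<Longrightarrow> \<gamma> s \<in> G"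
        using pathin_nbhd[OF path x01 opG True] by auto
      have "P s t" if st: "s \<le> x" "x \<le> t" "t - s < e" for s t
        unfolding P_def
      proof (intro impI subsetI)
        fix q assume as: "a \<le> s \<and> t \<le> b" and sub: "\<gamma> ` {a..s} \<subseteq> G" and "q \<in> \<gamma> ` {a..t}"
        then obtain u where u: "a \<le> u" "u \<le> t" "q = \<gamma> u" by auto
        show "q \<in> G"
        proof (cases "u \<le> s")
          case False
          then show ?thesis unfolding u(3) by (intro e(2)) (use st as u ab in auto)
        qed (use sub u in auto)
      qed
      then show ?thesis using e(1) by (intro exI[of _ e]) auto
    next
      case False
      then have "\<gamma> x \<in> topspace M - C" using CG pathin_topspace[OF path x01] by auto
      then obtain e where e: "e > 0" "\<And>s. 0 \<le> s \<Longrightarrow> s \<le> 1 \<Longrightarrow> \<bar>s - x\<bar> < e \<Longrightarrow> \<gamma> s \<in> topspace M - C"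
        using pathin_nbhd[OF path x01 opC] by auto
      have "P s t" if st: "s \<le> x" "x \<le> t" "t - s < e" for s t
        unfolding P_def
      proof (intro impI)
        assume as: "a \<le> s \<and> t \<le> b" and sub: "\<gamma> ` {a..s} \<subseteq> G"
        have "\<gamma> s \<in> C" using stay[OF _ _ sub] as st by simp
        moreover have "\<gamma> s \<in> topspace M - C" by (rule e(2)) (use st as ab in auto)
        ultimately show "\<gamma> ` {a..t} \<subseteq> G" by simp
      qed
      then show ?thesis using e(1) by (intro exI[of _ e]) auto
    qed
  qed
  moreover have "dist z (snd c (\<gamma> a)) < 2 * r"
    using start(2) zero_le_dist[of z "snd c (\<gamma> a)"] unfolding mem_ball by linarith
  then have "\<gamma> ` {a..a} \<subseteq> G"
    using start(1) by (auto simp: G_def)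
  ultimately have "\<gamma> ` {a..b} \<subseteq> G" by (simp add: P_def)
  then show "\<And>t. t \<in> {a..b} \<Longrightarrow> \<gamma> t \<in> fst c \<and> snd c (\<gamma> t) \<in> ball z (2 * r)"
    by (auto simp: G_def image_subset_iff)
qed

text \<open>Three radii are in play: a step starts within \<open>r\<close>, the curve stays within
  \<open>2 * r\<close> during the step, and the displaced points after a change of charts stay
  within \<open>3 * r\<close>.\<close>

lemma finite_patches:
  assumes "compact_space M"
  shows "\<exists>P. finite P \<and> (\<forall>(c, z, r)\<in>P. c \<in> A \<and> r > 0 \<and> cball z (3 * r) \<subseteq> chart_image c) \<and>
    (\<forall>p\<in>topspace M. \<exists>(c, z, r)\<in>P. p \<in> fst c \<and> snd c p \<in> ball z r)"
proof -
  have "\<forall>p\<in>topspace M. \<exists>c r. c \<in> A \<and> p \<in> fst c \<and> r > 0 \<and> cball (snd c p) (3 * r) \<subseteq> chart_image c"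
  proof
    fix p assume "p \<in> topspace M"
    then obtain c where c: "c \<in> A" "p \<in> fst c" using cover by blast
    obtain e where e: "e > 0" "cball (snd c p) e \<subseteq> chart_image c"
      using open_chart_image[OF c(1)] chart_in_image[OF c(2)] open_contains_cball by blast
    then show "\<exists>c r. c \<in> A \<and> p \<in> fst c \<and> r > 0 \<and> cball (snd c p) (3 * r) \<subseteq> chart_image c"
      using c by (intro exI[of _ c] exI[of _ "e / 3"]) simp
  qed
  then obtain c r where cr: "\<And>p. p \<in> topspace M \<Longrightarrow> c p \<in> A \<and> p \<in> fst (c p) \<and> r p > 0 \<and> cball (snd (c p) p) (3 * r p) \<subseteq> chart_image (c p)"
    by metis
  define V where "V p = {q \<in> fst (c p). snd (c p) q \<in> ball (snd (c p) p) (r p)}" for p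
  have V: "openin M (V p)" "p \<in> V p" if "p \<in> topspace M" for p
    unfolding V_def using chart_preimage_open[OF _ open_ball] cr[OF that] by auto
  have "\<forall>U\<in>V ` topspace M. openin M U" using V(1) by blast
  moreover have "topspace M \<subseteq> \<Union> (V ` topspace M)" using V(2) by blast
  ultimately have "\<exists>\<F>. finite \<F> \<and> \<F> \<subseteq> V ` topspace M \<and> topspace M \<subseteq> \<Union>\<F>"
    using assms unfolding compact_space_def compactin_def by presburger
  then obtain \<F> where F: "finite \<F>" "\<F> \<subseteq> V ` topspace M" "topspace M \<subseteq> \<Union>\<F>" by blast
  obtain Q where Q: "Q \<subseteq> topspace M" "finite Q" "\<F> = V ` Q"
    using finite_subset_image[OF F(1,2)] by blast
  show ?thesis
  proof (intro exI[of _ "(\<lambda>p. (c p, snd (c p) p, r p)) ` Q"] conjI ballI)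
    fix p assume "p \<in> topspace M"
    then obtain q where q: "q \<in> Q" "p \<in> V q" using F(3) Q(3) by auto
    then show "\<exists>(c, z, r)\<in>(\<lambda>p. (c p, snd (c p) p, r p)) ` Q. p \<in> fst c \<and> snd c p \<in> ball z r"
      by (intro bexI[of _ "(c q, snd (c q) q, r q)"]) (auto simp: V_def)
  next
    fix t assume "t \<in> (\<lambda>p. (c p, snd (c p) p, r p)) ` Q"
    then obtain p where p: "p \<in> Q" "t = (c p, snd (c p) p, r p)" by blast
    then have "p \<in> topspace M" using Q(1) by blast
    from cr[OF this] show "case t of (c, z, r) \<Rightarrow> c \<in> A \<and> r > 0 \<and> cball z (3 * r) \<subseteq> chart_image c"
      unfolding p(2) prod.case by blast
  next
    show "finite ((\<lambda>p. (c p, snd (c p) p, r p)) ` Q)" using Q(2) by (rule finite_imageI)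
  qed
qed

section \<open>Arc length\<close>

text \<open>The summand \<open>\<kappa> * t\<close> keeps the derivative positive where the curve
  stands still; the variation formula divides by that derivative.\<close>

definition arc :: "(real \<Rightarrow> 'a) \<Rightarrow> real \<Rightarrow> real \<Rightarrow> real" where
  "arc \<gamma> \<kappa> t = integral {0..t} (curve_speed A g \<gamma>) + \<kappa> * t"

lemma arc_diff:
  assumes pw: "piecewise_C1_curve M A \<gamma>" and ab: "0 \<le> a" "a \<le> b" "b \<le> 1"
  shows "arc \<gamma> \<kappa> b - arc \<gamma> \<kappa> a = integral {a..b} (curve_speed A g \<gamma>) + \<kappa> * (b - a)"
    and "integral {a..b} (curve_speed A g \<gamma>) \<ge> 0"
proof -
  have "curve_speed A g \<gamma> integrable_on {0..b}" by (rule curve_speed_integrable[OF pw]) (use ab in auto)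
  from Henstock_Kurzweil_Integration.integral_combine[OF ab(1,2) this]
  show "arc \<gamma> \<kappa> b - arc \<gamma> \<kappa> a = integral {a..b} (curve_speed A g \<gamma>) + \<kappa> * (b - a)"
    by (simp add: arc_def algebra_simps)
  have path: "pathin M \<gamma>" using pw by (simp add: piecewise_C1_curve_def)
  show "integral {a..b} (curve_speed A g \<gamma>) \<ge> 0"
    by (rule integral_nonneg[OF curve_speed_integrable[OF pw ab]])
      (rule curve_speed_nonneg[OF pathin_topspace[OF path]], use ab in auto)
qed

lemma arc_continuous:
  assumes pw: "piecewise_C1_curve M A \<gamma>"
  shows "continuous_on {0..1} (arc \<gamma> \<kappa>)"
  unfolding arc_def
  by (intro continuous_intros indefinite_integral_continuous_1 curve_speed_integrable[OF pw]) auto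

lemma arc_derivative:
  assumes pw: "piecewise_C1_curve M A \<gamma>" and c: "c \<in> A" and p: "C1_piece \<gamma> c a b D"
    and ab: "0 \<le> a" "b \<le> 1" and t: "t \<in> {a..b}"
  shows "(arc \<gamma> \<kappa> has_vector_derivative nrm c (snd c (\<gamma> t)) (D t) + \<kappa>) (at t within {a..b})"
proof -
  let ?h = "\<lambda>t. nrm c (snd c (\<gamma> t)) (D t)"
  note sp = C1_piece_speed_integral(1)[OF c p]
  have "((\<lambda>t. arc \<gamma> \<kappa> a + integral {a..t} ?h + \<kappa> * (t - a)) has_vector_derivative ?h t + \<kappa>) (at t within {a..b})"
    by (rule derivative_eq_intros integral_has_vector_derivative[OF sp t] refl | simp)+
  then show ?thesis
  proof (rule has_vector_derivative_transform[OF t, rotated])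
    fix s assume s: "s \<in> {a..b}"
    have "integral {a..s} (curve_speed A g \<gamma>) = integral {a..s} ?h"
    proof (cases "a = s")
      case False
      then show ?thesis
        using integral_unique[OF C1_piece_speed_integral(2)[OF c C1_piece_subinterval[OF p order_refl, of s]]] s by simp
    qed simp
    then show "arc \<gamma> \<kappa> s = arc \<gamma> \<kappa> a + integral {a..s} ?h + \<kappa> * (s - a)"
      using arc_diff(1)[OF pw, of a s \<kappa>] s ab by simp
  qed
qed

end

section \<open>The length of the varied curve\<close>

text \<open>With the matrix as an argument the expression is trilinear, so that the metric and the
  velocity can be expanded in powers of s together.\<close>

definition qform :: "real^'n^'n \<Rightarrow> real^'n \<Rightarrow> real^'n \<Rightarrow> real" where
  "qform M a c = a \<bullet> (M *v c)"

lemma metric_at_qform: "metric_at H x a c = qform (H x) a c"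
  by (simp add: metric_at_def qform_def)

lemma qform_simps:
  "qform (M + M') a c = qform M a c + qform M' a c" "qform (k *\<^sub>R M) a c = k * qform M a c"
  "qform M (a + a') c = qform M a c + qform M a' c" "qform M (k *\<^sub>R a) c = k * qform M a c"
  "qform M a (c + c') = qform M a c + qform M a c'" "qform M a (k *\<^sub>R c) = k * qform M a c"
  by (simp_all add: qform_def matrix_vector_mult_add_rdistrib matrix_vector_right_distrib inner_add_left inner_add_right
      matrix_vector_mult_scaleR scaleR_matrix_vector_assoc[symmetric])

lemma bounded_linear_qform: "bounded_linear (\<lambda>M. qform M a c)"
  by (rule linear_conv_bounded_linear[THEN iffD1]) (simp add: linear_iff qform_simps)

lemma qform_bound: "\<exists>k\<ge>0. \<forall>(M::real^'n^'n) a c. \<bar>qform M a c\<bar> \<le> k * norm M * norm a * norm c"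
proof -
  have "bilinear (\<lambda>(M::real^'n^'n) (c::real^'n). M *v c)"
    unfolding bilinear_def linear_iff
    by (simp add: matrix_vector_mult_add_rdistrib matrix_vector_right_distrib
      matrix_vector_mult_scaleR scaleR_matrix_vector_assoc[symmetric])
  then obtain k where k: "k > 0" "\<And>(M::real^'n^'n) (c::real^'n). norm (M *v c) \<le> k * norm M * norm c"
    using bilinear_bounded_pos by (metis mult.assoc mult.commute)
  have "\<bar>qform M a c\<bar> \<le> k * norm M * norm a * norm c" for M :: "real^'n^'n" and a c
  proof -
    have "\<bar>qform M a c\<bar> \<le> norm a * norm (M *v c)"
      unfolding qform_def by (rule Cauchy_Schwarz_ineq2)
    also have "\<dots> \<le> norm a * (k * norm M * norm c)" by (rule mult_left_mono[OF k(2)]) simp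
    finally show ?thesis by (simp add: mult_ac)
  qed
  then show ?thesis using k(1) by (intro exI[of _ k]) auto
qed

text \<open>The constant \<open>26\<close> is 17 + 9. There are 17 products of order at least three
  in \<open>s\<close>, each bounded by
  \<open>k * B ^ 3 * \<rho>\<^sup>2 * \<bar>s\<bar> ^ 3\<close>; the remainder matrix contributes 9
  because the velocity has norm at most \<open>3 * (B * \<rho>)\<close>.\<close>

lemma cubic_remainder:
  fixes M0 M1 M2 R :: "real^'n^'n"
  assumes Q: "\<And>(M::real^'n^'n) a c. \<bar>qform M a c\<bar> \<le> k * norm M * norm a * norm c" and k: "k \<ge> 0"
    and s: "\<bar>s\<bar> \<le> 1" and B: "B \<ge> 0"
    and M: "norm M0 \<le> B" "norm M1 \<le> B" "norm M2 \<le> B" "norm R \<le> B * \<bar>s\<bar> ^ 3"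
    and v: "norm u \<le> B * \<rho>" "norm p \<le> B * \<rho>" "norm q \<le> B * \<rho>" and \<rho>: "\<rho> \<ge> 0"
  defines "y \<equiv> u + s *\<^sub>R p + s\<^sup>2 *\<^sub>R q"
  shows "qform (M0 + s *\<^sub>R M1 + s\<^sup>2 *\<^sub>R M2 + R) y y \<le> qform M0 u u
     + s * (qform M0 u p + qform M0 p u + qform M1 u u)
     + s\<^sup>2 * (qform M0 p p + qform M0 u q + qform M0 q u + qform M1 u p + qform M1 p u + qform M2 u u)
     + 26 * k * B ^ 3 * \<bar>s\<bar> ^ 3 * \<rho>\<^sup>2"
proof -
  let ?X = "k * B * (B * \<rho>) * (B * \<rho>)"
  have X0: "?X \<ge> 0" using k B \<rho> by simp
  have b: "\<bar>qform M a c\<bar> \<le> k * m * x * z" if "norm M \<le> m" "norm a \<le> x" "norm c \<le> z" for M :: "real^'n^'n" and a c m x z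
  proof -
    have "0 \<le> m" "0 \<le> x" using that norm_ge_zero[of M] norm_ge_zero[of a] by linarith+
    then have "norm M * norm a * norm c \<le> m * x * z"
      using that by (intro mult_mono mult_nonneg_nonneg) auto
    then have "k * (norm M * norm a * norm c) \<le> k * (m * x * z)" using k by (rule mult_left_mono)
    then show ?thesis using Q[of M a c] by (simp add: mult.assoc)
  qed
  have s2: "\<bar>s\<bar> ^ 4 \<le> \<bar>s\<bar> ^ 3" "\<bar>s\<bar> ^ 5 \<le> \<bar>s\<bar> ^ 3" "\<bar>s\<bar> ^ 6 \<le> \<bar>s\<bar> ^ 3"
    by (rule power_decreasing; use s in simp)+
  have y: "norm y \<le> 3 * (B * \<rho>)"
  proof -
    have "norm y \<le> norm u + \<bar>s\<bar> * norm p + s\<^sup>2 * norm q"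
      unfolding y_def by (rule order_trans[OF norm_triangle_ineq], rule add_mono,
          rule order_trans[OF norm_triangle_ineq]) auto
    also have "\<dots> \<le> B * \<rho> + 1 * (B * \<rho>) + 1 * (B * \<rho>)"
      using s v B \<rho> by (intro add_mono mult_mono) (auto simp: abs_square_le_1)
    finally show ?thesis by simp
  qed
  have e1: "\<bar>qform R y y\<bar> \<le> 9 * (?X * \<bar>s\<bar> ^ 3)"
    using b[OF M(4) y y] by (simp add: mult_ac)
  have q2: "\<bar>qform M2 u p\<bar> \<le> ?X" "\<bar>qform M2 p u\<bar> \<le> ?X" "\<bar>qform M2 u q\<bar> \<le> ?X" "\<bar>qform M2 q u\<bar> \<le> ?X"
    "\<bar>qform M2 p p\<bar> \<le> ?X" "\<bar>qform M2 p q\<bar> \<le> ?X" "\<bar>qform M2 q p\<bar> \<le> ?X" "\<bar>qform M2 q q\<bar> \<le> ?X"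
    using b[OF M(3)] v by blast+
  have q1: "\<bar>qform M1 u q\<bar> \<le> ?X" "\<bar>qform M1 q u\<bar> \<le> ?X" "\<bar>qform M1 p p\<bar> \<le> ?X" "\<bar>qform M1 p q\<bar> \<le> ?X" "\<bar>qform M1 q p\<bar> \<le> ?X" "\<bar>qform M1 q q\<bar> \<le> ?X"
    using b[OF M(2)] v by blast+
  have q0: "\<bar>qform M0 p q\<bar> \<le> ?X" "\<bar>qform M0 q p\<bar> \<le> ?X" "\<bar>qform M0 q q\<bar> \<le> ?X"
    using b[OF M(1)] v by blast+
  have t: "s ^ j * z \<le> \<bar>s\<bar> ^ 3 * ?X" if "\<bar>z\<bar> \<le> ?X" "\<bar>s\<bar> ^ j \<le> \<bar>s\<bar> ^ 3" for j z
  proof -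
    have "s ^ j * z \<le> \<bar>s ^ j * z\<bar>" by simp
    also have "\<dots> = \<bar>s\<bar> ^ j * \<bar>z\<bar>" by (simp add: abs_mult power_abs)
    also have "\<dots> \<le> \<bar>s\<bar> ^ 3 * ?X" using that by (intro mult_mono) auto
    finally show ?thesis .
  qed
  have eq: "qform (M0 + s *\<^sub>R M1 + s\<^sup>2 *\<^sub>R M2 + R) y y = qform M0 u u
     + s * (qform M0 u p + qform M0 p u + qform M1 u u)
     + s\<^sup>2 * (qform M0 p p + qform M0 u q + qform M0 q u + qform M1 u p + qform M1 p u + qform M2 u u)
     + (qform R y y + s ^ 3 * qform M0 p q + s ^ 3 * qform M0 q p + s ^ 4 * qform M0 q q
     + s ^ 3 * qform M1 u q + s ^ 3 * qform M1 q u + s ^ 3 * qform M1 p p + s ^ 4 * qform M1 p q + s ^ 4 * qform M1 q p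
     + s ^ 5 * qform M1 q q
     + s ^ 3 * qform M2 u p + s ^ 3 * qform M2 p u + s ^ 4 * qform M2 u q + s ^ 4 * qform M2 q u + s ^ 4 * qform M2 p p
     + s ^ 5 * qform M2 p q + s ^ 5 * qform M2 q p + s ^ 6 * qform M2 q q)"
  proof -
    have "qform (M0 + s *\<^sub>R M1 + s\<^sup>2 *\<^sub>R M2 + R) y y = qform M0 y y + s * qform M1 y y + s\<^sup>2 * qform M2 y y + qform R y y"
      by (simp only: qform_simps)
    moreover have "qform M y y = qform M u u + s * (qform M u p + qform M p u)
        + s\<^sup>2 * (qform M p p + qform M u q + qform M q u) + s ^ 3 * (qform M p q + qform M q p) + s ^ 4 * qform M q q" for M
      unfolding y_def qform_simps by (simp add: algebra_simps power2_eq_square power3_eq_cube power4_eq_xxxx)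
    ultimately show ?thesis
      by (simp add: algebra_simps eval_nat_numeral)
  qed
  note bounds = t[OF q0(1) order_refl] t[OF q0(2) order_refl] t[OF q0(3) s2(1)]
    t[OF q1(1) order_refl] t[OF q1(2) order_refl] t[OF q1(3) order_refl] t[OF q1(4) s2(1)] t[OF q1(5) s2(1)] t[OF q1(6) s2(2)]
    t[OF q2(1) order_refl] t[OF q2(2) order_refl] t[OF q2(3) s2(1)] t[OF q2(4) s2(1)] t[OF q2(5) s2(1)]
    t[OF q2(6) s2(2)] t[OF q2(7) s2(2)] t[OF q2(8) s2(3)]
  have "qform R y y \<le> 9 * (\<bar>s\<bar> ^ 3 * ?X)" using e1 by (simp add: mult.commute)
  moreover have "26 * k * B ^ 3 * \<bar>s\<bar> ^ 3 * \<rho>\<^sup>2 = 26 * (\<bar>s\<bar> ^ 3 * ?X)"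
    by (simp add: power2_eq_square power3_eq_cube mult_ac)
  ultimately show ?thesis
    unfolding eq using bounds by linarith
qed

section \<open>Bounds for the connection and its derivative\<close>

context metric_domain begin

lemma gam_bound:
  assumes "compact K" "K \<subseteq> U"
  shows "\<exists>C\<ge>0. \<forall>x\<in>K. \<forall>v w. norm (gam H x v w) \<le> C * norm v * norm w"
  by (rule bilinear_family_bound[OF bilinear_gam assms(1)])
    (rule continuous_on_subset[OF smooth_on_continuous_on[OF smooth_gam] assms(2)])

lemma bilinear_dgam: "x \<in> U \<Longrightarrow> bilinear (\<lambda>v w. dir_deriv (\<lambda>y. gam H y v w) x a)"
  unfolding bilinear_def using dir_deriv_gam_linear by auto

lemma dgam_bound:
  assumes "compact K" "K \<subseteq> U"
  shows "\<exists>C\<ge>0. \<forall>x\<in>K. \<forall>a v w. norm (dir_deriv (\<lambda>y. gam H y v w) x a) \<le> C * norm v * norm w * norm a"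
proof -
  have "\<exists>C\<ge>0. \<forall>p\<in>K \<times> UNIV. \<forall>v w. norm (dir_deriv (\<lambda>y. gam H y v w) (fst p) (snd p)) \<le> C * norm v * norm w * norm (snd p)"
  proof (rule bilinear_bound_from_axes)
    show "bilinear (\<lambda>v w. dir_deriv (\<lambda>y. gam H y v w) (fst p) (snd p))" if "p \<in> K \<times> UNIV" for p
      using that assms(2) by (intro bilinear_dgam) auto
    fix i j
    obtain C where "C \<ge> 0" "\<forall>x\<in>K. \<forall>v. norm (dir_deriv (\<lambda>y. gam H y (axis i 1) (axis j 1)) x v) \<le> C * norm v"
      using dir_deriv_bound1[OF open_U smooth_gam assms] by blast
    then show "\<exists>C\<ge>0. \<forall>p\<in>K \<times> UNIV. norm (dir_deriv (\<lambda>y. gam H y (axis i 1) (axis j 1)) (fst p) (snd p)) \<le> C * norm (snd p)"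
      by (intro exI[of _ C]) auto
  qed
  then show ?thesis by fastforce
qed

lemma curv_linear3: "x \<in> U \<Longrightarrow> linear (\<lambda>w. curv H x a b w)"
  unfolding linear_iff curv_def
  using dir_deriv_gam_linear(3)[of x] by (auto simp: linear_iff gam_simps algebra_simps)

end

lemma bilinear_second_derivative:
  assumes "open U" "smooth_on U h" "x \<in> U"
  shows "bilinear (\<lambda>v w. dir_deriv (\<lambda>y. dir_deriv h y v) x w)"
  unfolding bilinear_def
proof (intro conjI allI)
  fix v show "linear (\<lambda>w. dir_deriv (\<lambda>y. dir_deriv h y v) x w)"
    by (intro linear_frechet_derivative smooth_on_differentiable[OF smooth_on_dir_deriv[OF assms(1,2)] assms(3)])
next
  fix w show "linear (\<lambda>v. dir_deriv (\<lambda>y. dir_deriv h y v) x w)"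
    unfolding linear_iff dir_deriv_dir_deriv_eq_sum[OF assms]
    by (simp add: scaleR_add_left sum.distrib scaleR_sum_right)
qed

text \<open>The root is concave, so its tangent line at \<open>r\<^sup>2\<close> lies above it. When
  \<open>X\<close> contains first order terms, the negative square of their contribution is given
  away.\<close>

lemma sqrt_le_tangent:
  fixes r X z :: real
  assumes r: "r > 0" and z: "0 \<le> z" "z \<le> r\<^sup>2 + X"
  shows "sqrt z \<le> r + X / (2 * r)"
proof (rule real_le_lsqrt)
  have "0 \<le> r\<^sup>2 + X" using z by linarith
  then have "0 \<le> r\<^sup>2 + (r\<^sup>2 + X)" using zero_le_power2[of r] by linarith
  then have "0 \<le> (r\<^sup>2 + (r\<^sup>2 + X)) / (2 * r)" by (rule divide_nonneg_nonneg) (use r in simp)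
  also have "\<dots> = r + X / (2 * r)" using r by (simp add: field_simps power2_eq_square)
  finally show "0 \<le> r + X / (2 * r)" .
  have "(r + X / (2 * r))\<^sup>2 = r\<^sup>2 + X + (X / (2 * r))\<^sup>2" using r by (simp add: power2_sum)
  then show "z \<le> (r + X / (2 * r))\<^sup>2" using z by (smt (verit) zero_le_power2)
qed

section \<open>The varied curves and the second order expansion of their speed\<close>

context soliton_domain begin

text \<open>Each of the 2 n varied curves takes an equal share of the displacement along the
  gradient, so that in the sum the Hessian has the same weight as the Ricci tensor.\<close>

definition beta :: real where "beta = 1 / (2 * CARD('a))"

text \<open>The connection term is the second order Taylor term of a geodesic with initial velocity
  \<open>e\<close>; without it the varied curve would depend on the chart already in second
  order.\<close>

definition nvar :: "real^'a \<Rightarrow> real^'a \<Rightarrow> real^'a" where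
  "nvar x e = - (beta *\<^sub>R Z x) - (1/2) *\<^sub>R gam H x e e"

text \<open>The time derivative of \<open>nvar\<close> along a curve with velocity \<open>u\<close>
  when \<open>e\<close> is parallel; the last summand comes from e' = -\<Gamma>(u, e).\<close>

definition dnvar :: "real^'a \<Rightarrow> real^'a \<Rightarrow> real^'a \<Rightarrow> real^'a" where
  "dnvar x u e = - (beta *\<^sub>R dir_deriv Z x u) - (1/2) *\<^sub>R dir_deriv (\<lambda>y. gam H y e e) x u + gam H x e (gam H x u e)"

definition yvar :: "real^'a \<Rightarrow> real^'a \<Rightarrow> real \<Rightarrow> real^'a" where
  "yvar x e \<tau> = x + \<tau> *\<^sub>R e + \<tau>\<^sup>2 *\<^sub>R nvar x e"

definition dyvar :: "real^'a \<Rightarrow> real^'a \<Rightarrow> real^'a \<Rightarrow> real \<Rightarrow> real \<Rightarrow> real^'a" where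
  "dyvar x u e \<tau> \<tau>' = u + \<tau>' *\<^sub>R e - \<tau> *\<^sub>R gam H x u e + (2 * \<tau> * \<tau>') *\<^sub>R nvar x e + \<tau>\<^sup>2 *\<^sub>R dnvar x u e"

lemma beta: "0 \<le> beta" "beta \<le> 1" "2 * CARD('a) * beta = 1"
proof -
  have "CARD('a) \<ge> 1" by (simp add: Suc_leI)
  then have n: "1 \<le> 2 * real CARD('a)" by linarith
  then have "1 / (2 * real CARD('a)) \<le> 1" by (subst divide_le_eq_1_pos) linarith+
  then show "0 \<le> beta" "beta \<le> 1" "2 * CARD('a) * beta = 1" using n by (auto simp: beta_def)
qed

definition local_bound :: "(real^'a) set \<Rightarrow> real \<Rightarrow> bool" where
  "local_bound K c \<longleftrightarrow> (\<forall>x\<in>K. \<forall>u. norm u \<le> c * sqrt (metric_at H x u u)) \<and>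
    (\<forall>x\<in>K. \<forall>v w. norm (gam H x v w) \<le> c * norm v * norm w) \<and>
    (\<forall>x\<in>K. \<forall>a v w. norm (dir_deriv (\<lambda>y. gam H y v w) x a) \<le> c * norm v * norm w * norm a) \<and>
    (\<forall>x\<in>K. norm (Z x) \<le> c) \<and> (\<forall>x\<in>K. \<forall>v. norm (dir_deriv Z x v) \<le> c * norm v) \<and>
    (\<forall>x\<in>K. norm (H x) \<le> c) \<and> (\<forall>x\<in>K. \<forall>v. norm (dir_deriv H x v) \<le> c * norm v) \<and>
    (\<forall>x\<in>K. \<forall>v w. norm (dir_deriv (\<lambda>y. dir_deriv H y v) x w) \<le> c * norm v * norm w)"

lemma local_bounds:
  assumes K: "compact K" "K \<subseteq> U"
  shows "\<exists>c\<ge>1. local_bound K c"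
proof -
  obtain m where m: "m > 0" "\<forall>x\<in>K. \<forall>v. m * norm v \<le> sqrt (metric_at H x v v)"
    using metric_lower_bound[OF K] by blast
  obtain c1 where c1: "c1 \<ge> 0" "\<forall>x\<in>K. \<forall>v w. norm (gam H x v w) \<le> c1 * norm v * norm w" using gam_bound[OF K] by blast
  obtain c2 where c2: "c2 \<ge> 0" "\<forall>x\<in>K. \<forall>a v w. norm (dir_deriv (\<lambda>y. gam H y v w) x a) \<le> c2 * norm v * norm w * norm a"
    using dgam_bound[OF K] by blast
  obtain c3 where c3: "c3 \<ge> 0" "\<forall>x\<in>K. norm (Z x) \<le> c3"
    using continuous_on_compact_bound[OF K(1) continuous_on_subset[OF smooth_on_continuous_on[OF smooth_Z] K(2)]] by blast
  obtain c4 where c4: "c4 \<ge> 0" "\<forall>x\<in>K. \<forall>v. norm (dir_deriv Z x v) \<le> c4 * norm v"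
    using dir_deriv_bound1[OF open_U smooth_Z K] by blast
  obtain c5 where c5: "c5 \<ge> 0" "\<forall>x\<in>K. norm (H x) \<le> c5"
    using continuous_on_compact_bound[OF K(1) continuous_on_subset[OF smooth_on_continuous_on[OF smooth_H] K(2)]] by blast
  obtain c6 where c6: "c6 \<ge> 0" "\<forall>x\<in>K. \<forall>v. norm (dir_deriv H x v) \<le> c6 * norm v"
    using dir_deriv_bound1[OF open_U smooth_H K] by blast
  obtain c7 where c7: "c7 \<ge> 0" "\<forall>x\<in>K. \<forall>v w. norm (dir_deriv (\<lambda>y. dir_deriv H y v) x w) \<le> c7 * norm v * norm w"
    using dir_deriv_bound2[OF open_U smooth_H K] by blast
  define c where "c = 1 + 1 / m + c1 + c2 + c3 + c4 + c5 + c6 + c7"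
  have le: "1 / m \<le> c" "c1 \<le> c" "c2 \<le> c" "c3 \<le> c" "c4 \<le> c" "c5 \<le> c" "c6 \<le> c" "c7 \<le> c" "1 \<le> c"
    using m(1) c1(1) c2(1) c3(1) c4(1) c5(1) c6(1) c7(1) zero_less_divide_1_iff[of m] by (auto simp: c_def)
  have mono1: "d * a \<le> c * a" if "d \<le> c" "a \<ge> 0" for d a :: real using that by (rule mult_right_mono)
  show ?thesis
    unfolding local_bound_def
  proof (intro exI[of _ c] conjI ballI allI le(9))
    fix x assume x: "x \<in> K"
    show "norm u \<le> c * sqrt (metric_at H x u u)" for u
    proof -
      have "norm u \<le> (1 / m) * sqrt (metric_at H x u u)" using m x by (simp add: field_simps)
      also have "\<dots> \<le> c * sqrt (metric_at H x u u)"
        by (rule mono1[OF le(1)]) (use metric_nonneg x K(2) in auto)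
      finally show ?thesis .
    qed
    show "norm (gam H x v w) \<le> c * norm v * norm w" for v w
      using c1(2) x mono1[OF le(2), of "norm v * norm w"] by (fastforce simp: mult.assoc intro: order_trans)
    show "norm (dir_deriv (\<lambda>y. gam H y v w) x a) \<le> c * norm v * norm w * norm a" for a v w
      using c2(2) x mono1[OF le(3), of "norm v * norm w * norm a"] by (fastforce simp: mult.assoc intro: order_trans)
    show "norm (Z x) \<le> c" using c3(2) x le(4) by (meson order_trans)
    show "norm (dir_deriv Z x v) \<le> c * norm v" for v
      using c4(2) x mono1[OF le(5), of "norm v"] by (meson norm_ge_zero order_trans)
    show "norm (H x) \<le> c" using c5(2) x le(6) by (meson order_trans)
    show "norm (dir_deriv H x v) \<le> c * norm v" for v
      using c6(2) x mono1[OF le(7), of "norm v"] by (meson norm_ge_zero order_trans)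
    show "norm (dir_deriv (\<lambda>y. dir_deriv H y v) x w) \<le> c * norm v * norm w" for v w
      using c7(2) x mono1[OF le(8), of "norm v * norm w"] by (fastforce simp: mult.assoc intro: order_trans)
  qed
qed

lemma dyvar_expand:
  "dyvar x u e (s * \<phi>) (s * \<psi>) = u + s *\<^sub>R (\<psi> *\<^sub>R e - \<phi> *\<^sub>R gam H x u e)
     + s\<^sup>2 *\<^sub>R ((2 * \<phi> * \<psi>) *\<^sub>R nvar x e + \<phi>\<^sup>2 *\<^sub>R dnvar x u e)"
  by (simp add: dyvar_def algebra_simps power2_eq_square)

text \<open>This is \<open>second_variation_coefficient\<close> with v = \<phi> e and w = -beta
  \<phi>^2 grad F. Since \<open>p\<close> has the form dictated by parallel transport, the covariant
  derivative of v is \<psi> e, which is \<open>pg\<close>; the connection drops out of the first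
  order coefficient for the same reason.\<close>

lemma variation_coefficients:
  fixes u e :: "real^'a" and \<phi> \<psi> :: real
  assumes x: "x \<in> U" and e: "metric_at H x e e = 1"
  defines "v \<equiv> \<phi> *\<^sub>R e" and "p \<equiv> \<psi> *\<^sub>R e - \<phi> *\<^sub>R gam H x u e"
    and "q \<equiv> (2 * \<phi> * \<psi>) *\<^sub>R nvar x e + \<phi>\<^sup>2 *\<^sub>R dnvar x u e" and "b \<equiv> \<phi>\<^sup>2 *\<^sub>R nvar x e"
  shows "2 * metric_at H x u p + dir_deriv (\<lambda>y. metric_at H y u u) x v = 2 * \<psi> * metric_at H x u e"
    and "metric_at H x p p + 2 * metric_at H x u q + 2 * dir_deriv (\<lambda>y. metric_at H y u p) x v
      + dir_deriv (\<lambda>y. metric_at H y u u) x b + dir_deriv (\<lambda>y. dir_deriv (\<lambda>y. metric_at H y u u) y v) x v / 2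
      = \<psi>\<^sup>2 + \<phi>\<^sup>2 * metric_at H x u (curv H x e u e)
        - 4 * beta * \<phi> * \<psi> * metric_at H x u (Z x) - 2 * beta * \<phi>\<^sup>2 * metric_at H x u (S x u)"
proof -
  have "dir_deriv (\<lambda>y. metric_at H y u u) x v = 2 * \<phi> * metric_at H x u (gam H x u e)"
    unfolding metric_compat[OF x] v_def gam_simps metric_at_simps
    using metric_sym[OF x, of "gam H x e u" u] gam_sym[OF x, of e u] by simp
  then show "2 * metric_at H x u p + dir_deriv (\<lambda>y. metric_at H y u u) x v = 2 * \<psi> * metric_at H x u e"
    by (simp add: p_def metric_at_simps algebra_simps)
  define w where "w = - ((beta * \<phi>\<^sup>2) *\<^sub>R Z x)"
  define wd where "wd = - ((2 * beta * \<phi> * \<psi>) *\<^sub>R Z x) - (beta * \<phi>\<^sup>2) *\<^sub>R dir_deriv Z x u"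
  have dg: "dir_deriv (\<lambda>y. gam H y v v) x u = \<phi>\<^sup>2 *\<^sub>R dir_deriv (\<lambda>y. gam H y e e) x u"
    using bilinear_lmul[OF bilinear_dgam[OF x]] bilinear_rmul[OF bilinear_dgam[OF x]]
    by (simp add: v_def power2_eq_square)
  have q: "q = wd - (1/2) *\<^sub>R dir_deriv (\<lambda>y. gam H y v v) x u - gam H x v p"
    unfolding dg
    unfolding q_def wd_def p_def v_def nvar_def dnvar_def gam_simps
    by (simp add: algebra_simps power2_eq_square)
  have b: "b = w - (1/2) *\<^sub>R gam H x v v"
    unfolding b_def w_def v_def nvar_def gam_simps by (simp add: algebra_simps power2_eq_square)
  have pg: "p + gam H x u v = \<psi> *\<^sub>R e" by (simp add: p_def v_def gam_simps)
  have wg: "wd + gam H x u w = - ((2 * beta * \<phi> * \<psi>) *\<^sub>R Z x) - (beta * \<phi>\<^sup>2) *\<^sub>R S x u"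
    by (simp add: wd_def w_def gam_simps algebra_simps)
  have cv: "curv H x v u v = \<phi>\<^sup>2 *\<^sub>R curv H x e u e"
    using linear_scale[OF curv_linear1[OF x]] linear_scale[OF curv_linear3[OF x]]
    by (simp add: v_def power2_eq_square)
  have "metric_at H x p p + 2 * metric_at H x u q + 2 * dir_deriv (\<lambda>y. metric_at H y u p) x v
      + dir_deriv (\<lambda>y. metric_at H y u u) x b + dir_deriv (\<lambda>y. dir_deriv (\<lambda>y. metric_at H y u u) y v) x v / 2
      = metric_at H x (\<psi> *\<^sub>R e) (\<psi> *\<^sub>R e) + metric_at H x u (\<phi>\<^sup>2 *\<^sub>R curv H x e u e)
        + 2 * metric_at H x u (- ((2 * beta * \<phi> * \<psi>) *\<^sub>R Z x) - (beta * \<phi>\<^sup>2) *\<^sub>R S x u)"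
    using second_variation_coefficient[OF x, of p u wd v w] unfolding q b pg wg cv by simp
  then show "metric_at H x p p + 2 * metric_at H x u q + 2 * dir_deriv (\<lambda>y. metric_at H y u p) x v
      + dir_deriv (\<lambda>y. metric_at H y u u) x b + dir_deriv (\<lambda>y. dir_deriv (\<lambda>y. metric_at H y u u) y v) x v / 2
      = \<psi>\<^sup>2 + \<phi>\<^sup>2 * metric_at H x u (curv H x e u e)
        - 4 * beta * \<phi> * \<psi> * metric_at H x u (Z x) - 2 * beta * \<phi>\<^sup>2 * metric_at H x u (S x u)"
    by (simp add: metric_at_simps e power2_eq_square algebra_simps)
qed

text \<open>The point is uniformity: \<open>C\<close> and \<open>s0\<close> depend on
  \<open>K\<close> and \<open>P\<close> only. By the bound on \<psi> the velocity and its
  corrections are all of size \<rho>, so the cubic error is proportional to \<rho> and integrates to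
  a multiple of the arc length, whatever the curve.\<close>

lemma variation_pointwise:
  assumes K: "compact K" "K \<subseteq> U" and P: "P \<ge> 0"
  shows "\<exists>C\<ge>0. \<exists>s0>0. \<forall>x\<in>K. \<forall>u e \<phi> \<psi> \<rho> s.
    0 < \<rho> \<and> metric_at H x u u \<le> \<rho>\<^sup>2 \<and> metric_at H x e e = 1 \<and> \<bar>\<phi>\<bar> \<le> 1 \<and> \<bar>\<psi>\<bar> \<le> P * \<rho> \<and> \<bar>s\<bar> \<le> s0 \<longrightarrow>
    yvar x e (s * \<phi>) \<in> U \<and>
    sqrt (metric_at H (yvar x e (s * \<phi>)) (dyvar x u e (s * \<phi>) (s * \<psi>)) (dyvar x u e (s * \<phi>) (s * \<psi>)))
      \<le> \<rho> + s * (\<psi> * metric_at H x u e / \<rho>) + s\<^sup>2 / (2 * \<rho>) * (\<psi>\<^sup>2 + \<phi>\<^sup>2 * metric_at H x u (curv H x e u e)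
        - 4 * beta * \<phi> * \<psi> * metric_at H x u (Z x) - 2 * beta * \<phi>\<^sup>2 * metric_at H x u (S x u)) + C * \<bar>s\<bar> ^ 3 * \<rho>"
proof -
  obtain c where c: "c \<ge> 1" and lb: "local_bound K c" using local_bounds[OF K] by blast
  have nb: "\<And>x u. x \<in> K \<Longrightarrow> norm u \<le> c * sqrt (metric_at H x u u)"
    and gb: "\<And>x v w. x \<in> K \<Longrightarrow> norm (gam H x v w) \<le> c * norm v * norm w"
    and dgb: "\<And>x a v w. x \<in> K \<Longrightarrow> norm (dir_deriv (\<lambda>y. gam H y v w) x a) \<le> c * norm v * norm w * norm a"
    and Zb: "\<And>x. x \<in> K \<Longrightarrow> norm (Z x) \<le> c" and dZb: "\<And>x v. x \<in> K \<Longrightarrow> norm (dir_deriv Z x v) \<le> c * norm v"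
    and Hb: "\<And>x. x \<in> K \<Longrightarrow> norm (H x) \<le> c" and dHb: "\<And>x v. x \<in> K \<Longrightarrow> norm (dir_deriv H x v) \<le> c * norm v"
    and ddHb: "\<And>x v w. x \<in> K \<Longrightarrow> norm (dir_deriv (\<lambda>y. dir_deriv H y v) x w) \<le> c * norm v * norm w"
    using lb unfolding local_bound_def by simp_all
  obtain r CT where r: "r > 0" and CT: "CT \<ge> 0" and taylor: "\<And>x \<xi>. x \<in> K \<Longrightarrow> norm \<xi> \<le> r \<Longrightarrow> x + \<xi> \<in> U \<and>
    norm (H (x + \<xi>) - H x - dir_deriv H x \<xi> - dir_deriv (\<lambda>y. dir_deriv H y \<xi>) x \<xi> /\<^sub>R 2) \<le> CT * norm \<xi> ^ 3"
    using taylor3[OF open_U smooth_H K] by blast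
  obtain k where k: "k \<ge> 0" and Q: "\<And>(M::real^'a^'a) a c. \<bar>qform M a c\<bar> \<le> k * norm M * norm a * norm c"
    using qform_bound by blast
  \<comment> \<open>\<open>cn\<close> bounds \<open>nvar\<close>, \<open>cd * \<rho>\<close> bounds
    \<open>dnvar\<close>, \<open>cp * \<rho>\<close> and \<open>cq * \<rho>\<close> bound the first
    and second order parts of the velocity, and \<open>cR\<close> is for the cubic part of the
    metric.\<close>
  define cn where "cn = c + c * c * c"
  define cd where "cd = c * c + c * c * c * c + c * c * (c * c * c)"
  define cq where "cq = 2 * P * cn + cd"
  define cp where "cp = P * c + c * c * c"
  define cR where "cR = CT * (c + cn) ^ 3 + c * c * cn + c * cn * cn"
  define B where "B = c + c * c + c * cn + c * c * c + cR + cp + cq"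
  have pos: "cn \<ge> 0" "cd \<ge> 0" "cq \<ge> 0" "cp \<ge> 0" "cR \<ge> 0" "c \<ge> 0"
    using c P CT by (auto simp: cn_def cd_def cq_def cp_def cR_def)
  have cc: "c * c \<ge> 0" "c * cn \<ge> 0" "c * c * c \<ge> 0" using pos by auto
  have B: "B \<ge> 0" "c \<le> B" "c * c \<le> B" "c * cn + c * c * c \<le> B" "cR \<le> B" "cp \<le> B" "cq \<le> B"
    using pos cc by (auto simp: B_def)
  \<comment> \<open>Keeps the displacement within the radius \<open>r\<close> of the Taylor
    expansion.\<close>
  define s0 where "s0 = min 1 (r / (c + cn))"
  have s0: "s0 > 0" using r c pos by (auto simp: s0_def intro!: divide_pos_pos add_pos_nonneg)
  \<comment> \<open>Half of the constant \<open>26\<close> of \<open>cubic_remainder\<close>,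
    because the root divides by \<open>2 * \<rho>\<close>.\<close>
  define C where "C = 13 * k * B ^ 3"
  have C: "C \<ge> 0" using k B by (simp add: C_def)
  have main: "yvar x e (s * \<phi>) \<in> U \<and>
    sqrt (metric_at H (yvar x e (s * \<phi>)) (dyvar x u e (s * \<phi>) (s * \<psi>)) (dyvar x u e (s * \<phi>) (s * \<psi>)))
      \<le> \<rho> + s * (\<psi> * metric_at H x u e / \<rho>) + s\<^sup>2 / (2 * \<rho>) * (\<psi>\<^sup>2 + \<phi>\<^sup>2 * metric_at H x u (curv H x e u e)
        - 4 * beta * \<phi> * \<psi> * metric_at H x u (Z x) - 2 * beta * \<phi>\<^sup>2 * metric_at H x u (S x u)) + C * \<bar>s\<bar> ^ 3 * \<rho>"
    if x: "x \<in> K" and \<rho>: "0 < \<rho>" and uu: "metric_at H x u u \<le> \<rho>\<^sup>2" and ee: "metric_at H x e e = 1"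
      and \<phi>: "\<bar>\<phi>\<bar> \<le> 1" and \<psi>: "\<bar>\<psi>\<bar> \<le> P * \<rho>" and s: "\<bar>s\<bar> \<le> s0" for x u e \<phi> \<psi> \<rho> s
  proof -
    have xU: "x \<in> U" using x K(2) by blast
    have s1: "\<bar>s\<bar> \<le> 1" using s by (simp add: s0_def)
    have nu: "norm u \<le> c * \<rho>"
    proof -
      have "sqrt (metric_at H x u u) \<le> \<rho>" using real_sqrt_le_mono[OF uu] \<rho> by simp
      then show ?thesis using nb[OF x, of u] mult_left_mono[of "sqrt (metric_at H x u u)" \<rho> c] pos(6) by linarith
    qed
    have ne: "norm e \<le> c" using nb[OF x, of e] by (simp add: ee)
    define v where "v = \<phi> *\<^sub>R e"
    define b where "b = \<phi>\<^sup>2 *\<^sub>R nvar x e"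
    define p where "p = \<psi> *\<^sub>R e - \<phi> *\<^sub>R gam H x u e"
    define q where "q = (2 * \<phi> * \<psi>) *\<^sub>R nvar x e + \<phi>\<^sup>2 *\<^sub>R dnvar x u e"
    have \<phi>2: "\<phi>\<^sup>2 \<le> 1" "\<bar>\<phi>\<^sup>2\<bar> \<le> 1" using \<phi> by (auto simp: abs_square_le_1)
    have m2: "a * a' \<le> d * d'" if "a \<le> d" "a' \<le> d'" "0 \<le> a'" "0 \<le> d" for a a' d d' :: real
      using that by (intro mult_mono) auto
    have ngee: "norm (gam H x e e) \<le> c * c * c"
      using gb[OF x, of e e] m2[OF mult_left_mono[OF ne pos(6)] ne] pos cc by simp
    have ngue: "norm (gam H x u e) \<le> c * c * c * \<rho>"
    proof -
      have "c * norm u * norm e \<le> c * (c * \<rho>) * c"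
        by (rule m2[OF mult_left_mono[OF nu pos(6)] ne]) (use pos \<rho> in auto)
      then show ?thesis using gb[OF x, of u e] by (simp add: mult_ac)
    qed
    have nn: "norm (nvar x e) \<le> cn"
    proof -
      have "norm (nvar x e) \<le> beta * norm (Z x) + (1/2) * norm (gam H x e e)"
        unfolding nvar_def using norm_triangle_ineq4[of "- (beta *\<^sub>R Z x)" "(1/2) *\<^sub>R gam H x e e"] beta by simp
      also have "\<dots> \<le> 1 * c + 1 * (c * c * c)"
        using beta Zb[OF x] ngee by (intro add_mono m2) auto
      finally show ?thesis by (simp add: cn_def)
    qed
    have nv: "norm v \<le> c"
      using m2[OF \<phi> ne] by (simp add: v_def)
    have nb': "norm b \<le> cn"
      using m2[OF \<phi>2(2) nn] by (simp add: b_def)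
    have nd: "norm (dnvar x u e) \<le> cd * \<rho>"
    proof -
      have "norm (dnvar x u e) \<le> beta * norm (dir_deriv Z x u) + (1/2) * norm (dir_deriv (\<lambda>y. gam H y e e) x u) + norm (gam H x e (gam H x u e))"
        unfolding dnvar_def
        using norm_triangle_ineq[of "- (beta *\<^sub>R dir_deriv Z x u) - (1/2) *\<^sub>R dir_deriv (\<lambda>y. gam H y e e) x u" "gam H x e (gam H x u e)"]
          norm_triangle_ineq4[of "- (beta *\<^sub>R dir_deriv Z x u)" "(1/2) *\<^sub>R dir_deriv (\<lambda>y. gam H y e e) x u"] beta by simp
      also have "\<dots> \<le> 1 * (c * (c * \<rho>)) + 1 * (c * c * c * (c * \<rho>)) + c * c * (c * c * c * \<rho>)"
      proof (intro add_mono)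
        show "beta * norm (dir_deriv Z x u) \<le> 1 * (c * (c * \<rho>))"
          by (rule m2[OF beta(2) order_trans[OF dZb[OF x] mult_left_mono[OF nu pos(6)]]]) auto
        have "c * norm e * norm e * norm u \<le> c * c * c * (c * \<rho>)"
          by (rule m2[OF m2[OF mult_left_mono[OF ne pos(6)] ne] nu]) (use pos in auto)
        then have "norm (dir_deriv (\<lambda>y. gam H y e e) x u) \<le> c * c * c * (c * \<rho>)"
          using dgb[OF x, of e e u] by linarith
        then show "1/2 * norm (dir_deriv (\<lambda>y. gam H y e e) x u) \<le> 1 * (c * c * c * (c * \<rho>))"
          by (intro m2) auto
        have "c * norm e * norm (gam H x u e) \<le> c * c * (c * c * c * \<rho>)"
          by (rule m2[OF mult_left_mono[OF ne pos(6)] ngue]) (use pos in auto)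
        then show "norm (gam H x e (gam H x u e)) \<le> c * c * (c * c * c * \<rho>)"
          using gb[OF x, of e "gam H x u e"] by linarith
      qed
      also have "\<dots> = cd * \<rho>" by (simp add: cd_def algebra_simps)
      finally show ?thesis .
    qed
    have np: "norm p \<le> cp * \<rho>"
    proof -
      have "norm p \<le> \<bar>\<psi>\<bar> * norm e + \<bar>\<phi>\<bar> * norm (gam H x u e)"
        unfolding p_def using norm_triangle_ineq4[of "\<psi> *\<^sub>R e" "\<phi> *\<^sub>R gam H x u e"] by simp
      also have "\<dots> \<le> P * \<rho> * c + 1 * (c * c * c * \<rho>)"
        by (intro add_mono m2 \<psi> ne \<phi> ngue) (use P \<rho> in auto)
      finally show ?thesis by (simp add: cp_def algebra_simps)
    qed
    have nq: "norm q \<le> cq * \<rho>"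
    proof -
      have "norm q \<le> \<bar>2 * \<phi> * \<psi>\<bar> * norm (nvar x e) + \<bar>\<phi>\<^sup>2\<bar> * norm (dnvar x u e)"
        unfolding q_def using norm_triangle_ineq[of "(2 * \<phi> * \<psi>) *\<^sub>R nvar x e" "\<phi>\<^sup>2 *\<^sub>R dnvar x u e"] by simp
      also have "\<dots> \<le> 2 * (P * \<rho>) * cn + 1 * (cd * \<rho>)"
      proof (intro add_mono m2 nn \<phi>2 nd)
        have "\<bar>\<phi>\<bar> * \<bar>\<psi>\<bar> \<le> 1 * (P * \<rho>)" by (rule m2[OF \<phi> \<psi>]) auto
        then show "\<bar>2 * \<phi> * \<psi>\<bar> \<le> 2 * (P * \<rho>)" by (simp add: abs_mult)
      qed (use P \<rho> in auto)
      finally show ?thesis by (simp add: cq_def algebra_simps)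
    qed
    define \<xi> where "\<xi> = s *\<^sub>R v + s\<^sup>2 *\<^sub>R b"
    have s2: "s\<^sup>2 \<le> \<bar>s\<bar>" "s ^ 4 \<le> \<bar>s\<bar> ^ 3"
    proof -
      have "\<bar>s\<bar> ^ 2 \<le> \<bar>s\<bar> ^ 1" "\<bar>s\<bar> ^ 4 \<le> \<bar>s\<bar> ^ 3" by (rule power_decreasing; use s1 in simp)+
      then show "s\<^sup>2 \<le> \<bar>s\<bar>" "s ^ 4 \<le> \<bar>s\<bar> ^ 3" by simp_all
    qed
    have n\<xi>: "norm \<xi> \<le> \<bar>s\<bar> * (c + cn)"
    proof -
      have "norm \<xi> \<le> \<bar>s\<bar> * norm v + s\<^sup>2 * norm b"
        unfolding \<xi>_def using norm_triangle_ineq[of "s *\<^sub>R v" "s\<^sup>2 *\<^sub>R b"] by simp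
      also have "\<dots> \<le> \<bar>s\<bar> * c + \<bar>s\<bar> * cn"
        by (intro add_mono m2 nv nb' s2) auto
      finally show ?thesis by (simp add: distrib_left)
    qed
    have "\<bar>s\<bar> * (c + cn) \<le> r"
    proof -
      have "\<bar>s\<bar> \<le> r / (c + cn)" using s by (simp add: s0_def)
      then show ?thesis using c pos(1) by (simp add: pos_le_divide_eq)
    qed
    then have nr: "norm \<xi> \<le> r" using n\<xi> by linarith
    have y: "yvar x e (s * \<phi>) = x + \<xi>"
      by (simp add: yvar_def \<xi>_def v_def b_def power_mult_distrib)
    have yU: "x + \<xi> \<in> U" using taylor[OF x nr] by blast
    define D2 where "D2 v w = dir_deriv (\<lambda>y. dir_deriv H y v) x w" for v w
    have bil: "bilinear D2" unfolding D2_def by (rule bilinear_second_derivative[OF open_U smooth_H xU])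
    have linH: "linear (dir_deriv H x)" by (rule linear_dir_deriv[OF smooth_H xU])
    \<comment> \<open>Collects the orders three and higher: the Taylor remainder, and the mixed
      terms that arise because the displacement has a quadratic part of its own.\<close>
    define R where "R = H (x + \<xi>) - H x - dir_deriv H x \<xi> - D2 \<xi> \<xi> /\<^sub>R 2
       + (s ^ 3 / 2) *\<^sub>R (D2 v b + D2 b v) + (s ^ 4 / 2) *\<^sub>R D2 b b"
    have HR: "H (x + \<xi>) = H x + s *\<^sub>R dir_deriv H x v + s\<^sup>2 *\<^sub>R (dir_deriv H x b + D2 v v /\<^sub>R 2) + R"
    proof -
      have "dir_deriv H x \<xi> = s *\<^sub>R dir_deriv H x v + s\<^sup>2 *\<^sub>R dir_deriv H x b"
        unfolding \<xi>_def using linH by (simp add: linear_add linear_scale)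
      moreover have "D2 \<xi> \<xi> = s\<^sup>2 *\<^sub>R D2 v v + s ^ 3 *\<^sub>R (D2 v b + D2 b v) + s ^ 4 *\<^sub>R D2 b b"
        unfolding \<xi>_def bilinear_ladd[OF bil] bilinear_radd[OF bil] bilinear_lmul[OF bil] bilinear_rmul[OF bil]
        by (simp add: algebra_simps eval_nat_numeral)
      ultimately show ?thesis unfolding R_def by (simp add: algebra_simps scaleR_half_double)
    qed
    have nD2: "norm (D2 a a') \<le> c * norm a * norm a'" for a a' unfolding D2_def by (rule ddHb[OF x])
    have nvb: "norm (D2 v b) \<le> c * c * cn" "norm (D2 b v) \<le> c * c * cn" "norm (D2 b b) \<le> c * cn * cn" "norm (D2 v v) \<le> c * c * c"
    proof -
      show "norm (D2 v b) \<le> c * c * cn"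
        by (rule order_trans[OF nD2 m2[OF mult_left_mono[OF nv pos(6)] nb']]) (use pos in auto)
      have "norm (D2 b v) \<le> c * cn * c"
        by (rule order_trans[OF nD2 m2[OF mult_left_mono[OF nb' pos(6)] nv]]) (use pos in auto)
      then show "norm (D2 b v) \<le> c * c * cn" by (simp add: mult_ac)
      show "norm (D2 b b) \<le> c * cn * cn"
        by (rule order_trans[OF nD2 m2[OF mult_left_mono[OF nb' pos(6)] nb']]) (use pos in auto)
      show "norm (D2 v v) \<le> c * c * c"
        by (rule order_trans[OF nD2 m2[OF mult_left_mono[OF nv pos(6)] nv]]) (use pos in auto)
    qed
    have nR: "norm R \<le> B * \<bar>s\<bar> ^ 3"
    proof -
      have "norm R \<le> norm (H (x + \<xi>) - H x - dir_deriv H x \<xi> - D2 \<xi> \<xi> /\<^sub>R 2)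
          + norm ((s ^ 3 / 2) *\<^sub>R (D2 v b + D2 b v)) + norm ((s ^ 4 / 2) *\<^sub>R D2 b b)"
        unfolding R_def by (intro order_trans[OF norm_triangle_ineq] add_mono norm_triangle_ineq order_refl)
      also have "\<dots> \<le> CT * (\<bar>s\<bar> ^ 3 * (c + cn) ^ 3) + \<bar>s\<bar> ^ 3 * (c * c * cn) + \<bar>s\<bar> ^ 3 * (c * cn * cn)"
      proof (intro add_mono)
        have "norm \<xi> ^ 3 \<le> (\<bar>s\<bar> * (c + cn)) ^ 3" by (rule power_mono[OF n\<xi>]) simp
        then have "CT * norm \<xi> ^ 3 \<le> CT * (\<bar>s\<bar> ^ 3 * (c + cn) ^ 3)"
          using CT by (intro mult_left_mono) (simp_all add: power_mult_distrib)
        then show "norm (H (x + \<xi>) - H x - dir_deriv H x \<xi> - D2 \<xi> \<xi> /\<^sub>R 2) \<le> CT * (\<bar>s\<bar> ^ 3 * (c + cn) ^ 3)"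
          using taylor[OF x nr] unfolding D2_def by linarith
        have "norm (D2 v b + D2 b v) \<le> 2 * (c * c * cn)" using norm_triangle_ineq[of "D2 v b" "D2 b v"] nvb by linarith
        then have "\<bar>s\<bar> ^ 3 / 2 * norm (D2 v b + D2 b v) \<le> \<bar>s\<bar> ^ 3 / 2 * (2 * (c * c * cn))" by (intro mult_left_mono) auto
        then show "norm ((s ^ 3 / 2) *\<^sub>R (D2 v b + D2 b v)) \<le> \<bar>s\<bar> ^ 3 * (c * c * cn)" by (simp add: power_abs)
        have "s ^ 4 / 2 * norm (D2 b b) \<le> \<bar>s\<bar> ^ 3 * (c * cn * cn)"
        proof (rule m2[OF _ nvb(3)])
          show "s ^ 4 / 2 \<le> \<bar>s\<bar> ^ 3" using s2(2) zero_le_power[of "\<bar>s\<bar>" 3] by linarith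
        qed auto
        then show "norm ((s ^ 4 / 2) *\<^sub>R D2 b b) \<le> \<bar>s\<bar> ^ 3 * (c * cn * cn)" by simp
      qed
      also have "\<dots> = cR * \<bar>s\<bar> ^ 3" by (simp add: cR_def algebra_simps)
      also have "\<dots> \<le> B * \<bar>s\<bar> ^ 3" by (rule mult_right_mono[OF B(5)]) simp
      finally show ?thesis .
    qed
    have nM: "norm (H x) \<le> B" "norm (dir_deriv H x v) \<le> B" "norm (dir_deriv H x b + D2 v v /\<^sub>R 2) \<le> B"
    proof -
      show "norm (H x) \<le> B" using Hb[OF x] B by linarith
      show "norm (dir_deriv H x v) \<le> B"
        using dHb[OF x, of v] mult_left_mono[OF nv pos(6)] B by linarith
      have "norm (dir_deriv H x b + D2 v v /\<^sub>R 2) \<le> norm (dir_deriv H x b) + norm (D2 v v) / 2"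
        using norm_triangle_ineq[of "dir_deriv H x b" "D2 v v /\<^sub>R 2"] by simp
      also have "\<dots> \<le> c * cn + c * c * c"
        using dHb[OF x, of b] mult_left_mono[OF nb' pos(6)] nvb(4) norm_ge_zero[of "D2 v v"] by linarith
      finally show "norm (dir_deriv H x b + D2 v v /\<^sub>R 2) \<le> B" using B by linarith
    qed
    have up: "norm u \<le> B * \<rho>" "norm p \<le> B * \<rho>" "norm q \<le> B * \<rho>"
      using nu np nq mult_right_mono[OF B(2), of \<rho>] mult_right_mono[OF B(6), of \<rho>] mult_right_mono[OF B(7), of \<rho>] \<rho>
      by linarith+
    have q1: "qform (dir_deriv H x a) a' a'' = dir_deriv (\<lambda>y. metric_at H y a' a'') x a" for a a' a''
      unfolding metric_at_qform
      by (rule dir_deriv_bounded_linear[OF bounded_linear_qform smooth_on_differentiable[OF smooth_H xU], symmetric])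
    have q2: "qform (D2 v v) u u = dir_deriv (\<lambda>y. dir_deriv (\<lambda>y. metric_at H y u u) y v) x v"
    proof -
      have "qform (D2 v v) u u = dir_deriv (\<lambda>y. qform (dir_deriv H y v) u u) x v"
        unfolding D2_def
        by (rule dir_deriv_bounded_linear[OF bounded_linear_qform smooth_on_differentiable[OF smooth_on_dir_deriv[OF open_U smooth_H] xU], symmetric])
      also have "\<dots> = dir_deriv (\<lambda>y. dir_deriv (\<lambda>y. metric_at H y u u) y v) x v"
        unfolding metric_at_qform
        by (rule dir_deriv_cong[OF open_U xU], rule dir_deriv_bounded_linear[OF bounded_linear_qform, symmetric],
            rule smooth_on_differentiable[OF smooth_H])
      finally show ?thesis .
    qed
    note vc = variation_coefficients[OF xU ee, where u = u and \<phi> = \<phi> and \<psi> = \<psi>, folded v_def p_def q_def b_def]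
    let ?y' = "dyvar x u e (s * \<phi>) (s * \<psi>)"
    let ?c2 = "\<psi>\<^sup>2 + \<phi>\<^sup>2 * metric_at H x u (curv H x e u e)
        - 4 * beta * \<phi> * \<psi> * metric_at H x u (Z x) - 2 * beta * \<phi>\<^sup>2 * metric_at H x u (S x u)"
    have y': "?y' = u + s *\<^sub>R p + s\<^sup>2 *\<^sub>R q"
      unfolding dyvar_expand p_def q_def ..
    have lin1: "qform (H x) u p + qform (H x) p u + qform (dir_deriv H x v) u u = 2 * \<psi> * metric_at H x u e"
      unfolding q1 metric_at_qform[symmetric, of H x] using vc(1) metric_sym[OF xU, of p u] by linarith
    have up_sym: "dir_deriv (\<lambda>y. metric_at H y p u) x v = dir_deriv (\<lambda>y. metric_at H y u p) x v"
      by (rule dir_deriv_cong[OF open_U xU metric_sym])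
    have m0: "qform (H x) a c = metric_at H x a c" for a c by (simp add: metric_at_qform)
    have M2: "qform (dir_deriv H x b + D2 v v /\<^sub>R 2) u u = dir_deriv (\<lambda>y. metric_at H y u u) x b
        + dir_deriv (\<lambda>y. dir_deriv (\<lambda>y. metric_at H y u u) y v) x v / 2"
      unfolding qform_simps q1 q2 by simp
    have quad: "qform (H x) p p + qform (H x) u q + qform (H x) q u + qform (dir_deriv H x v) u p + qform (dir_deriv H x v) p u
        + qform (dir_deriv H x b + D2 v v /\<^sub>R 2) u u = ?c2"
      unfolding M2 m0 q1 using vc(2) metric_sym[OF xU, of q u] up_sym by linarith
    have "metric_at H (x + \<xi>) ?y' ?y' \<le> qform (H x) u u + s * (2 * \<psi> * metric_at H x u e) + s\<^sup>2 * ?c2 + 26 * k * B ^ 3 * \<bar>s\<bar> ^ 3 * \<rho>\<^sup>2"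
      unfolding metric_at_qform[of H "x + \<xi>"] HR y'
      using cubic_remainder[OF Q k s1 B(1) nM nR up less_imp_le[OF \<rho>]] unfolding lin1 quad .
    also have "\<dots> \<le> \<rho>\<^sup>2 + (s * (2 * \<psi> * metric_at H x u e) + s\<^sup>2 * ?c2 + 26 * k * B ^ 3 * \<bar>s\<bar> ^ 3 * \<rho>\<^sup>2)"
      using uu by (simp add: metric_at_qform)
    finally have "sqrt (metric_at H (x + \<xi>) ?y' ?y') \<le> \<rho> + (s * (2 * \<psi> * metric_at H x u e) + s\<^sup>2 * ?c2 + 26 * k * B ^ 3 * \<bar>s\<bar> ^ 3 * \<rho>\<^sup>2) / (2 * \<rho>)"
      by (rule sqrt_le_tangent[OF \<rho> metric_nonneg[OF yU]])
    also have "\<dots> = \<rho> + s * (\<psi> * metric_at H x u e / \<rho>) + s\<^sup>2 / (2 * \<rho>) * ?c2 + C * \<bar>s\<bar> ^ 3 * \<rho>"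
      using \<rho> by (simp add: C_def add_divide_distrib power2_eq_square)
    finally show ?thesis unfolding y using yU by blast
  qed
  show ?thesis
    by (rule exI[of _ C], rule conjI[OF C], rule exI[of _ s0], rule conjI[OF s0]) (use main in blast)
qed

text \<open>Terms odd in s cancel between opposite signs. Over the frame the curvature gives -Ric(u,
  u), and the gradient terms add up with weight \<open>2 * CARD('a) * beta = 1\<close> to -Hess F(u,
  u); the soliton equation merges the two into -lam g(u, u).\<close>

lemma variation_frame_sum:
  fixes s \<phi> \<psi> \<rho> C :: real
  assumes x: "x \<in> U" and E: "frame H x E" and \<rho>: "\<rho> > 0"
  shows "(\<Sum>(i, b)\<in>UNIV. \<rho> + (if b then s else - s) * (\<psi> * metric_at H x u (E i) / \<rho>)
      + (if b then s else - s)\<^sup>2 / (2 * \<rho>) * (\<psi>\<^sup>2 + \<phi>\<^sup>2 * metric_at H x u (curv H x (E i) u (E i))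
        - 4 * beta * \<phi> * \<psi> * metric_at H x u (Z x) - 2 * beta * \<phi>\<^sup>2 * metric_at H x u (S x u))
      + C * \<bar>if b then s else - s\<bar> ^ 3 * \<rho>)
    = 2 * CARD('a) * \<rho> + s\<^sup>2 * ((CARD('a) * \<psi>\<^sup>2 - lam * \<phi>\<^sup>2 * metric_at H x u u - 2 * \<phi> * \<psi> * dir_deriv F x u) / \<rho>)
      + 2 * CARD('a) * C * \<bar>s\<bar> ^ 3 * \<rho>"
proof -
  let ?W = "\<psi>\<^sup>2 - 4 * beta * \<phi> * \<psi> * metric_at H x u (Z x) - 2 * beta * \<phi>\<^sup>2 * metric_at H x u (S x u)"
  have split: "(\<Sum>(i, b)\<in>UNIV. h i b) = (\<Sum>i\<in>UNIV. h i True + h i False)" for h :: "'a \<Rightarrow> bool \<Rightarrow> real"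
  proof -
    have "(\<Sum>(i, b)\<in>UNIV. h i b) = (\<Sum>i\<in>UNIV. \<Sum>b\<in>UNIV. h i b)"
      by (simp add: sum.cartesian_product UNIV_Times_UNIV[symmetric] del: UNIV_Times_UNIV)
    then show ?thesis by (simp add: UNIV_bool add.commute)
  qed
  have mu: "metric_at H x u (Z x) = dir_deriv F x u"
    using metric_Z[OF x, of u] metric_sym[OF x, of u "Z x"] by simp
  have ric: "ricci H x u u = lam * metric_at H x u u - metric_at H x u (S x u)"
    using ricci_S[OF x, of u u] metric_sym[OF x, of "S x u" u] by (simp only: metric_at_simps real_scaleR_def)
  have n: "2 * CARD('a) * beta = 1" by (rule beta(3))
  have "(\<Sum>i\<in>UNIV. ?W + \<phi>\<^sup>2 * metric_at H x u (curv H x (E i) u (E i))) = CARD('a) * ?W - \<phi>\<^sup>2 * ricci H x u u"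
    unfolding sum.distrib sum_distrib_left[symmetric] ricci_frame[OF x E] by simp
  also have "\<dots> = CARD('a) * \<psi>\<^sup>2 - (2 * CARD('a) * beta) * (2 * \<phi> * \<psi> * dir_deriv F x u + \<phi>\<^sup>2 * metric_at H x u (S x u))
      - \<phi>\<^sup>2 * ricci H x u u"
    unfolding mu by (simp add: algebra_simps)
  also have "\<dots> = CARD('a) * \<psi>\<^sup>2 - lam * \<phi>\<^sup>2 * metric_at H x u u - 2 * \<phi> * \<psi> * dir_deriv F x u"
    unfolding n ric by (simp add: algebra_simps)
  finally have key: "(\<Sum>i\<in>UNIV. ?W + \<phi>\<^sup>2 * metric_at H x u (curv H x (E i) u (E i)))
      = CARD('a) * \<psi>\<^sup>2 - lam * \<phi>\<^sup>2 * metric_at H x u u - 2 * \<phi> * \<psi> * dir_deriv F x u" .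
  have "(\<Sum>i\<in>UNIV. (2 * \<rho> + 2 * C * \<bar>s\<bar> ^ 3 * \<rho>) + (s\<^sup>2 / \<rho>) * (?W + \<phi>\<^sup>2 * metric_at H x u (curv H x (E i) u (E i))))
      = CARD('a) * (2 * \<rho> + 2 * C * \<bar>s\<bar> ^ 3 * \<rho>) + (s\<^sup>2 / \<rho>) * (\<Sum>i\<in>UNIV. ?W + \<phi>\<^sup>2 * metric_at H x u (curv H x (E i) u (E i)))"
    unfolding sum.distrib[of "\<lambda>_. 2 * \<rho> + 2 * C * \<bar>s\<bar> ^ 3 * \<rho>"] sum_distrib_left[of "s\<^sup>2 / \<rho>", symmetric]
    by simp
  also have "\<dots> = 2 * CARD('a) * \<rho> + s\<^sup>2 * ((CARD('a) * \<psi>\<^sup>2 - lam * \<phi>\<^sup>2 * metric_at H x u u - 2 * \<phi> * \<psi> * dir_deriv F x u) / \<rho>)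
      + 2 * CARD('a) * C * \<bar>s\<bar> ^ 3 * \<rho>"
    unfolding key by (simp add: algebra_simps add_divide_distrib diff_divide_distrib)
  finally have "(\<Sum>i\<in>UNIV. (2 * \<rho> + 2 * C * \<bar>s\<bar> ^ 3 * \<rho>) + (s\<^sup>2 / \<rho>) * (?W + \<phi>\<^sup>2 * metric_at H x u (curv H x (E i) u (E i))))
      = 2 * CARD('a) * \<rho> + s\<^sup>2 * ((CARD('a) * \<psi>\<^sup>2 - lam * \<phi>\<^sup>2 * metric_at H x u u - 2 * \<phi> * \<psi> * dir_deriv F x u) / \<rho>)
      + 2 * CARD('a) * C * \<bar>s\<bar> ^ 3 * \<rho>" .
  moreover have "(\<rho> + s * (\<psi> * metric_at H x u (E i) / \<rho>) + s\<^sup>2 / (2 * \<rho>) * (\<psi>\<^sup>2 + \<phi>\<^sup>2 * metric_at H x u (curv H x (E i) u (E i))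
        - 4 * beta * \<phi> * \<psi> * metric_at H x u (Z x) - 2 * beta * \<phi>\<^sup>2 * metric_at H x u (S x u)) + C * \<bar>s\<bar> ^ 3 * \<rho>)
     + (\<rho> + (- s) * (\<psi> * metric_at H x u (E i) / \<rho>) + (- s)\<^sup>2 / (2 * \<rho>) * (\<psi>\<^sup>2 + \<phi>\<^sup>2 * metric_at H x u (curv H x (E i) u (E i))
        - 4 * beta * \<phi> * \<psi> * metric_at H x u (Z x) - 2 * beta * \<phi>\<^sup>2 * metric_at H x u (S x u)) + C * \<bar>- s\<bar> ^ 3 * \<rho>)
     = (2 * \<rho> + 2 * C * \<bar>s\<bar> ^ 3 * \<rho>) + (s\<^sup>2 / \<rho>) * (?W + \<phi>\<^sup>2 * metric_at H x u (curv H x (E i) u (E i)))" for i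
  proof -
    have "(\<rho> + s * y + s\<^sup>2 / (2 * \<rho>) * X + C * \<bar>s\<bar> ^ 3 * \<rho>) + (\<rho> + (- s) * y + (- s)\<^sup>2 / (2 * \<rho>) * X + C * \<bar>- s\<bar> ^ 3 * \<rho>)
      = (2 * \<rho> + 2 * C * \<bar>s\<bar> ^ 3 * \<rho>) + (s\<^sup>2 / \<rho>) * X" for X y
      using \<rho> by (simp add: field_simps)
    moreover have "\<psi>\<^sup>2 + m - n - k = (\<psi>\<^sup>2 - n - k) + m" for m n k :: real by simp
    ultimately show ?thesis by (simp only:)
  qed
  ultimately show ?thesis
    unfolding split if_True if_False by (simp only:)
qed

lemma yvar_derivative:
  assumes xU: "x t \<in> U" and x: "(x has_vector_derivative u) (at t within T)"
    and e: "(e has_vector_derivative - gam H (x t) u (e t)) (at t within T)"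
    and \<tau>: "(\<tau> has_vector_derivative \<tau>') (at t within T)"
  shows "((\<lambda>t. yvar (x t) (e t) (\<tau> t)) has_vector_derivative dyvar (x t) u (e t) (\<tau> t) \<tau>') (at t within T)"
proof -
  have Z: "((\<lambda>t. Z (x t)) has_vector_derivative dir_deriv Z (x t) u) (at t within T)"
  proof -
    have "((\<lambda>t. Z (x t)) has_derivative (\<lambda>h. dir_deriv Z (x t) (h *\<^sub>R u))) (at t within T)"
      by (rule has_derivative_compose[OF x[unfolded has_vector_derivative_def], of Z])
        (rule smooth_on_has_derivative[OF smooth_Z xU])
    then show ?thesis
      unfolding has_vector_derivative_def by (simp add: linear_scale[OF linear_dir_deriv[OF smooth_Z xU]])
  qed
  have G: "((\<lambda>t. gam H (x t) (e t) (e t)) has_vector_derivative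
      dir_deriv (\<lambda>y. gam H y (e t) (e t)) (x t) u - 2 *\<^sub>R gam H (x t) (e t) (gam H (x t) u (e t))) (at t within T)"
  proof -
    note d = has_derivative_bilinear_field[OF bilinear_gam diff_gam[OF xU]
        x[unfolded has_vector_derivative_def] e[unfolded has_vector_derivative_def] e[unfolded has_vector_derivative_def]]
    have "(\<lambda>h. dir_deriv (\<lambda>y. gam H y (e t) (e t)) (x t) (h *\<^sub>R u) + gam H (x t) (h *\<^sub>R - gam H (x t) u (e t)) (e t)
         + gam H (x t) (e t) (h *\<^sub>R - gam H (x t) u (e t)))
       = (\<lambda>h. h *\<^sub>R (dir_deriv (\<lambda>y. gam H y (e t) (e t)) (x t) u - 2 *\<^sub>R gam H (x t) (e t) (gam H (x t) u (e t))))"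
    proof
      fix h
      have "dir_deriv (\<lambda>y. gam H y (e t) (e t)) (x t) (h *\<^sub>R u) = h *\<^sub>R dir_deriv (\<lambda>y. gam H y (e t) (e t)) (x t) u"
        by (rule linear_scale[OF linear_dir_deriv[OF smooth_gam xU]])
      moreover have "gam H (x t) (gam H (x t) u (e t)) (e t) = gam H (x t) (e t) (gam H (x t) u (e t))"
        by (rule gam_sym[OF xU])
      ultimately show "dir_deriv (\<lambda>y. gam H y (e t) (e t)) (x t) (h *\<^sub>R u) + gam H (x t) (h *\<^sub>R - gam H (x t) u (e t)) (e t)
         + gam H (x t) (e t) (h *\<^sub>R - gam H (x t) u (e t))
         = h *\<^sub>R (dir_deriv (\<lambda>y. gam H y (e t) (e t)) (x t) u - 2 *\<^sub>R gam H (x t) (e t) (gam H (x t) u (e t)))"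
        by (simp add: gam_simps algebra_simps scaleR_2)
    qed
    then show ?thesis unfolding has_vector_derivative_def using d by simp
  qed
  have N: "((\<lambda>t. nvar (x t) (e t)) has_vector_derivative dnvar (x t) u (e t)) (at t within T)"
  proof -
    have "((\<lambda>t. - (beta *\<^sub>R Z (x t)) - (1/2) *\<^sub>R gam H (x t) (e t) (e t)) has_vector_derivative
      - (beta *\<^sub>R dir_deriv Z (x t) u) - (1/2) *\<^sub>R (dir_deriv (\<lambda>y. gam H y (e t) (e t)) (x t) u
        - 2 *\<^sub>R gam H (x t) (e t) (gam H (x t) u (e t)))) (at t within T)"
      by (intro has_vector_derivative_diff has_vector_derivative_minus
          bounded_linear.has_vector_derivative[OF bounded_linear_scaleR_right] Z G)
    then show ?thesis unfolding nvar_def dnvar_def by (simp add: algebra_simps)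
  qed
  have sq: "((\<lambda>t. (\<tau> t)\<^sup>2) has_vector_derivative 2 * \<tau> t * \<tau>') (at t within T)"
    using has_vector_derivative_mult[OF \<tau> \<tau>] by (simp add: power2_eq_square algebra_simps)
  have "((\<lambda>t. x t + \<tau> t *\<^sub>R e t + (\<tau> t)\<^sup>2 *\<^sub>R nvar (x t) (e t)) has_vector_derivative
     u + (\<tau> t *\<^sub>R - gam H (x t) u (e t) + \<tau>' *\<^sub>R e t) + ((\<tau> t)\<^sup>2 *\<^sub>R dnvar (x t) u (e t) + (2 * \<tau> t * \<tau>') *\<^sub>R nvar (x t) (e t))) (at t within T)"
    by (intro has_vector_derivative_add x has_vector_derivative_scaleR e N
        \<tau>[unfolded has_real_derivative_iff_has_vector_derivative[symmetric]]
        sq[unfolded has_real_derivative_iff_has_vector_derivative[symmetric]])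
  then show ?thesis unfolding yvar_def dyvar_def by (simp add: algebra_simps)
qed

section \<open>Continuity and parallel frames along a curve\<close>

lemma bilinear_family_continuous:
  fixes B :: "real \<Rightarrow> real^'m \<Rightarrow> real^'l \<Rightarrow> 'c::real_normed_vector"
  assumes "\<And>t. t \<in> T \<Longrightarrow> bilinear (B t)" "\<And>v w. continuous_on T (\<lambda>t. B t v w)" "continuous_on T v" "continuous_on T w"
  shows "continuous_on T (\<lambda>t. B t (v t) (w t))"
proof -
  have "continuous_on T (\<lambda>t. \<Sum>i\<in>UNIV. \<Sum>j\<in>UNIV. (v t $ i * w t $ j) *\<^sub>R B t (axis i 1) (axis j 1))"
    by (intro continuous_on_sum continuous_on_scaleR continuous_on_mult continuous_on_component assms)
  then show ?thesis
    by (rule continuous_on_eq) (rule bilinear_eq_sum[OF assms(1), symmetric])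
qed

lemma dir_deriv_continuous:
  assumes h: "smooth_on U h" and x: "continuous_on T x" "x ` T \<subseteq> U" and u: "continuous_on T u"
  shows "continuous_on T (\<lambda>t. dir_deriv h (x t) (u t))"
proof -
  have "continuous_on T (\<lambda>t. \<Sum>i\<in>UNIV. u t $ i *\<^sub>R coord_deriv i h (x t))"
    by (intro continuous_on_sum continuous_on_scaleR continuous_on_component u
        continuous_on_compose2[OF smooth_on_continuous_on[OF smooth_on_coord_deriv[OF h]] x])
  then show ?thesis
    by (rule continuous_on_eq) (rule dir_deriv_eq_sum[OF smooth_on_differentiable[OF h], symmetric], use x(2) in auto)
qed

lemma gam_continuous:
  fixes x v w :: "real \<Rightarrow> real^'a"
  assumes "continuous_on T x" "x ` T \<subseteq> U" "continuous_on T v" "continuous_on T w"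
  shows "continuous_on T (\<lambda>t. gam H (x t) (v t) (w t))"
  by (rule bilinear_family_continuous[where B = "\<lambda>t. gam H (x t)", OF bilinear_gam _ assms(3,4)])
    (rule continuous_on_compose2[OF smooth_on_continuous_on[OF smooth_gam] assms(1,2)])

lemma dyvar_continuous:
  fixes x u e :: "real \<Rightarrow> real^'a"
  assumes x: "continuous_on T x" "x ` T \<subseteq> U" and u: "continuous_on T u" and e: "continuous_on T e"
    and \<tau>: "continuous_on T \<tau>" "continuous_on T \<tau>'"
  shows "continuous_on T (\<lambda>t. dyvar (x t) (u t) (e t) (\<tau> t) (\<tau>' t))"
proof -
  have dg: "continuous_on T (\<lambda>t. dir_deriv (\<lambda>y. gam H y (e t) (e t)) (x t) (u t))"
    by (rule bilinear_family_continuous[OF bilinear_dgam dir_deriv_continuous[OF smooth_gam x u] e e]) (use x(2) in auto)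
  have ZZ: "continuous_on T (\<lambda>t. Z (x t))"
    by (rule continuous_on_compose2[OF smooth_on_continuous_on[OF smooth_Z] x])
  show ?thesis
    unfolding dyvar_def nvar_def dnvar_def
    by (intro continuous_on_add continuous_on_diff continuous_on_minus continuous_on_scaleR continuous_on_mult continuous_on_power
        continuous_on_const x u e \<tau> ZZ dg gam_continuous dir_deriv_continuous[OF smooth_Z])
qed

text \<open>Metric compatibility makes the inner products of parallel fields constant.\<close>

lemma parallel_frame:
  assumes x: "\<And>t. t \<in> {a..b} \<Longrightarrow> (x has_vector_derivative u t) (at t within {a..b})" "x ` {a..b} \<subseteq> U"
    and e: "\<And>i t. t \<in> {a..b} \<Longrightarrow> (e i has_vector_derivative - gam H (x t) (u t) (e i t)) (at t within {a..b})"
    and E: "frame H (x a) (\<lambda>i. e i a)" and t: "t \<in> {a..b}"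
  shows "frame H (x t) (\<lambda>i. e i t)"
proof -
  have "metric_at H (x t) (e i t) (e j t) = metric_at H (x a) (e i a) (e j a)" for i j
  proof -
    have z: "((\<lambda>t. metric_at H (x t) (e i t) (e j t)) has_derivative (\<lambda>h. 0)) (at t within {a..b})" if t: "t \<in> {a..b}" for t
    proof -
      have xU: "x t \<in> U" using x(2) t by auto
      note d = has_derivative_bilinear_field[OF bilinear_metric_at diff_metric[OF xU]
          x(1)[OF t, unfolded has_vector_derivative_def] e[OF t, unfolded has_vector_derivative_def, of i]
          e[OF t, unfolded has_vector_derivative_def, of j]]
      have "(\<lambda>h. dir_deriv (\<lambda>y. metric_at H y (e i t) (e j t)) (x t) (h *\<^sub>R u t)
         + metric_at H (x t) (h *\<^sub>R - gam H (x t) (u t) (e i t)) (e j t)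
         + metric_at H (x t) (e i t) (h *\<^sub>R - gam H (x t) (u t) (e j t))) = (\<lambda>h. 0)"
        by (rule ext) (simp add: metric_compat[OF xU] metric_at_simps gam_simps)
      then show ?thesis using d by simp
    qed
    have "convex {a..b}" by (simp add: convex_real_interval)
    then have "\<exists>k. \<forall>t\<in>{a..b}. metric_at H (x t) (e i t) (e j t) = k"
      by (rule has_derivative_zero_constant) (rule z)
    then obtain k where k: "\<And>t. t \<in> {a..b} \<Longrightarrow> metric_at H (x t) (e i t) (e j t) = k" by blast
    have "a \<in> {a..b}" using t by auto
    then show ?thesis using k[OF t] k[of a] by simp
  qed
  then show ?thesis using E unfolding frame_def by simp
qed

end

context soliton_domain begin

text \<open>Names the conclusion of \<open>variation_pointwise\<close>. It is preserved when
  \<open>C\<close> grows and \<open>s0\<close> shrinks, and can so be made uniform over finitely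
  many patches.\<close>

definition good_consts :: "(real^'a) set \<Rightarrow> real \<Rightarrow> real \<Rightarrow> real \<Rightarrow> bool" where
  "good_consts K P C s0 \<longleftrightarrow> (\<forall>x\<in>K. \<forall>u e \<phi> \<psi> \<rho> s.
    0 < \<rho> \<and> metric_at H x u u \<le> \<rho>\<^sup>2 \<and> metric_at H x e e = 1 \<and> \<bar>\<phi>\<bar> \<le> 1 \<and> \<bar>\<psi>\<bar> \<le> P * \<rho> \<and> \<bar>s\<bar> \<le> s0 \<longrightarrow>
    yvar x e (s * \<phi>) \<in> U \<and>
    sqrt (metric_at H (yvar x e (s * \<phi>)) (dyvar x u e (s * \<phi>) (s * \<psi>)) (dyvar x u e (s * \<phi>) (s * \<psi>)))
      \<le> \<rho> + s * (\<psi> * metric_at H x u e / \<rho>) + s\<^sup>2 / (2 * \<rho>) * (\<psi>\<^sup>2 + \<phi>\<^sup>2 * metric_at H x u (curv H x e u e)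
        - 4 * beta * \<phi> * \<psi> * metric_at H x u (Z x) - 2 * beta * \<phi>\<^sup>2 * metric_at H x u (S x u)) + C * \<bar>s\<bar> ^ 3 * \<rho>)"

lemma good_consts_exist:
  "compact K \<Longrightarrow> K \<subseteq> U \<Longrightarrow> P \<ge> 0 \<Longrightarrow> \<exists>C\<ge>0. \<exists>s0>0. good_consts K P C s0"
  unfolding good_consts_def by (rule variation_pointwise)

lemma good_consts_frame:
  fixes P C s0 \<rho> \<phi> \<psi> s :: real
  assumes gc: "good_consts K P C s0" and K: "K \<subseteq> U" and x: "x \<in> K" and E: "frame H x E"
    and \<rho>: "0 < \<rho>" "metric_at H x u u \<le> \<rho>\<^sup>2" and \<phi>: "\<bar>\<phi>\<bar> \<le> 1" "\<bar>\<psi>\<bar> \<le> P * \<rho>" and s: "0 < s" "s \<le> s0"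
  shows "yvar x (E i) ((if b then s else - s) * \<phi>) \<in> U"
    and "(\<Sum>(i, b)\<in>UNIV. sqrt (metric_at H (yvar x (E i) ((if b then s else - s) * \<phi>))
       (dyvar x u (E i) ((if b then s else - s) * \<phi>) ((if b then s else - s) * \<psi>))
       (dyvar x u (E i) ((if b then s else - s) * \<phi>) ((if b then s else - s) * \<psi>))))
      \<le> 2 * real CARD('a) * \<rho> + s\<^sup>2 * ((real CARD('a) * \<psi>\<^sup>2 - lam * \<phi>\<^sup>2 * metric_at H x u u - 2 * \<phi> * \<psi> * dir_deriv F x u) / \<rho>)
      + 2 * real CARD('a) * C * s ^ 3 * \<rho>"
proof -
  have xU: "x \<in> U" using x K by blast
  define sg where "sg b = (if b then s else - s)" for b
  have sg: "\<bar>sg b\<bar> \<le> s0" for b using s by (simp add: sg_def)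
  have ee: "metric_at H x (E i) (E i) = 1" for i using E by (simp add: frame_def)
  note gi = gc[unfolded good_consts_def, rule_format, OF x, of \<rho> u "E _" \<phi> \<psi> "sg _", OF conjI[OF \<rho>(1) conjI[OF \<rho>(2) conjI[OF ee conjI[OF \<phi>(1) conjI[OF \<phi>(2) sg]]]]]]
  show "yvar x (E i) ((if b then s else - s) * \<phi>) \<in> U"
    using gi[of i b] unfolding sg_def by blast
  have "(\<Sum>(i, b)\<in>UNIV. sqrt (metric_at H (yvar x (E i) (sg b * \<phi>)) (dyvar x u (E i) (sg b * \<phi>) (sg b * \<psi>)) (dyvar x u (E i) (sg b * \<phi>) (sg b * \<psi>))))
     \<le> (\<Sum>(i, b)\<in>UNIV. \<rho> + sg b * (\<psi> * metric_at H x u (E i) / \<rho>)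
      + (sg b)\<^sup>2 / (2 * \<rho>) * (\<psi>\<^sup>2 + \<phi>\<^sup>2 * metric_at H x u (curv H x (E i) u (E i))
        - 4 * beta * \<phi> * \<psi> * metric_at H x u (Z x) - 2 * beta * \<phi>\<^sup>2 * metric_at H x u (S x u))
      + C * \<bar>sg b\<bar> ^ 3 * \<rho>)"
  proof (rule sum_mono)
    fix ib :: "'a \<times> bool" assume "ib \<in> UNIV"
    obtain i b where ib: "ib = (i, b)" by (cases ib)
    show "(case ib of (i, b) \<Rightarrow> sqrt (metric_at H (yvar x (E i) (sg b * \<phi>)) (dyvar x u (E i) (sg b * \<phi>) (sg b * \<psi>)) (dyvar x u (E i) (sg b * \<phi>) (sg b * \<psi>))))
      \<le> (case ib of (i, b) \<Rightarrow> \<rho> + sg b * (\<psi> * metric_at H x u (E i) / \<rho>)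
      + (sg b)\<^sup>2 / (2 * \<rho>) * (\<psi>\<^sup>2 + \<phi>\<^sup>2 * metric_at H x u (curv H x (E i) u (E i))
        - 4 * beta * \<phi> * \<psi> * metric_at H x u (Z x) - 2 * beta * \<phi>\<^sup>2 * metric_at H x u (S x u))
      + C * \<bar>sg b\<bar> ^ 3 * \<rho>)"
      unfolding ib prod.case using gi[of i b] by blast
  qed
  also have "\<dots> = 2 * real CARD('a) * \<rho> + s\<^sup>2 * ((real CARD('a) * \<psi>\<^sup>2 - lam * \<phi>\<^sup>2 * metric_at H x u u - 2 * \<phi> * \<psi> * dir_deriv F x u) / \<rho>)
      + 2 * real CARD('a) * C * s ^ 3 * \<rho>"
    using variation_frame_sum[OF xU E \<rho>(1), of s \<psi> u \<phi> C] s(1) unfolding sg_def by simp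
  finally show "(\<Sum>(i, b)\<in>UNIV. sqrt (metric_at H (yvar x (E i) ((if b then s else - s) * \<phi>))
       (dyvar x u (E i) ((if b then s else - s) * \<phi>) ((if b then s else - s) * \<psi>))
       (dyvar x u (E i) ((if b then s else - s) * \<phi>) ((if b then s else - s) * \<psi>))))
      \<le> 2 * real CARD('a) * \<rho> + s\<^sup>2 * ((real CARD('a) * \<psi>\<^sup>2 - lam * \<phi>\<^sup>2 * metric_at H x u u - 2 * \<phi> * \<psi> * dir_deriv F x u) / \<rho>)
      + 2 * real CARD('a) * C * s ^ 3 * \<rho>"
    unfolding sg_def .
qed

end

section \<open>Transporting the variation along a curve\<close>

context ricci_soliton_mfd begin

abbreviation Yv :: "('a, 'b) chart \<Rightarrow> real^'b \<Rightarrow> real^'b \<Rightarrow> real \<Rightarrow> real^'b" where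
  "Yv c \<equiv> soliton_domain.yvar (g c) (Fc c)"

definition total_dist :: "'a \<Rightarrow> ('a, 'b) chart \<Rightarrow> real^'b \<Rightarrow> ('b \<Rightarrow> real^'b) \<Rightarrow> real \<Rightarrow> real" where
  "total_dist p c x E \<tau> = (\<Sum>(i, b)\<in>UNIV. riem_dist M A g p (chart_inv c (Yv c x (E i) (if b then \<tau> else - \<tau>))))"

text \<open>The new frame is chosen before \<open>s\<close>, so one transported frame serves all
  \<open>s\<close>. Every term of the bound is an increment of a function of time; the property
  therefore composes without loss.\<close>

definition variation_step :: "'a \<Rightarrow> (real \<Rightarrow> 'a) \<Rightarrow> ('a, 'b) chart \<Rightarrow> (real \<Rightarrow> real) \<Rightarrow> (real \<Rightarrow> real) \<Rightarrow> (real \<Rightarrow> real) \<Rightarrow> real \<Rightarrow> real \<Rightarrow>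
    real \<Rightarrow> real \<Rightarrow> bool" where
  "variation_step p \<gamma> c \<phi> \<sigma> Acc C s0 a b \<longleftrightarrow> (\<forall>E. frame (g c) (snd c (\<gamma> a)) E \<longrightarrow> (\<exists>E'. frame (g c) (snd c (\<gamma> b)) E' \<and>
    (\<forall>s. 0 < s \<and> s \<le> s0 \<longrightarrow> total_dist p c (snd c (\<gamma> b)) E' (s * \<phi> b) \<le> total_dist p c (snd c (\<gamma> a)) E (s * \<phi> a)
      + 2 * real CARD('b) * (\<sigma> b - \<sigma> a) + s\<^sup>2 * (Acc b - Acc a) + 2 * real CARD('b) * C * s ^ 3 * (\<sigma> b - \<sigma> a))))"

lemma variation_step_refl: "variation_step p \<gamma> c \<phi> \<sigma> Acc C s0 t t"
  unfolding variation_step_def by (intro allI impI exI conjI) auto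

lemma variation_step_trans:
  fixes \<phi> \<sigma> Acc :: "real \<Rightarrow> real" and C s0 :: real
  assumes "variation_step p \<gamma> c \<phi> \<sigma> Acc C s0 r t" "variation_step p \<gamma> c \<phi> \<sigma> Acc C s0 t u"
  shows "variation_step p \<gamma> c \<phi> \<sigma> Acc C s0 r u"
  unfolding variation_step_def
proof (intro allI impI)
  fix E assume "frame (g c) (snd c (\<gamma> r)) E"
  then obtain E' where E': "frame (g c) (snd c (\<gamma> t)) E'" and 1: "\<And>s. 0 < s \<and> s \<le> s0 \<Longrightarrow>
      total_dist p c (snd c (\<gamma> t)) E' (s * \<phi> t) \<le> total_dist p c (snd c (\<gamma> r)) E (s * \<phi> r)
      + 2 * real CARD('b) * (\<sigma> t - \<sigma> r) + s\<^sup>2 * (Acc t - Acc r) + 2 * real CARD('b) * C * s ^ 3 * (\<sigma> t - \<sigma> r)"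
    using assms(1) unfolding variation_step_def by meson
  then obtain E'' where E'': "frame (g c) (snd c (\<gamma> u)) E''" and 2: "\<And>s. 0 < s \<and> s \<le> s0 \<Longrightarrow>
      total_dist p c (snd c (\<gamma> u)) E'' (s * \<phi> u) \<le> total_dist p c (snd c (\<gamma> t)) E' (s * \<phi> t)
      + 2 * real CARD('b) * (\<sigma> u - \<sigma> t) + s\<^sup>2 * (Acc u - Acc t) + 2 * real CARD('b) * C * s ^ 3 * (\<sigma> u - \<sigma> t)"
    using assms(2) unfolding variation_step_def by meson
  have "total_dist p c (snd c (\<gamma> u)) E'' (s * \<phi> u) \<le> total_dist p c (snd c (\<gamma> r)) E (s * \<phi> r)
      + 2 * real CARD('b) * (\<sigma> u - \<sigma> r) + s\<^sup>2 * (Acc u - Acc r) + 2 * real CARD('b) * C * s ^ 3 * (\<sigma> u - \<sigma> r)"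
    if s: "0 < s \<and> s \<le> s0" for s
    using 1[OF s] 2[OF s] by (simp add: algebra_simps)
  then show "\<exists>E'. frame (g c) (snd c (\<gamma> u)) E' \<and> (\<forall>s. 0 < s \<and> s \<le> s0 \<longrightarrow>
      total_dist p c (snd c (\<gamma> u)) E' (s * \<phi> u) \<le> total_dist p c (snd c (\<gamma> r)) E (s * \<phi> r)
      + 2 * real CARD('b) * (\<sigma> u - \<sigma> r) + s\<^sup>2 * (Acc u - Acc r) + 2 * real CARD('b) * C * s ^ 3 * (\<sigma> u - \<sigma> r))"
    using E'' by blast
qed

text \<open>The interval has to be short only for parallel transport to exist by
  \<open>linear_ode_short\<close>; \<open>C\<close> and \<open>s0\<close> belong to the compact set
  \<open>K\<close> and are unaffected by the interval.\<close>

lemma short_step: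
  fixes \<phi> \<psi> \<sigma> \<rho> Acc Acc' :: "real \<Rightarrow> real" and C s0 P L :: real
  assumes M: "connected_space M" and p: "p \<in> topspace M" and c: "c \<in> A" and K: "K \<subseteq> chart_image c"
    and gc: "soliton_domain.good_consts (chart_image c) (g c) (Fc c) K P C s0"
    and piece: "C1_piece \<gamma> c a b D" and xK: "\<And>t. t \<in> {a..b} \<Longrightarrow> snd c (\<gamma> t) \<in> K"
    and L: "L \<ge> 0" "\<And>t v. t \<in> {a..b} \<Longrightarrow> norm (gam (g c) (snd c (\<gamma> t)) (D t) v) \<le> L * norm v" "L * (b - a) \<le> 1 / 2"
    and \<sigma>: "\<And>t. t \<in> {a..b} \<Longrightarrow> (\<sigma> has_vector_derivative \<rho> t) (at t within {a..b})"
    and \<rho>: "\<And>t. t \<in> {a..b} \<Longrightarrow> 0 < \<rho> t" "\<And>t. t \<in> {a..b} \<Longrightarrow> metric_at (g c) (snd c (\<gamma> t)) (D t) (D t) \<le> (\<rho> t)\<^sup>2"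
    and Acc: "\<And>t. t \<in> {a..b} \<Longrightarrow> (Acc has_vector_derivative Acc' t) (at t within {a..b})"
    and Acc': "\<And>t. t \<in> {a..b} \<Longrightarrow> (real CARD('b) * (\<psi> t)\<^sup>2 - lam * (\<phi> t)\<^sup>2 * metric_at (g c) (snd c (\<gamma> t)) (D t) (D t)
        - 2 * \<phi> t * \<psi> t * dir_deriv (Fc c) (snd c (\<gamma> t)) (D t)) / \<rho> t \<le> Acc' t"
    and \<phi>: "\<And>t. t \<in> {a..b} \<Longrightarrow> (\<phi> has_vector_derivative \<psi> t) (at t within {a..b})" "continuous_on {a..b} \<psi>"
      "\<And>t. t \<in> {a..b} \<Longrightarrow> \<bar>\<phi> t\<bar> \<le> 1" "\<And>t. t \<in> {a..b} \<Longrightarrow> \<bar>\<psi> t\<bar> \<le> P * \<rho> t"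
  shows "variation_step p \<gamma> c \<phi> \<sigma> Acc C s0 a b"
  unfolding variation_step_def
proof (intro allI impI)
  interpret C: soliton_domain "chart_image c" "g c" "Fc c" lam by (rule soliton_domain[OF c])
  fix E assume E: "frame (g c) (snd c (\<gamma> a)) E"
  define x where "x t = snd c (\<gamma> t)" for t
  have ab: "a < b" using piece by (simp add: C1_piece_def)
  have xd: "\<And>t. t \<in> {a..b} \<Longrightarrow> (x has_vector_derivative D t) (at t within {a..b})"
    and Dc: "continuous_on {a..b} D" and xc: "continuous_on {a..b} x"
    using piece C1_piece_continuous[OF piece] unfolding C1_piece_def x_def by auto
  have xU: "x ` {a..b} \<subseteq> chart_image c" using xK K unfolding x_def by blast
  have "\<exists>e. e a = E i \<and> (\<forall>t\<in>{a..b}. (e has_vector_derivative - gam (g c) (x t) (D t) (e t)) (at t within {a..b}))" for i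
  proof (rule linear_ode_short[where L = L])
    show "linear (\<lambda>v. - gam (g c) (x t) (D t) v)" for t
      using linear_compose_neg[OF linear_fixed_args(2)[OF bilinear_gam]] .
    show "continuous_on {a..b} (\<lambda>t. - gam (g c) (x t) (D t) v)" for v
      by (intro continuous_on_minus C.gam_continuous xc xU Dc continuous_on_const)
    show "norm (- gam (g c) (x t) (D t) v) \<le> L * norm v" if "t \<in> {a..b}" for t v
      using L(2)[OF that, of v] by (simp add: x_def)
  qed (use ab L in auto)
  then obtain e where e: "\<And>i. e i a = E i" "\<And>i t. t \<in> {a..b} \<Longrightarrow> (e i has_vector_derivative - gam (g c) (x t) (D t) (e i t)) (at t within {a..b})"
    by metis
  have ec: "continuous_on {a..b} (e i)" for i
    unfolding continuous_on_eq_continuous_within using has_vector_derivative_continuous[OF e(2)] by blast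
  have \<phi>c: "continuous_on {a..b} \<phi>"
    unfolding continuous_on_eq_continuous_within using has_vector_derivative_continuous[OF \<phi>(1)] by blast
  have fra: "frame (g c) (x a) (\<lambda>i. e i a)" using E by (simp add: e(1) x_def)
  have fr: "frame (g c) (x t) (\<lambda>i. e i t)" if "t \<in> {a..b}" for t
    by (rule C.parallel_frame[OF xd xU e(2) fra that])
  have "total_dist p c (x b) (\<lambda>i. e i b) (s * \<phi> b) \<le> total_dist p c (x a) E (s * \<phi> a)
      + 2 * real CARD('b) * (\<sigma> b - \<sigma> a) + s\<^sup>2 * (Acc b - Acc a) + 2 * real CARD('b) * C * s ^ 3 * (\<sigma> b - \<sigma> a)"
    if s: "0 < s \<and> s \<le> s0" for s
  proof -
    define sg where "sg b = (if b then s else - s)" for b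
    define y where "y ib t = Yv c (x t) (e (fst ib) t) (sg (snd ib) * \<phi> t)" for ib t
    define dy where "dy ib t = C.dyvar (x t) (D t) (e (fst ib) t) (sg (snd ib) * \<phi> t) (sg (snd ib) * \<psi> t)" for ib t
    define B where "B t = 2 * real CARD('b) * \<sigma> t + s\<^sup>2 * Acc t + 2 * real CARD('b) * C * s ^ 3 * \<sigma> t" for t
    define B' where "B' t = 2 * real CARD('b) * \<rho> t + s\<^sup>2 * Acc' t + 2 * real CARD('b) * C * s ^ 3 * \<rho> t" for t
    have yU: "y ib t \<in> chart_image c" if "t \<in> {a..b}" for ib t
      using C.good_consts_frame(1)[OF gc K xK[OF that] fr[OF that, unfolded x_def] \<rho>(1)[OF that] \<rho>(2)[OF that] \<phi>(3)[OF that] \<phi>(4)[OF that], of s "fst ib" "snd ib"] s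
      by (simp add: y_def sg_def x_def)
    have "(\<Sum>ib\<in>UNIV. riem_dist M A g (chart_inv c (y ib a)) (chart_inv c (y ib b))) \<le> B b - B a"
    proof (rule dist_family_le[OF c _ ab yU])
      show "continuous_on {a..b} (dy ib)" for ib
        unfolding dy_def
        by (intro C.dyvar_continuous xc xU Dc ec continuous_on_mult continuous_on_const \<phi>c \<phi>(2))
      show "(y ib has_vector_derivative dy ib t) (at t within {a..b})" if t: "t \<in> {a..b}" for ib t
        unfolding y_def dy_def
      proof (rule C.yvar_derivative[OF _ xd[OF t] e(2)[OF t]])
        show "x t \<in> chart_image c" using xU t by blast
        show "((\<lambda>t. sg (snd ib) * \<phi> t) has_vector_derivative sg (snd ib) * \<psi> t) (at t within {a..b})"
          using has_vector_derivative_scaleR[OF DERIV_const[of "sg (snd ib)"] \<phi>(1)[OF t]] by simp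
      qed
      show "(B has_vector_derivative B' t) (at t within {a..b})" if t: "t \<in> {a..b}" for t
      proof -
        have m: "((\<lambda>t. k * h t) has_vector_derivative k * h') (at t within {a..b})"
          if "(h has_vector_derivative h') (at t within {a..b})" for k h' :: real and h
          using bounded_linear.has_vector_derivative[OF bounded_linear_mult_right that] .
        show ?thesis unfolding B_def B'_def by (intro has_vector_derivative_add m \<sigma>[OF t] Acc[OF t])
      qed
      show "(\<Sum>ib\<in>UNIV. nrm c (y ib t) (dy ib t)) \<le> B' t" if t: "t \<in> {a..b}" for t
      proof -
        have "(\<Sum>ib\<in>UNIV. nrm c (y ib t) (dy ib t)) \<le> 2 * real CARD('b) * \<rho> t + s\<^sup>2 * ((real CARD('b) * (\<psi> t)\<^sup>2 - lam * (\<phi> t)\<^sup>2 * metric_at (g c) (x t) (D t) (D t)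
            - 2 * \<phi> t * \<psi> t * dir_deriv (Fc c) (x t) (D t)) / \<rho> t) + 2 * real CARD('b) * C * s ^ 3 * \<rho> t"
          using C.good_consts_frame(2)[OF gc K xK[OF t] fr[OF t, unfolded x_def] \<rho>(1)[OF t] \<rho>(2)[OF t] \<phi>(3)[OF t] \<phi>(4)[OF t] conjunct1[OF s] conjunct2[OF s]]
          unfolding y_def dy_def sg_def x_def case_prod_unfold .
        also have "\<dots> \<le> B' t"
          unfolding B'_def by (intro add_mono order_refl mult_left_mono Acc'[OF t, folded x_def]) simp
        finally show ?thesis .
      qed
    qed simp
    moreover have "total_dist p c (x b) (\<lambda>i. e i b) (s * \<phi> b) \<le> total_dist p c (x a) E (s * \<phi> a)
        + (\<Sum>ib\<in>UNIV. riem_dist M A g (chart_inv c (y ib a)) (chart_inv c (y ib b)))"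
    proof -
      have t: "total_dist p c (x b) (\<lambda>i. e i b) (s * \<phi> b) = (\<Sum>ib\<in>UNIV. riem_dist M A g p (chart_inv c (y ib b)))"
        "total_dist p c (x a) E (s * \<phi> a) = (\<Sum>ib\<in>UNIV. riem_dist M A g p (chart_inv c (y ib a)))"
        unfolding total_dist_def y_def sg_def by (intro sum.cong refl, simp add: split_beta e(1))+
      have "riem_dist M A g p (chart_inv c (y ib b)) \<le> riem_dist M A g p (chart_inv c (y ib a)) + riem_dist M A g (chart_inv c (y ib a)) (chart_inv c (y ib b))" for ib
        by (rule riem_dist_triangle[OF M p chart_inv_topspace[OF c yU] chart_inv_topspace[OF c yU]]) (use ab in auto)
      then show ?thesis unfolding t sum.distrib[symmetric] by (rule sum_mono)
    qed
    ultimately show ?thesis unfolding B_def by (simp add: algebra_simps)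
  qed
  then show "\<exists>E'. frame (g c) (snd c (\<gamma> b)) E' \<and> (\<forall>s. 0 < s \<and> s \<le> s0 \<longrightarrow>
      total_dist p c (snd c (\<gamma> b)) E' (s * \<phi> b) \<le> total_dist p c (snd c (\<gamma> a)) E (s * \<phi> a)
      + 2 * real CARD('b) * (\<sigma> b - \<sigma> a) + s\<^sup>2 * (Acc b - Acc a) + 2 * real CARD('b) * C * s ^ 3 * (\<sigma> b - \<sigma> a))"
    using fr[of b] ab unfolding x_def by (intro exI[of _ "\<lambda>i. e i b"]) auto
qed

text \<open>The admissible length of an interval, and with it the number of intervals, depends on
  the speed of the curve. This is harmless, as \<open>variation_step_trans\<close> adds no
  error.\<close>

lemma piece_step:
  fixes \<phi> \<psi> \<sigma> \<rho> Acc Acc' :: "real \<Rightarrow> real" and C s0 P :: real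
  assumes M: "connected_space M" and p: "p \<in> topspace M" and c: "c \<in> A" and K: "compact K" "K \<subseteq> chart_image c"
    and gc: "soliton_domain.good_consts (chart_image c) (g c) (Fc c) K P C s0"
    and piece: "C1_piece \<gamma> c a b D" and xK: "\<And>t. t \<in> {a..b} \<Longrightarrow> snd c (\<gamma> t) \<in> K"
    and \<sigma>: "\<And>t. t \<in> {a..b} \<Longrightarrow> (\<sigma> has_vector_derivative \<rho> t) (at t within {a..b})"
    and \<rho>: "\<And>t. t \<in> {a..b} \<Longrightarrow> 0 < \<rho> t" "\<And>t. t \<in> {a..b} \<Longrightarrow> metric_at (g c) (snd c (\<gamma> t)) (D t) (D t) \<le> (\<rho> t)\<^sup>2"
    and Acc: "\<And>t. t \<in> {a..b} \<Longrightarrow> (Acc has_vector_derivative Acc' t) (at t within {a..b})"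
    and Acc': "\<And>t. t \<in> {a..b} \<Longrightarrow> (real CARD('b) * (\<psi> t)\<^sup>2 - lam * (\<phi> t)\<^sup>2 * metric_at (g c) (snd c (\<gamma> t)) (D t) (D t)
        - 2 * \<phi> t * \<psi> t * dir_deriv (Fc c) (snd c (\<gamma> t)) (D t)) / \<rho> t \<le> Acc' t"
    and \<phi>: "\<And>t. t \<in> {a..b} \<Longrightarrow> (\<phi> has_vector_derivative \<psi> t) (at t within {a..b})" "continuous_on {a..b} \<psi>"
      "\<And>t. t \<in> {a..b} \<Longrightarrow> \<bar>\<phi> t\<bar> \<le> 1" "\<And>t. t \<in> {a..b} \<Longrightarrow> \<bar>\<psi> t\<bar> \<le> P * \<rho> t"
  shows "variation_step p \<gamma> c \<phi> \<sigma> Acc C s0 a b"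
proof -
  interpret C: soliton_domain "chart_image c" "g c" "Fc c" lam by (rule soliton_domain[OF c])
  have ab: "a < b" and Dc: "continuous_on {a..b} D" using piece by (auto simp: C1_piece_def)
  obtain c1 where c1: "c1 \<ge> 0" "\<And>x v w. x \<in> K \<Longrightarrow> norm (gam (g c) x v w) \<le> c1 * norm v * norm w"
    using C.gam_bound[OF K] by blast
  obtain d1 where d1: "d1 \<ge> 0" "\<And>t. t \<in> {a..b} \<Longrightarrow> norm (D t) \<le> d1"
    using continuous_on_compact_bound[OF compact_Icc Dc] by blast
  define L where "L = c1 * d1"
  have L0: "L \<ge> 0" using c1 d1 by (simp add: L_def)
  have L: "norm (gam (g c) (snd c (\<gamma> t)) (D t) v) \<le> L * norm v" if "t \<in> {a..b}" for t v
  proof -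
    have "c1 * norm (D t) * norm v \<le> c1 * d1 * norm v"
      by (intro mult_right_mono mult_left_mono d1(2)[OF that] c1(1)) simp
    then show ?thesis using c1(2)[OF xK[OF that], of "D t" v] unfolding L_def by linarith
  qed
  define Q where "Q s t \<longleftrightarrow> (a \<le> s \<and> t \<le> b \<longrightarrow> variation_step p \<gamma> c \<phi> \<sigma> Acc C s0 s t)" for s t
  have "Q a b"
  proof (rule Bolzano[OF less_imp_le[OF ab]])
    show "Q r u" if "Q r t" "Q t u" "r \<le> t" "t \<le> u" for r t u
      using that variation_step_trans[of p \<gamma> c \<phi> \<sigma> Acc C s0 r t u] unfolding Q_def by simp
    fix x
    \<comment> \<open>\<open>L + 1\<close> in place of \<open>L\<close> avoids a vanishing
      denominator.\<close>
    define d where "d = 1 / (2 * (L + 1))"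
    have d: "d > 0" using L0 by (simp add: d_def)
    have "Q r t" if rt: "r \<le> x" "x \<le> t" "t - r < d" for r t
      unfolding Q_def
    proof
      assume in_ab: "a \<le> r \<and> t \<le> b"
      show "variation_step p \<gamma> c \<phi> \<sigma> Acc C s0 r t"
      proof (cases "r = t")
        case False
        then have lt: "r < t" using rt by simp
        have sub: "{r..t} \<subseteq> {a..b}" using in_ab by auto
        then have mem: "u \<in> {a..b}" if "u \<in> {r..t}" for u using that by blast
        note sub_d = has_vector_derivative_within_subset[OF _ sub]
        have "L * (t - r) \<le> (L + 1) * d" using rt L0 lt by (intro mult_mono) auto
        also have "\<dots> = 1 / 2" using L0 by (simp add: d_def)
        finally have Ls: "L * (t - r) \<le> 1 / 2" .
        show ?thesis
          by (rule short_step[OF M p c K(2) gc C1_piece_subinterval[OF piece _ lt] xK[OF mem] L0 L[OF mem] Ls sub_d[OF \<sigma>[OF mem]]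
            \<rho>(1)[OF mem] \<rho>(2)[OF mem] sub_d[OF Acc[OF mem]] Acc'[OF mem] sub_d[OF \<phi>(1)[OF mem]] continuous_on_subset[OF \<phi>(2) sub]
            \<phi>(3)[OF mem] \<phi>(4)[OF mem]]) (use in_ab in auto)
      qed (simp add: variation_step_refl)
    qed
    then show "\<exists>d>0. \<forall>r t. r \<le> x \<and> x \<le> t \<and> t - r < d \<longrightarrow> Q r t" using d by blast
  qed
  then show ?thesis by (simp add: Q_def)
qed

section \<open>Change of charts along the varied curves\<close>

lemma Yv_eq: "c \<in> A \<Longrightarrow> Yv c x e \<tau> = x + \<tau> *\<^sub>R e + \<tau>\<^sup>2 *\<^sub>R (- ((1 / (2 * CARD('b))) *\<^sub>R Zc c x) - (1/2) *\<^sub>R gam (g c) x e e)"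
  using soliton_domain.yvar_def[OF soliton_domain] soliton_domain.nvar_def[OF soliton_domain] soliton_domain.beta_def[OF soliton_domain]
  by metis

text \<open>The curves \<open>\<tau> \<mapsto> Yv c x e \<tau>\<close> of two charts agree to second order because of the transformation law
  of the Christoffel symbols.\<close>

lemma chart_change:
  assumes c: "c \<in> A" and d: "d \<in> A" and K1: "compact K1" "K1 \<subseteq> chart_image c"
    and r2: "r2 > 0" "cball z (3 * r2) \<subseteq> chart_image d"
  shows "\<exists>B\<ge>0. \<exists>s1>0. \<forall>q e \<tau>. q \<in> fst c \<and> q \<in> fst d \<and> snd c q \<in> K1 \<and> snd d q \<in> cball z (2 * r2) \<and>
     metric_at (g c) (snd c q) e e = 1 \<and> \<bar>\<tau>\<bar> \<le> s1 \<longrightarrow>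
     Yv c (snd c q) e \<tau> \<in> chart_image c \<and>
     Yv d (snd d q) (dir_deriv (chart_transition c d) (snd c q) e) \<tau> \<in> chart_image d \<and>
     riem_dist M A g (chart_inv c (Yv c (snd c q) e \<tau>))
       (chart_inv d (Yv d (snd d q) (dir_deriv (chart_transition c d) (snd c q) e) \<tau>)) \<le> B * \<bar>\<tau>\<bar> ^ 3"
proof -
  interpret C: soliton_domain "chart_image c" "g c" "Fc c" lam by (rule soliton_domain[OF c])
  let ?T = "chart_transition c d"
  note opn = open_overlap[OF c d] and smT = smooth_transition[OF c d]
  \<comment> \<open>Closed in \<open>K1\<close> as a preimage of a set closed in \<open>M\<close>,
    hence a compact subset of the overlap, on which Taylor constants for the transition map
    exist.\<close>
  define K where "K = {x \<in> K1. chart_inv c x \<in> {p \<in> fst d. snd d p \<in> cball z (2 * r2)}}"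
  have "closedin (top_of_set K1) K"
  proof -
    have "continuous_map (top_of_set K1) M (chart_inv c)"
      by (rule continuous_map_from_subtopology_mono[OF continuous_map_chart_inv[OF c] K1(2)])
    moreover have "cball z (2 * r2) \<subseteq> cball z (3 * r2)" using r2(1) by (intro subset_cball) simp
    then have "closedin M {p \<in> fst d. snd d p \<in> cball z (2 * r2)}"
      using r2 by (intro closedin_chart_cball[OF d]) blast
    ultimately have "closedin (top_of_set K1) {x \<in> topspace (top_of_set K1). chart_inv c x \<in> {p \<in> fst d. snd d p \<in> cball z (2 * r2)}}"
      by (rule closedin_continuous_map_preimage)
    then show ?thesis unfolding K_def by simp
  qed
  then have Kc: "compact K" using K1(1) closedin_compact by blast
  have Kov: "K \<subseteq> overlap c d"
    using overlap_iff[OF c] K1(2) unfolding K_def by blast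
  obtain cc where cc: "cc \<ge> 1" and lb: "C.local_bound K1 cc" using C.local_bounds[OF K1] by blast
  have nb: "\<And>x u. x \<in> K1 \<Longrightarrow> norm u \<le> cc * sqrt (metric_at (g c) x u u)"
    and gb: "\<And>x v w. x \<in> K1 \<Longrightarrow> norm (gam (g c) x v w) \<le> cc * norm v * norm w"
    and Zb: "\<And>x. x \<in> K1 \<Longrightarrow> norm (C.Z x) \<le> cc"
    using lb unfolding C.local_bound_def by simp_all
  define cn where "cn = cc + cc * cc * cc"
  have cn: "cn \<ge> 0" using cc by (simp add: cn_def)
  obtain r CT where r: "r > 0" and CT: "CT \<ge> 0" and taylor: "\<And>x \<xi>. x \<in> K \<Longrightarrow> norm \<xi> \<le> r \<Longrightarrow> x + \<xi> \<in> overlap c d \<and>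
    norm (?T (x + \<xi>) - ?T x - dir_deriv ?T x \<xi> - dir_deriv (\<lambda>y. dir_deriv ?T y \<xi>) x \<xi> /\<^sub>R 2) \<le> CT * norm \<xi> ^ 3"
    using taylor3[OF opn smT Kc Kov] by blast
  obtain t1 where t1: "t1 \<ge> 0" "\<And>x v. x \<in> K \<Longrightarrow> norm (dir_deriv ?T x v) \<le> t1 * norm v"
    using dir_deriv_bound1[OF opn smT Kc Kov] by blast
  obtain t2 where t2: "t2 \<ge> 0" "\<And>x v w. x \<in> K \<Longrightarrow> norm (dir_deriv (\<lambda>y. dir_deriv ?T y v) x w) \<le> t2 * norm v * norm w"
    using dir_deriv_bound2[OF opn smT Kc Kov] by blast
  obtain Lp where Lp: "Lp \<ge> 0" "\<And>y1 y2. y1 \<in> cball z (3 * r2) \<Longrightarrow> y2 \<in> cball z (3 * r2) \<Longrightarrow>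
     riem_dist M A g (chart_inv d y1) (chart_inv d y2) \<le> Lp * norm (y2 - y1)"
    using riem_dist_lipschitz[OF d convex_cball compact_cball r2(2)] by blast
  define h where "h = cc + cn"
  have h: "h > 0" using cc cn by (simp add: h_def)
  define B0 where "B0 = CT * h ^ 3 + t2 * cc * cn + t2 * cn * cn"
  have B0: "B0 \<ge> 0" using CT h t2 cc cn by (simp add: B0_def)
  \<comment> \<open>Bounds, per unit of \<bar>\<tau>\<bar>, how far the two displaced points move in
    the second chart; \<open>s1\<close> then keeps both in \<open>cball z (3 * r2)\<close>.\<close>
  define W where "W = h * t1 + h * h * t2 + CT * h ^ 3 + B0 + 1"
  have W: "W > 0" using h t1 t2 CT B0 by (simp add: W_def add_nonneg_pos)
  define s1 where "s1 = min 1 (min (r / h) (r2 / W))"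
  have s1: "s1 > 0" using r h r2 W by (simp add: s1_def)
  have main: "Yv c (snd c q) e \<tau> \<in> chart_image c \<and>
     Yv d (snd d q) (dir_deriv ?T (snd c q) e) \<tau> \<in> chart_image d \<and>
     riem_dist M A g (chart_inv c (Yv c (snd c q) e \<tau>))
       (chart_inv d (Yv d (snd d q) (dir_deriv ?T (snd c q) e) \<tau>)) \<le> (Lp * B0) * \<bar>\<tau>\<bar> ^ 3"
    if q: "q \<in> fst c" "q \<in> fst d" "snd c q \<in> K1" "snd d q \<in> cball z (2 * r2)"
      and ee: "metric_at (g c) (snd c q) e e = 1" and \<tau>: "\<bar>\<tau>\<bar> \<le> s1" for q e \<tau>
  proof -
    define x where "x = snd c q"
    have xK1: "x \<in> K1" using q by (simp add: x_def)
    have xK: "x \<in> K" using q c by (simp add: K_def x_def)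
    have xov: "x \<in> overlap c d" using Kov xK by blast
    have Tx: "?T x = snd d q" using q c by (simp add: x_def)
    have lT: "linear (dir_deriv ?T x)" by (rule linear_transition[OF c d xov])
    define e' where "e' = dir_deriv ?T x e"
    define N where "N = - ((1 / (2 * CARD('b))) *\<^sub>R Zc c x) - (1/2) *\<^sub>R gam (g c) x e e"
    define N' where "N' = - ((1 / (2 * CARD('b))) *\<^sub>R Zc d (?T x)) - (1/2) *\<^sub>R gam (g d) (?T x) e' e'"
    define D2 where "D2 v w = dir_deriv (\<lambda>y. dir_deriv ?T y v) x w" for v w
    have bil: "bilinear D2" unfolding D2_def by (rule bilinear_second_derivative[OF opn smT xov])
    have DN: "dir_deriv ?T x N + D2 e e /\<^sub>R 2 = N'"
    proof -
      have "dir_deriv ?T x N = - ((1 / (2 * CARD('b))) *\<^sub>R dir_deriv ?T x (Zc c x)) - (1/2) *\<^sub>R dir_deriv ?T x (gam (g c) x e e)"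
        unfolding N_def using lT by (simp add: linear_diff linear_neg linear_scale)
      then show ?thesis
        unfolding grad_transition[OF c d xov] gam_transition[OF c d xov] N'_def e'_def D2_def
        by (simp add: algebra_simps)
    qed
    have ne: "norm e \<le> cc" using nb[OF xK1, of e] ee by (simp add: x_def)
    have nN: "norm N \<le> cn"
    proof -
      have b: "0 \<le> 1 / (2 * real CARD('b))" "1 / (2 * real CARD('b)) \<le> 1"
        using C.beta(1,2) unfolding C.beta_def by auto
      have "norm N \<le> 1 / (2 * real CARD('b)) * norm (Zc c x) + (1/2) * norm (gam (g c) x e e)"
        unfolding N_def using norm_triangle_ineq4[of "- ((1 / (2 * CARD('b))) *\<^sub>R Zc c x)" "(1/2) *\<^sub>R gam (g c) x e e"] b by simp
      moreover have "1 / (2 * real CARD('b)) * norm (Zc c x) \<le> 1 * cc"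
        using b Zb[OF xK1] by (intro mult_mono) auto
      moreover have "cc * norm e * norm e \<le> cc * cc * cc"
        using ne cc by (intro mult_mono) auto
      then have "norm (gam (g c) x e e) \<le> cc * cc * cc" using gb[OF xK1, of e e] by linarith
      ultimately show ?thesis unfolding cn_def using norm_ge_zero[of "gam (g c) x e e"] by linarith
    qed
    define \<xi> where "\<xi> = \<tau> *\<^sub>R e + \<tau>\<^sup>2 *\<^sub>R N"
    have Yc: "Yv c x e \<tau> = x + \<xi>" unfolding Yv_eq[OF c] N_def[symmetric] \<xi>_def by (simp add: add.assoc)
    have Yd: "Yv d (?T x) e' \<tau> = ?T x + \<tau> *\<^sub>R e' + \<tau>\<^sup>2 *\<^sub>R N'" unfolding Yv_eq[OF d] N'_def ..
    have \<tau>1: "\<bar>\<tau>\<bar> \<le> 1" "\<bar>\<tau>\<bar> * h \<le> r" "\<bar>\<tau>\<bar> * W \<le> r2"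
    proof -
      show "\<bar>\<tau>\<bar> \<le> 1" using \<tau> by (simp add: s1_def)
      have "\<bar>\<tau>\<bar> \<le> r / h" "\<bar>\<tau>\<bar> \<le> r2 / W" using \<tau> by (auto simp: s1_def)
      then show "\<bar>\<tau>\<bar> * h \<le> r" "\<bar>\<tau>\<bar> * W \<le> r2" using h W by (auto simp: pos_le_divide_eq)
    qed
    have pw: "\<tau>\<^sup>2 \<le> \<bar>\<tau>\<bar>" "\<tau> ^ 4 \<le> \<bar>\<tau>\<bar> ^ 3" "\<bar>\<tau>\<bar> ^ 3 \<le> \<bar>\<tau>\<bar>"
    proof -
      have "\<bar>\<tau>\<bar> ^ 2 \<le> \<bar>\<tau>\<bar> ^ 1" "\<bar>\<tau>\<bar> ^ 4 \<le> \<bar>\<tau>\<bar> ^ 3" "\<bar>\<tau>\<bar> ^ 3 \<le> \<bar>\<tau>\<bar> ^ 1" by (rule power_decreasing; use \<tau>1 in simp)+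
      then show "\<tau>\<^sup>2 \<le> \<bar>\<tau>\<bar>" "\<tau> ^ 4 \<le> \<bar>\<tau>\<bar> ^ 3" "\<bar>\<tau>\<bar> ^ 3 \<le> \<bar>\<tau>\<bar>" by simp_all
    qed
    have n\<xi>: "norm \<xi> \<le> \<bar>\<tau>\<bar> * h"
    proof -
      have "norm \<xi> \<le> \<bar>\<tau>\<bar> * norm e + \<tau>\<^sup>2 * norm N"
        unfolding \<xi>_def using norm_triangle_ineq[of "\<tau> *\<^sub>R e" "\<tau>\<^sup>2 *\<^sub>R N"] by simp
      also have "\<dots> \<le> \<bar>\<tau>\<bar> * cc + \<bar>\<tau>\<bar> * cn"
        by (intro add_mono mult_mono ne nN pw) auto
      finally show ?thesis by (simp add: h_def distrib_left)
    qed
    have nr: "norm \<xi> \<le> r" using n\<xi> \<tau>1 by linarith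
    have ov: "x + \<xi> \<in> overlap c d" using taylor[OF xK nr] by blast
    define R where "R = ?T (x + \<xi>) - ?T x - dir_deriv ?T x \<xi> - D2 \<xi> \<xi> /\<^sub>R 2"
    have nR: "norm R \<le> CT * norm \<xi> ^ 3" using taylor[OF xK nr] unfolding R_def D2_def by blast
    have n3: "CT * norm \<xi> ^ 3 \<le> CT * h ^ 3 * \<bar>\<tau>\<bar> ^ 3"
    proof -
      have "norm \<xi> ^ 3 \<le> (\<bar>\<tau>\<bar> * h) ^ 3" by (rule power_mono[OF n\<xi>]) simp
      then have "CT * norm \<xi> ^ 3 \<le> CT * (\<bar>\<tau>\<bar> * h) ^ 3" using CT by (rule mult_left_mono)
      then show ?thesis by (simp add: power_mult_distrib mult_ac)
    qed
    have diff: "?T (x + \<xi>) - Yv d (?T x) e' \<tau> = R + (\<tau> ^ 3 / 2) *\<^sub>R (D2 e N + D2 N e) + (\<tau> ^ 4 / 2) *\<^sub>R D2 N N"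
    proof -
      have "dir_deriv ?T x \<xi> = \<tau> *\<^sub>R e' + \<tau>\<^sup>2 *\<^sub>R dir_deriv ?T x N"
        unfolding \<xi>_def e'_def using lT by (simp add: linear_add linear_scale)
      moreover have "D2 \<xi> \<xi> = \<tau>\<^sup>2 *\<^sub>R D2 e e + \<tau> ^ 3 *\<^sub>R (D2 e N + D2 N e) + \<tau> ^ 4 *\<^sub>R D2 N N"
        unfolding \<xi>_def bilinear_ladd[OF bil] bilinear_radd[OF bil] bilinear_lmul[OF bil] bilinear_rmul[OF bil]
        by (simp add: algebra_simps eval_nat_numeral)
      moreover have "N' = dir_deriv ?T x N + D2 e e /\<^sub>R 2" using DN by simp
      ultimately show ?thesis unfolding R_def Yd by (simp add: algebra_simps)
    qed
    have nD2: "norm (D2 v w) \<le> t2 * norm v * norm w" for v w unfolding D2_def by (rule t2(2)[OF xK])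
    have b1: "norm (D2 e N) \<le> t2 * cc * cn" "norm (D2 N e) \<le> t2 * cc * cn" "norm (D2 N N) \<le> t2 * cn * cn"
    proof -
      have "t2 * norm e * norm N \<le> t2 * cc * cn" "t2 * norm N * norm e \<le> t2 * cn * cc" "t2 * norm N * norm N \<le> t2 * cn * cn"
        using t2(1) ne nN cc cn by (intro mult_mono; simp)+
      then show "norm (D2 e N) \<le> t2 * cc * cn" "norm (D2 N e) \<le> t2 * cc * cn" "norm (D2 N N) \<le> t2 * cn * cn"
        using nD2[of e N] nD2[of N e] nD2[of N N] by (simp_all add: mult_ac)
    qed
    have nd: "norm (?T (x + \<xi>) - Yv d (?T x) e' \<tau>) \<le> B0 * \<bar>\<tau>\<bar> ^ 3"
    proof -
      have "norm (R + (\<tau> ^ 3 / 2) *\<^sub>R (D2 e N + D2 N e) + (\<tau> ^ 4 / 2) *\<^sub>R D2 N N)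
        \<le> norm R + norm ((\<tau> ^ 3 / 2) *\<^sub>R (D2 e N + D2 N e)) + norm ((\<tau> ^ 4 / 2) *\<^sub>R D2 N N)"
        by (intro order_trans[OF norm_triangle_ineq] add_mono norm_triangle_ineq order_refl)
      also have "\<dots> \<le> CT * h ^ 3 * \<bar>\<tau>\<bar> ^ 3 + \<bar>\<tau>\<bar> ^ 3 * (t2 * cc * cn) + \<bar>\<tau>\<bar> ^ 3 * (t2 * cn * cn)"
      proof (intro add_mono)
        show "norm R \<le> CT * h ^ 3 * \<bar>\<tau>\<bar> ^ 3" using nR n3 by linarith
        have "norm (D2 e N + D2 N e) \<le> 2 * (t2 * cc * cn)" using norm_triangle_ineq[of "D2 e N" "D2 N e"] b1 by linarith
        then have "\<bar>\<tau>\<bar> ^ 3 / 2 * norm (D2 e N + D2 N e) \<le> \<bar>\<tau>\<bar> ^ 3 / 2 * (2 * (t2 * cc * cn))" by (intro mult_left_mono) auto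
        then show "norm ((\<tau> ^ 3 / 2) *\<^sub>R (D2 e N + D2 N e)) \<le> \<bar>\<tau>\<bar> ^ 3 * (t2 * cc * cn)" by (simp add: power_abs)
        have "\<tau> ^ 4 / 2 * norm (D2 N N) \<le> \<bar>\<tau>\<bar> ^ 3 * (t2 * cn * cn)"
        proof (rule mult_mono[OF _ b1(3)])
          show "\<tau> ^ 4 / 2 \<le> \<bar>\<tau>\<bar> ^ 3" using pw(2) zero_le_power[of "\<bar>\<tau>\<bar>" 3] by linarith
        qed auto
        then show "norm ((\<tau> ^ 4 / 2) *\<^sub>R D2 N N) \<le> \<bar>\<tau>\<bar> ^ 3 * (t2 * cn * cn)" by simp
      qed
      also have "\<dots> = B0 * \<bar>\<tau>\<bar> ^ 3" by (simp add: B0_def algebra_simps)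
      finally show ?thesis unfolding diff .
    qed
    have nT: "norm (?T (x + \<xi>) - ?T x) \<le> \<bar>\<tau>\<bar> * (h * t1 + h * h * t2 + CT * h ^ 3)"
    proof -
      have "?T (x + \<xi>) - ?T x = R + dir_deriv ?T x \<xi> + D2 \<xi> \<xi> /\<^sub>R 2" by (simp add: R_def)
      then have "norm (?T (x + \<xi>) - ?T x) \<le> norm R + norm (dir_deriv ?T x \<xi>) + norm (D2 \<xi> \<xi> /\<^sub>R 2)"
        by (simp only:) (intro order_trans[OF norm_triangle_ineq] add_mono norm_triangle_ineq order_refl)
      moreover have "norm R \<le> CT * h ^ 3 * \<bar>\<tau>\<bar>"
        using nR n3 mult_left_mono[OF pw(3), of "CT * h ^ 3"] CT h by (smt (verit) mult_nonneg_nonneg zero_le_power)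
      moreover have "norm (dir_deriv ?T x \<xi>) \<le> t1 * (\<bar>\<tau>\<bar> * h)"
        using t1(2)[OF xK, of \<xi>] mult_left_mono[OF n\<xi> t1(1)] by linarith
      moreover have "norm (D2 \<xi> \<xi>) \<le> t2 * h * (\<bar>\<tau>\<bar> * h)"
      proof -
        have "\<bar>\<tau>\<bar> * h \<le> 1 * h" using \<tau>1(1) h by (intro mult_right_mono) auto
        then have "norm \<xi> \<le> h" using n\<xi> by linarith
        then have "t2 * norm \<xi> * norm \<xi> \<le> t2 * h * (\<bar>\<tau>\<bar> * h)"
          using t2(1) n\<xi> h by (intro mult_mono) auto
        then show ?thesis using nD2[of \<xi> \<xi>] by linarith
      qed
      moreover have "norm (D2 \<xi> \<xi> /\<^sub>R 2) \<le> norm (D2 \<xi> \<xi>)" by simp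
      moreover have "\<bar>\<tau>\<bar> * (h * t1 + h * h * t2 + CT * h ^ 3) = t1 * (\<bar>\<tau>\<bar> * h) + t2 * h * (\<bar>\<tau>\<bar> * h) + CT * h ^ 3 * \<bar>\<tau>\<bar>"
        by (simp add: algebra_simps)
      ultimately show ?thesis by linarith
    qed
    have in1: "?T (x + \<xi>) \<in> cball z (3 * r2)" "Yv d (?T x) e' \<tau> \<in> cball z (3 * r2)"
    proof -
      have zt: "dist z (?T x) \<le> 2 * r2" using q(4) by (simp add: Tx)
      have le: "\<bar>\<tau>\<bar> * (h * t1 + h * h * t2 + CT * h ^ 3) + B0 * \<bar>\<tau>\<bar> ^ 3 \<le> r2"
      proof -
        have "B0 * \<bar>\<tau>\<bar> ^ 3 \<le> B0 * \<bar>\<tau>\<bar>" by (rule mult_left_mono[OF pw(3) B0])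
        then have "\<bar>\<tau>\<bar> * (h * t1 + h * h * t2 + CT * h ^ 3) + B0 * \<bar>\<tau>\<bar> ^ 3 \<le> \<bar>\<tau>\<bar> * W"
          unfolding W_def by (simp add: algebra_simps)
        then show ?thesis using \<tau>1(3) by linarith
      qed
      have B3: "B0 * \<bar>\<tau>\<bar> ^ 3 \<ge> 0" using B0 by simp
      have "dist z (?T (x + \<xi>)) \<le> dist z (?T x) + norm (?T (x + \<xi>) - ?T x)"
        using dist_triangle[of z "?T (x + \<xi>)" "?T x"] by (simp add: dist_norm[of "?T x"] norm_minus_commute)
      then show "?T (x + \<xi>) \<in> cball z (3 * r2)" using zt nT le B3 unfolding mem_cball by linarith
      have "dist z (Yv d (?T x) e' \<tau>) \<le> dist z (?T (x + \<xi>)) + norm (?T (x + \<xi>) - Yv d (?T x) e' \<tau>)"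
        using dist_triangle[of z "Yv d (?T x) e' \<tau>" "?T (x + \<xi>)"] by (simp add: dist_norm[of "?T (x + \<xi>)"])
      then show "Yv d (?T x) e' \<tau> \<in> cball z (3 * r2)"
        using zt nT nd le \<open>dist z (?T (x + \<xi>)) \<le> dist z (?T x) + norm (?T (x + \<xi>) - ?T x)\<close> unfolding mem_cball by linarith
    qed
    have "riem_dist M A g (chart_inv d (?T (x + \<xi>))) (chart_inv d (Yv d (?T x) e' \<tau>)) \<le> Lp * norm (Yv d (?T x) e' \<tau> - ?T (x + \<xi>))"
      by (rule Lp(2)[OF in1])
    also have "\<dots> \<le> Lp * (B0 * \<bar>\<tau>\<bar> ^ 3)"
      using nd Lp(1) by (intro mult_left_mono) (simp_all add: norm_minus_commute)
    finally have "riem_dist M A g (chart_inv c (x + \<xi>)) (chart_inv d (Yv d (?T x) e' \<tau>)) \<le> (Lp * B0) * \<bar>\<tau>\<bar> ^ 3"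
      unfolding chart_inv_transition[OF c d ov] by (simp add: mult.assoc)
    then show ?thesis
      unfolding x_def[symmetric] Tx[symmetric] Yc e'_def[symmetric]
      using subsetD[OF overlap_subset ov] subsetD[OF r2(2) in1(2)] by (intro conjI)
  qed
  have "Lp * B0 \<ge> 0" using Lp(1) B0 by simp
  then show ?thesis
    by (intro exI[of _ "Lp * B0"] conjI exI[of _ s1] s1 allI impI) (use main in blast)+
qed

end

section \<open>The diameter bound\<close>

text \<open>\<open>accum\<close> integrates an upper bound of the \<open>s\<^sup>2\<close>-coefficient of the summed length, after
  integration by parts of the term with \<open>f\<close>; \<open>\<kappa>\<close> is a small multiple of the parameter that makes \<open>\<sigma>\<close>
  strictly increasing.\<close>

definition accum :: "real \<Rightarrow> real \<Rightarrow> real \<Rightarrow> real \<Rightarrow> real \<Rightarrow> (real \<Rightarrow> real) \<Rightarrow> (real \<Rightarrow> real) \<Rightarrow> real \<Rightarrow> real" where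
  "accum n lam k \<omega> \<kappa> \<sigma> h t = n * \<omega>\<^sup>2 * (\<sigma> t / 2 + sin (2 * \<omega> * \<sigma> t) / (4 * \<omega>))
     - lam * (\<sigma> t / 2 - sin (2 * \<omega> * \<sigma> t) / (4 * \<omega>)) + 2 * \<kappa> * lam * t
     - \<omega> * sin (2 * \<omega> * \<sigma> t) * (h t - k / 2)
     + \<omega>\<^sup>2 * k * (99 / 140 * \<sigma> t + 7 / 80 * (sin (4 * \<omega> * \<sigma> t) / \<omega>))"

text \<open>The squares of sine and cosine appear in double angle form, and the last factor is 7/10
  c^2 + 5/14 with c = cos(2 \<omega> s), rewritten by the double angle formula; every term then has
  an elementary primitive.\<close>

definition accum_rate :: "real \<Rightarrow> real \<Rightarrow> real \<Rightarrow> real \<Rightarrow> real \<Rightarrow> real \<Rightarrow> real \<Rightarrow> real \<Rightarrow> real \<Rightarrow> real" where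
  "accum_rate n lam k \<omega> \<kappa> s \<rho> h h' = n * \<omega>\<^sup>2 * \<rho> * (1 / 2 + cos (2 * \<omega> * s) / 2) - lam * \<rho> * (1 / 2 - cos (2 * \<omega> * s) / 2)
     + 2 * \<kappa> * lam - (2 * \<omega>\<^sup>2 * \<rho> * cos (2 * \<omega> * s) * (h - k / 2) + \<omega> * sin (2 * \<omega> * s) * h')
     + \<omega>\<^sup>2 * k * \<rho> * (99 / 140 + 7 / 20 * cos (4 * \<omega> * s))"

lemma accum_derivative:
  assumes "(\<sigma> has_real_derivative \<rho>) (at t within S)" "(h has_real_derivative h') (at t within S)" "\<omega> \<noteq> 0"
  shows "(accum n lam k \<omega> \<kappa> \<sigma> h has_real_derivative accum_rate n lam k \<omega> \<kappa> (\<sigma> t) \<rho> (h t) h') (at t within S)"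
  unfolding accum_def accum_rate_def
  by (rule derivative_eq_intros assms refl | use assms(3) in \<open>simp; fail\<close>)+
    (use assms(3) in \<open>simp add: field_simps power2_eq_square\<close>)

text \<open>The weak form \<open>\<bar>c\<bar> \<le> 7/10 c\<^sup>2 + 5/14\<close> of the bound for the potential term
  keeps the accumulated variation elementary.\<close>

lemma accum_rate_ge:
  assumes \<rho>: "\<rho> > 0" and a: "(\<rho> - \<kappa>)\<^sup>2 = a" and lam: "lam \<ge> 0" and \<kappa>: "\<kappa> \<ge> 0" and h: "0 \<le> h" "h \<le> k"
  shows "(n * (\<omega> * cos (\<omega> * s) * \<rho>)\<^sup>2 - lam * (sin (\<omega> * s))\<^sup>2 * a - 2 * sin (\<omega> * s) * (\<omega> * cos (\<omega> * s) * \<rho>) * h') / \<rho>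
    \<le> accum_rate n lam k \<omega> \<kappa> s \<rho> h h'"
proof -
  define S where "S = sin (\<omega> * s)"
  define C where "C = cos (\<omega> * s)"
  have SC: "S\<^sup>2 + C\<^sup>2 = 1" by (simp add: S_def C_def)
  have S1: "S\<^sup>2 \<le> 1" using SC zero_le_power2[of C] by linarith
  have s2: "sin (2 * \<omega> * s) = 2 * S * C" using sin_double[of "\<omega> * s"] by (simp add: S_def C_def mult.assoc)
  have "cos (2 * \<omega> * s) = 2 * C\<^sup>2 - 1" using cos_double_cos[of "\<omega> * s"] by (simp add: C_def mult.assoc)
  then have C2: "C\<^sup>2 = 1 / 2 + cos (2 * \<omega> * s) / 2" and S2: "S\<^sup>2 = 1 / 2 - cos (2 * \<omega> * s) / 2" using SC by (simp_all add: field_simps)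
  define c where "c = cos (2 * \<omega> * s)"
  have c4: "cos (4 * \<omega> * s) = 2 * c\<^sup>2 - 1" using cos_double_cos[of "2 * \<omega> * s"] by (simp add: c_def mult.assoc)
  \<comment> \<open>The quotient enters with a minus sign, so a lower bound is wanted. The defect
    \<open>2 * \<kappa>\<close> reappears as the summand \<open>2 * \<kappa> * lam\<close> of
    \<open>accum_rate\<close>.\<close>
  have "\<rho> - 2 * \<kappa> \<le> a / \<rho>"
  proof -
    have "(\<rho> - 2 * \<kappa>) * \<rho> \<le> a" using zero_le_power2[of \<kappa>] unfolding a[symmetric] by (simp add: power2_eq_square algebra_simps)
    then show ?thesis using \<rho> by (simp add: pos_le_divide_eq)
  qed
  then have "lam * S\<^sup>2 * (\<rho> - 2 * \<kappa>) \<le> lam * S\<^sup>2 * (a / \<rho>)" using lam by (intro mult_left_mono) auto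
  moreover have "lam * S\<^sup>2 * (2 * \<kappa>) \<le> lam * 1 * (2 * \<kappa>)"
    using lam \<kappa> S1 by (intro mult_right_mono mult_left_mono) auto
  ultimately have 1: "- (lam * S\<^sup>2 * (a / \<rho>)) \<le> - (lam * S\<^sup>2 * \<rho>) + 2 * \<kappa> * lam" by (simp add: algebra_simps)
  \<comment> \<open>Centring \<open>h\<close> in its range halves the bound. The shift by
    \<open>k / 2\<close> is free, since it is multiplied by sin(2 \<omega> \<sigma>), which vanishes
    at both ends of the curve.\<close>
  have "2 * c * (h - k / 2) \<le> \<bar>c\<bar> * k"
  proof -
    have "c * (2 * h - k) \<le> \<bar>c\<bar> * \<bar>2 * h - k\<bar>" by (metis abs_ge_self abs_mult)
    also have "\<dots> \<le> \<bar>c\<bar> * k" using h by (intro mult_left_mono) auto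
    finally show ?thesis by (simp add: algebra_simps)
  qed
  \<comment> \<open>Among the majorants a c^2 + 1/(4 a) of \<bar>c\<bar> the mean over a period, a/2
    + 1/(4 a), is least for a = 1/sqrt 2. The rational value 7/10 gives 99/140, close to that
    minimum.\<close>
  also have "\<dots> \<le> (7 / 10 * c\<^sup>2 + 5 / 14) * k"
  proof (rule mult_right_mono)
    have "0 \<le> 7 / 10 * (\<bar>c\<bar> - 5 / 7)\<^sup>2" by simp
    then show "\<bar>c\<bar> \<le> 7 / 10 * c\<^sup>2 + 5 / 14" by (simp add: power2_eq_square algebra_simps)
  qed (use h in simp)
  also have "\<dots> = k * (99 / 140 + 7 / 20 * cos (4 * \<omega> * s))" unfolding c4 by (simp add: field_simps)
  finally have "\<omega>\<^sup>2 * \<rho> * (2 * c * (h - k / 2)) \<le> \<omega>\<^sup>2 * \<rho> * (k * (99 / 140 + 7 / 20 * cos (4 * \<omega> * s)))"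
    using \<rho> by (intro mult_left_mono) auto
  then have 2: "2 * \<omega>\<^sup>2 * \<rho> * c * (h - k / 2) \<le> \<omega>\<^sup>2 * k * \<rho> * (99 / 140 + 7 / 20 * cos (4 * \<omega> * s))"
    by (simp only: mult_ac)
  have "(n * (\<omega> * C * \<rho>)\<^sup>2 - lam * S\<^sup>2 * a - 2 * S * (\<omega> * C * \<rho>) * h') / \<rho>
     = n * \<omega>\<^sup>2 * \<rho> * C\<^sup>2 - lam * S\<^sup>2 * (a / \<rho>) - \<omega> * (2 * S * C) * h'"
    using \<rho> by (simp add: field_simps power2_eq_square)
  also have "\<dots> \<le> n * \<omega>\<^sup>2 * \<rho> * C\<^sup>2 - lam * S\<^sup>2 * \<rho> + 2 * \<kappa> * lam - \<omega> * (2 * S * C) * h'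
      + (\<omega>\<^sup>2 * k * \<rho> * (99 / 140 + 7 / 20 * cos (4 * \<omega> * s)) - 2 * \<omega>\<^sup>2 * \<rho> * c * (h - k / 2))"
    using 1 2 by linarith
  also have "\<dots> = accum_rate n lam k \<omega> \<kappa> s \<rho> h h'"
    unfolding accum_rate_def s2 C2 S2 c_def by (simp add: algebra_simps)
  finally show ?thesis unfolding S_def C_def .
qed

text \<open>Monotonicity lets the constants of finitely many members be replaced by one maximum and
  one minimum.\<close>

lemma finite_uniform_constants:
  fixes R :: "'i \<Rightarrow> real \<Rightarrow> real \<Rightarrow> bool"
  assumes fin: "finite I" and ex: "\<And>i. i \<in> I \<Longrightarrow> \<exists>C\<ge>0. \<exists>s>0. R i C s"
    and mono: "\<And>i C s C' s'. i \<in> I \<Longrightarrow> R i C s \<Longrightarrow> C \<le> C' \<Longrightarrow> s' \<le> s \<Longrightarrow> R i C' s'"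
  shows "\<exists>C\<ge>0. \<exists>s>0. \<forall>i\<in>I. R i C s"
proof -
  have "J \<subseteq> I \<Longrightarrow> \<exists>C\<ge>0. \<exists>s>0. \<forall>i\<in>J. R i C s" if "finite J" for J
    using that
  proof (induction J rule: finite_induct)
    case empty
    have "(0::real) \<le> 0" "(1::real) > 0" "\<forall>i\<in>{}. R i 0 1" by simp_all
    then show ?case by blast
  next
    case (insert i J)
    obtain C s where 1: "C \<ge> 0" "s > 0" "\<forall>j\<in>J. R j C s" using insert.IH insert.prems by blast
    obtain C' s' where 2: "C' \<ge> 0" "s' > 0" "R i C' s'" using ex[of i] insert.prems by blast
    have "R j (max C C') (min s s')" if j: "j \<in> insert i J" for j
    proof -
      have jI: "j \<in> I" using j insert.prems by blast
      consider "R j C s" | "R j C' s'" using j 1(3) 2(3) by blast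
      then show ?thesis
      proof cases
        case 1
        show ?thesis by (rule mono[OF jI 1]) auto
      next
        case 2
        show ?thesis by (rule mono[OF jI 2]) auto
      qed
    qed
    then have "\<forall>j\<in>insert i J. R j (max C C') (min s s')" by blast
    moreover have "max C C' \<ge> 0" "min s s' > 0" using 1 2 by auto
    ultimately show ?case by blast
  qed
  then show ?thesis using fin by blast
qed

context soliton_domain begin

lemma good_consts_mono:
  assumes gc: "good_consts K P C s0" and le: "C \<le> C'" "s1 \<le> s0"
  shows "good_consts K P C' s1"
  unfolding good_consts_def
proof (intro ballI allI impI)
  fix x u e :: "real^'a" and \<phi> \<psi> \<rho> s :: real
  assume x: "x \<in> K"
    and as: "0 < \<rho> \<and> metric_at H x u u \<le> \<rho>\<^sup>2 \<and> metric_at H x e e = 1 \<and> \<bar>\<phi>\<bar> \<le> 1 \<and> \<bar>\<psi>\<bar> \<le> P * \<rho> \<and> \<bar>s\<bar> \<le> s1"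
  let ?X = "\<rho> + s * (\<psi> * metric_at H x u e / \<rho>) + s\<^sup>2 / (2 * \<rho>) * (\<psi>\<^sup>2 + \<phi>\<^sup>2 * metric_at H x u (curv H x e u e)
        - 4 * beta * \<phi> * \<psi> * metric_at H x u (Z x) - 2 * beta * \<phi>\<^sup>2 * metric_at H x u (S x u))"
  have "C * \<bar>s\<bar> ^ 3 * \<rho> \<le> C' * \<bar>s\<bar> ^ 3 * \<rho>" using le(1) as by (intro mult_right_mono) auto
  moreover have "yvar x e (s * \<phi>) \<in> U \<and>
    sqrt (metric_at H (yvar x e (s * \<phi>)) (dyvar x u e (s * \<phi>) (s * \<psi>)) (dyvar x u e (s * \<phi>) (s * \<psi>))) \<le> ?X + C * \<bar>s\<bar> ^ 3 * \<rho>"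
    by (rule gc[unfolded good_consts_def, rule_format, OF x]) (use as le(2) in linarith)
  ultimately show "yvar x e (s * \<phi>) \<in> U \<and>
    sqrt (metric_at H (yvar x e (s * \<phi>)) (dyvar x u e (s * \<phi>) (s * \<psi>)) (dyvar x u e (s * \<phi>) (s * \<psi>))) \<le> ?X + C' * \<bar>s\<bar> ^ 3 * \<rho>"
    by linarith
qed

end

section \<open>The variation along a whole curve and the distance bound\<close>

context ricci_soliton_mfd begin

text \<open>With the sine of the arc length as weight, \<psi> = \<omega> cos(\<omega> \<sigma>)
  \<rho>, and the bound on \<psi> demanded by \<open>good_consts\<close> reduces to
  \<open>\<omega> \<le> P\<close>.\<close>

lemma piece_variation:
  fixes C s0 P \<omega> \<kappa> k :: real
  assumes M: "connected_space M" and p: "p \<in> topspace M" and c: "c \<in> A" and K: "compact K" "K \<subseteq> chart_image c"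
    and gc: "soliton_domain.good_consts (chart_image c) (g c) (Fc c) K P C s0"
    and pw: "piecewise_C1_curve M A \<gamma>" and piece: "C1_piece \<gamma> c a b D" and ab: "0 \<le> a" "b \<le> 1"
    and xK: "\<And>t. t \<in> {a..b} \<Longrightarrow> snd c (\<gamma> t) \<in> K"
    and \<omega>: "0 < \<omega>" "\<omega> \<le> P" and \<kappa>: "\<kappa> > 0" and lam: "lam \<ge> 0"
    and k: "\<And>q. q \<in> topspace M \<Longrightarrow> 0 \<le> f q \<and> f q \<le> k"
  shows "variation_step p \<gamma> c (\<lambda>t. sin (\<omega> * arc \<gamma> \<kappa> t)) (arc \<gamma> \<kappa>) (accum (real CARD('b)) lam k \<omega> \<kappa> (arc \<gamma> \<kappa>) (f \<circ> \<gamma>)) C s0 a b"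
proof -
  define \<rho> where "\<rho> t = nrm c (snd c (\<gamma> t)) (D t) + \<kappa>" for t
  define \<psi> where "\<psi> t = \<omega> * cos (\<omega> * arc \<gamma> \<kappa> t) * \<rho> t" for t
  define dF where "dF t = dir_deriv (Fc c) (snd c (\<gamma> t)) (D t)" for t
  have dom: "\<gamma> t \<in> fst c" if "t \<in> {a..b}" for t using piece that unfolding C1_piece_def by auto
  have xU: "snd c (\<gamma> t) \<in> chart_image c" if "t \<in> {a..b}" for t using xK[OF that] K by blast
  have nn: "nrm c (snd c (\<gamma> t)) (D t) \<ge> 0" if "t \<in> {a..b}" for t by (rule nrm_nonneg[OF c xU[OF that]])
  have \<rho>: "\<rho> t > 0" if "t \<in> {a..b}" for t using nn[OF that] \<kappa> unfolding \<rho>_def by linarith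
  have msq: "(\<rho> t - \<kappa>)\<^sup>2 = metric_at (g c) (snd c (\<gamma> t)) (D t) (D t)" if "t \<in> {a..b}" for t
    using metric_domain.metric_nonneg[OF metric_domain[OF c] xU[OF that]] by (simp add: \<rho>_def)
  have \<sigma>: "(arc \<gamma> \<kappa> has_real_derivative \<rho> t) (at t within {a..b})" if "t \<in> {a..b}" for t
    using arc_derivative[OF pw c piece ab that] unfolding \<rho>_def has_real_derivative_iff_has_vector_derivative .
  have fd: "((f \<circ> \<gamma>) has_real_derivative dF t) (at t within {a..b})" if t: "t \<in> {a..b}" for t
  proof -
    have xd: "((\<lambda>t. snd c (\<gamma> t)) has_derivative (\<lambda>h. h *\<^sub>R D t)) (at t within {a..b})"
      using piece t unfolding C1_piece_def has_vector_derivative_def by blast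
    have Fd: "(Fc c has_derivative dir_deriv (Fc c) (snd c (\<gamma> t))) (at (snd c (\<gamma> t)))"
      by (rule smooth_on_has_derivative[OF smooth_Fc[OF c] xU[OF t]])
    have "((\<lambda>t. Fc c (snd c (\<gamma> t))) has_derivative (\<lambda>h. dir_deriv (Fc c) (snd c (\<gamma> t)) (h *\<^sub>R D t))) (at t within {a..b})"
      by (rule has_derivative_compose[OF xd Fd])
    then have "((\<lambda>t. Fc c (snd c (\<gamma> t))) has_vector_derivative dF t) (at t within {a..b})"
      unfolding has_vector_derivative_def dF_def by (simp add: linear_scale[OF has_derivative_linear[OF Fd]])
    then show ?thesis
      unfolding has_real_derivative_iff_has_vector_derivative
      by (rule has_vector_derivative_transform[OF t, rotated]) (simp add: Fc_def dom c)
  qed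
  have \<sigma>c: "continuous_on {a..b} (arc \<gamma> \<kappa>)"
    using \<sigma> DERIV_continuous unfolding continuous_on_eq_continuous_within by blast
  have f: "0 \<le> (f \<circ> \<gamma>) t \<and> (f \<circ> \<gamma>) t \<le> k" if "t \<in> {a..b}" for t
    using k dom[OF that] dom_topspace[OF c] by auto
  show ?thesis
  proof (rule piece_step[OF M p c K gc piece xK])
    show "(arc \<gamma> \<kappa> has_vector_derivative \<rho> t) (at t within {a..b})" if "t \<in> {a..b}" for t
      using \<sigma>[OF that] unfolding has_real_derivative_iff_has_vector_derivative .
    show "\<rho> t > 0" if "t \<in> {a..b}" for t by (rule \<rho>[OF that])
    show "metric_at (g c) (snd c (\<gamma> t)) (D t) (D t) \<le> (\<rho> t)\<^sup>2" if t: "t \<in> {a..b}" for t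
      unfolding msq[OF t, symmetric] using nn[OF t] \<kappa> by (intro power_mono) (auto simp: \<rho>_def)
    show "(accum (real CARD('b)) lam k \<omega> \<kappa> (arc \<gamma> \<kappa>) (f \<circ> \<gamma>) has_vector_derivative
        accum_rate (real CARD('b)) lam k \<omega> \<kappa> (arc \<gamma> \<kappa> t) (\<rho> t) ((f \<circ> \<gamma>) t) (dF t)) (at t within {a..b})" if t: "t \<in> {a..b}" for t
      using accum_derivative[OF \<sigma>[OF t] fd[OF t], of \<omega>] \<omega> unfolding has_real_derivative_iff_has_vector_derivative by simp
    show "(real CARD('b) * (\<psi> t)\<^sup>2 - lam * (sin (\<omega> * arc \<gamma> \<kappa> t))\<^sup>2 * metric_at (g c) (snd c (\<gamma> t)) (D t) (D t)
        - 2 * sin (\<omega> * arc \<gamma> \<kappa> t) * \<psi> t * dir_deriv (Fc c) (snd c (\<gamma> t)) (D t)) / \<rho> t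
      \<le> accum_rate (real CARD('b)) lam k \<omega> \<kappa> (arc \<gamma> \<kappa> t) (\<rho> t) ((f \<circ> \<gamma>) t) (dF t)" if t: "t \<in> {a..b}" for t
      unfolding \<psi>_def dF_def[symmetric]
      by (rule accum_rate_ge[OF \<rho>[OF t] msq[OF t] lam less_imp_le[OF \<kappa>] conjunct1[OF f[OF t]] conjunct2[OF f[OF t]]])
    show "((\<lambda>t. sin (\<omega> * arc \<gamma> \<kappa> t)) has_vector_derivative \<psi> t) (at t within {a..b})" if t: "t \<in> {a..b}" for t
      unfolding has_real_derivative_iff_has_vector_derivative[symmetric] \<psi>_def
      by (rule derivative_eq_intros \<sigma>[OF t] refl | simp)+
    show "continuous_on {a..b} \<psi>"
      unfolding \<psi>_def \<rho>_def by (intro continuous_intros \<sigma>c C1_piece_speed_integral(1)[OF c piece])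
    show "\<bar>sin (\<omega> * arc \<gamma> \<kappa> t)\<bar> \<le> 1" for t by simp
    show "\<bar>\<psi> t\<bar> \<le> P * \<rho> t" if t: "t \<in> {a..b}" for t
    proof -
      have "\<omega> * \<bar>cos (\<omega> * arc \<gamma> \<kappa> t)\<bar> \<le> P * 1" using \<omega> by (intro mult_mono) auto
      then have "\<omega> * \<bar>cos (\<omega> * arc \<gamma> \<kappa> t)\<bar> * \<rho> t \<le> P * \<rho> t" using \<rho>[OF t] by (intro mult_right_mono) auto
      then show ?thesis using \<rho>[OF t] \<omega> by (simp add: \<psi>_def abs_mult)
    qed
  qed
qed

lemma curve_variation:
  fixes C s0 P \<omega> \<kappa> k :: real
  assumes M: "connected_space M" and p: "p \<in> topspace M" and c: "c \<in> A" and K: "compact K" "K \<subseteq> chart_image c"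
    and gc: "soliton_domain.good_consts (chart_image c) (g c) (Fc c) K P C s0"
    and pw: "piecewise_C1_curve M A \<gamma>" and ab: "0 \<le> a" "a \<le> b" "b \<le> 1"
    and dom: "\<And>t. t \<in> {a..b} \<Longrightarrow> \<gamma> t \<in> fst c \<and> snd c (\<gamma> t) \<in> K"
    and \<omega>: "0 < \<omega>" "\<omega> \<le> P" and \<kappa>: "\<kappa> > 0" and lam: "lam \<ge> 0"
    and k: "\<And>q. q \<in> topspace M \<Longrightarrow> 0 \<le> f q \<and> f q \<le> k"
  shows "variation_step p \<gamma> c (\<lambda>t. sin (\<omega> * arc \<gamma> \<kappa> t)) (arc \<gamma> \<kappa>) (accum (real CARD('b)) lam k \<omega> \<kappa> (arc \<gamma> \<kappa>) (f \<circ> \<gamma>)) C s0 a b"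
proof (rule piecewise_chart_induct[OF pw c ab _ variation_step_refl])
  show "\<gamma> ` {a..b} \<subseteq> fst c" using dom by auto
  show "variation_step p \<gamma> c (\<lambda>t. sin (\<omega> * arc \<gamma> \<kappa> t)) (arc \<gamma> \<kappa>) (accum (real CARD('b)) lam k \<omega> \<kappa> (arc \<gamma> \<kappa>) (f \<circ> \<gamma>)) C s0 s t"
    if st: "a \<le> s" "t \<le> b" "C1_piece \<gamma> c s t D" for s t D
  proof (rule piece_variation[OF M p c K gc pw st(3) _ _ _ \<omega> \<kappa> lam k])
    show "snd c (\<gamma> u) \<in> K" if "u \<in> {s..t}" for u using dom[of u] that st by auto
  qed (use st ab in auto)
qed (rule variation_step_trans)

definition chart_jump :: "('a, 'b) chart \<Rightarrow> (real^'b) set \<Rightarrow> ('a, 'b) chart \<Rightarrow> (real^'b) set \<Rightarrow> real \<Rightarrow> real \<Rightarrow> bool" where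
  "chart_jump c K d L C s0 \<longleftrightarrow> (\<forall>q e \<tau>. q \<in> fst c \<and> q \<in> fst d \<and> snd c q \<in> K \<and> snd d q \<in> L \<and>
     metric_at (g c) (snd c q) e e = 1 \<and> \<bar>\<tau>\<bar> \<le> s0 \<longrightarrow>
     Yv c (snd c q) e \<tau> \<in> chart_image c \<and>
     Yv d (snd d q) (dir_deriv (chart_transition c d) (snd c q) e) \<tau> \<in> chart_image d \<and>
     riem_dist M A g (chart_inv c (Yv c (snd c q) e \<tau>))
       (chart_inv d (Yv d (snd d q) (dir_deriv (chart_transition c d) (snd c q) e) \<tau>)) \<le> C * \<bar>\<tau>\<bar> ^ 3)"

text \<open>The triangle inequality charges each of the 2 n points the distance between its versions
  in the two charts.\<close>

lemma total_dist_chart_jump: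
  assumes M: "connected_space M" and p: "p \<in> topspace M" and c: "c \<in> A" and d: "d \<in> A"
    and q: "q \<in> fst c" "q \<in> fst d" "snd c q \<in> K" "snd d q \<in> L"
    and jump: "chart_jump c K d L C s0" and E: "frame (g c) (snd c q) E" and \<tau>: "\<bar>\<tau>\<bar> \<le> s0"
  shows "total_dist p d (snd d q) (\<lambda>i. dir_deriv (chart_transition c d) (snd c q) (E i)) \<tau>
    \<le> total_dist p c (snd c q) E \<tau> + 2 * real CARD('b) * (C * \<bar>\<tau>\<bar> ^ 3)"
proof -
  let ?e' = "\<lambda>i. dir_deriv (chart_transition c d) (snd c q) (E i)"
  have ee: "metric_at (g c) (snd c q) (E i) (E i) = 1" for i using E by (simp add: frame_def)
  have le: "riem_dist M A g p (chart_inv d (Yv d (snd d q) (?e' i) v))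
      \<le> riem_dist M A g p (chart_inv c (Yv c (snd c q) (E i) v)) + C * \<bar>\<tau>\<bar> ^ 3" if v: "\<bar>v\<bar> = \<bar>\<tau>\<bar>" for i v
  proof -
    have j: "Yv c (snd c q) (E i) v \<in> chart_image c" "Yv d (snd d q) (?e' i) v \<in> chart_image d"
      "riem_dist M A g (chart_inv c (Yv c (snd c q) (E i) v)) (chart_inv d (Yv d (snd d q) (?e' i) v)) \<le> C * \<bar>v\<bar> ^ 3"
      using jump[unfolded chart_jump_def, rule_format, of q "E i" v] q ee v \<tau> by simp_all
    show ?thesis
      using riem_dist_triangle[OF M p chart_inv_topspace[OF c j(1)] chart_inv_topspace[OF d j(2)]] j(3) v by simp
  qed
  have "total_dist p d (snd d q) ?e' \<tau> \<le> (\<Sum>(i, b)\<in>UNIV. riem_dist M A g p (chart_inv c (Yv c (snd c q) (E i) (if b then \<tau> else - \<tau>))) + C * \<bar>\<tau>\<bar> ^ 3)"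
    unfolding total_dist_def case_prod_unfold by (intro sum_mono le) simp
  also have "\<dots> = total_dist p c (snd c q) E \<tau> + 2 * real CARD('b) * (C * \<bar>\<tau>\<bar> ^ 3)"
    unfolding total_dist_def case_prod_unfold sum.distrib by simp
  finally show ?thesis .
qed

text \<open>The pair is ordered: estimates are made on the first patch, then the chart is changed to
  the second. \<open>s0\<close> bounds the variation parameter and also the arc length of one step;
  \<open>s0 \<le> m * r\<close> keeps such a step within twice the radius.\<close>

definition patch_consts :: "real \<Rightarrow> (('a, 'b) chart \<times> (real^'b) \<times> real) \<times> (('a, 'b) chart \<times> (real^'b) \<times> real) \<Rightarrow> real \<Rightarrow> real \<Rightarrow> bool" where
  "patch_consts P = (\<lambda>((c, z, r), (d, w, r')) C s0.
     soliton_domain.good_consts (chart_image c) (g c) (Fc c) (cball z (2 * r)) P C s0 \<and>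
     (\<exists>m>0. s0 \<le> m * r \<and> (\<forall>x\<in>cball z (2 * r). \<forall>v. m * norm v \<le> nrm c x v)) \<and>
     chart_jump c (cball z (2 * r)) d (cball w (2 * r')) C s0)"

lemma chart_jump_mono:
  assumes jump: "chart_jump c K d L C s0" and le: "C \<le> C'" "s1 \<le> s0"
  shows "chart_jump c K d L C' s1"
  unfolding chart_jump_def
proof (intro allI impI)
  fix q e \<tau>
  assume as: "q \<in> fst c \<and> q \<in> fst d \<and> snd c q \<in> K \<and> snd d q \<in> L \<and> metric_at (g c) (snd c q) e e = 1 \<and> \<bar>\<tau>\<bar> \<le> s1"
  let ?y = "Yv c (snd c q) e \<tau>" let ?z = "Yv d (snd d q) (dir_deriv (chart_transition c d) (snd c q) e) \<tau>"
  have "C * \<bar>\<tau>\<bar> ^ 3 \<le> C' * \<bar>\<tau>\<bar> ^ 3" using le(1) by (intro mult_right_mono) auto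
  moreover have "?y \<in> chart_image c \<and> ?z \<in> chart_image d \<and> riem_dist M A g (chart_inv c ?y) (chart_inv d ?z) \<le> C * \<bar>\<tau>\<bar> ^ 3"
    by (rule jump[unfolded chart_jump_def, rule_format]) (use as le(2) in linarith)
  ultimately show "?y \<in> chart_image c \<and> ?z \<in> chart_image d \<and> riem_dist M A g (chart_inv c ?y) (chart_inv d ?z) \<le> C' * \<bar>\<tau>\<bar> ^ 3"
    by linarith
qed

lemma patch_consts_exist:
  assumes c: "c \<in> A" "r > 0" "cball z (3 * r) \<subseteq> chart_image c" and d: "d \<in> A" "r' > 0" "cball w (3 * r') \<subseteq> chart_image d"
    and P: "P \<ge> 0"
  shows "\<exists>C\<ge>0. \<exists>s0>0. patch_consts P ((c, z, r), (d, w, r')) C s0"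
proof -
  interpret C: soliton_domain "chart_image c" "g c" "Fc c" lam by (rule soliton_domain[OF c(1)])
  have "cball z (2 * r) \<subseteq> cball z (3 * r)" using c(2) by (intro cball_subset_cball_iff[THEN iffD2] disjI1) simp
  then have sub: "cball z (2 * r) \<subseteq> chart_image c" using c(3) by (rule order_trans)
  obtain C1 s1 where 1: "C1 \<ge> 0" "s1 > 0" "C.good_consts (cball z (2 * r)) P C1 s1"
    using C.good_consts_exist[OF compact_cball sub P] by blast
  obtain m where m: "m > 0" "\<forall>x\<in>cball z (2 * r). \<forall>v. m * norm v \<le> nrm c x v"
    using C.metric_lower_bound[OF compact_cball sub] by blast
  obtain C2 s2 where 2: "C2 \<ge> 0" "s2 > 0" "chart_jump c (cball z (2 * r)) d (cball w (2 * r')) C2 s2"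
    using chart_change[OF c(1) d(1) compact_cball sub d(2,3)] unfolding chart_jump_def by blast
  define s0 where "s0 = min (m * r) (min s1 s2)"
  have s0: "s0 > 0" "s0 \<le> m * r" "s0 \<le> s1" "s0 \<le> s2" using 1 2 m c(2) by (auto simp: s0_def)
  have "patch_consts P ((c, z, r), (d, w, r')) (max C1 C2) s0"
    unfolding patch_consts_def prod.case
    by (intro conjI exI[of _ m] m s0 C.good_consts_mono[OF 1(3)] chart_jump_mono[OF 2(3)]) auto
  then show ?thesis using s0(1) 1(1) by (intro exI[of _ "max C1 C2"] conjI exI[of _ s0]) auto
qed

lemma patch_consts_mono:
  assumes pc: "patch_consts P ((c, z, r), (d, w, r')) C s0" and c: "c \<in> A" and le: "C \<le> C'" "s1 \<le> s0"
  shows "patch_consts P ((c, z, r), (d, w, r')) C' s1"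
proof -
  interpret C: soliton_domain "chart_image c" "g c" "Fc c" lam by (rule soliton_domain[OF c])
  obtain m where m: "m > 0" "s0 \<le> m * r" "\<forall>x\<in>cball z (2 * r). \<forall>v. m * norm v \<le> nrm c x v"
    and 1: "C.good_consts (cball z (2 * r)) P C s0" and 2: "chart_jump c (cball z (2 * r)) d (cball w (2 * r')) C s0"
    using pc unfolding patch_consts_def prod.case by blast
  show ?thesis
    unfolding patch_consts_def prod.case
    using C.good_consts_mono[OF 1 le] m(1) order_trans[OF le(2) m(2)] m(3) chart_jump_mono[OF 2 le]
    by (intro conjI exI[of _ m])
qed

text \<open>Induction over steps of arc length \<open>s0\<close>. A step stays in one patch and ends
  with one change of charts, at the cost of \<open>2 * real CARD('b) * C * s ^ 3\<close>; the
  summand \<open>j\<close> in the last term counts these changes.\<close>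

lemma curve_estimate:
  fixes C s0 P \<omega> \<kappa> k :: real
  assumes M: "connected_space M" and PS: "\<And>c z r. (c, z, r) \<in> PS \<Longrightarrow> c \<in> A \<and> r > 0 \<and> cball z (3 * r) \<subseteq> chart_image c"
    and cov: "\<And>q. q \<in> topspace M \<Longrightarrow> \<exists>(c, z, r)\<in>PS. q \<in> fst c \<and> snd c q \<in> ball z r"
    and uniform: "\<And>x. x \<in> PS \<times> PS \<Longrightarrow> patch_consts P x C s0" and C: "C \<ge> 0" and s0: "s0 > 0"
    and pw: "piecewise_C1_curve M A \<gamma>" and \<omega>: "0 < \<omega>" "\<omega> \<le> P" and \<kappa>: "\<kappa> > 0" and lam: "lam \<ge> 0"
    and k: "\<And>q. q \<in> topspace M \<Longrightarrow> 0 \<le> f q \<and> f q \<le> k" and t: "0 \<le> t" "t \<le> 1" and j: "arc \<gamma> \<kappa> t \<le> real j * s0"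
  shows "\<exists>c z r E. (c, z, r) \<in> PS \<and> \<gamma> t \<in> fst c \<and> snd c (\<gamma> t) \<in> ball z r \<and> frame (g c) (snd c (\<gamma> t)) E \<and>
    (\<forall>s. 0 < s \<and> s \<le> s0 \<longrightarrow> total_dist (\<gamma> 0) c (snd c (\<gamma> t)) E (s * sin (\<omega> * arc \<gamma> \<kappa> t)) \<le> 2 * real CARD('b) * arc \<gamma> \<kappa> t
      + s\<^sup>2 * accum (real CARD('b)) lam k \<omega> \<kappa> (arc \<gamma> \<kappa>) (f \<circ> \<gamma>) t
      + 2 * real CARD('b) * C * s ^ 3 * (arc \<gamma> \<kappa> t + j))"
proof -
  let ?\<sigma> = "arc \<gamma> \<kappa>" let ?n = "real CARD('b)"
  let ?\<phi> = "\<lambda>t. sin (\<omega> * arc \<gamma> \<kappa> t)" let ?Acc = "accum ?n lam k \<omega> \<kappa> ?\<sigma> (f \<circ> \<gamma>)"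
  let ?bound = "\<lambda>j t s. 2 * ?n * ?\<sigma> t + s\<^sup>2 * ?Acc t + 2 * ?n * C * s ^ 3 * (?\<sigma> t + real j)"
  let ?G = "\<lambda>j t. \<exists>c z r E. (c, z, r) \<in> PS \<and> \<gamma> t \<in> fst c \<and> snd c (\<gamma> t) \<in> ball z r \<and> frame (g c) (snd c (\<gamma> t)) E \<and>
    (\<forall>s. 0 < s \<and> s \<le> s0 \<longrightarrow> total_dist (\<gamma> 0) c (snd c (\<gamma> t)) E (s * ?\<phi> t) \<le> ?bound j t s)"
  have path: "pathin M \<gamma>" using pw by (simp add: piecewise_C1_curve_def)
  have tops: "\<gamma> u \<in> topspace M" if "0 \<le> u" "u \<le> 1" for u by (rule pathin_topspace[OF path that])
  have p: "\<gamma> 0 \<in> topspace M" by (rule tops) auto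
  have \<sigma>0: "?\<sigma> 0 = 0" by (simp add: arc_def)
  have C3: "C * s ^ 3 \<ge> 0" if "s > 0" for s using C that by simp
  have "\<forall>t. 0 \<le> t \<and> t \<le> 1 \<and> ?\<sigma> t \<le> real j * s0 \<longrightarrow> ?G j t"
  proof (induction j)
    case 0
    show ?case
    proof (intro allI impI)
      fix t assume t: "0 \<le> t \<and> t \<le> 1 \<and> ?\<sigma> t \<le> real 0 * s0"
      \<comment> \<open>As \<kappa> is positive, zero arc length occurs at time 0 only, even for a
        curve that rests at first.\<close>
      have "\<kappa> * t \<le> 0" using arc_diff(1)[OF pw, of 0 t \<kappa>] arc_diff(2)[OF pw, of 0 t] t \<sigma>0 by simp
      then have t0: "t = 0" using \<kappa> t by (simp add: mult_le_0_iff)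
      obtain c z r where cz: "(c, z, r) \<in> PS" "\<gamma> 0 \<in> fst c" "snd c (\<gamma> 0) \<in> ball z r" using cov[OF p] by auto
      have c: "c \<in> A" using PS[OF cz(1)] by simp
      obtain E where E: "frame (g c) (snd c (\<gamma> 0)) E"
        using metric_domain.exists_frame[OF metric_domain[OF c] chart_in_image[OF cz(2)]] by blast
      have "total_dist (\<gamma> 0) c (snd c (\<gamma> 0)) E 0 \<le> 0"
        unfolding total_dist_def case_prod_unfold
        by (intro sum_nonpos) (use riem_dist_refl_le[OF p] in \<open>simp add: Yv_eq c cz(2)\<close>)
      then have "\<forall>s. 0 < s \<and> s \<le> s0 \<longrightarrow> total_dist (\<gamma> 0) c (snd c (\<gamma> 0)) E (s * ?\<phi> 0) \<le> ?bound 0 0 s"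
        by (simp add: \<sigma>0 accum_def)
      then show "?G 0 t" unfolding t0 using cz E by blast
    qed
  next
    case (Suc j)
    show ?case
    proof (intro allI impI)
      fix t assume t: "0 \<le> t \<and> t \<le> 1 \<and> ?\<sigma> t \<le> real (Suc j) * s0"
      \<comment> \<open>The induction hypothesis is applied at the time where the arc length equals
        \<open>v\<close>; the minimum covers a \<open>t\<close> that \<open>j\<close> steps already
        reach.\<close>
      define v where "v = min (?\<sigma> t) (real j * s0)"
      have "\<exists>u. 0 \<le> u \<and> u \<le> t \<and> ?\<sigma> u = v"
      proof (rule IVT')
        have "0 \<le> ?\<sigma> t" using arc_diff(1)[OF pw, of 0 t \<kappa>] arc_diff(2)[OF pw, of 0 t] t \<sigma>0 \<kappa> by simp
        then show "?\<sigma> 0 \<le> v" using s0 by (simp add: v_def \<sigma>0)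
        show "v \<le> ?\<sigma> t" by (simp add: v_def)
        show "continuous_on {0..t} ?\<sigma>" using arc_continuous[OF pw] by (rule continuous_on_subset) (use t in auto)
      qed (use t in auto)
      then obtain u where u: "0 \<le> u" "u \<le> t" "?\<sigma> u = v" by blast
      have v: "v \<le> real j * s0" "?\<sigma> t - v \<le> s0" using t s0 by (auto simp: v_def min_def algebra_simps)
      obtain c z r E where cz: "(c, z, r) \<in> PS" "\<gamma> u \<in> fst c" "snd c (\<gamma> u) \<in> ball z r" "frame (g c) (snd c (\<gamma> u)) E"
        and IH: "\<And>s. 0 < s \<and> s \<le> s0 \<Longrightarrow> total_dist (\<gamma> 0) c (snd c (\<gamma> u)) E (s * ?\<phi> u) \<le> ?bound j u s"
        using Suc.IH[rule_format, of u] u v(1) t by auto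
      obtain d w r' where dw: "(d, w, r') \<in> PS" "\<gamma> t \<in> fst d" "snd d (\<gamma> t) \<in> ball w r'" using cov[OF tops[of t]] t by auto
      have c: "c \<in> A" "r > 0" "cball z (3 * r) \<subseteq> chart_image c" using PS[OF cz(1)] by auto
      have d: "d \<in> A" "r' > 0" using PS[OF dw(1)] by auto
      have "cball z (2 * r) \<subseteq> cball z (3 * r)" using c(2) by (intro cball_subset_cball_iff[THEN iffD2] disjI1) simp
      then have sub: "cball z (2 * r) \<subseteq> chart_image c" using c(3) by (rule order_trans)
      have pc: "patch_consts P ((c, z, r), (d, w, r')) C s0" using uniform cz(1) dw(1) by simp
      obtain m where m: "m > 0" "s0 \<le> m * r" "\<forall>x\<in>cball z (2 * r). \<forall>v. m * norm v \<le> nrm c x v"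
        and gc: "soliton_domain.good_consts (chart_image c) (g c) (Fc c) (cball z (2 * r)) P C s0"
        and jump: "chart_jump c (cball z (2 * r)) d (cball w (2 * r')) C s0"
        using pc unfolding patch_consts_def prod.case by blast
      have short: "integral {u..t} (curve_speed A g \<gamma>) \<le> m * r"
      proof -
        have "0 \<le> \<kappa> * (t - u)" using \<kappa> u by simp
        then show ?thesis using arc_diff(1)[OF pw u(1,2), of \<kappa>] t v(2) m(2) u(3) by simp
      qed
      have in2: "\<gamma> x \<in> fst c \<and> snd c (\<gamma> x) \<in> ball z (2 * r)" if "x \<in> {u..t}" for x
        by (rule short_curve_in_ball[OF pw c(1) sub m(1) m(3)[rule_format] u(1,2) _ cz(2,3) short that]) (use t in auto)
      have "variation_step (\<gamma> 0) \<gamma> c ?\<phi> ?\<sigma> ?Acc C s0 u t"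
      proof (rule curve_variation[OF M p c(1) compact_cball sub gc pw u(1,2) _ _ \<omega> \<kappa> lam k])
        show "\<gamma> x \<in> fst c \<and> snd c (\<gamma> x) \<in> cball z (2 * r)" if "x \<in> {u..t}" for x
          using in2[OF that] by (simp add: less_imp_le)
      qed (use t in auto)
      then obtain E' where E': "frame (g c) (snd c (\<gamma> t)) E'" and st: "\<And>s. 0 < s \<and> s \<le> s0 \<Longrightarrow>
          total_dist (\<gamma> 0) c (snd c (\<gamma> t)) E' (s * ?\<phi> t) \<le> total_dist (\<gamma> 0) c (snd c (\<gamma> u)) E (s * ?\<phi> u)
            + 2 * ?n * (?\<sigma> t - ?\<sigma> u) + s\<^sup>2 * (?Acc t - ?Acc u) + 2 * ?n * C * s ^ 3 * (?\<sigma> t - ?\<sigma> u)"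
        using cz(4) unfolding variation_step_def by meson
      have tc: "\<gamma> t \<in> fst c" "snd c (\<gamma> t) \<in> cball z (2 * r)" using in2[of t] u(2) by (auto simp: less_imp_le)
      have td: "snd d (\<gamma> t) \<in> cball w (2 * r')" using dw(3) d(2) by simp
      define E'' where "E'' = (\<lambda>i. dir_deriv (chart_transition c d) (snd c (\<gamma> t)) (E' i))"
      have "snd c (\<gamma> t) \<in> overlap c d" using tc(1) dw(2) by (auto simp: overlap_def)
      from frame_transition[OF c(1) d(1) this E']
      have E'': "frame (g d) (snd d (\<gamma> t)) E''" using tc(1) c(1) by (simp add: E''_def)
      have fin: "total_dist (\<gamma> 0) d (snd d (\<gamma> t)) E'' (s * ?\<phi> t) \<le> ?bound (Suc j) t s" if s: "0 < s \<and> s \<le> s0" for s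
      proof -
        have "s * \<bar>?\<phi> t\<bar> \<le> s * 1" using s by (intro mult_left_mono) auto
        then have le: "\<bar>s * ?\<phi> t\<bar> \<le> s" using s by (simp add: abs_mult)
        have "\<bar>s * ?\<phi> t\<bar> ^ 3 \<le> s ^ 3" by (rule power_mono[OF le]) simp
        then have "2 * ?n * (C * \<bar>s * ?\<phi> t\<bar> ^ 3) \<le> 2 * ?n * (C * s ^ 3)" using C by (intro mult_left_mono) auto
        moreover have "total_dist (\<gamma> 0) d (snd d (\<gamma> t)) E'' (s * ?\<phi> t)
            \<le> total_dist (\<gamma> 0) c (snd c (\<gamma> t)) E' (s * ?\<phi> t) + 2 * ?n * (C * \<bar>s * ?\<phi> t\<bar> ^ 3)"
          unfolding E''_def
          by (rule total_dist_chart_jump[OF M p c(1) d(1) tc(1) dw(2) tc(2) td jump E']) (use le s in linarith)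
        ultimately have "total_dist (\<gamma> 0) d (snd d (\<gamma> t)) E'' (s * ?\<phi> t) \<le> ?bound j u s
            + 2 * ?n * (?\<sigma> t - ?\<sigma> u) + s\<^sup>2 * (?Acc t - ?Acc u) + 2 * ?n * C * s ^ 3 * (?\<sigma> t - ?\<sigma> u) + 2 * ?n * (C * s ^ 3)"
          using IH[OF s] st[OF s] by linarith
        also have "\<dots> = ?bound (Suc j) t s" by (simp add: algebra_simps)
        finally show ?thesis .
      qed
      show "?G (Suc j) t" using dw E'' fin by blast
    qed
  qed
  then show ?thesis using t j by blast
qed

text \<open>The gap \<open>G\<close> and the constants \<open>C\<close>, \<open>s0\<close>,
  \<open>N\<close>, \<open>K\<close> are fixed before a nearly minimal curve is taken. The 2 n
  distances at its end are exactly \<open>D\<close>, while the estimate puts their sum below 2 n D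
  by s^2 D G / 2, up to errors governed by \<delta> and s^3.\<close>

lemma weak_myers:
  fixes k :: real
  assumes "compact_space M" "connected_space M" and p: "p \<in> topspace M" and q: "q \<in> topspace M" and lam: "lam > 0"
    and k: "\<And>q. q \<in> topspace M \<Longrightarrow> 0 \<le> f q \<and> f q \<le> k"
  shows "lam * (riem_dist M A g p q)\<^sup>2 \<le> pi\<^sup>2 * (real CARD('b) + 99 / 70 * k)"
proof (rule ccontr)
  assume neg: "\<not> ?thesis"
  let ?n = "real CARD('b)"
  define D where "D = riem_dist M A g p q"
  have D0: "D \<ge> 0"
  proof (rule ccontr)
    assume "\<not> D \<ge> 0"
    then obtain l where "conn p q l" "l < D + - D" using riem_dist_approx[OF assms(2) p q, of "- D"] unfolding D_def by auto
    then show False using conn_nonneg[of p q l] by simp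
  qed
  have k0: "k \<ge> 0" using k[OF p] by linarith
  have n1: "?n \<ge> 1" using zero_less_card_finite[where 'a = 'b] by linarith
  have gap: "pi\<^sup>2 * (?n + 99 / 70 * k) < lam * D\<^sup>2" using neg by (simp add: D_def)
  have "0 \<le> pi\<^sup>2 * (?n + 99 / 70 * k)" using k0 by simp
  then have "D \<noteq> 0" using gap by auto
  then have D: "D > 0" using D0 by simp
  \<comment> \<open>Up to the factor \<open>- D / 2\<close> this is the limit of
    \<open>accum\<close> at the end of the curve as \<delta> tends to 0.\<close>
  define G where "G = lam - pi\<^sup>2 * (?n + 99 / 70 * k) / D\<^sup>2"
  have G: "G > 0" using gap D by (simp add: G_def pos_divide_less_eq)
  from finite_patches[OF assms(1)]
  obtain PS where PS3: "finite PS \<and> (\<forall>(c, z, r)\<in>PS. c \<in> A \<and> r > 0 \<and> cball z (3 * r) \<subseteq> chart_image c) \<and>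
      (\<forall>p\<in>topspace M. \<exists>(c, z, r)\<in>PS. p \<in> fst c \<and> snd c p \<in> ball z r)"
    by (rule exE)
  note PS = conjunct1[OF PS3] conjunct1[OF conjunct2[OF PS3]] and cov = conjunct2[OF conjunct2[OF PS3]]
  have PS': "c \<in> A \<and> r > 0 \<and> cball z (3 * r) \<subseteq> chart_image c" if "(c, z, r) \<in> PS" for c z r
    using bspec[OF PS(2) that] unfolding prod.case .
  \<comment> \<open>\<open>pi / D\<close> dominates the frequency pi / L of every curve considered,
    since L is at least \<open>D\<close>; hence these constants serve all curves.\<close>
  have "\<exists>C\<ge>0. \<exists>s0>0. \<forall>x\<in>PS \<times> PS. patch_consts (pi / D) x C s0"
  proof (rule finite_uniform_constants)
    show "finite (PS \<times> PS)" using PS(1) by simp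
    fix x assume x: "x \<in> PS \<times> PS"
    obtain c z r d w r' where x': "x = ((c, z, r), (d, w, r'))" by (metis surj_pair)
    have c: "c \<in> A" "r > 0" "cball z (3 * r) \<subseteq> chart_image c" and d: "d \<in> A" "r' > 0" "cball w (3 * r') \<subseteq> chart_image d"
      using PS'[of c z r] PS'[of d w r'] x by (simp_all add: x')
    show "\<exists>C\<ge>0. \<exists>s0>0. patch_consts (pi / D) x C s0"
      unfolding x' by (rule patch_consts_exist[OF c d]) (use D in simp)
    show "patch_consts (pi / D) x C' s1" if "patch_consts (pi / D) x C s0" "C \<le> C'" "s1 \<le> s0" for C s0 C' s1
      using patch_consts_mono[OF _ c(1) that(2,3)] that(1) unfolding x' by blast
  qed
  then obtain C s0 where C: "C \<ge> 0" and s0: "s0 > 0" and uniform: "\<And>x. x \<in> PS \<times> PS \<Longrightarrow> patch_consts (pi / D) x C s0" by blast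
  \<comment> \<open>\<open>D + 2\<close> bounds the modified length, at most
    \<open>D + 2 * \<delta>\<close>, so that \<open>N\<close> steps suffice for every \<delta> <
    1.\<close>
  obtain N :: nat where N: "D + 2 \<le> real N * s0"
  proof -
    obtain N :: nat where "(D + 2) / s0 \<le> real N" using real_arch_simple by blast
    then show ?thesis using that s0 by (simp add: pos_divide_le_eq)
  qed
  define K where "K = 2 * ?n * C * (D + 2 + real N)"
  have K: "K \<ge> 0" using C D by (simp add: K_def)
  have main: "0 \<le> 4 * ?n * \<delta> + s\<^sup>2 * (2 * \<delta> * lam - D * G / 2) + s ^ 3 * K"
    if \<delta>: "0 < \<delta>" "\<delta> < 1" and s: "0 < s" "s \<le> s0" for \<delta> s
  proof -
    obtain l where l: "conn p q l" "l < D + \<delta>" using riem_dist_approx[OF assms(2) p q \<delta>(1)] unfolding D_def by blast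
    have lD: "D \<le> l" unfolding D_def by (rule riem_dist_le[OF l(1)])
    obtain \<gamma> where pw: "piecewise_C1_curve M A \<gamma>" and ends: "\<gamma> 0 = p" "\<gamma> 1 = q"
      and len: "(curve_speed A g \<gamma> has_integral l) {0..1}" using l(1) unfolding conn_def by blast
    define L where "L = arc \<gamma> \<delta> 1"
    have L: "L = l + \<delta>" using integral_unique[OF len] by (simp add: L_def arc_def)
    have LD: "D \<le> L" "L \<le> D + 2 * \<delta>" "L > 0" "L \<le> D + 2" using L lD l(2) \<delta> D by auto
    define \<omega> where "\<omega> = pi / L"
    have \<omega>: "\<omega> > 0" "\<omega> \<le> pi / D" "\<omega> * L = pi"
      using LD D by (auto simp: \<omega>_def intro!: divide_left_mono)
    have aN: "arc \<gamma> \<delta> 1 \<le> real N * s0" using LD N unfolding L_def[symmetric] by linarith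
    have "\<exists>c z r E. (c, z, r) \<in> PS \<and> \<gamma> 1 \<in> fst c \<and> snd c (\<gamma> 1) \<in> ball z r \<and> frame (g c) (snd c (\<gamma> 1)) E \<and>
      (\<forall>s. 0 < s \<and> s \<le> s0 \<longrightarrow> total_dist (\<gamma> 0) c (snd c (\<gamma> 1)) E (s * sin (\<omega> * L)) \<le> 2 * ?n * L
        + s\<^sup>2 * accum ?n lam k \<omega> \<delta> (arc \<gamma> \<delta>) (f \<circ> \<gamma>) 1 + 2 * ?n * C * s ^ 3 * (L + real N))"
      unfolding L_def
      by (rule curve_estimate[OF assms(2) PS' cov[rule_format] uniform C s0 pw \<omega>(1,2) \<delta>(1) less_imp_le[OF lam] k zero_le_one order_refl aN])
    then obtain c z r E where cz: "(c, z, r) \<in> PS" "\<gamma> 1 \<in> fst c"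
      and est: "(\<forall>s. 0 < s \<and> s \<le> s0 \<longrightarrow> total_dist (\<gamma> 0) c (snd c (\<gamma> 1)) E (s * sin (\<omega> * L)) \<le> 2 * ?n * L
        + s\<^sup>2 * accum ?n lam k \<omega> \<delta> (arc \<gamma> \<delta>) (f \<circ> \<gamma>) 1 + 2 * ?n * C * s ^ 3 * (L + real N))"
      by (elim exE conjE) (rule that; assumption)
    have c: "c \<in> A" using PS'[OF cz(1)] by simp
    \<comment> \<open>\<open>\<omega> * L = pi\<close> makes the sine vanish at the end, so all
      varied points coincide with \<open>q\<close>.\<close>
    have "total_dist p c (snd c q) E 0 = 2 * ?n * D"
    proof -
      have "(if b then 0 else - (0::real)) = 0" for b :: bool by simp
      then show ?thesis
        unfolding total_dist_def case_prod_unfold using cz(2) c by (simp add: Yv_eq ends D_def)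
    qed
    then have 1: "2 * ?n * D \<le> 2 * ?n * L + s\<^sup>2 * accum ?n lam k \<omega> \<delta> (arc \<gamma> \<delta>) (f \<circ> \<gamma>) 1 + 2 * ?n * C * s ^ 3 * (L + real N)"
      using est[rule_format, of s] s by (simp add: \<omega>(3) ends)
    \<comment> \<open>The oscillating terms vanish at the end, among them the boundary term of the
      integration by parts; the value of f at \<open>q\<close> drops out.\<close>
    have sin0: "sin (2 * \<omega> * L) = 0" "sin (4 * \<omega> * L) = 0"
    proof -
      have "2 * \<omega> * L = 2 * pi" "4 * \<omega> * L = of_nat 4 * pi" using \<omega>(3) by auto
      then show "sin (2 * \<omega> * L) = 0" "sin (4 * \<omega> * L) = 0" by (simp_all only: sin_two_pi sin_npi)
    qed
    have "accum ?n lam k \<omega> \<delta> (arc \<gamma> \<delta>) (f \<circ> \<gamma>) 1 = ?n * \<omega>\<^sup>2 * (L / 2) - lam * (L / 2) + 2 * \<delta> * lam + \<omega>\<^sup>2 * k * (99 / 140 * L)"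
      unfolding accum_def L_def[symmetric] sin0 by simp
    also have "\<dots> = L / 2 * (pi\<^sup>2 * (?n + 99 / 70 * k) / L\<^sup>2 - lam) + 2 * \<delta> * lam"
      using LD(3) by (simp add: \<omega>_def field_simps power2_eq_square)
    also have "\<dots> \<le> - (D / 2 * G) + 2 * \<delta> * lam"
    proof -
      have "pi\<^sup>2 * (?n + 99 / 70 * k) / L\<^sup>2 \<le> pi\<^sup>2 * (?n + 99 / 70 * k) / D\<^sup>2"
        using k0 D LD by (intro divide_left_mono power_mono mult_nonneg_nonneg) auto
      then have "L / 2 * (pi\<^sup>2 * (?n + 99 / 70 * k) / L\<^sup>2 - lam) \<le> L / 2 * (- G)"
        unfolding G_def using LD(3) by (intro mult_left_mono) auto
      moreover have "D / 2 * G \<le> L / 2 * G" using LD(1) G by (intro mult_right_mono) auto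
      ultimately show ?thesis by linarith
    qed
    finally have "s\<^sup>2 * accum ?n lam k \<omega> \<delta> (arc \<gamma> \<delta>) (f \<circ> \<gamma>) 1 \<le> s\<^sup>2 * (2 * \<delta> * lam - D * G / 2)"
      by (intro mult_left_mono) auto
    moreover have "2 * ?n * C * s ^ 3 * (L + real N) \<le> 2 * ?n * C * s ^ 3 * (D + 2 + real N)"
      using LD(4) C s by (intro mult_left_mono) auto
    moreover have "2 * ?n * C * s ^ 3 * (D + 2 + real N) = s ^ 3 * K" by (simp add: K_def)
    moreover have "2 * ?n * L \<le> 2 * ?n * (D + 2 * \<delta>)" using LD(2) by (intro mult_left_mono) auto
    moreover have "2 * ?n * (D + 2 * \<delta>) = 2 * ?n * D + 4 * ?n * \<delta>" by (simp add: algebra_simps)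
    ultimately show ?thesis using 1 by linarith
  qed
  \<comment> \<open>\<open>s\<close> is chosen before \<delta>. In units of s^2 D G the cubic term
    takes one eighth, and \<delta>, small against s^2, adds two more; three eighths stay below the
    gain of one half.\<close>
  define s where "s = min s0 (D * G / (8 * (K + 1)))"
  have DG: "D * G > 0" using D G by simp
  have s: "0 < s" "s \<le> s0" using s0 DG K by (auto simp: s_def)
  have sK: "s * K \<le> D * G / 8"
  proof -
    have "s * K \<le> D * G / (8 * (K + 1)) * (K + 1)" using s K DG by (intro mult_mono) (auto simp: s_def)
    also have "\<dots> = D * G / 8" using K by (simp add: field_simps)
    finally show ?thesis .
  qed
  define \<delta> where "\<delta> = min (1 / 2) (min (s\<^sup>2 * (D * G) / (32 * ?n)) (D * G / (16 * lam)))"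
  have \<delta>: "0 < \<delta>" "\<delta> < 1" using s DG lam n1 by (auto simp: \<delta>_def)
  have "\<delta> \<le> s\<^sup>2 * (D * G) / (32 * ?n)" by (simp add: \<delta>_def)
  then have 1: "4 * ?n * \<delta> \<le> s\<^sup>2 * (D * G / 8)" using n1 by (simp add: field_simps)
  have "\<delta> \<le> D * G / (16 * lam)" by (simp add: \<delta>_def)
  then have 2: "2 * \<delta> * lam \<le> D * G / 8" using lam by (simp add: field_simps)
  have 3: "s ^ 3 * K \<le> s\<^sup>2 * (D * G / 8)"
    using mult_left_mono[OF sK, of "s\<^sup>2"] by (simp add: power2_eq_square power3_eq_cube mult_ac)
  have "s\<^sup>2 * (2 * \<delta> * lam - D * G / 2) \<le> s\<^sup>2 * (D * G / 8 - D * G / 2)" using 2 by (intro mult_left_mono) auto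
  moreover have "s\<^sup>2 * (D * G) > 0" using s DG by simp
  ultimately show False using main[OF \<delta> s] 1 3 by (simp add: algebra_simps)
qed

end

theorem corollary1p14:
  fixes M :: "'a topology"
    and A :: "('a, 4) chart set"
    and g :: "('a, 4) metric"
    and f :: "'a \<Rightarrow> real"
    and lam Rmax :: real
    and \<mu> :: "'a chain set"
  assumes "riemannian_manifold M A g"
    and "compact_space M" and "connected_space M" and "topspace M \<noteq> {}"
    and "fundamental_class 4 M \<mu>"
    and "lam > 0"
    and "smooth_function A f"
    and "ricci_soliton A g f lam"
    and "\<forall>p\<in>topspace M. scalar_curvature A g p + grad_norm_sq A g f p = 2 * lam * f p"
    and "Rmax \<in> scalar_curvature A g ` topspace M"
    and "\<forall>p\<in>topspace M. scalar_curvature A g p \<le> Rmax"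
    and "sqrt (Rmax / lam\<^sup>2 * (4 * pi + pi\<^sup>2 / 2)) \<le> riem_diam M A g"
  shows "2 * euler_characteristic M \<ge> 3 * \<bar>signature M \<mu>\<bar>"
proof -
  interpret ricci_soliton_mfd M A g f lam
    using assms by unfold_locales auto
  have lam: "lam > 0" by (rule assms(6))
  have Rmax: "scalar_curvature A g p \<le> Rmax" if "p \<in> topspace M" for p using assms(11) that by blast
  have R4: "4 * lam \<le> Rmax" using potential_bounds(1)[OF assms(2,4) lam Rmax] by simp
  define k where "k = Rmax / (2 * lam)"
  have k: "0 \<le> f p \<and> f p \<le> k" if "p \<in> topspace M" for p
    using potential_bounds(2,3)[OF assms(2,4) lam Rmax that] unfolding k_def by blast
  define B where "B = pi\<^sup>2 * (4 + 99 / 70 * k) / lam"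
  have Dle: "riem_dist M A g p q \<le> sqrt B" if "p \<in> topspace M" "q \<in> topspace M" for p q
  proof (rule real_le_rsqrt)
    show "(riem_dist M A g p q)\<^sup>2 \<le> B"
      using weak_myers[OF assms(2,3) that lam k] lam by (simp add: B_def pos_le_divide_eq mult.commute)
  qed
  obtain p0 where "p0 \<in> topspace M" using assms(4) by blast
  then have "riem_diam M A g \<le> sqrt B"
    unfolding riem_diam_def by (intro cSup_least) (use Dle in auto)
  then have "Rmax / lam\<^sup>2 * (4 * pi + pi\<^sup>2 / 2) \<le> B"
    using assms(12) by (meson order_trans real_sqrt_le_iff)
  then have "lam * (Rmax / lam\<^sup>2 * (4 * pi + pi\<^sup>2 / 2)) \<le> lam * B"
    using lam by (intro mult_left_mono) auto
  \<comment> \<open>The scale invariant form of the maximal curvature; in terms of it the inequality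
    contains neither \<open>lam\<close> nor the size of the metric.\<close>
  moreover define r where "r = Rmax / lam"
  moreover have "lam * (Rmax / lam\<^sup>2 * (4 * pi + pi\<^sup>2 / 2)) = r * (4 * pi + pi\<^sup>2 / 2)"
    using lam by (simp add: r_def power2_eq_square)
  moreover have "lam * B = pi\<^sup>2 * (4 + 99 / 140 * r)"
    using lam by (simp add: B_def k_def r_def)
  ultimately have "r * (4 * pi + pi\<^sup>2 / 2) \<le> pi\<^sup>2 * (4 + 99 / 140 * r)" by simp
  then have "pi * (r * (4 + pi / 2)) \<le> pi * (pi * (4 + 99 / 140 * r))" by (simp add: power2_eq_square algebra_simps)
  then have "r * (4 + pi / 2) \<le> pi * (4 + 99 / 140 * r)" by (rule mult_left_le_imp_le) simp
  then have "4 * r + pi * r / 2 \<le> 4 * pi + 99 / 140 * (pi * r)" by (simp add: algebra_simps)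
  moreover have r4: "r \<ge> 4" using R4 lam by (simp add: r_def pos_le_divide_eq)
  then have "4 * pi \<le> pi * r" by simp
  \<comment> \<open>The crude bound 16/5 for pi is enough, since 16/5 (1/2 + 99/140) is still below
    4.\<close>
  moreover have "pi * r < 16 / 5 * r" using pi_approx(2) r4 by (intro mult_strict_right_mono) auto
  ultimately have False using r4 by linarith
  then show ?thesis ..
qed

end
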